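(* Let $\Omega$, $\gamma$, $D(t)$, $D_T$, the curve $y$, $\Sigma_T$, $p_{\tau,\Sigma}$, $\kappa$, $U_\tau$, $U_\tau^*$, $W_\tau$, $V_\tau$ and $I_\infty(\tau,\mu,\theta,T)$ be as in the context, and assume condition (C-D). Let $\theta\in(0,T)$ and assume $\Sigma_T\cap\overline{D_T}=\emptyset$. Then there exists $\mu_1>\mu_{T,\theta}:=l_0\max\big(\tfrac1\theta,\tfrac1{T-\theta}\big)$ such that for every $\mu>\mu_1$ there exist $C(\mu)>1$ and $\tau_1>\mu_1$ such that, whenever the family of initial data $(v_0^{(\tau)})_{\tau>0}$ satisfies condition (C-0) (with constant $l_0$), for all $\tau>\tau_1$, $$\frac1{C(\mu)}\int_{\Omega_T}|\gamma-1|\,|\nabla_x p_{\tau,\Sigma}|^2\,\kappa(t)\,dx\,dt\;\le\;|I_\infty(\tau,\mu,\theta,T)|\;\le\;C(\mu)\int_{\Omega_T}|\gamma-1|\,|\nabla_x p_{\tau,\Sigma}|^2\,\kappa(t)\,dx\,dt .$$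
   Context: Setting. $\Omega\subset\mathbb R^3$ is a bounded domain with Lipschitz boundary $\Gamma$, $T>0$, $\Omega_T=(0,T)\times\Omega$, $\Gamma_T=(0,T)\times\Gamma$. The conductivity $\gamma\in W^{1,\infty}((0,T);L^\infty(\Omega))$ satisfies: there exist a positive function $k(t,x)$ and, for every $t\in[0,T]$, a nonempty open set $D(t)\subset\Omega$ (no smoothness assumed, and $\partial D(t)$ may meet $\Gamma$) such that, with $D_T:=\bigcup_{t\in[0,T]}\{t\}\times D(t)$ (and similarly $D_{T'}$ for $T'\le T$), $1/C\le k\le C$ on $D_T$ for some $C>1$, $k-1$ has constant sign on $D_T$, and $\gamma(t,x)=1$ if $x\notin D(t)$, $\gamma(t,x)=k(t,x)$ if $x\in D(t)$. Condition (C-D): for all $t\in[0,T]$ and every compact $K\subset D(t)$, $\inf_{x\in K}|k(t,x)-1|>0$. Condition (C-0): the initial data $v_0=v_0^{(\tau)}\in L^2(\Omega)$ may depend on a parameter $\tau>0$, and there are $\tau$-independent constants $C,l_0>0$ with $\|v_0^{(\tau)}\|_{L^2(\Omega)}\le Ce^{\tau l_0}$ for all $\tau$. Curve. $\Omega'$ is a smooth bounded domain containing $\overline\Omega$, and $y:\mathbb R\to\Omega'$ is globally Lipschitz with $y(t)\notin\overline\Omega$ for $t\le0$. For $T'\in(0,T]$, $\Sigma_{T'}=\{(t,y(t)):0\le t\le T'\}\subset\mathbb R\times\mathbb R^3$. Functions. For $\tau>0$, $y\in\mathbb R^3$: $p_{\tau,y}(x)=\frac{e^{-\tau|x-y|}}{|x-y|}$,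 and $p_{\tau,\Sigma}(t,x)=p_{\tau,y(t)}(x)$. For $\mu>0$, $\theta\in[0,T]$: $\kappa(t)=e^{-\tau\mu|t-\theta|}$, $\eta(t)=\mu\,\mathrm{sgn}(t-\theta)$, $\rho(t)=\int_0^t\eta(s)\,ds$. Define $U_\tau(t,x)=e^{\tau^2t}u_\tau(t,x)$ with $u_\tau(t,x)=\frac1{8\pi^{3/2}}\int_0^\infty e^{-\tau^2 s}e^{-|x-y(t-s)|^2/(4s)}s^{-3/2}\,ds$ (a solution of $(\partial_t-\Delta_x+\tau^2)u_\tau=\delta(x-y(t))$), and $U_\tau^*(t,x)=e^{-\tau^2t}u^*_\tau(t,x)$ with $u^*_\tau(t,x)=\frac1{8\pi^{3/2}}\int_0^\infty e^{-\tau^2 s-\tau(\rho(t+s)-\rho(t))}e^{-|x-y(t+s)|^2/(4s)}s^{-3/2}\,ds$ (a solution of $(-\partial_t-\Delta_x+\tau^2+\tau\eta(t))u^*_\tau=\delta(x-y(t))$). With $\mathcal L_\gamma=\partial_t-\nabla_x\cdot(\gamma\nabla_x\,\cdot)$, $W_\tau$ is the unique solution of $\mathcal L_\gamma W_\tau=\nabla_x\cdot((\gamma-1)\nabla_xU_\tau)$ in $\Omega_T$, $W_\tau=0$ on $\Gamma_T$, $W_\tau|_{t=0}=v_0-U_\tau(0,\cdot)$ in $\Omega$; and $V_\tau=U_\tau+W_\tau$. Finally $$I_\infty(\tau,\mu,\theta,T)=\int_{\Omega_T}(\gamma-1)\nabla_xV_\tau\cdot\nabla_xU_\tau^*\,\kappa(t)\,dx\,dt+\int_\Omega\big[\kappa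 W_\tau U_\tau^*\big]_{t=0}^{t=T}dx .$$
   Formalization: The constant C of condition (C-0) is fixed together with l0 before μ1, C(μ) and τ1, which may depend on it; a τ1 uniform in C would be false, since I_∞ is affine in v0 and scaling v0 breaks the upper bound. *)

theory Defs
  imports "HOL-Analysis.Analysis"
begin

definition lipschitz_domain :: "(real^3) set \<Rightarrow> bool" where
  "lipschitz_domain \<Omega> \<longleftrightarrow> open \<Omega> \<and> connected \<Omega> \<and> bounded \<Omega> \<and> \<Omega> \<noteq> {} \<and>
     (\<forall>p\<in>frontier \<Omega>. \<exists>(R :: real^3 \<Rightarrow> real^3) (g :: real \<times> real \<Rightarrow> real) L r.
        orthogonal_transformation R \<and> L-lipschitz_on UNIV g \<and> r > 0 \<and>
        (\<forall>x\<in>ball p r. x \<in> \<Omega> \<longleftrightarrow> (R (x - p)) $ 3 < g ((R (x - p)) $ 1, (R (x - p)) $ 2)))"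

definition grad :: "(real^3 \<Rightarrow> real) \<Rightarrow> real^3 \<Rightarrow> real^3" where
  "grad f x = (\<chi> i. frechet_derivative f (at x) (axis i 1))"

definition dt_part :: "(real \<times> (real^3) \<Rightarrow> real) \<Rightarrow> real \<times> (real^3) \<Rightarrow> real" where
  "dt_part \<phi> z = frechet_derivative \<phi> (at z) (1, 0)"

definition gradx_part :: "(real \<times> (real^3) \<Rightarrow> real) \<Rightarrow> real \<times> (real^3) \<Rightarrow> real^3" where
  "gradx_part \<phi> z = (\<chi> i. frechet_derivative \<phi> (at z) (0, axis i 1))"

definition C1c_on :: "(real \<times> (real^3) \<Rightarrow> real) \<Rightarrow> (real \<times> (real^3)) set \<Rightarrow> bool" where
  "C1c_on \<phi> S \<longleftrightarrow> (\<forall>z. \<phi> differentiable (at z)) \<and>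
      (\<forall>v. continuous_on UNIV (\<lambda>z. frechet_derivative \<phi> (at z) v)) \<and>
      (\<exists>K. compact K \<and> K \<subseteq> S \<and> (\<forall>z. z \<notin> K \<longrightarrow> \<phi> z = 0))"

text \<open>gamma in W^{1,infinity}((0,T); L^infinity(Omega)): gamma is bounded, measurable, and
 gamma(t) = gamma(0) + int_0^t g(s) ds (a.e. in x, for every t) with g bounded measurable.\<close>
definition W1inf_time :: "(real \<Rightarrow> real^3 \<Rightarrow> real) \<Rightarrow> (real^3) set \<Rightarrow> real \<Rightarrow> bool" where
  "W1inf_time \<gamma> \<Omega> T \<longleftrightarrow> (\<exists>(g :: real \<Rightarrow> real^3 \<Rightarrow> real) M.
      (\<lambda>(t,x). \<gamma> t x) \<in> borel_measurable (lebesgue_on ({0..T} \<times> \<Omega>)) \<and>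
      (\<lambda>(t,x). g t x) \<in> borel_measurable (lebesgue_on ({0..T} \<times> \<Omega>)) \<and>
      (\<forall>t\<in>{0..T}. \<forall>x\<in>\<Omega>. \<bar>\<gamma> t x\<bar> \<le> M \<and> \<bar>g t x\<bar> \<le> M) \<and>
      (\<forall>t\<in>{0..T}. AE x in lebesgue_on \<Omega>. \<gamma> t x = \<gamma> 0 x + (LBINT s=0..t. g s x)))"

definition DT :: "(real \<Rightarrow> (real^3) set) \<Rightarrow> real \<Rightarrow> (real \<times> (real^3)) set" where
  "DT D T = {(t, x). t \<in> {0..T} \<and> x \<in> D t}"

definition SigmaT :: "(real \<Rightarrow> real^3) \<Rightarrow> real \<Rightarrow> (real \<times> (real^3)) set" where
  "SigmaT y T = {(t, y t) | t. t \<in> {0..T}}"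

definition p_tau :: "real \<Rightarrow> real^3 \<Rightarrow> real^3 \<Rightarrow> real" where
  "p_tau \<tau> z x = exp (- \<tau> * norm (x - z)) / norm (x - z)"

definition p_Sigma :: "(real \<Rightarrow> real^3) \<Rightarrow> real \<Rightarrow> real \<Rightarrow> real^3 \<Rightarrow> real" where
  "p_Sigma y \<tau> t x = p_tau \<tau> (y t) x"

definition kappa :: "real \<Rightarrow> real \<Rightarrow> real \<Rightarrow> real \<Rightarrow> real" where
  "kappa \<tau> \<mu> \<theta> t = exp (- \<tau> * \<mu> * \<bar>t - \<theta>\<bar>)"

definition eta :: "real \<Rightarrow> real \<Rightarrow> real \<Rightarrow> real" where
  "eta \<mu> \<theta> t = \<mu> * sgn (t - \<theta>)"

definition rho :: "real \<Rightarrow> real \<Rightarrow> real \<Rightarrow> real" where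
  "rho \<mu> \<theta> t = (LBINT s=0..t. eta \<mu> \<theta> s)"

definition u_tau :: "(real \<Rightarrow> real^3) \<Rightarrow> real \<Rightarrow> real \<Rightarrow> real^3 \<Rightarrow> real" where
  "u_tau y \<tau> t x = 1 / (8 * pi powr (3/2)) *
     (LINT s:{0<..}|lborel. exp (- (\<tau>^2) * s) * exp (- ((norm (x - y (t - s)))^2) / (4 * s)) * s powr (-3/2))"

definition U_tau :: "(real \<Rightarrow> real^3) \<Rightarrow> real \<Rightarrow> real \<Rightarrow> real^3 \<Rightarrow> real" where
  "U_tau y \<tau> t x = exp (\<tau>^2 * t) * u_tau y \<tau> t x"

definition u_star :: "(real \<Rightarrow> real^3) \<Rightarrow> real \<Rightarrow> real \<Rightarrow> real \<Rightarrow> real \<Rightarrow> real^3 \<Rightarrow> real" where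
  "u_star y \<tau> \<mu> \<theta> t x = 1 / (8 * pi powr (3/2)) *
     (LINT s:{0<..}|lborel. exp (- (\<tau>^2) * s - \<tau> * (rho \<mu> \<theta> (t + s) - rho \<mu> \<theta> t)) *
        exp (- ((norm (x - y (t + s)))^2) / (4 * s)) * s powr (-3/2))"

definition U_star :: "(real \<Rightarrow> real^3) \<Rightarrow> real \<Rightarrow> real \<Rightarrow> real \<Rightarrow> real \<Rightarrow> real^3 \<Rightarrow> real" where
  "U_star y \<tau> \<mu> \<theta> t x = exp (- (\<tau>^2) * t) * u_star y \<tau> \<mu> \<theta> t x"

text \<open>W is the weak solution, with weak spatial gradient G, of
  dW/dt - div(gamma grad W) = div F in Omega_T, W = 0 on Gamma_T, W(0) = W0:
  W, G in L^2(Omega_T); the zero extension of W has weak x-gradient the zero extension of G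
  (i.e. W in L^2(0,T;H^1_0(Omega))); W in C([0,T];L^2(Omega)); W(0) = W0; and the weak form
  of the equation holds for all C^1 test functions with compact support in (-inf,T) x Omega.\<close>
definition weak_sol :: "(real^3) set \<Rightarrow> real \<Rightarrow> (real \<Rightarrow> real^3 \<Rightarrow> real) \<Rightarrow>
    (real \<Rightarrow> real^3 \<Rightarrow> real^3) \<Rightarrow> (real^3 \<Rightarrow> real) \<Rightarrow>
    (real \<Rightarrow> real^3 \<Rightarrow> real) \<Rightarrow> (real \<Rightarrow> real^3 \<Rightarrow> real^3) \<Rightarrow> bool" where
  "weak_sol \<Omega> T \<gamma> F W0 W G \<longleftrightarrow>
     (\<lambda>(t,x). W t x) \<in> borel_measurable (lebesgue_on ({0<..<T} \<times> \<Omega>)) \<and>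
     (\<lambda>(t,x). G t x) \<in> borel_measurable (lebesgue_on ({0<..<T} \<times> \<Omega>)) \<and>
     set_integrable lebesgue ({0<..<T} \<times> \<Omega>) (\<lambda>(t,x). (W t x)^2) \<and>
     set_integrable lebesgue ({0<..<T} \<times> \<Omega>) (\<lambda>(t,x). (norm (G t x))^2) \<and>
     (\<forall>\<phi> i. C1c_on \<phi> ({0<..<T} \<times> UNIV) \<longrightarrow>
        (LINT z:{0<..<T} \<times> \<Omega>|lebesgue. W (fst z) (snd z) * gradx_part \<phi> z $ i)
        = - (LINT z:{0<..<T} \<times> \<Omega>|lebesgue. G (fst z) (snd z) $ i * \<phi> z)) \<and>
     (\<forall>t\<in>{0..T}. W t \<in> borel_measurable (lebesgue_on \<Omega>) \<and>
        set_integrable lebesgue \<Omega> (\<lambda>x. (W t x)^2) \<and>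
        ((\<lambda>s. LINT x:\<Omega>|lebesgue. (W s x - W t x)^2) \<longlongrightarrow> 0) (at t within {0..T})) \<and>
     (AE x in lebesgue. x \<in> \<Omega> \<longrightarrow> W 0 x = W0 x) \<and>
     (\<forall>\<phi>. C1c_on \<phi> ({..<T} \<times> \<Omega>) \<longrightarrow>
        - (LINT z:{0<..<T} \<times> \<Omega>|lebesgue. W (fst z) (snd z) * dt_part \<phi> z)
        + (LINT z:{0<..<T} \<times> \<Omega>|lebesgue.
              \<gamma> (fst z) (snd z) * (G (fst z) (snd z) \<bullet> gradx_part \<phi> z))
        - (LINT x:\<Omega>|lebesgue. W0 x * \<phi> (0, x))
        = - (LINT z:{0<..<T} \<times> \<Omega>|lebesgue. F (fst z) (snd z) \<bullet> gradx_part \<phi> z))"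

definition cond_C0 :: "(real \<Rightarrow> real^3 \<Rightarrow> real) \<Rightarrow> (real^3) set \<Rightarrow> real \<Rightarrow> real \<Rightarrow> bool" where
  "cond_C0 v0 \<Omega> C0 l0 \<longleftrightarrow> (\<forall>\<tau>>0. v0 \<tau> \<in> borel_measurable (lebesgue_on \<Omega>) \<and>
      set_integrable lebesgue \<Omega> (\<lambda>x. (v0 \<tau> x)^2) \<and>
      sqrt (LINT x:\<Omega>|lebesgue. (v0 \<tau> x)^2) \<le> C0 * exp (\<tau> * l0))"

text \<open>I_infinity, where W (with weak gradient G) is the solution, so grad V = grad U + G.\<close>
definition I_inf :: "(real^3) set \<Rightarrow> real \<Rightarrow> (real \<Rightarrow> real^3 \<Rightarrow> real) \<Rightarrow> (real \<Rightarrow> real^3) \<Rightarrow>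
    (real \<Rightarrow> real^3 \<Rightarrow> real) \<Rightarrow> (real \<Rightarrow> real^3 \<Rightarrow> real^3) \<Rightarrow> real \<Rightarrow> real \<Rightarrow> real \<Rightarrow> real" where
  "I_inf \<Omega> T \<gamma> y W G \<tau> \<mu> \<theta> =
     (LINT z:{0<..<T} \<times> \<Omega>|lebesgue.
        (\<gamma> (fst z) (snd z) - 1) *
        ((grad (U_tau y \<tau> (fst z)) (snd z) + G (fst z) (snd z))
           \<bullet> grad (U_star y \<tau> \<mu> \<theta> (fst z)) (snd z)) * kappa \<tau> \<mu> \<theta> (fst z))
   + (LINT x:\<Omega>|lebesgue. kappa \<tau> \<mu> \<theta> T * W T x * U_star y \<tau> \<mu> \<theta> T x
                         - kappa \<tau> \<mu> \<theta> 0 * W 0 x * U_star y \<tau> \<mu> \<theta> 0 x)"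

definition P_int :: "(real^3) set \<Rightarrow> real \<Rightarrow> (real \<Rightarrow> real^3 \<Rightarrow> real) \<Rightarrow> (real \<Rightarrow> real^3) \<Rightarrow>
    real \<Rightarrow> real \<Rightarrow> real \<Rightarrow> real" where
  "P_int \<Omega> T \<gamma> y \<tau> \<mu> \<theta> =
     (LINT z:{0<..<T} \<times> \<Omega>|lebesgue.
        \<bar>\<gamma> (fst z) (snd z) - 1\<bar> * (norm (grad (p_Sigma y \<tau> (fst z)) (snd z)))^2 * kappa \<tau> \<mu> \<theta> (fst z))"

end

theory Submission imports Defs begin

text \<open>Testing the equation of the reflected wave \<open>W\<close> with \<open>K W\<close>, where \<open>K\<close> is a weight for which
 \<open>\<kappa> \<nabla>U\<^sup>*\<close> is close to \<open>K \<nabla>U\<close>, turns the cross term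
 \<open>\<integral>(\<gamma> - 1) \<nabla>W \<bullet> \<nabla>U\<^sup>* \<kappa>\<close> of the indicator into a quantity controlled by the energy
 \<open>M = \<integral>|\<gamma> - 1| |\<nabla>U|\<^sup>2 K\<close>; since \<open>\<gamma> - 1\<close> has constant sign, the cross term cannot cancel
 \<open>\<integral>(\<gamma> - 1) \<nabla>U \<bullet> \<nabla>U\<^sup>* \<kappa>\<close>. Laplace's method, uniformly along a merely Lipschitz curve, shows
 that \<open>\<nabla>U\<close> and \<open>\<nabla>U\<^sup>*\<close> are asymptotically radial with explicit modulus; this yields \<open>K\<close>, namely the
 exponential of a mollified logarithmic weight that is Lipschitz in space uniformly in \<open>\<tau>\<close>, and the comparison of
 \<open>M\<close> with \<open>\<integral>|\<gamma> - 1| |\<nabla>p|\<^sup>2 \<kappa>\<close>. As the last integral decays like \<open>exp (-\<tau> (2 Rm + \<mu> m / 2))\<close> at worst, with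
 \<open>m = min \<theta> (T - \<theta>)\<close>, the contributions of \<open>t = 0\<close> and \<open>t = T\<close>, of size \<open>exp (-\<tau> (\<mu> m - 2 l0))\<close>, are negligible
 for large \<open>\<mu>\<close>. The test function \<open>K W\<close> is admissible because zero extensions with a weak gradient can be shifted
 into a Lipschitz domain and mollified, and the time derivative is treated by difference quotients.\<close>

section \<open>Square-integrable functions and translations\<close>

text \<open>The obstacle is that the curve is only Lipschitz. Both gradient integrals have their
  saddle point at s = R / (2 tau), R being the distance to the source. In such a time the curve
  moves by up to order 1 / tau, and the factor tau in the exponent makes this a multiplicative error
  of order 1 that need not converge as tau grows. A weight depending on t alone therefore cannot
  match the two gradients; K has to carry the displacement of the curve. Its logarithm is Lipschitz
  in x uniformly in tau, because the displacement vanishes linearly in R where the direction to the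
  source becomes singular. The factor exp (-2 tau^2 t), the quotient of the prefactors of
  \<open>U_star\<close> and \<open>U_tau\<close>, makes K decay in time at rate at least tau^2,
  which pays for the terms with the gradient of K. The cross term cannot cancel the main term for
  two different reasons: if gamma >= 1, Young's inequality has the constant 1 - 1/C < 1; if gamma <=
  1, the energy inequality gives the cross term the sign of the main term up to small errors.
  Comparing the exponents mu m - 2 l0 and 2 Rm + mu m / 2 fixes the threshold for mu.\<close>

definition L2 :: "('a::euclidean_space \<Rightarrow> real) \<Rightarrow> bool" where
 "L2 f \<longleftrightarrow> f \<in> borel_measurable borel \<and> integrable lborel (\<lambda>z. (f z)\<^sup>2)"

definition N2 :: "('a::euclidean_space \<Rightarrow> real) \<Rightarrow> real" where
 "N2 f = (LBINT z. (f z)\<^sup>2)"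

lemma L2_measurable [measurable_dest]: "L2 f \<Longrightarrow> f \<in> borel_measurable borel"
 by (simp add: L2_def)

lemma L2_integrable_sq: "L2 f \<Longrightarrow> integrable lborel (\<lambda>z. (f z)\<^sup>2)"
 by (simp add: L2_def)

lemma N2_nonneg [simp]: "0 \<le> N2 f"
 by (simp add: N2_def)

lemma L2_bound:
 assumes "g \<in> borel_measurable borel" "L2 f" "\<And>z. \<bar>g z\<bar> \<le> B * \<bar>f z\<bar>"
 shows "L2 g" and "N2 g \<le> B\<^sup>2 * N2 f"
proof -
 have le: "(g z)\<^sup>2 \<le> B\<^sup>2 * (f z)\<^sup>2" for z
  using power_mono[OF assms(3)[of z], of 2] by (simp add: power_mult_distrib)
 have i: "integrable lborel (\<lambda>z. B\<^sup>2 * (f z)\<^sup>2)"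
  using assms(2) by (simp add: L2_def)
 show L: "L2 g" unfolding L2_def
  using assms(1) le by (auto intro!: Bochner_Integration.integrable_bound[OF i])
 have "N2 g \<le> (LBINT z. B\<^sup>2 * (f z)\<^sup>2)"
  unfolding N2_def using L i le by (intro integral_mono) (auto simp: L2_def)
 then show "N2 g \<le> B\<^sup>2 * N2 f" by (simp add: N2_def)
qed

lemma L2_prod_integrable:
 assumes "L2 f" "L2 g" shows "integrable lborel (\<lambda>z. f z * g z)"
proof (rule Bochner_Integration.integrable_bound)
 show "integrable lborel (\<lambda>z. (f z)\<^sup>2 + (g z)\<^sup>2)"
  using assms by (auto simp: L2_def)
 show "(\<lambda>z. f z * g z) \<in> borel_measurable lborel"
  using assms by (auto simp: L2_def)
 have "2 * \<bar>a * b\<bar> \<le> a\<^sup>2 + b\<^sup>2" for a b :: real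
  using zero_le_power2[of "\<bar>a\<bar> - \<bar>b\<bar>"] by (simp add: power2_diff abs_mult)
 then have "\<bar>a * b\<bar> \<le> a\<^sup>2 + b\<^sup>2" for a b :: real
  by (smt (verit) abs_ge_zero)
 then show "AE z in lborel. norm (f z * g z) \<le> norm ((f z)\<^sup>2 + (g z)\<^sup>2)"
  by (simp add: abs_of_nonneg)
qed

lemma L2_cmult: "L2 f \<Longrightarrow> L2 (\<lambda>z. c * f z)"
 by (auto simp: L2_def power_mult_distrib)

lemma N2_cmult: "N2 (\<lambda>z. c * f z) = c\<^sup>2 * N2 f"
 by (simp add: N2_def power_mult_distrib)

lemma L2_add: assumes "L2 f" "L2 g" shows "L2 (\<lambda>z. f z + g z)"
proof -
 have "integrable lborel (\<lambda>z. (f z)\<^sup>2 + (g z)\<^sup>2 + 2 * (f z * g z))"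
  using assms L2_prod_integrable[OF assms] by (auto simp: L2_def)
 then show ?thesis using assms by (auto simp: L2_def power2_sum algebra_simps)
qed

lemma L2_zero [simp]: "L2 (\<lambda>z. 0)" by (simp add: L2_def)

lemma L2_uminus: "L2 f \<Longrightarrow> L2 (\<lambda>z. - f z)"
 using L2_cmult[of f "-1"] by simp

lemma L2_diff: assumes "L2 f" "L2 g" shows "L2 (\<lambda>z. f z - g z)"
 using L2_add[OF assms(1) L2_uminus[OF assms(2)]] by simp

lemma N2_add_le: assumes "L2 f" "L2 g" shows "N2 (\<lambda>z. f z + g z) \<le> 2 * N2 f + 2 * N2 g"
proof -
 have "N2 (\<lambda>z. f z + g z) \<le> (LBINT z. 2 * (f z)\<^sup>2 + 2 * (g z)\<^sup>2)"
  unfolding N2_def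
 proof (rule integral_mono)
  show "integrable lborel (\<lambda>z. (f z + g z)\<^sup>2)" using L2_add[OF assms] by (simp add: L2_def)
  show "integrable lborel (\<lambda>z. 2 * (f z)\<^sup>2 + 2 * (g z)\<^sup>2)" using assms by (simp add: L2_def)
  show "(f z + g z)\<^sup>2 \<le> 2 * (f z)\<^sup>2 + 2 * (g z)\<^sup>2" for z
   using zero_le_power2[of "f z - g z"] by (simp add: power2_diff power2_sum)
 qed
 also have "\<dots> = 2 * N2 f + 2 * N2 g" using assms by (simp add: N2_def L2_def)
 finally show ?thesis .
qed

lemma N2_diff_le: assumes "L2 f" "L2 g" shows "N2 (\<lambda>z. f z - g z) \<le> 2 * N2 f + 2 * N2 g"
 using N2_add_le[OF assms(1) L2_uminus[OF assms(2)]] by (simp add: N2_def)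

lemma N2_triangle:
 assumes "L2 f" "L2 g" "L2 h"
 shows "N2 (\<lambda>z. f z - h z) \<le> 2 * N2 (\<lambda>z. f z - g z) + 2 * N2 (\<lambda>z. g z - h z)"
 using N2_add_le[OF L2_diff[OF assms(1,2)] L2_diff[OF assms(2,3)]] by simp

lemma L2_Cauchy_Schwarz:
 assumes "L2 f" "L2 g"
 shows "\<bar>\<integral>z. f z * g z \<partial>lborel\<bar> \<le> sqrt (N2 f) * sqrt (N2 g)"
proof -
 let ?c = "\<integral>z. f z * g z \<partial>lborel"
 have q: "0 \<le> N2 f * s\<^sup>2 + 2 * ?c * s + N2 g" for s
 proof -
  have "0 \<le> N2 (\<lambda>z. s * f z + g z)" by simp
  also have "N2 (\<lambda>z. s * f z + g z)
    = (LBINT z. s\<^sup>2 * (f z)\<^sup>2 + 2 * s * (f z * g z) + (g z)\<^sup>2)"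
   by (simp add: N2_def power2_sum power_mult_distrib algebra_simps)
  also have "\<dots> = s\<^sup>2 * N2 f + 2 * s * ?c + N2 g"
   using assms L2_prod_integrable[OF assms] by (simp add: N2_def L2_def)
  finally show ?thesis by (simp add: algebra_simps)
 qed
 have "?c\<^sup>2 \<le> N2 f * N2 g"
 proof (cases "N2 f = 0")
  case True
  have "?c = 0"
  proof (rule ccontr)
   assume "?c \<noteq> 0"
   \<comment> \<open>With \<open>N2 f = 0\<close> the quadratic is affine in s and takes the value
     -1 at this s.\<close>
   then show False using q[of "- (N2 g + 1) / (2 * ?c)"] True by (simp add: field_simps)
  qed
  then show ?thesis using True by simp
 next
  case False
  then have p: "N2 f > 0" by (simp add: order.not_eq_order_implies_strict)
  have "0 \<le> N2 f * (- ?c / N2 f)\<^sup>2 + 2 * ?c * (- ?c / N2 f) + N2 g" by (rule q)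
  also have "\<dots> = N2 g - ?c\<^sup>2 / N2 f" using p by (simp add: field_simps power2_eq_square)
  finally show ?thesis using p by (simp add: field_simps)
 qed
 then have "sqrt (?c\<^sup>2) \<le> sqrt (N2 f * N2 g)" by (rule real_sqrt_le_mono)
 then show ?thesis by (simp add: real_sqrt_mult)
qed

section \<open>Invariance of Lebesgue measure under translation and reflection\<close>

lemma lborel_distr_shift: "distr lborel borel (\<lambda>x. x + c) = (lborel :: 'a::euclidean_space measure)"
proof -
 have "(\<lambda>x. x + c) = (+) c" by (auto simp: add.commute)
 then show ?thesis using lborel_distr_plus[of c] by metis
qed

lemma lborel_distr_reflect: "distr lborel borel (\<lambda>x. c - x) = (lborel :: 'a::euclidean_space measure)"
 by (subst lborel_affine[of "-1" c]) (auto simp: density_1 distr_distr o_def density_distr)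

text \<open>No measurability is assumed: a function that is not Borel measurable stays so after a
  shift, and both integrals then have the default value 0. This removes a side condition from the
  many changes of variable below.\<close>

lemma lborel_shift_integral:
 fixes f :: "'a::euclidean_space \<Rightarrow> 'b::{banach, second_countable_topology}"
 shows "(LBINT x. f (x + c)) = (LBINT x. f x)"
proof (cases "f \<in> borel_measurable borel")
 case True
 then show ?thesis
  by (subst (2) lborel_distr_shift[of c, symmetric], subst integral_distr) auto
next
 case False
 have "(\<lambda>x. f (x + c)) \<notin> borel_measurable borel"
 proof
  assume "(\<lambda>x. f (x + c)) \<in> borel_measurable borel"
  from measurable_compose[OF _ this, of "\<lambda>x. x - c" borel] False show False by simp
 qed
 then have "\<not> integrable lborel (\<lambda>x. f (x + c))" by (auto dest: borel_measurable_integrable)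
 moreover have "\<not> integrable lborel f" using False by (auto dest: borel_measurable_integrable)
 ultimately show ?thesis by (simp add: not_integrable_integral_eq)
qed

lemma lborel_shift_integrable:
 fixes f :: "'a::euclidean_space \<Rightarrow> 'b::{banach, second_countable_topology}"
 assumes "integrable lborel f" shows "integrable lborel (\<lambda>x. f (x + c))"
proof -
 have "f \<in> borel_measurable borel" using assms by auto
 then have "integrable (distr lborel borel (\<lambda>x. x + c)) f \<longleftrightarrow> integrable lborel (\<lambda>x. f (x + c))"
  by (intro integrable_distr_eq) auto
 then show ?thesis using assms by (simp add: lborel_distr_shift)
qed

lemma lborel_reflect_integral:
 fixes f :: "'a::euclidean_space \<Rightarrow> 'b::{banach, second_countable_topology}"
 assumes "f \<in> borel_measurable borel"
 shows "(LBINT x. f (c - x)) = (LBINT x. f x)"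
 by (subst (2) lborel_distr_reflect[of c, symmetric], subst integral_distr) (use assms in auto)

lemma lborel_reflect_integrable:
 fixes f :: "'a::euclidean_space \<Rightarrow> 'b::{banach, second_countable_topology}"
 assumes "integrable lborel f" shows "integrable lborel (\<lambda>x. f (c - x))"
proof -
 have "f \<in> borel_measurable borel" using assms by auto
 then have "integrable (distr lborel borel (\<lambda>x. c - x)) f \<longleftrightarrow> integrable lborel (\<lambda>x. f (c - x))"
  by (intro integrable_distr_eq) auto
 then show ?thesis using assms by (simp add: lborel_distr_reflect)
qed

lemma lborel_shift_nn_integral:
 assumes [measurable]: "f \<in> borel_measurable borel"
 shows "(\<integral>\<^sup>+x. f (x + c) \<partial>lborel) = (\<integral>\<^sup>+x. f (x::'a::euclidean_space) \<partial>lborel)"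
 by (subst (2) lborel_distr_shift[of c, symmetric], subst nn_integral_distr) auto

lemma L2_shift: "L2 f \<Longrightarrow> L2 (\<lambda>z. f (z + c))"
 unfolding L2_def using lborel_shift_integrable[of "\<lambda>z. (f z)\<^sup>2" c]
 by (auto intro: measurable_compose[of "\<lambda>z. z + c" borel borel f])

lemma N2_shift: "N2 (\<lambda>z. f (z + c)) = N2 f"
 unfolding N2_def by (rule lborel_shift_integral)

section \<open>Continuity of translations in the mean\<close>

definition L1_trans :: "('a::euclidean_space \<Rightarrow> real) \<Rightarrow> bool" where
 "L1_trans f \<longleftrightarrow> (\<forall>e>0. \<exists>d>0. \<forall>h. norm h < d \<longrightarrow> (LBINT z. \<bar>f (z + h) - f z\<bar>) < e)"

text \<open>Regularity of the measure traps A between a compact K and an open U. A shift shorter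
  than the distance from K to the complement of U cannot carry a point of K out of U, so A and its
  translate differ only on the small set (U - A) \<union> (A - K) and the translate of that
  set.\<close>

lemma L1_trans_indicator:
 fixes A :: "'a::euclidean_space set"
 assumes A: "A \<in> sets lborel" "emeasure lborel A < \<infinity>"
 shows "L1_trans (\<lambda>x. indicator A x * c)"
proof -
 have "\<exists>d>0. \<forall>h. norm h < d \<longrightarrow> (LBINT z. \<bar>indicator A (z + h) * c - indicator A z * c\<bar>) < e"
  if e: "e > 0" for e
 proof -
  \<comment> \<open>Three pieces have measure below e1, namely U - A, A - K0 and the tail of K0;
    each is counted for the set and for its translate, which makes 6.\<close>
  define e1 where "e1 = e / (6 * (\<bar>c\<bar> + 1))"
  have e1: "e1 > 0" using e by (simp add: e1_def)
  have AL: "A \<in> sets lebesgue" using A by simp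
  obtain U where U: "open U" "A \<subseteq> U" "U - A \<in> lmeasurable" "emeasure lebesgue (U - A) < ennreal e1"
   using sets_lebesgue_outer_open[OF AL e1] by blast
  obtain K0 where K0: "closed K0" "K0 \<subseteq> A" "A - K0 \<in> lmeasurable" "emeasure lebesgue (A - K0) < ennreal e1"
   using sets_lebesgue_inner_closed[OF AL e1] by blast
  have AB: "A \<in> sets borel" using A by simp
  have AM: "A \<in> lmeasurable" using A by (auto simp: fmeasurable_def)
  have mK0: "K0 - cball 0 (real n) \<in> lmeasurable" for n
   using K0(1,2) by (intro fmeasurableI2[OF AM]) auto
  \<comment> \<open>Inner regularity only provides a closed set; cutting off its part outside a
    large ball costs little measure and makes it compact.\<close>
  have "(\<lambda>n. measure lebesgue (K0 - cball 0 (real n))) \<longlonglongrightarrow> measure lebesgue (\<Inter>n. K0 - cball 0 (real n))"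
  proof (rule Lim_measure_decseq)
   show "range (\<lambda>n. K0 - cball 0 (real n)) \<subseteq> sets lebesgue" using mK0 by blast
   show "decseq (\<lambda>n. K0 - cball 0 (real n))" by (auto simp: decseq_def)
   show "emeasure lebesgue (K0 - cball 0 (real n)) \<noteq> \<infinity>" for n using fmeasurableD2[OF mK0] by simp
  qed
  moreover have "(\<Inter>n. K0 - cball 0 (real n)) = {}"
  proof (rule ccontr)
   assume "(\<Inter>n. K0 - cball 0 (real n)) \<noteq> {}"
   then obtain x where x: "\<And>n. x \<in> K0 - cball 0 (real n)" by blast
   obtain n where "norm x \<le> real n" using real_arch_simple by blast
   then show False using x[of n] by simp
  qed
  ultimately have "(\<lambda>n. measure lebesgue (K0 - cball 0 (real n))) \<longlonglongrightarrow> 0"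
   by (metis measure_empty)
  then have "\<forall>\<^sub>F n in sequentially. measure lebesgue (K0 - cball 0 (real n)) < e1"
   using e1 by (rule order_tendstoD)
  then obtain n where n: "measure lebesgue (K0 - cball 0 (real n)) < e1"
   by (meson eventually_sequentially order_refl)
  define K where "K = K0 \<inter> cball 0 (real n)"
  have K: "compact K" "K \<subseteq> U" "K \<subseteq> A" using K0 U by (auto simp: K_def closed_Int_compact)
  obtain d where d: "d > 0" "\<And>x y. x \<in> K \<Longrightarrow> y \<notin> U \<Longrightarrow> d \<le> dist x y"
  proof (cases "K = {} \<or> U = UNIV")
   case True then show ?thesis by (intro that[of 1]) auto
  next
   case False
   have "\<exists>d>0. \<forall>x\<in>K. \<forall>y\<in>- U. d \<le> dist x y"
    using K U by (intro separate_compact_closed) (auto simp: closed_Compl)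
   then show ?thesis using that by auto
  qed
  show ?thesis
  proof (intro exI[of _ d] conjI allI impI d(1))
   fix h :: 'a assume h: "norm h < d"
   let ?B = "(U - A) \<union> (A - K)"
   have [measurable]: "U \<in> sets borel" "K \<in> sets borel" "A \<in> sets borel" using U K AB by (auto simp: compact_imp_closed)
   have eAK: "A - K = (A - K0) \<union> (K0 - cball 0 (real n))" using K0 by (auto simp: K_def)
   have m1: "measure lebesgue (A - K) \<le> measure lebesgue (A - K0) + measure lebesgue (K0 - cball 0 (real n))"
    unfolding eAK using K0(3) mK0[of n] by (intro measure_Un_le) (auto simp: fmeasurableD)
   have m2: "measure lebesgue (A - K0) < e1" "measure lebesgue (U - A) < e1"
    using K0(3,4) U(3,4) e1 by (auto simp: emeasure_eq_measure2 ennreal_less_iff)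
   have mB: "?B \<in> lmeasurable" unfolding eAK using U(3) K0(3) mK0[of n] by (intro fmeasurable.Un) auto
   have "measure lebesgue ?B \<le> measure lebesgue (U - A) + measure lebesgue (A - K)"
    by (intro measure_Un_le) auto
   then have mB3: "measure lborel ?B < 3 * e1" using m1 m2 n by (simp add: measure_completion)
   have iB: "integrable lborel (indicator ?B :: 'a \<Rightarrow> real)"
    using mB by (auto simp: integrable_indicator_iff fmeasurable_def emeasure_completion)
   have iB': "integrable lborel (\<lambda>z. indicator ?B (z + h) :: real)" by (rule lborel_shift_integrable[OF iB])
   have le: "\<bar>indicator A (z + h) * c - indicator A z * c\<bar> \<le> \<bar>c\<bar> * (indicator ?B z + indicator ?B (z + h))" for z
   proof -
    have 1: "z \<in> ?B \<or> z + h \<in> ?B" if "z \<in> A" "z + h \<notin> A"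
    proof (cases "z \<in> K")
     case True
     have "z + h \<in> U" using d(2)[OF True, of "z + h"] h by (force simp: dist_norm)
     then show ?thesis using that by auto
    qed (use that in auto)
    have 2: "z \<in> ?B \<or> z + h \<in> ?B" if "z \<notin> A" "z + h \<in> A"
    proof (cases "z + h \<in> K")
     case True
     have "z \<in> U" using d(2)[OF True, of "z"] h by (force simp: dist_norm)
     then show ?thesis using that by auto
    qed (use that in auto)
    have "\<bar>indicator A (z + h) - indicator A z\<bar> \<le> (indicator ?B z + indicator ?B (z + h) :: real)"
     using 1 2 by (auto simp: indicator_def)
    then have "\<bar>c\<bar> * \<bar>indicator A (z + h) - indicator A z\<bar> \<le> \<bar>c\<bar> * (indicator ?B z + indicator ?B (z + h))"
     by (rule mult_left_mono) simp
    then show ?thesis by (simp add: abs_mult[symmetric] algebra_simps)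
   qed
   have "(LBINT z. \<bar>indicator A (z + h) * c - indicator A z * c\<bar>)
     \<le> (LBINT z. \<bar>c\<bar> * (indicator ?B z + indicator ?B (z + h)))"
   proof (rule integral_mono'[OF _ le])
    show "integrable lborel (\<lambda>z. \<bar>c\<bar> * (indicator ?B z + indicator ?B (z + h)))"
     using iB iB' by (intro integrable_mult_right Bochner_Integration.integrable_add) auto
   qed auto
   also have "\<dots> = \<bar>c\<bar> * (measure lborel ?B + measure lborel ?B)"
    using iB iB' lborel_shift_integral[of "indicator ?B :: 'a \<Rightarrow> real" h] by simp
   also have "\<dots> \<le> \<bar>c\<bar> * (6 * e1)" using mB3 by (intro mult_left_mono) auto
   also have "\<dots> < e" using e by (simp add: e1_def field_simps)
   finally show "(LBINT z. \<bar>indicator A (z + h) * c - indicator A z * c\<bar>) < e" .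
  qed
 qed
 then show ?thesis by (simp add: L1_trans_def)
qed

lemma L1_trans_add:
 assumes "integrable lborel f" "L1_trans f" "integrable lborel g" "L1_trans g"
 shows "L1_trans (\<lambda>x. f x + g x)"
 unfolding L1_trans_def
proof (intro allI impI)
 fix e :: real assume e: "e > 0"
 obtain d1 where d1: "d1 > 0" "\<And>h. norm h < d1 \<Longrightarrow> (LBINT z. \<bar>f (z + h) - f z\<bar>) < e/2"
  using assms(2) e half_gt_zero unfolding L1_trans_def by meson
 obtain d2 where d2: "d2 > 0" "\<And>h. norm h < d2 \<Longrightarrow> (LBINT z. \<bar>g (z + h) - g z\<bar>) < e/2"
  using assms(4) e half_gt_zero unfolding L1_trans_def by meson
 show "\<exists>d>0. \<forall>h. norm h < d \<longrightarrow> (LBINT z. \<bar>f (z + h) + g (z + h) - (f z + g z)\<bar>) < e"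
 proof (intro exI[of _ "min d1 d2"] conjI allI impI)
  fix h :: 'a assume h: "norm h < min d1 d2"
  note i = assms(1,3) lborel_shift_integrable[OF assms(1), of h] lborel_shift_integrable[OF assms(3), of h]
  have "(LBINT z. \<bar>f (z + h) + g (z + h) - (f z + g z)\<bar>)
    \<le> (LBINT z. \<bar>f (z + h) - f z\<bar> + \<bar>g (z + h) - g z\<bar>)"
   using i by (intro integral_mono) auto
  also have "\<dots> < e" using i d1(2)[of h] d2(2)[of h] h by (subst Bochner_Integration.integral_add) auto
  finally show "(LBINT z. \<bar>f (z + h) + g (z + h) - (f z + g z)\<bar>) < e" .
 qed (use d1 d2 in auto)
qed

text \<open>The induction reduces the claim to indicators. In the limit step the approximation error
  occurs twice, once translated, and translation leaves its integral unchanged.\<close>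

lemma L1_trans_integrable:
 fixes f :: "'a::euclidean_space \<Rightarrow> real"
 assumes "integrable lborel f" shows "L1_trans f"
 using assms
proof (induction rule: integrable_induct)
 case (base A c)
 then show ?case using L1_trans_indicator[of A c] by simp
next
 case (add f g)
 show ?case by (rule L1_trans_add[OF add(1,3,2,4)])
next
 case (lim f s)
 have si: "\<And>i. integrable lborel (s i)" and fi: "integrable lborel f" and sP: "\<And>i. L1_trans (s i)"
  and st: "\<And>x. (\<lambda>i. s i x) \<longlonglongrightarrow> f x" and sb: "\<And>i x. norm (s i x) \<le> 2 * norm (f x)"
  using lim by auto
 have conv: "(\<lambda>i. LBINT z. \<bar>s i z - f z\<bar>) \<longlonglongrightarrow> integral\<^sup>L lborel (\<lambda>z::'a. 0)"
 proof (rule integral_dominated_convergence[where w = "\<lambda>z. 3 * \<bar>f z\<bar>"])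
  show "AE x in lborel. (\<lambda>i. \<bar>s i x - f x\<bar>) \<longlonglongrightarrow> 0"
   using st by (auto intro!: tendsto_rabs_zero simp: LIM_zero_iff)
  show "AE x in lborel. norm \<bar>s i x - f x\<bar> \<le> 3 * \<bar>f x\<bar>" for i
  proof (rule AE_I2)
   fix x :: 'a assume "x \<in> space lborel"
   with sb[of i x] show "norm \<bar>s i x - f x\<bar> \<le> 3 * \<bar>f x\<bar>" by (simp add: abs_le_iff) linarith
  qed
 qed (use si fi in auto)
 show ?case unfolding L1_trans_def
 proof (intro allI impI)
  fix e :: real assume e: "e > 0"
  have "\<forall>\<^sub>F i in sequentially. (LBINT z. \<bar>s i z - f z\<bar>) < e/3"
   using order_tendstoD(2)[OF conv, of "e/3"] e by simp
  then obtain i where i: "(LBINT z. \<bar>s i z - f z\<bar>) < e/3"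
   by (meson eventually_sequentially order_refl)
  obtain d where d: "d > 0" "\<And>h. norm h < d \<Longrightarrow> (LBINT z. \<bar>s i (z + h) - s i z\<bar>) < e/3"
   using sP[of i] e unfolding L1_trans_def by (meson divide_pos_pos zero_less_numeral)
  show "\<exists>d>0. \<forall>h. norm h < d \<longrightarrow> (LBINT z. \<bar>f (z + h) - f z\<bar>) < e"
  proof (intro exI[of _ d] conjI allI impI d(1))
   fix h :: 'a assume h: "norm h < d"
   have k: "integrable lborel (\<lambda>z. \<bar>s i z - f z\<bar>)" using si fi by auto
   note l = si[of i] fi lborel_shift_integrable[OF si[of i], of h] lborel_shift_integrable[OF fi, of h]
   have "(LBINT z. \<bar>f (z + h) - f z\<bar>)
     \<le> (LBINT z. \<bar>s i (z + h) - f (z + h)\<bar> + (\<bar>s i (z + h) - s i z\<bar> + \<bar>s i z - f z\<bar>))"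
    using l by (intro integral_mono) auto
   also have "\<dots> = (LBINT z. \<bar>s i (z + h) - f (z + h)\<bar>) + ((LBINT z. \<bar>s i (z + h) - s i z\<bar>) + (LBINT z. \<bar>s i z - f z\<bar>))"
    using l by simp
   also have "(LBINT z. \<bar>s i (z + h) - f (z + h)\<bar>) = (LBINT z. \<bar>s i z - f z\<bar>)"
    by (rule lborel_shift_integral)
   finally show "(LBINT z. \<bar>f (z + h) - f z\<bar>) < e" using i d(2)[OF h] by linarith
  qed
 qed
qed

text \<open>Reads continuity of translations in L2 off from continuity in L1 applied to the square.
  It requires nonnegative values, hence the splitting into positive and negative part in
  \<open>L2_translation\<close>.\<close>

lemma nonneg_diff_sq_le: "(a - b)\<^sup>2 \<le> \<bar>a\<^sup>2 - b\<^sup>2\<bar>" if "a \<ge> 0" "b \<ge> 0" for a b :: real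
proof -
 have "(a - b)\<^sup>2 = \<bar>a - b\<bar> * \<bar>a - b\<bar>" by (simp add: power2_eq_square)
 also have "\<dots> \<le> \<bar>a - b\<bar> * \<bar>a + b\<bar>" using that by (intro mult_left_mono) auto
 also have "\<dots> = \<bar>a\<^sup>2 - b\<^sup>2\<bar>" by (simp add: abs_mult[symmetric] power2_eq_square algebra_simps)
 finally show ?thesis .
qed

lemma L2_translation_nonneg:
 assumes f: "L2 f" "\<And>z. f z \<ge> 0" and e: "e > 0"
 shows "\<exists>d>0. \<forall>h. norm h < d \<longrightarrow> N2 (\<lambda>z. f (z + h) - f z) < e"
proof -
 have i: "integrable lborel (\<lambda>z. (f z)\<^sup>2)" using f by (simp add: L2_def)
 obtain d where d: "d > 0" "\<And>h. norm h < d \<Longrightarrow> (LBINT z. \<bar>(f (z + h))\<^sup>2 - (f z)\<^sup>2\<bar>) < e"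
  using L1_trans_integrable[OF i] e unfolding L1_trans_def by blast
 show ?thesis
 proof (intro exI[of _ d] conjI allI impI d(1))
  fix h :: 'a assume h: "norm h < d"
  have "N2 (\<lambda>z. f (z + h) - f z) \<le> (LBINT z. \<bar>(f (z + h))\<^sup>2 - (f z)\<^sup>2\<bar>)"
   unfolding N2_def
  proof (rule integral_mono)
   show "integrable lborel (\<lambda>x. (f (x + h) - f x)\<^sup>2)"
    using L2_diff[OF L2_shift[OF f(1)] f(1)] by (simp add: L2_def)
   show "integrable lborel (\<lambda>x. \<bar>(f (x + h))\<^sup>2 - (f x)\<^sup>2\<bar>)"
    using i lborel_shift_integrable[OF i] by auto
  qed (use f nonneg_diff_sq_le in auto)
  with d(2)[OF h] show "N2 (\<lambda>z. f (z + h) - f z) < e" by linarith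
 qed
qed

lemma L2_translation:
 assumes f: "L2 f" and e: "e > 0"
 shows "\<exists>d>0. \<forall>h. norm h < d \<longrightarrow> N2 (\<lambda>z. f (z + h) - f z) < e"
proof -
 let ?p = "\<lambda>z. max 0 (f z)" and ?n = "\<lambda>z. max 0 (- f z)"
 have p: "L2 ?p" and n: "L2 ?n" using f by (auto intro!: L2_bound(1)[of _ f 1])
 obtain d1 where d1: "d1 > 0" "\<And>h. norm h < d1 \<Longrightarrow> N2 (\<lambda>z. ?p (z + h) - ?p z) < e/4"
  using L2_translation_nonneg[OF p, of "e/4"] e by auto
 obtain d2 where d2: "d2 > 0" "\<And>h. norm h < d2 \<Longrightarrow> N2 (\<lambda>z. ?n (z + h) - ?n z) < e/4"
  using L2_translation_nonneg[OF n, of "e/4"] e by auto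
 show ?thesis
 proof (intro exI[of _ "min d1 d2"] conjI allI impI)
  fix h :: 'a assume h: "norm h < min d1 d2"
  have "(\<lambda>z. f (z + h) - f z) = (\<lambda>z. (?p (z + h) - ?p z) - (?n (z + h) - ?n z))" by auto
  then have "N2 (\<lambda>z. f (z + h) - f z) \<le> 2 * N2 (\<lambda>z. ?p (z + h) - ?p z) + 2 * N2 (\<lambda>z. ?n (z + h) - ?n z)"
   using N2_diff_le[OF L2_diff[OF L2_shift[OF p, of h] p] L2_diff[OF L2_shift[OF n, of h] n]] by simp
  then show "N2 (\<lambda>z. f (z + h) - f z) < e" using d1(2)[of h] d2(2)[of h] h by simp
 qed (use d1 d2 in auto)
qed

section \<open>Continuously differentiable functions and convolution\<close>

text \<open>Differentiability with continuous directional derivatives, in exactly the form demanded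
  by \<open>C1c_on\<close>, so that \<open>C1c_on_iff\<close> is immediate.\<close>

definition C1 :: "('a::euclidean_space \<Rightarrow> real) \<Rightarrow> bool" where
 "C1 f \<longleftrightarrow> (\<forall>z. f differentiable (at z)) \<and>
   (\<forall>v. continuous_on UNIV (\<lambda>z. frechet_derivative f (at z) v))"

lemma frechet_derivative_eqI: "(f has_derivative f') (at z) \<Longrightarrow> frechet_derivative f (at z) = f'"
 using frechet_derivative_at by metis

lemma C1I:
 assumes "\<And>z. (f has_derivative f' z) (at z)" "\<And>v. continuous_on UNIV (\<lambda>z. f' z v)"
 shows "C1 f"
 unfolding C1_def using assms frechet_derivative_eqI[OF assms(1)] by (auto simp: differentiable_def)

lemma C1_has_derivative: "C1 f \<Longrightarrow> (f has_derivative frechet_derivative f (at z)) (at z)"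
 by (simp add: C1_def frechet_derivative_works[symmetric])

lemma C1_continuous_derivative: "C1 f \<Longrightarrow> continuous_on UNIV (\<lambda>z. frechet_derivative f (at z) v)"
 by (simp add: C1_def)

lemma C1_continuous: "C1 f \<Longrightarrow> continuous_on UNIV f"
 by (meson C1_def continuous_at_imp_continuous_on differentiable_imp_continuous_within)

lemma C1_linear: "C1 f \<Longrightarrow> linear (frechet_derivative f (at z))"
 by (simp add: C1_def linear_frechet_derivative)

lemma C1_const [simp]: "C1 (\<lambda>z. c)"
 by (rule C1I[of _ "\<lambda>_ _. 0"]) auto

lemma frechet_derivative_add:
 "C1 f \<Longrightarrow> C1 g \<Longrightarrow> frechet_derivative (\<lambda>z. f z + g z) (at z) v
   = frechet_derivative f (at z) v + frechet_derivative g (at z) v"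
 by (subst frechet_derivative_eqI[OF has_derivative_add[OF C1_has_derivative C1_has_derivative]]) auto

lemma C1_add: "C1 f \<Longrightarrow> C1 g \<Longrightarrow> C1 (\<lambda>z. f z + g z)"
 by (rule C1I[OF has_derivative_add[OF C1_has_derivative C1_has_derivative]])
   (auto intro!: continuous_intros C1_continuous_derivative)

lemma frechet_derivative_mult:
 "C1 f \<Longrightarrow> C1 g \<Longrightarrow> frechet_derivative (\<lambda>z. f z * g z) (at z) v
   = f z * frechet_derivative g (at z) v + frechet_derivative f (at z) v * g z"
 by (subst frechet_derivative_eqI[OF has_derivative_mult[OF C1_has_derivative C1_has_derivative]]) auto

lemma C1_mult: assumes "C1 f" "C1 g" shows "C1 (\<lambda>z. f z * g z)"
proof (rule C1I[OF has_derivative_mult[OF C1_has_derivative[OF assms(1)] C1_has_derivative[OF assms(2)]]])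
 note [continuous_intros] = C1_continuous_derivative[OF assms(1)] C1_continuous_derivative[OF assms(2)]
  C1_continuous[OF assms(1)] C1_continuous[OF assms(2)]
 show "continuous_on UNIV (\<lambda>z. f z * frechet_derivative g (at z) v + frechet_derivative f (at z) v * g z)" for v
  by (intro continuous_intros)
qed

lemma C1_diff: "C1 f \<Longrightarrow> C1 g \<Longrightarrow> C1 (\<lambda>z. f z - g z)"
 using C1_add[of f "\<lambda>z. (-1) * g z"] C1_mult[of "\<lambda>_. -1" g] by simp

lemma frechet_derivative_real_compose:
 assumes "C1 f" "\<And>s. (q has_real_derivative q' s) (at s)"
 shows "((\<lambda>z. q (f z)) has_derivative (\<lambda>v. frechet_derivative f (at z) v * q' (f z))) (at z)"
 using DERIV_compose_FDERIV[OF assms(2) C1_has_derivative[OF assms(1)]] .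

lemma C1_real_compose:
 assumes "C1 f" "\<And>s. (q has_real_derivative q' s) (at s)" "continuous_on UNIV q'"
 shows "C1 (\<lambda>z. q (f z))"
proof (rule C1I[OF frechet_derivative_real_compose[OF assms(1,2)]])
 have "continuous_on UNIV (\<lambda>z. q' (f z))"
  using continuous_on_compose2[OF assms(3) C1_continuous[OF assms(1)]] by simp
 then show "continuous_on UNIV (\<lambda>z. frechet_derivative f (at z) v * q' (f z))" for v
  by (intro continuous_intros C1_continuous_derivative assms(1))
qed

lemma C1_exp: "C1 f \<Longrightarrow> C1 (\<lambda>z. exp (f z))"
 by (rule C1_real_compose[of f exp exp]) (auto intro: continuous_intros)

lemma frechet_derivative_exp:
 "C1 f \<Longrightarrow> frechet_derivative (\<lambda>z. exp (f z)) (at z) v = frechet_derivative f (at z) v * exp (f z)"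
 by (subst frechet_derivative_eqI[OF frechet_derivative_real_compose[of f exp exp]]) auto

lemma has_derivative_shift:
 assumes "C1 f"
 shows "((\<lambda>z. f (z + c)) has_derivative frechet_derivative f (at (z + c))) (at z)"
proof -
 have "((\<lambda>z. z + c) has_derivative (\<lambda>v. v)) (at z)" by (auto intro!: derivative_eq_intros)
 from has_derivative_compose[OF this C1_has_derivative[OF assms]] show ?thesis .
qed

lemma has_derivative_reflect:
 assumes "C1 f"
 shows "((\<lambda>w. f (z - w)) has_derivative (\<lambda>v. - frechet_derivative f (at (z - w)) v)) (at w)"
proof -
 have "((\<lambda>w. z - w) has_derivative (\<lambda>v. - v)) (at w)" by (auto intro!: derivative_eq_intros)
 from has_derivative_compose[OF this C1_has_derivative[OF assms]] show ?thesis by (simp add: linear_neg[OF C1_linear[OF assms]])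
qed

lemma C1_reflect: assumes "C1 f" shows "C1 (\<lambda>w. f (z - w))"
proof (rule C1I[OF has_derivative_reflect[OF assms]])
 show "continuous_on UNIV (\<lambda>w. - frechet_derivative f (at (z - w)) v)" for v
  by (intro continuous_on_minus continuous_on_compose2[OF C1_continuous_derivative[OF assms, of v]])
    (auto intro: continuous_intros)
qed

lemma frechet_derivative_outside:
 assumes "closed K" "\<And>z. z \<notin> K \<Longrightarrow> f z = 0" "z \<notin> K"
 shows "(f has_derivative (\<lambda>v. 0)) (at z)"
proof (rule has_derivative_transform_within_open[of "\<lambda>z. 0"])
 show "open (- K)" using assms by auto
qed (use assms in auto)

lemma C1_compact_derivative_bound:
 fixes f :: "'a::euclidean_space \<Rightarrow> real"
 assumes f: "C1 f" and K: "compact K"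
 obtains B where "B \<ge> 0" "\<And>z v. z \<in> K \<Longrightarrow> \<bar>frechet_derivative f (at z) v\<bar> \<le> B * norm v"
proof -
 have "\<exists>M. \<forall>z\<in>K. \<bar>frechet_derivative f (at z) b\<bar> \<le> M" for b
 proof -
  have "compact ((\<lambda>z. frechet_derivative f (at z) b) ` K)"
   using K C1_continuous_derivative[OF f] by (meson compact_continuous_image continuous_on_subset top_greatest)
  then show ?thesis by (auto dest!: compact_imp_bounded simp: bounded_iff)
 qed
 then obtain M where M: "\<And>z b. z \<in> K \<Longrightarrow> \<bar>frechet_derivative f (at z) b\<bar> \<le> M b" by metis
 show thesis
 proof
  show "0 \<le> (\<Sum>b\<in>Basis. \<bar>M b\<bar>)" by (intro sum_nonneg) auto
  fix z v assume z: "z \<in> K"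
  interpret linear "frechet_derivative f (at z)" by (rule C1_linear[OF f])
  have "frechet_derivative f (at z) v = frechet_derivative f (at z) (\<Sum>b\<in>Basis. (v \<bullet> b) *\<^sub>R b)"
   by (simp add: euclidean_representation)
  also have "\<dots> = (\<Sum>b\<in>Basis. (v \<bullet> b) * frechet_derivative f (at z) b)"
   by (simp add: sum scale)
  finally have "\<bar>frechet_derivative f (at z) v\<bar> \<le> (\<Sum>b\<in>Basis. \<bar>(v \<bullet> b) * frechet_derivative f (at z) b\<bar>)"
   by simp
  also have "\<dots> \<le> (\<Sum>b\<in>Basis. \<bar>M b\<bar> * norm v)"
  proof (rule sum_mono)
   fix b :: 'a assume b: "b \<in> Basis"
   have "\<bar>(v \<bullet> b)\<bar> * \<bar>frechet_derivative f (at z) b\<bar> \<le> norm v * \<bar>M b\<bar>"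
    using M[OF z, of b] Basis_le_norm[OF b, of v] by (intro mult_mono) auto
   then show "\<bar>(v \<bullet> b) * frechet_derivative f (at z) b\<bar> \<le> \<bar>M b\<bar> * norm v"
    by (simp add: abs_mult mult.commute)
  qed
  finally show "\<bar>frechet_derivative f (at z) v\<bar> \<le> (\<Sum>b\<in>Basis. \<bar>M b\<bar>) * norm v"
   by (simp add: sum_distrib_right)
 qed
qed

text \<open>By the mean value inequality the remainder of each integrand, divided by the norm of the
  increment, is at most 2 g, so dominated convergence applies along every sequence of increments.
  The lemma serves convolutions, averages in time and the heat potentials alike.\<close>

lemma has_derivative_integral_dominated:
 fixes f :: "'b \<Rightarrow> 'a::euclidean_space \<Rightarrow> real"
 assumes U: "convex U" "open U" "x \<in> U"
  and der: "\<And>w z. w \<in> space M \<Longrightarrow> z \<in> U \<Longrightarrow> (f w has_derivative f' w z) (at z)"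
  and int: "\<And>z. z \<in> U \<Longrightarrow> integrable M (\<lambda>w. f w z)"
  and bd: "\<And>w z v. w \<in> space M \<Longrightarrow> z \<in> U \<Longrightarrow> \<bar>f' w z v\<bar> \<le> g w * norm v"
  and g: "integrable M g"
  and meas: "\<And>v. (\<lambda>w. f' w x v) \<in> borel_measurable M"
 shows "((\<lambda>z. \<integral>w. f w z \<partial>M) has_derivative (\<lambda>v. \<integral>w. f' w x v \<partial>M)) (at x)"
  and "integrable M (\<lambda>w. f' w x v)"
proof -
 have if': "integrable M (\<lambda>w. f' w x v)" for v
  by (rule Bochner_Integration.integrable_bound[where f = "\<lambda>w. g w * norm v"])
   (use g meas bd U in \<open>auto intro!: AE_I2 order_trans[OF bd abs_ge_self]\<close>)
 show "integrable M (\<lambda>w. f' w x v)" by (rule if')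
 have lin: "linear (f' w x)" if "w \<in> space M" for w
  using der[OF that U(3)] by (simp add: bounded_linear.linear has_derivative_bounded_linear)
 have lin2: "linear (\<lambda>v. \<integral>w. f' w x v \<partial>M)"
 proof (rule linearI)
  fix u v
  have "(\<integral>w. f' w x (u + v) \<partial>M) = (\<integral>w. f' w x u + f' w x v \<partial>M)"
   by (rule Bochner_Integration.integral_cong) (auto simp: linear_add[OF lin])
  then show "(\<integral>w. f' w x (u + v) \<partial>M) = (\<integral>w. f' w x u \<partial>M) + (\<integral>w. f' w x v \<partial>M)" using if' by simp
 next
  fix c v
  have "(\<integral>w. f' w x (c *\<^sub>R v) \<partial>M) = (\<integral>w. c * f' w x v \<partial>M)"
   by (rule Bochner_Integration.integral_cong) (auto simp: linear_scale[OF lin])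
  then show "(\<integral>w. f' w x (c *\<^sub>R v) \<partial>M) = c *\<^sub>R (\<integral>w. f' w x v \<partial>M)" by simp
 qed
 have lip: "\<bar>f w z - f w x\<bar> \<le> g w * norm (z - x)" if w: "w \<in> space M" and z: "z \<in> U" for w z
 proof -
  have "norm (f w z - f w x) \<le> g w * norm (z - x)"
  proof (rule differentiable_bound[OF U(1)])
   show "(f w has_derivative f' w y) (at y within U)" if "y \<in> U" for y
    using der[OF w that] has_derivative_at_withinI by blast
   show "onorm (f' w y) \<le> g w" if "y \<in> U" for y
    by (rule onorm_le) (use bd[OF w that] in auto)
  qed (use z U in auto)
  then show ?thesis by simp
 qed
 let ?q = "\<lambda>h w. (f w (x + h) - f w x - f' w x h) / norm h"
 obtain r where r: "r > 0" "ball x r \<subseteq> U" using U open_contains_ball by blast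
 have ev: "\<bar>?q h w\<bar> \<le> 2 * g w" if "w \<in> space M" "norm h < r" "h \<noteq> 0" for h w
 proof -
  have "x + h \<in> U" using that r by (auto simp: subset_iff dist_norm)
  then have "\<bar>f w (x + h) - f w x\<bar> \<le> g w * norm h" using lip[OF that(1)] by fastforce
  moreover have "\<bar>f' w x h\<bar> \<le> g w * norm h" using bd[OF that(1) U(3)] .
  ultimately have "\<bar>f w (x + h) - f w x - f' w x h\<bar> \<le> 2 * g w * norm h" by linarith
  then show ?thesis using that by (simp add: field_simps)
 qed
 have "((\<lambda>h. \<integral>w. ?q h w \<partial>M) \<longlongrightarrow> 0) (at 0)"
  unfolding tendsto_at_iff_sequentially
 proof (intro allI impI)
  fix X :: "nat \<Rightarrow> 'a" assume X: "\<forall>i. X i \<in> UNIV - {0}" "X \<longlonglongrightarrow> 0"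
  have "\<forall>\<^sub>F i in sequentially. norm (X i) < r"
   using tendstoD[OF X(2) r(1)] by (simp add: dist_norm)
  then obtain N where N: "\<And>i. i \<ge> N \<Longrightarrow> norm (X i) < r" by (auto simp: eventually_sequentially)
  have "(\<lambda>i. \<integral>w. ?q (X (i + N)) w \<partial>M) \<longlonglongrightarrow> (\<integral>w. 0 \<partial>M)"
  proof (rule integral_dominated_convergence[where w = "\<lambda>w. 2 * g w" and f = "\<lambda>_. 0"
     and s = "\<lambda>i. ?q (X (i + N))"])
   show "(\<lambda>w. ?q (X (i + N)) w) \<in> borel_measurable M" for i
   proof -
    have xU: "x + X (i + N) \<in> U" using N[of "i+N"] r by (auto simp: subset_iff dist_norm)
    show ?thesis
     by (rule borel_measurable_divide[OF borel_measurable_diff[OF borel_measurable_diff[OF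
        borel_measurable_integrable[OF int[OF xU]] borel_measurable_integrable[OF int[OF U(3)]]] meas]
        borel_measurable_const])
   qed
   show "AE w in M. (\<lambda>i. ?q (X (i + N)) w) \<longlonglongrightarrow> 0"
   proof (rule AE_I2)
    fix w assume w: "w \<in> space M"
    have "((\<lambda>h. norm (f w (x + h) - f w x - f' w x h) / norm h) \<longlongrightarrow> 0) (at 0)"
     using der[OF w U(3)] unfolding has_derivative_at by blast
    then have "((\<lambda>h. norm (?q h w)) \<longlongrightarrow> 0) (at 0)" by simp
    then have "((\<lambda>h. ?q h w) \<longlongrightarrow> 0) (at 0)" by (rule tendsto_norm_zero_cancel)
    then have "((\<lambda>h. ?q h w) \<circ> X) \<longlonglongrightarrow> 0" using X unfolding tendsto_at_iff_sequentially by blast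
    then show "(\<lambda>i. ?q (X (i + N)) w) \<longlonglongrightarrow> 0" unfolding o_def by (rule LIMSEQ_ignore_initial_segment)
   qed
   show "AE w in M. norm (?q (X (i + N)) w) \<le> 2 * g w" for i
    using ev[of _ "X (i + N)"] N[of "i + N"] X(1) by auto
  qed (use g in auto)
  then show "((\<lambda>h. \<integral>w. ?q h w \<partial>M) \<circ> X) \<longlonglongrightarrow> 0"
   unfolding o_def using LIMSEQ_offset by fastforce
 qed
 moreover have "\<forall>\<^sub>F h in at 0. (\<integral>w. ?q h w \<partial>M) = ((\<integral>w. f w (x + h) \<partial>M) - (\<integral>w. f w x \<partial>M) - (\<integral>w. f' w x h \<partial>M)) / norm h"
 proof -
  have "\<forall>\<^sub>F h in at 0. norm (h::'a) < r" using r(1) eventually_at_ball[of r 0 UNIV] by (auto simp: dist_norm elim: eventually_mono)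
  then show ?thesis
  proof eventually_elim
   case (elim h)
   have "x + h \<in> U" using elim r by (auto simp: subset_iff dist_norm)
   then show ?case using int int[OF U(3)] if' by simp
  qed
 qed
 ultimately have "((\<lambda>h. ((\<integral>w. f w (x + h) \<partial>M) - (\<integral>w. f w x \<partial>M) - (\<integral>w. f' w x h \<partial>M)) / norm h) \<longlongrightarrow> 0) (at 0)"
  by (rule Lim_transform_eventually)
 then have "((\<lambda>h. norm ((\<integral>w. f w (x + h) \<partial>M) - (\<integral>w. f w x \<partial>M) - (\<integral>w. f' w x h \<partial>M)) / norm h) \<longlongrightarrow> 0) (at 0)"
  using tendsto_norm_zero by fastforce
 then show "((\<lambda>z. \<integral>w. f w z \<partial>M) has_derivative (\<lambda>v. \<integral>w. f' w x v \<partial>M)) (at x)"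
  unfolding has_derivative_at using lin2 by (simp add: linear_conv_bounded_linear)
qed

section \<open>Convolution with compactly supported kernels\<close>

definition locint :: "('a::euclidean_space \<Rightarrow> real) \<Rightarrow> bool" where
 "locint f \<longleftrightarrow> f \<in> borel_measurable borel \<and> (\<forall>c r. integrable lborel (\<lambda>w. indicator (cball c r) w * f w))"

lemma integrable_indicator_cball: "integrable lborel (indicator (cball c r) :: 'a::euclidean_space \<Rightarrow> real)"
 using emeasure_lborel_cball_finite[of c r] by (simp add: integrable_indicator_iff top.not_eq_extremum)

lemma L2_locint: assumes "L2 f" shows "locint f"
 unfolding locint_def
proof (intro conjI allI)
 show m: "f \<in> borel_measurable borel" using assms by (simp add: L2_def)
 fix c r
 show "integrable lborel (\<lambda>w. indicator (cball c r) w * f w)"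
 proof (rule Bochner_Integration.integrable_bound)
  show "integrable lborel (\<lambda>w. indicator (cball c r) w + (f w)\<^sup>2 :: real)"
   by (rule Bochner_Integration.integrable_add[OF integrable_indicator_cball L2_integrable_sq[OF assms]])
  have "\<bar>a\<bar> \<le> 1 + a\<^sup>2" for a :: real
   using zero_le_power2[of "\<bar>a\<bar> - 1"] by (simp add: power2_diff)
  then show "AE w in lborel. norm (indicator (cball c r) w * f w) \<le> norm (indicator (cball c r) w + (f w)\<^sup>2)"
   by (intro AE_I2) (auto simp: indicator_def abs_of_nonneg)
 qed (use m in \<open>auto intro!: borel_measurable_times borel_measurable_indicator\<close>)
qed

lemma continuous_locint:
 assumes f: "continuous_on UNIV f" shows "locint f"
 unfolding locint_def
proof (intro conjI allI)
 show m: "f \<in> borel_measurable borel" using f by (rule borel_measurable_continuous_onI)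
 fix c r
 have "compact (f ` cball c r)" using f by (meson compact_cball compact_continuous_image continuous_on_subset top_greatest)
 then have "bounded (f ` cball c r)" by (rule compact_imp_bounded)
 then obtain B where B0: "\<forall>y\<in>f ` cball c r. norm y \<le> B" unfolding bounded_iff by blast
 have B: "\<bar>f z\<bar> \<le> B" if "z \<in> cball c r" for z using B0 that by (metis imageI real_norm_def)
 show "integrable lborel (\<lambda>w. indicator (cball c r) w * f w)"
 proof (rule Bochner_Integration.integrable_bound)
  show "integrable lborel (\<lambda>w. B * indicator (cball c r) w :: real)"
   using integrable_indicator_cball[of c r] by auto
  show "AE w in lborel. norm (indicator (cball c r) w * f w) \<le> norm (B * indicator (cball c r) w)"
   using B by (intro AE_I2) (auto simp: indicator_def intro: order_trans[OF _ abs_ge_self])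
 qed (use m in \<open>auto intro!: borel_measurable_times borel_measurable_indicator\<close>)
qed

definition conv :: "('a::euclidean_space \<Rightarrow> real) \<Rightarrow> ('a \<Rightarrow> real) \<Rightarrow> 'a \<Rightarrow> real" where
 "conv k f z = (LBINT w. k (z - w) * f w)"

lemma continuous_compact_bound:
 fixes f :: "'a::euclidean_space \<Rightarrow> real"
 assumes f: "continuous_on UNIV f" "\<And>z. z \<notin> cball a r \<Longrightarrow> f z = 0"
 obtains B where "B \<ge> 0" "\<And>z. \<bar>f z\<bar> \<le> B"
proof -
 have "compact (f ` cball a r)" using f by (meson compact_cball compact_continuous_image continuous_on_subset top_greatest)
 then have "bounded (f ` cball a r)" by (rule compact_imp_bounded)
 then obtain B where B0: "\<forall>y\<in>f ` cball a r. norm y \<le> B" unfolding bounded_iff by blast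
 have B: "\<bar>f z\<bar> \<le> B" if "z \<in> cball a r" for z using B0 that by (metis imageI real_norm_def)
 show thesis
 proof (rule that[of "\<bar>B\<bar>"])
  show "\<bar>f z\<bar> \<le> \<bar>B\<bar>" for z using B[of z] f(2)[of z] by (cases "z \<in> cball a r") auto
 qed auto
qed

text \<open>One majorant for all z within distance 1 of z0; both continuity and differentiability of
  convolutions follow from it by dominated convergence.\<close>

lemma conv_dominated:
 fixes j :: "'a::euclidean_space \<Rightarrow> real"
 assumes j: "\<And>z. \<bar>j z\<bar> \<le> B" "\<And>z. z \<notin> cball a r \<Longrightarrow> j z = 0" and z: "dist z z0 \<le> 1"
 shows "\<bar>j (z - w) * f w\<bar> \<le> B * \<bar>indicator (cball (z0 - a) (r + 1)) w * f w\<bar>"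
proof (cases "z - w \<in> cball a r")
 case True
 have "dist (z0 - a) w = norm ((z0 - z) + (z - w - a))" by (simp add: dist_norm algebra_simps)
 also have "\<dots> \<le> norm (z0 - z) + norm (z - w - a)" by (rule norm_triangle_ineq)
 also have "\<dots> \<le> 1 + r" using z True by (simp add: dist_norm norm_minus_commute)
 finally show ?thesis using j(1)[of "z - w"] by (simp add: abs_mult mult_right_mono)
next
 case False
 have "0 \<le> B" using j(1)[of 0] by linarith
 then show ?thesis using j(2)[OF False] by simp
qed

lemma conv_integrable:
 fixes j :: "'a::euclidean_space \<Rightarrow> real"
 assumes j: "continuous_on UNIV j" "\<And>z. z \<notin> cball a r \<Longrightarrow> j z = 0" and f: "locint f"
 shows "integrable lborel (\<lambda>w. j (z - w) * f w)"
proof -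
 obtain B where B: "B \<ge> 0" "\<And>z. \<bar>j z\<bar> \<le> B" using continuous_compact_bound[OF j] by blast
 have [measurable]: "f \<in> borel_measurable borel" "j \<in> borel_measurable borel"
  using f j(1) by (auto simp: locint_def borel_measurable_continuous_onI)
 show ?thesis
 proof (rule Bochner_Integration.integrable_bound)
  show "integrable lborel (\<lambda>w. B * \<bar>indicator (cball (z - a) (r + 1)) w * f w\<bar>)"
   using f by (auto simp: locint_def)
  show "AE w in lborel. norm (j (z - w) * f w) \<le> norm (B * \<bar>indicator (cball (z - a) (r + 1)) w * f w\<bar>)"
   using conv_dominated[OF B(2) j(2), where z=z and ?z0.0=z] B(1) by (intro AE_I2) auto
 qed measurable
qed

lemma conv_continuous:
 fixes j :: "'a::euclidean_space \<Rightarrow> real"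
 assumes j: "continuous_on UNIV j" "\<And>z. z \<notin> cball a r \<Longrightarrow> j z = 0" and f: "locint f"
 shows "continuous_on UNIV (conv j f)"
proof -
 obtain B where B: "B \<ge> 0" "\<And>z. \<bar>j z\<bar> \<le> B" using continuous_compact_bound[OF j] by blast
 have [measurable]: "f \<in> borel_measurable borel" "j \<in> borel_measurable borel"
  using f j(1) by (auto simp: locint_def borel_measurable_continuous_onI)
 show ?thesis
  unfolding continuous_on_sequentially o_def
 proof (intro ballI allI impI; elim conjE)
  fix z :: 'a and X assume X: "X \<longlonglongrightarrow> z"
  then obtain N where N: "\<And>i. i \<ge> N \<Longrightarrow> dist (X i) z \<le> 1"
   unfolding lim_sequentially by (meson less_imp_le zero_less_one)
  have "(\<lambda>i. conv j f (X (i + N))) \<longlonglongrightarrow> conv j f z"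
   unfolding conv_def
  proof (rule integral_dominated_convergence[where w = "\<lambda>w. B * \<bar>indicator (cball (z - a) (r + 1)) w * f w\<bar>"])
   show "integrable lborel (\<lambda>w. B * \<bar>indicator (cball (z - a) (r + 1)) w * f w\<bar>)"
    using f by (auto simp: locint_def)
   show "AE w in lborel. norm (j (X (i + N) - w) * f w) \<le> B * \<bar>indicator (cball (z - a) (r + 1)) w * f w\<bar>" for i
    using conv_dominated[OF B(2) j(2) N[of "i + N"]] by (intro AE_I2) auto
   show "AE w in lborel. (\<lambda>i. j (X (i + N) - w) * f w) \<longlonglongrightarrow> j (z - w) * f w"
   proof (intro AE_I2 tendsto_intros)
    fix w
    have "(\<lambda>i. X (i + N) - w) \<longlonglongrightarrow> z - w" using LIMSEQ_ignore_initial_segment[OF X] by (intro tendsto_intros)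
    then show "(\<lambda>i. j (X (i + N) - w)) \<longlonglongrightarrow> j (z - w)"
     using continuous_on_tendsto_compose[OF j(1)] by auto
   qed
  qed measurable
  then show "(\<lambda>i. conv j f (X i)) \<longlonglongrightarrow> conv j f z" by (rule LIMSEQ_offset)
 qed
qed

lemma conv_has_derivative:
 fixes k :: "'a::euclidean_space \<Rightarrow> real"
 assumes k: "C1 k" "\<And>z. z \<notin> cball a r \<Longrightarrow> k z = 0" and f: "locint f"
 shows "(conv k f has_derivative (\<lambda>v. conv (\<lambda>z. frechet_derivative k (at z) v) f z)) (at z)"
  and "C1 (conv k f)"
proof -
 have k': "frechet_derivative k (at z) = (\<lambda>v. 0)" if "z \<notin> cball a r" for z
  by (rule frechet_derivative_eqI[OF frechet_derivative_outside[OF closed_cball k(2) that]])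
 obtain B where B: "B \<ge> 0" "\<And>z v. z \<in> cball a r \<Longrightarrow> \<bar>frechet_derivative k (at z) v\<bar> \<le> B * norm v"
  using C1_compact_derivative_bound[OF k(1) compact_cball] by blast
 have B': "\<bar>frechet_derivative k (at z) v\<bar> \<le> B * norm v" for z v
  using B k'[of z] by (cases "z \<in> cball a r") auto
 have [measurable]: "f \<in> borel_measurable borel" using f by (simp add: locint_def)
 have [measurable]: "(\<lambda>z. frechet_derivative k (at z) v) \<in> borel_measurable borel" for v
  using C1_continuous_derivative[OF k(1)] by (rule borel_measurable_continuous_onI)
 show *: "(conv k f has_derivative (\<lambda>v. conv (\<lambda>z. frechet_derivative k (at z) v) f z)) (at z)" for z
  unfolding conv_def[abs_def]
 proof (rule has_derivative_integral_dominated(1)[where U = "ball z 1" and g = "\<lambda>w. B * \<bar>indicator (cball (z - a) (r + 1)) w * f w\<bar>"])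
  show "((\<lambda>y. k (y - w) * f w) has_derivative (\<lambda>v. frechet_derivative k (at (y - w)) v * f w)) (at y)" for w y
   using has_derivative_shift[OF k(1), of "- w" y] by (auto intro: has_derivative_mult_left)
  show "integrable lborel (\<lambda>w. k (y - w) * f w)" for y
   by (rule conv_integrable[OF C1_continuous[OF k(1)] k(2) f])
  show "integrable lborel (\<lambda>w. B * \<bar>indicator (cball (z - a) (r + 1)) w * f w\<bar>)" using f by (auto simp: locint_def)
  fix w y v assume y: "y \<in> ball z 1"
  have "\<bar>frechet_derivative k (at (y - w)) v * f w\<bar> \<le> (B * norm v) * \<bar>indicator (cball (z - a) (r + 1)) w * f w\<bar>"
   by (rule conv_dominated[where a=a and j="\<lambda>z. frechet_derivative k (at z) v"])
     (use B' k' y in \<open>auto simp: dist_commute\<close>)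
  then show "\<bar>frechet_derivative k (at (y - w)) v * f w\<bar> \<le> B * \<bar>indicator (cball (z - a) (r + 1)) w * f w\<bar> * norm v"
   by (simp add: mult_ac)
 qed auto
 show "C1 (conv k f)"
  by (rule C1I[OF *], rule conv_continuous[OF C1_continuous_derivative[OF k(1)] _ f, of a r]) (simp add: k')
qed

lemma conv_flip:
 fixes k :: "'a::euclidean_space \<Rightarrow> real"
 assumes "k \<in> borel_measurable borel" "f \<in> borel_measurable borel"
 shows "conv k f z = (LBINT h. k h * f (z - h))"
proof -
 note [measurable] = assms
 have "(\<lambda>h. k h * f (z - h)) \<in> borel_measurable borel" by measurable
 from lborel_reflect_integral[OF this, of z]
 have "(LBINT h. k (z - h) * f (z - (z - h))) = (LBINT h. k h * f (z - h))" .
 then show ?thesis by (simp add: conv_def)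
qed

text \<open>The centre a is left free: smoothing with a kernel centred away from 0 also shifts the
  support, and this is how functions on a Lipschitz domain are moved inward.\<close>

definition kernel :: "('a::euclidean_space \<Rightarrow> real) \<Rightarrow> 'a \<Rightarrow> real \<Rightarrow> bool" where
 "kernel k a r \<longleftrightarrow> C1 k \<and> (\<forall>z. k z \<ge> 0) \<and> (\<forall>z. z \<notin> ball a r \<longrightarrow> k z = 0) \<and> (LBINT z. k z) = 1"

text \<open>The square of the positive part is a simple C^1 function that vanishes on a half line.
  The bumps and cutoffs below are built from it, since one continuous derivative is all they
  need.\<close>

lemma DERIV_max_sq: "((\<lambda>s. (max 0 s)\<^sup>2) has_real_derivative 2 * max 0 s) (at (s::real))"
proof (cases "s = 0")
 case True
 have "(\<lambda>h::real. (max 0 h)\<^sup>2 / h) \<midarrow>0\<rightarrow> 0"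
 proof (rule Lim_null_comparison[where g = "\<lambda>h. \<bar>h\<bar>"])
  show "\<forall>\<^sub>F h in at (0::real). norm ((max 0 h)\<^sup>2 / h) \<le> \<bar>h\<bar>"
   by (intro always_eventually allI) (auto simp: max_def power2_eq_square)
 qed (auto intro!: tendsto_eq_intros)
 then show ?thesis using True by (simp add: DERIV_def)
next
 case False
 show ?thesis
 proof (cases "s > 0")
  case True
  have "((\<lambda>s. s\<^sup>2) has_real_derivative 2 * max 0 s) (at s)" using True by (auto intro!: derivative_eq_intros)
  then show ?thesis by (rule has_field_derivative_transform_within_open[of _ _ _ "{0<..}"]) (use True in auto)
 next
  case F: False
  have "((\<lambda>s. 0) has_real_derivative 2 * max 0 s) (at s)" using F by (auto intro!: derivative_eq_intros)
  then show ?thesis by (rule has_field_derivative_transform_within_open[of _ _ _ "{..<0}"]) (use False F in auto)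
 qed
qed

lemma C1_inner_sq: "C1 (\<lambda>z. (z - a) \<bullet> (z - a))"
proof (rule C1I)
 show "((\<lambda>z. (z - a) \<bullet> (z - a)) has_derivative (\<lambda>v. 2 * ((z - a) \<bullet> v))) (at z)" for z
  by (auto intro!: derivative_eq_intros simp: inner_commute)
qed (auto intro!: continuous_intros)

definition bump :: "'a::euclidean_space \<Rightarrow> real \<Rightarrow> 'a \<Rightarrow> real" where
 "bump a r z = (max 0 (r\<^sup>2 - (z - a) \<bullet> (z - a)))\<^sup>2"

lemma C1_bump: "C1 (bump a r)"
 unfolding bump_def
 by (rule C1_real_compose[OF C1_diff[OF C1_const C1_inner_sq] DERIV_max_sq]) (auto intro!: continuous_intros)

lemma bump_nonneg: "bump a r z \<ge> 0" by (simp add: bump_def)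

lemma bump_pos_iff: "r > 0 \<Longrightarrow> bump a r z > 0 \<longleftrightarrow> z \<in> ball a r"
 by (auto simp: bump_def dist_norm norm_minus_commute power2_norm_eq_inner[symmetric] abs_le_square_iff[symmetric] not_le max_def)

lemma kernel_exists:
 fixes a :: "'a::euclidean_space" assumes r: "r > 0" obtains k where "kernel k a r"
proof -
 have z: "bump a r z = 0" if "z \<notin> ball a r" for z
  using bump_pos_iff[OF r, of a z] bump_nonneg[of a r z] that by auto
 have i: "integrable lborel (bump a r)"
 proof -
  have "locint (bump a r)" by (rule continuous_locint[OF C1_continuous[OF C1_bump]])
  then have "integrable lborel (\<lambda>w. indicator (cball a r) w * bump a r w)" by (simp add: locint_def)
  moreover have "(\<lambda>w. indicator (cball a r) w * bump a r w) = bump a r"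
   using z by (auto simp: indicator_def fun_eq_iff)
  ultimately show ?thesis by simp
 qed
 let ?I = "\<integral>z. bump a r z \<partial>lborel"
 have "?I \<noteq> 0"
 proof
  assume "?I = 0"
  then have "AE z in lborel. bump a r z = 0"
   using integral_nonneg_eq_0_iff_AE[OF i] bump_nonneg by auto
  then have "AE z in lborel. z \<notin> ball a r" by eventually_elim (use bump_pos_iff[OF r, of a] in force)
  then have "ball a r \<in> null_sets lborel" by (subst AE_iff_null_sets) auto
  then have "negligible (ball a r)" using null_sets_completionI negligible_iff_null_sets by blast
  then show False using r open_not_negligible[of "ball a r"] by simp
 qed
 moreover have "?I \<ge> 0" by (intro integral_nonneg_AE) (simp add: bump_nonneg)
 ultimately have p: "?I > 0" by linarith
 have "C1 (\<lambda>z. bump a r z * (1 / ?I))" by (intro C1_mult C1_bump C1_const)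
 then have "kernel (\<lambda>z. bump a r z * (1 / ?I)) a r"
  unfolding kernel_def using z p by (auto simp: bump_nonneg)
 then show thesis by (rule that)
qed

lemma kernelD:
 assumes "kernel k a r"
 shows "C1 k" "\<And>z. k z \<ge> 0" "\<And>z. z \<notin> ball a r \<Longrightarrow> k z = 0" "\<And>z. z \<notin> cball a r \<Longrightarrow> k z = 0"
  "(LBINT z. k z) = 1" "integrable lborel k" "k \<in> borel_measurable borel" "continuous_on UNIV k"
proof -
 show "(LBINT z. k z) = 1" using assms by (simp add: kernel_def)
 then show "integrable lborel k" using not_integrable_integral_eq by fastforce
 then show "k \<in> borel_measurable borel" by auto
qed (use assms C1_continuous in \<open>auto simp: kernel_def\<close>)

text \<open>Jensen's inequality for the probability density k bounds the squared pointwise error by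
  a k-average of squared translation errors. Exchanging the integrals leaves the k-average of
  \<open>N2\<close> of the translation errors, each of which is at most e.\<close>

lemma conv_kernel_L2_close:
 fixes f :: "'a::euclidean_space \<Rightarrow> real"
 assumes k: "kernel k a r" and f: "L2 f" and e: "e \<ge> 0"
  and close: "\<And>h. h \<in> ball a r \<Longrightarrow> N2 (\<lambda>z. f (z - h) - f z) \<le> e"
 shows "L2 (conv k f)" and "N2 (\<lambda>z. conv k f z - f z) \<le> e"
proof -
 note kd = kernelD[OF k]
 have [measurable]: "k \<in> borel_measurable borel" "f \<in> borel_measurable borel" using kd f by auto
 obtain B where B: "B \<ge> 0" "\<And>z. \<bar>k z\<bar> \<le> B" using continuous_compact_bound[OF kd(8) kd(4)] by blast
 have lf: "locint f" by (rule L2_locint[OF f])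
 have [measurable]: "conv k f \<in> borel_measurable borel"
  by (rule borel_measurable_continuous_onI[OF conv_continuous[OF kd(8) kd(4) lf]])
 have jensen: "(conv k f z - f z)\<^sup>2 \<le> (LBINT h. k h * (f (z - h) - f z)\<^sup>2)"
  and ij: "integrable lborel (\<lambda>h. k h * (f (z - h) - f z)\<^sup>2)" for z
 proof -
  have "integrable lborel (\<lambda>w. k (z - w) * f w)"
   by (rule conv_integrable[where a = a and r = r]) (auto simp: kd lf)
  from lborel_reflect_integrable[OF this, of z]
  have i1: "integrable lborel (\<lambda>h. k h * f (z - h))" by simp
  have i2: "integrable lborel (\<lambda>h. k h * (f (z - h))\<^sup>2)"
  proof (rule Bochner_Integration.integrable_bound)
   show "integrable lborel (\<lambda>h. B * (f (z - h))\<^sup>2)"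
    using lborel_reflect_integrable[OF L2_integrable_sq[OF f], of z] by simp
   show "AE h in lborel. norm (k h * (f (z - h))\<^sup>2) \<le> norm (B * (f (z - h))\<^sup>2)"
    using B by (intro AE_I2) (auto simp: abs_mult intro!: mult_right_mono)
  qed measurable
  have i3: "integrable lborel (\<lambda>h. k h * c)" for c using kd(6) by simp
  have exp1: "k h * (f (z - h) - c)\<^sup>2 = k h * (f (z - h))\<^sup>2 - 2 * c * (k h * f (z - h)) + c\<^sup>2 * k h" for h c
   by (simp add: power2_diff algebra_simps)
  show ij: "integrable lborel (\<lambda>h. k h * (f (z - h) - f z)\<^sup>2)"
   unfolding exp1 using i1 i2 kd(6) by auto
  let ?m = "conv k f z"
  have m: "(LBINT h. k h * f (z - h)) = ?m" by (rule conv_flip[symmetric]) auto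
  have v: "(LBINT h. k h * (f (z - h) - c)\<^sup>2) = (LBINT h. k h * (f (z - h))\<^sup>2) - 2 * c * ?m + c\<^sup>2" for c
   unfolding exp1 using i1 i2 kd(5,6) m by simp
  \<comment> \<open>The variance of f (z - h) under the density k is nonnegative; expanded by
    \<open>v\<close>, this is the required case of Jensen's inequality.\<close>
  have "0 \<le> (LBINT h. k h * (f (z - h) - ?m)\<^sup>2)" by (intro integral_nonneg_AE) (simp add: kd(2))
  then show "(conv k f z - f z)\<^sup>2 \<le> (LBINT h. k h * (f (z - h) - f z)\<^sup>2)"
   unfolding v by (simp add: power2_eq_square algebra_simps)
 qed
 have "(\<integral>\<^sup>+z. ennreal ((conv k f z - f z)\<^sup>2) \<partial>lborel)
   \<le> (\<integral>\<^sup>+z. (\<integral>\<^sup>+h. ennreal (k h * (f (z - h) - f z)\<^sup>2) \<partial>lborel) \<partial>lborel)"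
  using jensen kd(2) by (intro nn_integral_mono) (subst nn_integral_eq_integral[OF ij]; auto intro!: ennreal_leI)
 also have "\<dots> = (\<integral>\<^sup>+h. (\<integral>\<^sup>+z. ennreal (k h * (f (z - h) - f z)\<^sup>2) \<partial>lborel) \<partial>lborel)"
  by (rule lborel_pair.Fubini') measurable
 also have "\<dots> \<le> (\<integral>\<^sup>+h. ennreal (k h * e) \<partial>lborel)"
 proof (rule nn_integral_mono)
  fix h
  have s: "L2 (\<lambda>z. f (z - h) - f z)" using L2_diff[OF L2_shift[OF f, of "- h"] f] by simp
  have "(\<integral>\<^sup>+z. ennreal (k h * (f (z - h) - f z)\<^sup>2) \<partial>lborel) = ennreal (k h * N2 (\<lambda>z. f (z - h) - f z))"
   unfolding N2_def using kd(2) L2_integrable_sq[OF s]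
   by (subst nn_integral_eq_integral) auto
  also have "\<dots> \<le> ennreal (k h * e)"
   using close[of h] kd(2)[of h] kd(3)[of h] by (cases "h \<in> ball a r") (auto intro!: ennreal_leI mult_left_mono)
  finally show "(\<integral>\<^sup>+z. ennreal (k h * (f (z - h) - f z)\<^sup>2) \<partial>lborel) \<le> ennreal (k h * e)" .
 qed
 also have "\<dots> = ennreal e"
  using kd(2,5,6) e by (subst nn_integral_eq_integral) auto
 finally have fin: "(\<integral>\<^sup>+z. ennreal ((conv k f z - f z)\<^sup>2) \<partial>lborel) \<le> ennreal e" .
 have "L2 (\<lambda>z. conv k f z - f z)" unfolding L2_def
 proof (intro conjI integrableI_bounded)
  show "(\<integral>\<^sup>+ x. ennreal (norm ((conv k f x - f x)\<^sup>2)) \<partial>lborel) < \<infinity>"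
   using fin by (simp add: order.strict_trans1[OF _ ennreal_less_top])
 qed measurable
 from L2_add[OF this f] show "L2 (conv k f)" by simp
 show "N2 (\<lambda>z. conv k f z - f z) \<le> e"
  unfolding N2_def using fin e by (subst integral_eq_nn_integral) (auto intro: enn2real_leI)
qed

section \<open>Weak spatial gradients and density of test functions\<close>

lemma C1c_on_iff: "C1c_on \<phi> S \<longleftrightarrow> C1 \<phi> \<and> (\<exists>K. compact K \<and> K \<subseteq> S \<and> (\<forall>z. z \<notin> K \<longrightarrow> \<phi> z = 0))"
 by (simp add: C1c_on_def C1_def)

lemma C1c_on_C1: "C1c_on \<phi> S \<Longrightarrow> C1 \<phi>" by (simp add: C1c_on_iff)

lemma gradx_part_nth: "gradx_part \<phi> z $ i = frechet_derivative \<phi> (at z) (0, axis i 1)"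
 by (simp add: gradx_part_def)

lemma gradx_part_mult: "C1 f \<Longrightarrow> C1 g \<Longrightarrow> gradx_part (\<lambda>z. f z * g z) z = f z *\<^sub>R gradx_part g z + g z *\<^sub>R gradx_part f z"
 by (simp add: vec_eq_iff gradx_part_nth frechet_derivative_mult)

lemma gradx_part_add: "C1 f \<Longrightarrow> C1 g \<Longrightarrow> gradx_part (\<lambda>z. f z + g z) z = gradx_part f z + gradx_part g z"
 by (simp add: vec_eq_iff gradx_part_nth frechet_derivative_add)

lemma gradx_part_exp: "C1 f \<Longrightarrow> gradx_part (\<lambda>z. exp (f z)) z = exp (f z) *\<^sub>R gradx_part f z"
 by (simp add: vec_eq_iff gradx_part_nth frechet_derivative_exp)

lemma continuous_gradx_part: "C1 f \<Longrightarrow> continuous_on UNIV (\<lambda>z. gradx_part f z $ i)"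
 unfolding gradx_part_nth by (rule C1_continuous_derivative)

lemma bounded_support_L2:
 assumes f: "f \<in> borel_measurable borel" and B: "\<And>z. \<bar>f z\<bar> \<le> B" and s: "\<And>z. z \<notin> cball a r \<Longrightarrow> f z = 0"
 shows "L2 f"
 unfolding L2_def
proof (rule conjI[OF f], rule Bochner_Integration.integrable_bound)
 show "integrable lborel (\<lambda>z. B\<^sup>2 * indicator (cball a r) z)" using integrable_indicator_cball[of a r] by simp
 have le: "(f z)\<^sup>2 \<le> B\<^sup>2 * indicator (cball a r) z" for z
  using s[of z] power_mono[OF B[of z], of 2] by (cases "z \<in> cball a r") auto
 show "AE z in lborel. norm ((f z)\<^sup>2) \<le> norm (B\<^sup>2 * indicator (cball a r) z)"
  using order_trans[OF le abs_ge_self] by (intro AE_I2) (simp only: real_norm_def abs_of_nonneg zero_le_power2)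
qed (use f in \<open>auto intro: borel_measurable_power\<close>)

lemma L2_mult_continuous:
 fixes \<xi> :: "'a::euclidean_space \<Rightarrow> real"
 assumes f: "L2 f" "\<And>z. z \<notin> cball a r \<Longrightarrow> f z = 0" and c: "continuous_on UNIV \<xi>"
 shows "L2 (\<lambda>z. \<xi> z * f z)"
proof -
 have "compact (\<xi> ` cball a r)" using c by (meson compact_cball compact_continuous_image continuous_on_subset top_greatest)
 then have "bounded (\<xi> ` cball a r)" by (rule compact_imp_bounded)
 then obtain B where B0: "\<forall>y\<in>\<xi> ` cball a r. norm y \<le> B" unfolding bounded_iff by blast
 have B: "\<bar>\<xi> z\<bar> \<le> B" if "z \<in> cball a r" for z using B0 that by (metis imageI real_norm_def)
 have m: "\<xi> \<in> borel_measurable borel" using c by (rule borel_measurable_continuous_onI)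
 show ?thesis
 proof (rule L2_bound(1)[OF _ f(1)])
  show "(\<lambda>z. \<xi> z * f z) \<in> borel_measurable borel" using m f(1) by (auto intro: borel_measurable_times)
  show "\<bar>\<xi> z * f z\<bar> \<le> B * \<bar>f z\<bar>" for z
   using f(2)[of z] B[of z] by (cases "z \<in> cball a r") (auto simp: abs_mult intro!: mult_right_mono)
 qed
qed

lemma C1c_on_ball:
 assumes "C1c_on \<phi> S" obtains r where "\<And>z. z \<notin> cball 0 r \<Longrightarrow> \<phi> z = 0"
  "\<And>z v. z \<notin> cball 0 r \<Longrightarrow> frechet_derivative \<phi> (at z) v = 0"
proof -
 obtain K where K: "compact K" "\<And>z. z \<notin> K \<Longrightarrow> \<phi> z = 0" using assms by (auto simp: C1c_on_iff)
 obtain r where "\<forall>z\<in>K. norm z \<le> r" using compact_imp_bounded[OF K(1)] unfolding bounded_iff by blast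
 then have r: "K \<subseteq> cball 0 r" by auto
 show thesis
 proof (rule that[of r])
  fix z :: "real \<times> (real^3)" assume z: "z \<notin> cball 0 r"
  then have "z \<notin> K" using r by blast
  then show "\<phi> z = 0" by (rule K(2))
  have "(\<phi> has_derivative (\<lambda>v. 0)) (at z)"
   by (rule frechet_derivative_outside[OF compact_imp_closed[OF K(1)]]) (use K r z in auto)
  then show "frechet_derivative \<phi> (at z) v = 0" for v by (simp add: frechet_derivative_eqI)
 qed
qed

lemma C1c_on_bound:
 assumes "C1c_on \<phi> S"
 obtains B where "B \<ge> 0" "\<And>z. \<bar>\<phi> z\<bar> \<le> B" "\<And>z v. \<bar>frechet_derivative \<phi> (at z) v\<bar> \<le> B * norm v"
proof -
 obtain r where r: "\<And>z. z \<notin> cball 0 r \<Longrightarrow> \<phi> z = 0"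
  "\<And>z v. z \<notin> cball 0 r \<Longrightarrow> frechet_derivative \<phi> (at z) v = 0" using C1c_on_ball[OF assms] by metis
 obtain B1 where B1: "B1 \<ge> 0" "\<And>z. \<bar>\<phi> z\<bar> \<le> B1"
  using continuous_compact_bound[OF C1_continuous[OF C1c_on_C1[OF assms]] r(1)] by blast
 obtain B2 where B2: "B2 \<ge> 0" "\<And>z v. z \<in> cball 0 r \<Longrightarrow> \<bar>frechet_derivative \<phi> (at z) v\<bar> \<le> B2 * norm v"
  using C1_compact_derivative_bound[OF C1c_on_C1[OF assms] compact_cball] by blast
 show thesis
 proof (rule that[of "max B1 B2"])
  show "\<bar>\<phi> z\<bar> \<le> max B1 B2" for z using B1(2)[of z] by linarith
  fix z v :: "real \<times> (real^3)"
  have "\<bar>frechet_derivative \<phi> (at z) v\<bar> \<le> B2 * norm v"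
   using B2(2)[of z v] r(2)[of z v] B2(1) by (cases "z \<in> cball 0 r") auto
  also have "\<dots> \<le> max B1 B2 * norm v" by (intro mult_right_mono) auto
  finally show "\<bar>frechet_derivative \<phi> (at z) v\<bar> \<le> max B1 B2 * norm v" .
 qed (use B1 in auto)
qed

lemma C1c_on_L2: assumes "C1c_on \<phi> S" shows "L2 \<phi>" "L2 (\<lambda>z. frechet_derivative \<phi> (at z) v)"
proof -
 obtain r where r: "\<And>z. z \<notin> cball 0 r \<Longrightarrow> \<phi> z = 0"
  "\<And>z v. z \<notin> cball 0 r \<Longrightarrow> frechet_derivative \<phi> (at z) v = 0" using C1c_on_ball[OF assms] by metis
 obtain B where B: "\<And>z. \<bar>\<phi> z\<bar> \<le> B" "\<And>z v. \<bar>frechet_derivative \<phi> (at z) v\<bar> \<le> B * norm v"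
  using C1c_on_bound[OF assms] by metis
 note c = C1c_on_C1[OF assms]
 show "L2 \<phi>" by (rule bounded_support_L2[OF borel_measurable_continuous_onI[OF C1_continuous[OF c]] B(1) r(1)])
 show "L2 (\<lambda>z. frechet_derivative \<phi> (at z) v)"
  by (rule bounded_support_L2[OF borel_measurable_continuous_onI[OF C1_continuous_derivative[OF c]] B(2) r(2)])
qed

lemma C1c_on_mult: "C1c_on \<phi> S \<Longrightarrow> C1 \<xi> \<Longrightarrow> C1c_on (\<lambda>z. \<xi> z * \<phi> z) S"
 by (auto simp: C1c_on_iff intro!: C1_mult)

lemma C1c_on_add: assumes "C1c_on \<phi> S" "C1c_on \<psi> S" shows "C1c_on (\<lambda>z. \<phi> z + \<psi> z) S"
proof -
 obtain K L where "compact K" "K \<subseteq> S" "\<And>z. z \<notin> K \<Longrightarrow> \<phi> z = 0" "compact L" "L \<subseteq> S" "\<And>z. z \<notin> L \<Longrightarrow> \<psi> z = 0"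
  using assms by (auto simp: C1c_on_iff)
 then have "compact (K \<union> L)" "K \<union> L \<subseteq> S" "\<forall>z. z \<notin> K \<union> L \<longrightarrow> \<phi> z + \<psi> z = 0" by auto
 moreover have "C1 (\<lambda>z. \<phi> z + \<psi> z)" using assms by (auto simp: C1c_on_iff intro!: C1_add)
 ultimately show ?thesis unfolding C1c_on_iff by blast
qed

text \<open>Only the spatial gradient is weak. With S = (0,T) \<times> UNIV the test functions need
  not vanish on the lateral boundary of the domain, so the condition encodes zero boundary values of
  the extended function, while nothing is asserted across t = 0 and t = T.\<close>

definition wgrad_on :: "(real \<times> (real^3)) set \<Rightarrow> (real \<times> (real^3) \<Rightarrow> real) \<Rightarrow> (real \<times> (real^3) \<Rightarrow> real^3) \<Rightarrow> bool" where
 "wgrad_on S f g \<longleftrightarrow> L2 f \<and> (\<forall>i. L2 (\<lambda>z. g z $ i)) \<and>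
   (\<forall>\<phi> i. C1c_on \<phi> S \<longrightarrow> (LBINT z. f z * gradx_part \<phi> z $ i) = - (LBINT z. g z $ i * \<phi> z))"

text \<open>No time derivative is approximated: the evolution is treated by difference quotients in
  time, for which closeness in L2 of the function and of its spatial gradient suffices.\<close>

definition approximable :: "(real \<times> (real^3)) set \<Rightarrow> (real \<times> (real^3) \<Rightarrow> real) \<Rightarrow> (real \<times> (real^3) \<Rightarrow> real^3) \<Rightarrow> bool" where
 "approximable X f g \<longleftrightarrow> (\<forall>e>0. \<exists>\<phi>. C1c_on \<phi> X \<and> N2 (\<lambda>z. \<phi> z - f z) < e \<and>
   (\<forall>i. N2 (\<lambda>z. gradx_part \<phi> z $ i - g z $ i) < e))"

lemma wgrad_onD:
 assumes "wgrad_on S f g"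
 shows "L2 f" "\<And>i. L2 (\<lambda>z. g z $ i)"
  "\<And>\<phi> i. C1c_on \<phi> S \<Longrightarrow> (LBINT z. f z * gradx_part \<phi> z $ i) = - (LBINT z. g z $ i * \<phi> z)"
 using assms by (auto simp: wgrad_on_def)

text \<open>The product rule, tested by moving xi onto the test function. A factor xi that vanishes
  near t = 0 and t = T turns every test function into one supported in S, and the product then has a
  weak gradient on all of space-time.\<close>

lemma wgrad_on_mult:
 assumes w: "wgrad_on S f g" and \<xi>: "C1 \<xi>" and S: "\<And>\<phi>. C1c_on \<phi> UNIV \<Longrightarrow> C1c_on (\<lambda>z. \<xi> z * \<phi> z) S"
  and supp: "\<And>z. z \<notin> cball a r \<Longrightarrow> f z = 0" "\<And>z. z \<notin> cball a r \<Longrightarrow> g z = 0"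
 shows "wgrad_on UNIV (\<lambda>z. \<xi> z * f z) (\<lambda>z. \<xi> z *\<^sub>R g z + f z *\<^sub>R gradx_part \<xi> z)"
 unfolding wgrad_on_def
proof (intro conjI allI impI)
 note wd = wgrad_onD[OF w]
 show Lf: "L2 (\<lambda>z. \<xi> z * f z)" by (rule L2_mult_continuous[OF wd(1) supp(1) C1_continuous[OF \<xi>]])
 have Lg: "L2 (\<lambda>z. \<xi> z * g z $ i)" for i
  by (rule L2_mult_continuous[OF wd(2) _ C1_continuous[OF \<xi>], of a r]) (simp add: supp)
 have Lc: "L2 (\<lambda>z. gradx_part \<xi> z $ i * f z)" for i
  by (rule L2_mult_continuous[OF wd(1) supp(1) continuous_gradx_part[OF \<xi>]])
 show "L2 (\<lambda>z. (\<xi> z *\<^sub>R g z + f z *\<^sub>R gradx_part \<xi> z) $ i)" for i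
  using L2_add[OF Lg[of i] Lc[of i]] by (simp add: mult.commute)
 fix \<phi> :: "real \<times> (real^3) \<Rightarrow> real" and i assume \<phi>: "C1c_on \<phi> UNIV"
 note p = C1c_on_C1[OF \<phi>] C1c_on_L2(1)[OF \<phi>] C1c_on_L2(2)[OF \<phi>, of "(0, axis i 1)", folded gradx_part_nth]
 have "(LBINT z. f z * gradx_part (\<lambda>z. \<xi> z * \<phi> z) z $ i) = - (LBINT z. g z $ i * (\<xi> z * \<phi> z))"
  by (rule wd(3)[OF S[OF \<phi>]])
 also have "(LBINT z. f z * gradx_part (\<lambda>z. \<xi> z * \<phi> z) z $ i)
   = (LBINT z. (\<xi> z * f z) * gradx_part \<phi> z $ i + (gradx_part \<xi> z $ i * f z) * \<phi> z)"
  unfolding gradx_part_mult[OF \<xi> p(1)] by (simp add: algebra_simps)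
 also have "\<dots> = (LBINT z. (\<xi> z * f z) * gradx_part \<phi> z $ i) + (LBINT z. (gradx_part \<xi> z $ i * f z) * \<phi> z)"
  by (rule Bochner_Integration.integral_add[OF L2_prod_integrable[OF Lf p(3)] L2_prod_integrable[OF Lc p(2)]])
 also have "(LBINT z. g z $ i * (\<xi> z * \<phi> z)) = (LBINT z. (\<xi> z * g z $ i) * \<phi> z)"
  by (simp add: mult_ac)
 finally have "(LBINT z. (\<xi> z * f z) * gradx_part \<phi> z $ i)
   = - ((LBINT z. (\<xi> z * g z $ i) * \<phi> z) + (LBINT z. (gradx_part \<xi> z $ i * f z) * \<phi> z))" by simp
 also have "\<dots> = - (LBINT z. (\<xi> z * g z $ i) * \<phi> z + (gradx_part \<xi> z $ i * f z) * \<phi> z)"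
  by (simp add: Bochner_Integration.integral_add[OF L2_prod_integrable[OF Lg p(2)] L2_prod_integrable[OF Lc p(2)]])
 finally show "(LBINT z. \<xi> z * f z * gradx_part \<phi> z $ i)
   = - (LBINT z. (\<xi> z *\<^sub>R g z + f z *\<^sub>R gradx_part \<xi> z) $ i * \<phi> z)"
  by (simp add: algebra_simps)
qed

lemma approximable_limit:
 assumes f: "L2 f" "\<And>i. L2 (\<lambda>z. g z $ i)"
  and lim: "\<And>e. e > 0 \<Longrightarrow> \<exists>f' g'. approximable X f' g' \<and> L2 f' \<and> (\<forall>i. L2 (\<lambda>z. g' z $ i)) \<and>
    N2 (\<lambda>z. f' z - f z) < e \<and> (\<forall>i. N2 (\<lambda>z. g' z $ i - g z $ i) < e)"
 shows "approximable X f g"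
 unfolding approximable_def
proof (intro allI impI)
 fix e :: real assume e: "e > 0"
 obtain f' g' where 1: "approximable X f' g'" "L2 f'" "\<And>i. L2 (\<lambda>z. g' z $ i)"
  "N2 (\<lambda>z. f' z - f z) < e/4" "\<And>i. N2 (\<lambda>z. g' z $ i - g z $ i) < e/4"
  using lim[of "e/4"] e by auto
 obtain \<phi> where \<phi>: "C1c_on \<phi> X" "N2 (\<lambda>z. \<phi> z - f' z) < e/4" "\<And>i. N2 (\<lambda>z. gradx_part \<phi> z $ i - g' z $ i) < e/4"
  using 1(1) e unfolding approximable_def by (meson divide_pos_pos zero_less_numeral)
 have "N2 (\<lambda>z. \<phi> z - f z) < e"
  using N2_triangle[OF C1c_on_L2(1)[OF \<phi>(1)] 1(2) f(1)] \<phi>(2) 1(4) by simp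
 moreover have "N2 (\<lambda>z. gradx_part \<phi> z $ i - g z $ i) < e" for i
  using N2_triangle[OF C1c_on_L2(2)[OF \<phi>(1), of "(0, axis i 1)", folded gradx_part_nth] 1(3)[of i] f(2)[of i]] \<phi>(3)[of i] 1(5)[of i] by simp
 ultimately show "\<exists>\<phi>. C1c_on \<phi> X \<and> N2 (\<lambda>z. \<phi> z - f z) < e \<and> (\<forall>i. N2 (\<lambda>z. gradx_part \<phi> z $ i - g z $ i) < e)"
  using \<phi>(1) by blast
qed

lemma approximable_add:
 assumes "approximable X f g" "approximable X f' g'"
  and L: "L2 f" "L2 f'" "\<And>i. L2 (\<lambda>z. g z $ i)" "\<And>i. L2 (\<lambda>z. g' z $ i)"
 shows "approximable X (\<lambda>z. f z + f' z) (\<lambda>z. g z + g' z)"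
 unfolding approximable_def
proof (intro allI impI)
 fix e :: real assume e: "e > 0"
 obtain \<phi> where \<phi>: "C1c_on \<phi> X" "N2 (\<lambda>z. \<phi> z - f z) < e/4" "\<And>i. N2 (\<lambda>z. gradx_part \<phi> z $ i - g z $ i) < e/4"
  using assms(1) e unfolding approximable_def by (meson divide_pos_pos zero_less_numeral)
 obtain \<psi> where \<psi>: "C1c_on \<psi> X" "N2 (\<lambda>z. \<psi> z - f' z) < e/4" "\<And>i. N2 (\<lambda>z. gradx_part \<psi> z $ i - g' z $ i) < e/4"
  using assms(2) e unfolding approximable_def by (meson divide_pos_pos zero_less_numeral)
 have "N2 (\<lambda>z. (\<phi> z + \<psi> z) - (f z + f' z)) < e"
  using N2_add_le[OF L2_diff[OF C1c_on_L2(1)[OF \<phi>(1)] L(1)] L2_diff[OF C1c_on_L2(1)[OF \<psi>(1)] L(2)]] \<phi>(2) \<psi>(2)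
  by (simp add: algebra_simps)
 moreover have "N2 (\<lambda>z. gradx_part (\<lambda>z. \<phi> z + \<psi> z) z $ i - (g z + g' z) $ i) < e" for i
  using N2_add_le[OF L2_diff[OF C1c_on_L2(2)[OF \<phi>(1), of "(0, axis i 1)", folded gradx_part_nth] L(3)[of i]]
    L2_diff[OF C1c_on_L2(2)[OF \<psi>(1), of "(0, axis i 1)", folded gradx_part_nth] L(4)[of i]]] \<phi>(3)[of i] \<psi>(3)[of i]
  by (simp add: algebra_simps gradx_part_add[OF C1c_on_C1[OF \<phi>(1)] C1c_on_C1[OF \<psi>(1)]])
 ultimately show "\<exists>\<phi>. C1c_on \<phi> X \<and> N2 (\<lambda>z. \<phi> z - (f z + f' z)) < e \<and>
   (\<forall>i. N2 (\<lambda>z. gradx_part \<phi> z $ i - (g z + g' z) $ i) < e)"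
  using C1c_on_add[OF \<phi>(1) \<psi>(1)] by blast
qed

text \<open>The reflected kernel w \<mapsto> k (z - w) is itself an admissible test function, so the
  derivative passes from the kernel to the weak gradient.\<close>

lemma gradx_part_conv:
 assumes k: "kernel k a r" and w: "wgrad_on UNIV f g"
 shows "gradx_part (conv k f) z $ i = conv k (\<lambda>z. g z $ i) z"
proof -
 note kd = kernelD[OF k]
 have "gradx_part (conv k f) z $ i = conv (\<lambda>z. frechet_derivative k (at z) (0, axis i 1)) f z"
  unfolding gradx_part_nth
  by (subst frechet_derivative_eqI[OF conv_has_derivative(1)[where a = a and r = r]])
    (use kd L2_locint[OF wgrad_onD(1)[OF w]] in auto)
 also have "\<dots> = (LBINT w. f w * - gradx_part (\<lambda>w. k (z - w)) w $ i)"
  by (simp add: conv_def gradx_part_nth frechet_derivative_eqI[OF has_derivative_reflect[OF kd(1)]] mult.commute)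
 also have "\<dots> = - (LBINT w. f w * gradx_part (\<lambda>w. k (z - w)) w $ i)" by simp
 also have "\<dots> = (LBINT w. g w $ i * k (z - w))"
 proof (subst wgrad_onD(3)[OF w])
  have "dist (z - a) w = dist a (z - w)" for w
   using norm_minus_cancel[of "a - (z - w)"] by (simp add: dist_norm algebra_simps)
  then have "\<forall>w. w \<notin> cball (z - a) r \<longrightarrow> k (z - w) = 0" using kd(4) by simp
  then show "C1c_on (\<lambda>w. k (z - w)) UNIV"
   unfolding C1c_on_iff by (intro conjI exI[of _ "cball (z - a) r"] C1_reflect[OF kd(1)]) simp_all
 qed simp
 finally show ?thesis by (simp add: conv_def mult.commute)
qed

text \<open>Convolution with a kernel supported in \<open>ball b s\<close> enlarges the support set
  A to at most A + \<open>ball b s\<close>. The hypothesis places this sum in a compact part of X,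
  while all shifts have norm below norm b + s and are therefore harmless in L2.\<close>

lemma approximable_local:
 assumes w: "wgrad_on UNIV f g" and supp: "\<And>z. z \<notin> A \<Longrightarrow> f z = 0"
  and A: "\<And>\<eta>. \<eta> > 0 \<Longrightarrow> \<exists>b s K. s > 0 \<and> norm b + s < \<eta> \<and> compact K \<and> K \<subseteq> X \<and> (\<forall>z\<in>A. \<forall>h\<in>ball b s. z + h \<in> K)"
 shows "approximable X f g"
 unfolding approximable_def
proof (intro allI impI)
 fix e :: real assume e: "e > 0"
 note wd = wgrad_onD[OF w]
 obtain d0 where d0: "d0 > 0" "\<And>h. norm h < d0 \<Longrightarrow> N2 (\<lambda>z. f (z + h) - f z) < e/2"
  using L2_translation[OF wd(1), of "e/2"] e by auto
 have "\<forall>i. \<exists>d>0. \<forall>h. norm h < d \<longrightarrow> N2 (\<lambda>z. g (z + h) $ i - g z $ i) < e/2"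
  using L2_translation[OF wd(2), of "e/2"] e by auto
 from choice[OF this] obtain d where d: "\<And>i. d i > 0" "\<And>i h. norm h < d i \<Longrightarrow> N2 (\<lambda>z. g (z + h) $ i - g z $ i) < e/2"
  by blast
 define \<eta> where "\<eta> = min d0 (Min (range d))"
 have \<eta>: "\<eta> > 0" "\<eta> \<le> d0" "\<And>i. \<eta> \<le> d i" using d0 d by (auto simp: \<eta>_def min.coboundedI2)
 obtain b s K where b: "s > 0" "norm b + s < \<eta>" "compact K" "K \<subseteq> X" "\<And>z h. z \<in> A \<Longrightarrow> h \<in> ball b s \<Longrightarrow> z + h \<in> K"
  using A[OF \<eta>(1)] by blast
 obtain k where k: "kernel k b s" using kernel_exists[OF b(1)] .
 note kd = kernelD[OF k]
 have nh: "norm h < \<eta>" if "h \<in> ball b s" for h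
 proof -
  have "norm h \<le> norm b + norm (h - b)" by (metis add.commute diff_add_cancel norm_triangle_ineq)
  then show ?thesis using that b(2) by (simp add: dist_norm norm_minus_commute)
 qed
 have "C1c_on (conv k f) X" unfolding C1c_on_iff
 proof (intro conjI exI[of _ K] b(3,4) allI impI)
  show "C1 (conv k f)" using conv_has_derivative(2)[where a = b and r = s] kd L2_locint[OF wd(1)] by blast
  fix z assume z: "z \<notin> K"
  have "k (z - w) * f w = 0" for w
  proof (cases "w \<in> A")
   case True
   then have "z - w \<notin> ball b s" using b(5)[of w "z - w"] z by auto
   then show ?thesis using kd(3) by auto
  qed (use supp in auto)
  then show "conv k f z = 0" unfolding conv_def by (simp only: Bochner_Integration.integral_zero)
 qed
 moreover have "N2 (\<lambda>z. conv k f z - f z) \<le> e/2"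
 proof (rule conv_kernel_L2_close(2)[OF k wd(1)])
  show "N2 (\<lambda>z. f (z - h) - f z) \<le> e/2" if "h \<in> ball b s" for h
   using d0(2)[of "-h"] nh[OF that] \<eta>(2) by simp
 qed (use e in auto)
 moreover have "N2 (\<lambda>z. gradx_part (conv k f) z $ i - g z $ i) \<le> e/2" for i
  unfolding gradx_part_conv[OF k w]
 proof (rule conv_kernel_L2_close(2)[OF k wd(2)])
  show "N2 (\<lambda>z. g (z - h) $ i - g z $ i) \<le> e/2" if "h \<in> ball b s" for h
   using d(2)[of "-h" i] nh[OF that] \<eta>(3)[of i] by simp
 qed (use e in auto)
 moreover have "e/2 < e" using e by simp
 ultimately show "\<exists>\<phi>. C1c_on \<phi> X \<and> N2 (\<lambda>z. \<phi> z - f z) < e \<and> (\<forall>i. N2 (\<lambda>z. gradx_part \<phi> z $ i - g z $ i) < e)"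
  by (intro exI[of _ "conv k f"] conjI allI) (assumption | erule (1) order.strict_trans1 | rule order.strict_trans1)+
qed

text \<open>At an interior point the shift b can be 0, at a boundary point it has to point into the
  domain. The ball of shifts around b leaves room for a mollifier, and the compact K yields compact
  support of the mollified function.\<close>

definition inward :: "(real^3) set \<Rightarrow> real^3 \<Rightarrow> real \<Rightarrow> bool" where
 "inward \<Omega> p r \<longleftrightarrow> r > 0 \<and> (\<forall>\<eta>>0. \<exists>b s K. s > 0 \<and> norm b + s < \<eta> \<and> compact K \<and> K \<subseteq> \<Omega> \<and>
   (\<forall>x\<in>closure \<Omega> \<inter> cball p r. \<forall>h\<in>ball b s. x + h \<in> K))"

lemma inward_interior:
 assumes "open \<Omega>" "p \<in> \<Omega>" shows "\<exists>r. inward \<Omega> p r"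
proof -
 obtain r where r: "r > 0" "cball p r \<subseteq> \<Omega>" using assms open_contains_cball by blast
 have "inward \<Omega> p (r/2)" unfolding inward_def
 proof (intro conjI allI impI)
  fix \<eta> :: real assume \<eta>: "\<eta> > 0"
  define s where "s = min \<eta> r / 2"
  have "x + h \<in> cball p r" if "x \<in> cball p (r/2)" "h \<in> ball 0 s" for x h
  proof -
   have "dist p (x + h) \<le> dist p x + norm h" using norm_triangle_ineq4[of "p - x" h] by (simp add: dist_norm algebra_simps)
   then show ?thesis using that by (simp add: s_def)
  qed
  then show "\<exists>b s K. s > 0 \<and> norm b + s < \<eta> \<and> compact K \<and> K \<subseteq> \<Omega> \<and> (\<forall>x\<in>closure \<Omega> \<inter> cball p (r/2). \<forall>h\<in>ball b s. x + h \<in> K)"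
   using r \<eta> by (intro exI[of _ 0] exI[of _ s] exI[of _ "cball p r"]) (auto simp: s_def)
 qed (use r in auto)
 then show ?thesis ..
qed

lemma norm_pair_12_le: fixes a :: "real^3" shows "norm (a$1, a$2) \<le> norm a"
proof -
 have "(norm (a$1, a$2))\<^sup>2 \<le> (norm a)\<^sup>2"
  by (simp add: norm_Pair power2_norm_eq_inner inner_vec_def sum_3 power2_eq_square[symmetric])
 then show ?thesis by (rule power2_le_imp_le) simp
qed

text \<open>The shift goes by t downwards, against the direction n of the graph. An additional error
  of norm s raises the third coordinate by at most s and the graph value changes by at most L s, so
  s (1 + L) < t keeps the shifted point strictly below the graph.\<close>

lemma inward_frontier:
 assumes lip: "lipschitz_domain \<Omega>" and p: "p \<in> frontier \<Omega>" shows "\<exists>r. inward \<Omega> p r"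
proof -
 obtain R :: "real^3 \<Rightarrow> real^3" and g :: "real \<times> real \<Rightarrow> real" and L r where
  R: "orthogonal_transformation R" and L: "L-lipschitz_on UNIV g" and r: "r > 0"
  and loc: "\<And>x. x \<in> ball p r \<Longrightarrow> x \<in> \<Omega> \<longleftrightarrow> (R (x - p)) $ 3 < g ((R (x - p)) $ 1, (R (x - p)) $ 2)"
  using lip p unfolding lipschitz_domain_def by blast
 have bnd: "bounded \<Omega>" using lip by (simp add: lipschitz_domain_def)
 have L0: "L \<ge> 0" using L lipschitz_on_nonneg by blast
 have linR: "linear R" using R orthogonal_transformation_linear by blast
 have cR: "continuous_on UNIV R" using linR linear_continuous_on linear_linear by blast
 have cg: "continuous_on UNIV g" using L lipschitz_on_continuous_on by blast
 obtain n where n: "R n = axis 3 1" using orthogonal_transformation_surj[OF R] by (metis surjD)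
 have nn: "norm n = 1" using orthogonal_transformation_norm[OF R, of n] n by simp
 \<comment> \<open>The set strictly above the graph is open and misses the domain inside the ball,
   hence it misses the closure too.\<close>
 have clos: "(R (x - p)) $ 3 \<le> g ((R (x - p)) $ 1, (R (x - p)) $ 2)" if "x \<in> closure \<Omega>" "x \<in> ball p r" for x
 proof (rule ccontr)
  assume c: "\<not> ?thesis"
  let ?V = "{x. (R (x - p)) $ 3 > g ((R (x - p)) $ 1, (R (x - p)) $ 2)} \<inter> ball p r"
  have 1: "continuous_on UNIV (\<lambda>x. R (x - p))" by (rule continuous_on_compose2[OF cR]) (auto intro: continuous_intros)
  have "open {x. (R (x - p)) $ 3 > g ((R (x - p)) $ 1, (R (x - p)) $ 2)}"
   by (intro open_Collect_less continuous_intros 1 continuous_on_compose2[OF cg]) auto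
  then have "open ?V" by auto
  moreover have "x \<in> ?V" using c that by auto
  moreover have "?V \<inter> \<Omega> = {}" using loc by force
  ultimately show False using that(1) open_Int_closure_eq_empty[of ?V \<Omega>] by blast
 qed
 have "inward \<Omega> p (r/2)" unfolding inward_def
 proof (intro conjI allI impI)
  fix \<eta> :: real assume \<eta>: "\<eta> > 0"
  \<comment> \<open>A fifth is enough for both demands: norm b + s <= 2 t < eta, and a point within
    r/2 of p stays within r of p after a shift of norm at most 2 t.\<close>
  define t where "t = min \<eta> r / 5"
  define s where "s = t / (2 * (1 + L))"
  have t: "t > 0" "5 * t \<le> \<eta>" "5 * t \<le> r" using \<eta> r by (auto simp: t_def)
  have s: "s > 0" "s \<le> t" "s * (1 + L) < t" using t(1) L0
   by (auto simp: s_def divide_le_eq mult_left_le_one_le field_simps intro: add_pos_nonneg)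
  let ?b = "- t *\<^sub>R n"
  let ?K = "{x + h | x h. x \<in> closure \<Omega> \<inter> cball p (r/2) \<and> h \<in> cball ?b s}"
  have "compact ?K" using bnd by (intro compact_sums) (auto simp: compact_closure intro!: compact_Int_closed)
  moreover have "?K \<subseteq> \<Omega>"
  proof
   fix y assume "y \<in> ?K"
   then obtain x h where y: "y = x + h" and x: "x \<in> closure \<Omega>" "x \<in> cball p (r/2)" and h: "h \<in> cball ?b s" by blast
   define u where "u = h - ?b"
   have u: "norm u \<le> s" using h by (simp add: u_def dist_norm norm_minus_commute)
   have hu: "h = - t *\<^sub>R n + u" by (simp add: u_def)
   have nh: "norm h \<le> t + s" unfolding hu using norm_triangle_ineq[of "- t *\<^sub>R n" u] u nn t by simp
   have "dist p y \<le> dist p x + norm h" unfolding y using norm_triangle_ineq4[of "p - x" h] by (simp add: dist_norm algebra_simps)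
   then have yb: "y \<in> ball p r" using nh x t s r by simp
   have xb: "x \<in> ball p r" using x r by simp
   have Ry: "R (y - p) = R (x - p) - t *\<^sub>R axis 3 1 + R u"
   proof -
    have "y - p = (x - p) + (- t *\<^sub>R n + u)" by (simp add: y hu)
    then show ?thesis by (simp add: linear_add[OF linR] linear_diff[OF linR] linear_scale[OF linR] linear_neg[OF linR] n)
   qed
   have Ru: "norm (R u) \<le> s" using u orthogonal_transformation_norm[OF R] by simp
   have R3: "(R (y - p)) $ 3 \<le> (R (x - p)) $ 3 - t + s"
    using component_le_norm_cart[of "R u" 3] Ru by (simp add: Ry)
   have R12: "((R (y - p)) $ 1, (R (y - p)) $ 2) = ((R (x - p)) $ 1, (R (x - p)) $ 2) + ((R u) $ 1, (R u) $ 2)"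
    by (simp add: Ry axis_def)
   have dist_add_self: "dist a (a + c) = norm c" for a c :: "real \<times> real" by (simp add: dist_norm)
   have "dist (g ((R (x - p)) $ 1, (R (x - p)) $ 2)) (g ((R (y - p)) $ 1, (R (y - p)) $ 2)) \<le> L * norm ((R u) $ 1, (R u) $ 2)"
    using lipschitz_onD[OF L, of "((R (x - p)) $ 1, (R (x - p)) $ 2)" "((R (y - p)) $ 1, (R (y - p)) $ 2)"] unfolding R12
    by (simp only: dist_add_self UNIV_I simp_thms)
   also have "\<dots> \<le> L * s" using norm_pair_12_le[of "R u"] Ru L0 by (intro mult_left_mono) auto
   finally have "g ((R (y - p)) $ 1, (R (y - p)) $ 2) \<ge> g ((R (x - p)) $ 1, (R (x - p)) $ 2) - L * s"
    by (simp add: dist_real_def)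
   then have "(R (y - p)) $ 3 < g ((R (y - p)) $ 1, (R (y - p)) $ 2)"
    using R3 clos[OF x(1) xb] s(3) by (simp add: algebra_simps)
   then show "y \<in> \<Omega>" using loc[OF yb] by simp
  qed
  moreover have "norm ?b + s < \<eta>" using nn t s by simp
  moreover have "\<forall>x\<in>closure \<Omega> \<inter> cball p (r/2). \<forall>h\<in>ball ?b s. x + h \<in> ?K" by fastforce
  ultimately show "\<exists>b s K. s > 0 \<and> norm b + s < \<eta> \<and> compact K \<and> K \<subseteq> \<Omega> \<and> (\<forall>x\<in>closure \<Omega> \<inter> cball p (r/2). \<forall>h\<in>ball b s. x + h \<in> K)"
   using s(1) by blast
 qed (use r in auto)
 then show ?thesis ..
qed

text \<open>The balls of half radius already cover, so a cutoff equal to 1 on such a ball can still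
  be supported in the full ball, where the shifts are under control.\<close>

lemma inward_cover:
 assumes lip: "lipschitz_domain \<Omega>"
 obtains J where "finite J" "\<And>p r. (p, r) \<in> J \<Longrightarrow> inward \<Omega> p r" "closure \<Omega> \<subseteq> (\<Union>(p, r)\<in>J. ball p (r/2))"
proof -
 have o: "open \<Omega>" "compact (closure \<Omega>)" using lip by (auto simp: lipschitz_domain_def compact_closure)
 have "\<exists>r. inward \<Omega> p r" if "p \<in> closure \<Omega>" for p
 proof (cases "p \<in> \<Omega>")
  case False
  then have "p \<in> frontier \<Omega>" using that o by (simp add: frontier_def interior_open)
  then show ?thesis using inward_frontier[OF lip] by blast
 qed (use inward_interior o in auto)
 then obtain r where r: "\<And>p. p \<in> closure \<Omega> \<Longrightarrow> inward \<Omega> p (r p)" by metis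
 obtain C where C: "C \<subseteq> closure \<Omega>" "finite C" "closure \<Omega> \<subseteq> (\<Union>p\<in>C. ball p (r p / 2))"
 proof (rule compactE_image[OF o(2), of "closure \<Omega>" "\<lambda>p. ball p (r p / 2)"])
  show "closure \<Omega> \<subseteq> (\<Union>p\<in>closure \<Omega>. ball p (r p / 2))"
   using r by (fastforce simp: inward_def)
 qed auto
 show thesis
  by (rule that[of "(\<lambda>p. (p, r p)) ` C"]) (use C r in auto)
qed


section \<open>Cutoff functions and admissibility of multiplied solutions\<close>

definition cutoff :: "real \<Rightarrow> real" where
 "cutoff t = (max 0 (1 - (max 0 t)\<^sup>2))\<^sup>2"

lemma cutoff_simps: "t \<le> 0 \<Longrightarrow> cutoff t = 1" "t \<ge> 1 \<Longrightarrow> cutoff t = 0" "0 \<le> cutoff t" "cutoff t \<le> 1"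
proof -
 show "cutoff t = 0" if "t \<ge> 1"
 proof -
  have "1 - (max 0 t)\<^sup>2 \<le> 0" using that one_le_power[OF that, of 2] by (simp add: max_def)
  then show ?thesis by (simp only: cutoff_def max_absorb1) simp
 qed
 show "cutoff t \<le> 1" unfolding cutoff_def by (intro power_le_one) auto
qed (auto simp: cutoff_def)

lemma cutoff_DERIV:
 "(cutoff has_real_derivative - 4 * max 0 (1 - (max 0 t)\<^sup>2) * max 0 t) (at t)"
proof -
 have "((\<lambda>t. 1 - (max 0 t)\<^sup>2) has_real_derivative (0 - 2 * max 0 t)) (at t)"
  by (intro DERIV_diff DERIV_const DERIV_max_sq)
 from DERIV_chain2[OF DERIV_max_sq this] show ?thesis
  unfolding cutoff_def[abs_def] by (simp add: algebra_simps)
qed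

lemma C1_cutoff: assumes "C1 f" shows "C1 (\<lambda>z. cutoff (f z))"
 by (rule C1_real_compose[OF assms cutoff_DERIV]) (intro continuous_intros)

lemma C1_snd_dist: "C1 (\<lambda>z :: real \<times> (real^3). (snd z - p) \<bullet> (snd z - p))"
proof (rule C1I)
 show "((\<lambda>z :: real \<times> (real^3). (snd z - p) \<bullet> (snd z - p)) has_derivative (\<lambda>v. 2 * ((snd z - p) \<bullet> snd v))) (at z)" for z
  by (auto intro!: derivative_eq_intros simp: inner_commute)
qed (auto intro!: continuous_intros)

lemma C1_fst: "C1 (fst :: real \<times> (real^3) \<Rightarrow> real)"
proof (rule C1I)
 show "((fst :: real \<times> (real^3) \<Rightarrow> real) has_derivative fst) (at z)" for z
  by (auto intro!: derivative_eq_intros)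
qed (auto intro!: continuous_intros)

lemma C1_cmult: "C1 f \<Longrightarrow> C1 (\<lambda>z. c * f z)"
 by (rule C1_mult[OF C1_const])

lemma spatial_cutoff_exists:
 assumes r: "r > 0"
 obtains \<xi> :: "real \<times> (real^3) \<Rightarrow> real" where "C1 \<xi>" "\<And>z. snd z \<in> ball p (r/2) \<Longrightarrow> \<xi> z = 1"
  "\<And>z. snd z \<notin> cball p r \<Longrightarrow> \<xi> z = 0" 
\<comment> \<open>The argument of \<open>cutoff\<close> is affine in the squared distance; it equals
  0 at distance r/2 and 1 at distance r.\<close>
proof (rule that[of "\<lambda>z. cutoff ((4 / (3 * r\<^sup>2)) * ((snd z - p) \<bullet> (snd z - p)) - 1/3)"])
 show "C1 (\<lambda>z :: real \<times> (real^3). cutoff ((4 / (3 * r\<^sup>2)) * ((snd z - p) \<bullet> (snd z - p)) - 1/3))"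
  by (intro C1_cutoff C1_diff C1_cmult C1_snd_dist C1_const)
 have e: "(x - p) \<bullet> (x - p) = (dist p x)\<^sup>2" for x :: "real^3"
  using dist_commute[of p x] by (simp only: dist_norm power2_norm_eq_inner)
 show "cutoff ((4 / (3 * r\<^sup>2)) * ((snd z - p) \<bullet> (snd z - p)) - 1/3) = 1" if "snd z \<in> ball p (r/2)" for z :: "real \<times> (real^3)"
 proof (rule cutoff_simps(1))
  have "(dist p (snd z))\<^sup>2 \<le> (r/2)\<^sup>2" using that by (intro power_mono) auto
  then show "(4 / (3 * r\<^sup>2)) * ((snd z - p) \<bullet> (snd z - p)) - 1/3 \<le> 0" unfolding e using r
   by (simp add: field_simps power2_eq_square)
 qed
 show "cutoff ((4 / (3 * r\<^sup>2)) * ((snd z - p) \<bullet> (snd z - p)) - 1/3) = 0" if "snd z \<notin> cball p r" for z :: "real \<times> (real^3)"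
 proof (rule cutoff_simps(2))
  have "(dist p (snd z))\<^sup>2 \<ge> r\<^sup>2" using that r by (intro power_mono) auto
  then show "(4 / (3 * r\<^sup>2)) * ((snd z - p) \<bullet> (snd z - p)) - 1/3 \<ge> 1" unfolding e using r
   by (simp add: field_simps power2_eq_square)
 qed
qed

lemma approximable_zero: "approximable X (\<lambda>z. 0) (\<lambda>z. 0)"
 unfolding approximable_def
proof (intro allI impI exI[of _ "\<lambda>z. 0"] conjI)
 show "C1c_on (\<lambda>z. 0) X" by (auto simp: C1c_on_iff)
 have "gradx_part (\<lambda>z. 0) z = 0" for z
  by (simp add: vec_eq_iff gradx_part_nth frechet_derivative_eqI[OF has_derivative_const])
 then show "N2 (\<lambda>z. gradx_part (\<lambda>z. 0) z $ i - 0 $ i) < e" if "e > 0" for e i using that by (simp add: N2_def)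
qed (simp add: N2_def)

text \<open>An induction over the cover takes the place of a partition of unity. The part xi f lives
  near one ball and is treated by a shift; the part (1 - xi) f vanishes on the half ball, so the
  remaining half balls cover its support.\<close>

lemma approximable_inward_cover:
 assumes J: "finite J" "\<And>p r. (p, r) \<in> J \<Longrightarrow> inward \<Omega> p r"
  and ab: "0 < \<alpha>" "\<beta> < T" and bnd: "bounded \<Omega>"
  and w: "wgrad_on UNIV f g"
  and supp: "\<And>z. z \<notin> {\<alpha>..\<beta>} \<times> \<Omega> \<Longrightarrow> f z = 0 \<and> g z = 0"
  and cov: "\<And>z. snd z \<notin> (\<Union>(p, r)\<in>J. ball p (r/2)) \<Longrightarrow> f z = 0 \<and> g z = 0"
 shows "approximable ({0<..<T} \<times> \<Omega>) f g"
 using J w supp cov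
proof (induction J arbitrary: f g rule: finite_induct)
 case empty
 have "f = (\<lambda>z. 0)" "g = (\<lambda>z. 0)" using empty.prems(4) by (auto simp: fun_eq_iff)
 then show ?case using approximable_zero by simp
next
 case (insert pr J)
 obtain p r where pr: "pr = (p, r)" by (cases pr)
 have inw: "inward \<Omega> p r" using insert.prems(1) pr by blast
 then have r: "r > 0" by (simp add: inward_def)
 obtain \<xi> :: "real \<times> (real^3) \<Rightarrow> real" where \<xi>: "C1 \<xi>" "\<And>z. snd z \<in> ball p (r/2) \<Longrightarrow> \<xi> z = 1" "\<And>z. snd z \<notin> cball p r \<Longrightarrow> \<xi> z = 0"
  using spatial_cutoff_exists[OF r, of p] by blast
 have \<xi>': "C1 (\<lambda>z. 1 - \<xi> z)" by (intro C1_diff C1_const \<xi>)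
 have "bounded ({\<alpha>..\<beta>} \<times> \<Omega>)" by (intro bounded_Times bnd) auto
 then obtain \<rho> where \<rho>0: "\<forall>z\<in>{\<alpha>..\<beta>} \<times> \<Omega>. norm z \<le> \<rho>" unfolding bounded_iff by blast
 have \<rho>: "f z = 0" "g z = 0" if "z \<notin> cball 0 \<rho>" for z
 proof -
  have "z \<notin> {\<alpha>..\<beta>} \<times> \<Omega>" using that \<rho>0 by auto
  then show "f z = 0" "g z = 0" using insert.prems(3) by blast+
 qed
 note w = insert.prems(2)
 let ?f1 = "\<lambda>z. \<xi> z * f z" and ?g1 = "\<lambda>z. \<xi> z *\<^sub>R g z + f z *\<^sub>R gradx_part \<xi> z"
 let ?f2 = "\<lambda>z. (1 - \<xi> z) * f z" and ?g2 = "\<lambda>z. (1 - \<xi> z) *\<^sub>R g z + f z *\<^sub>R gradx_part (\<lambda>z. 1 - \<xi> z) z"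
 have w1: "wgrad_on UNIV ?f1 ?g1" by (rule wgrad_on_mult[OF w \<xi>(1) C1c_on_mult[OF _ \<xi>(1)] \<rho>])
 have w2: "wgrad_on UNIV ?f2 ?g2" by (rule wgrad_on_mult[OF w \<xi>' C1c_on_mult[OF _ \<xi>'] \<rho>])
 have "approximable ({0<..<T} \<times> \<Omega>) ?f1 ?g1"
 proof (rule approximable_local[OF w1])
  let ?A = "{\<alpha>..\<beta>} \<times> (\<Omega> \<inter> cball p r)"
  show "?f1 z = 0" if "z \<notin> ?A" for z
   using that insert.prems(3)[of z] \<xi>(3)[of z] by (cases z) auto
  fix \<eta> :: real assume \<eta>: "\<eta> > 0"
  \<comment> \<open>The shift is purely spatial, but the kernel also spreads by s in time, which
    must stay below the distance of [alpha, beta] to the ends of (0, T).\<close>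
  define \<eta>' where "\<eta>' = min \<eta> (min \<alpha> (T - \<beta>))"
  have \<eta>': "\<eta>' > 0" using \<eta> ab by (simp add: \<eta>'_def)
  obtain b s K where b: "s > 0" "norm b + s < \<eta>'" "compact K" "K \<subseteq> \<Omega>"
   "\<And>x h. x \<in> closure \<Omega> \<inter> cball p r \<Longrightarrow> h \<in> ball b s \<Longrightarrow> x + h \<in> K"
   using inw \<eta>' unfolding inward_def by meson
  have sl: "s < \<alpha>" "s < T - \<beta>" "norm b + s < \<eta>" using b(2) by (auto simp: \<eta>'_def intro: order.strict_trans1[of s "norm b + s"])
  show "\<exists>b s K. s > 0 \<and> norm b + s < \<eta> \<and> compact K \<and> K \<subseteq> {0<..<T} \<times> \<Omega> \<and> (\<forall>z\<in>?A. \<forall>h\<in>ball b s. z + h \<in> K)"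
  proof (intro exI[of _ "(0, b)"] exI[of _ s] exI[of _ "{\<alpha> - s..\<beta> + s} \<times> K"] conjI ballI)
   show "compact ({\<alpha> - s..\<beta> + s} \<times> K)" by (intro compact_Times b(3) compact_Icc)
   show "{\<alpha> - s..\<beta> + s} \<times> K \<subseteq> {0<..<T} \<times> \<Omega>" using sl b(4) by (intro Sigma_mono) auto
   show "norm (0::real, b) + s < \<eta>" using sl by (simp add: norm_Pair)
   fix z h :: "real \<times> (real^3)" assume z: "z \<in> ?A" and h: "h \<in> ball (0, b) s"
   have "dist 0 (fst h) < s" using h dist_fst_le[of "(0, b)" h] by (simp add: order.strict_trans1)
   moreover have "snd h \<in> ball b s" using h dist_snd_le[of "(0, b)" h] by (simp add: order.strict_trans1)
   moreover have "snd z \<in> closure \<Omega> \<inter> cball p r" using z closure_subset[of \<Omega>] by auto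
   ultimately have "snd z + snd h \<in> K" "\<bar>fst h\<bar> < s" using b(5) by (auto simp: dist_real_def)
   then show "z + h \<in> {\<alpha> - s..\<beta> + s} \<times> K" using z by (cases z; cases h) auto
  qed (use b in auto)
 qed
 moreover have "approximable ({0<..<T} \<times> \<Omega>) ?f2 ?g2"
 proof (rule insert.IH[OF _ w2])
  show "inward \<Omega> p' r'" if "(p', r') \<in> J" for p' r' using insert.prems(1) that by blast
  show "?f2 z = 0 \<and> ?g2 z = 0" if "z \<notin> {\<alpha>..\<beta>} \<times> \<Omega>" for z
   using insert.prems(3)[OF that] by simp
  fix z :: "real \<times> (real^3)" assume z: "snd z \<notin> (\<Union>(p, r)\<in>J. ball p (r/2))"
  show "?f2 z = 0 \<and> ?g2 z = 0"
  proof (cases "snd z \<in> ball p (r/2)")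
   case True
   \<comment> \<open>The gradient of the remaining part contains f times the gradient of 1 - xi,
     which vanishes on the half ball because 1 - xi is zero on this open set.\<close>
   have "((\<lambda>z. 1 - \<xi> z) has_derivative (\<lambda>v. 0)) (at z)"
   proof (rule frechet_derivative_outside)
    show "closed (- (UNIV \<times> ball p (r/2)))" by (intro closed_Compl open_Times) auto
    show "1 - \<xi> z = 0" if "z \<notin> - (UNIV \<times> ball p (r/2))" for z
     using \<xi>(2)[of z] that by (cases z) auto
    show "z \<notin> - (UNIV \<times> ball p (r/2))" using True by (cases z) auto
   qed
   then have "gradx_part (\<lambda>z. 1 - \<xi> z) z = 0" by (simp add: vec_eq_iff gradx_part_nth frechet_derivative_eqI)
   then show ?thesis using \<xi>(2)[OF True] by simp
  next
   case False
   then have "f z = 0 \<and> g z = 0" using z insert.prems(4)[of z] by (auto simp: pr)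
   then show ?thesis by simp
  qed
 qed
 ultimately have "approximable ({0<..<T} \<times> \<Omega>) (\<lambda>z. ?f1 z + ?f2 z) (\<lambda>z. ?g1 z + ?g2 z)"
  using wgrad_onD[OF w1] wgrad_onD[OF w2] by (intro approximable_add) auto
 moreover have "(\<lambda>z. ?f1 z + ?f2 z) = f" by (simp add: algebra_simps)
 moreover have "gradx_part \<xi> z + gradx_part (\<lambda>z. 1 - \<xi> z) z = 0" for z
  using gradx_part_add[OF \<xi>(1) \<xi>', of z]
  by (simp add: vec_eq_iff gradx_part_nth frechet_derivative_eqI[OF has_derivative_const])
 then have "?g1 z + ?g2 z = g z" for z
  by (metis (no_types, lifting) add.commute add.left_neutral diff_add_cancel group_cancel.add1 scaleR_left_distrib scaleR_one scaleR_right_distrib scaleR_zero_right add.assoc)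
 ultimately show ?case by simp
qed

lemma time_cutoff_exists:
 assumes d: "d > 0"
 obtains \<alpha> :: "real \<times> (real^3) \<Rightarrow> real" where "C1 \<alpha>" "\<And>z. gradx_part \<alpha> z = 0" "\<And>z. 0 \<le> \<alpha> z" "\<And>z. \<alpha> z \<le> 1"
  "\<And>z. fst z \<in> {2*d..T-2*d} \<Longrightarrow> \<alpha> z = 1" "\<And>z. fst z \<notin> {d..T-d} \<Longrightarrow> \<alpha> z = 0"
proof -
 let ?a = "\<lambda>z :: real \<times> (real^3). cutoff (2 + (- 1/d) * fst z) * cutoff ((2 - T/d) + (1/d) * fst z)"
 show thesis
 proof (rule that[of ?a])
  show "C1 ?a" by (intro C1_mult C1_cutoff C1_add C1_const C1_cmult C1_fst)
  let ?q = "\<lambda>t. cutoff (2 + (- 1/d) * t) * cutoff ((2 - T/d) + (1/d) * t)"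
  have c: "((\<lambda>t. cutoff (a + b * t)) has_real_derivative - 4 * max 0 (1 - (max 0 (a + b * t))\<^sup>2) * max 0 (a + b * t) * b) (at t)" for a b t
   by (rule DERIV_chain2[OF cutoff_DERIV]) (auto intro!: derivative_eq_intros)
  have "\<exists>q'. (?q has_real_derivative q') (at t)" for t
   using DERIV_mult[OF c c] by blast
  then obtain q' where q': "\<And>t. (?q has_real_derivative q' t) (at t)" by metis
  have "frechet_derivative ?a (at z) (0, v) = 0" for z v
  proof -
   have "frechet_derivative fst (at z) = fst"
    by (rule frechet_derivative_eqI) (auto intro!: derivative_eq_intros)
   then show ?thesis by (subst frechet_derivative_eqI[OF frechet_derivative_real_compose[OF C1_fst q']]) simp
  qed
  then show "gradx_part ?a z = 0" for z by (simp only: vec_eq_iff gradx_part_nth zero_index simp_thms)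
  show "0 \<le> ?a z" "?a z \<le> 1" for z by (auto intro!: mult_nonneg_nonneg mult_le_one cutoff_simps)
  show "?a z = 1" if "fst z \<in> {2*d..T-2*d}" for z using that d
   by (subst cutoff_simps(1); (subst cutoff_simps(1))?) (auto simp: field_simps)
  show "?a z = 0" if "fst z \<notin> {d..T-d}" for z 
  proof -
   have "2 + (- 1/d) * fst z \<ge> 1 \<or> (2 - T/d) + (1/d) * fst z \<ge> 1" using that d by (auto simp: field_simps)
   then show ?thesis using cutoff_simps(2) by auto
  qed
 qed
qed

text \<open>Makes K w admissible although w need not vanish at t = 0 and t = T. Cutoffs in time tend
  to 1 on (0, T); as they do not depend on x, they merely multiply the spatial gradient, so
  dominated convergence removes them.\<close>

theorem approximable_multiplier:
 assumes lip: "lipschitz_domain \<Omega>" and T: "T > 0"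
  and w: "wgrad_on ({0<..<T} \<times> UNIV) f g"
  and supp: "\<And>z. z \<notin> {0<..<T} \<times> \<Omega> \<Longrightarrow> f z = 0 \<and> g z = 0" and K: "C1 K"
 shows "approximable ({0<..<T} \<times> \<Omega>) (\<lambda>z. K z * f z) (\<lambda>z. K z *\<^sub>R g z + f z *\<^sub>R gradx_part K z)"
  and "L2 (\<lambda>z. K z * f z)" and "L2 (\<lambda>z. (K z *\<^sub>R g z + f z *\<^sub>R gradx_part K z) $ i)"
proof -
 have bnd: "bounded \<Omega>" using lip by (simp add: lipschitz_domain_def)
 note wd = wgrad_onD[OF w]
 have "bounded ({0<..<T} \<times> \<Omega>)" by (intro bounded_Times bnd) auto
 then obtain \<rho> where \<rho>0: "\<forall>z\<in>{0<..<T} \<times> \<Omega>. norm z \<le> \<rho>" unfolding bounded_iff by blast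
 have \<rho>: "f z = 0" "g z = 0" if "z \<notin> cball 0 \<rho>" for z
 proof -
  have "z \<notin> {0<..<T} \<times> \<Omega>" using that \<rho>0 by auto
  then show "f z = 0" "g z = 0" using supp by blast+
 qed
 let ?F = "\<lambda>z. K z * f z" and ?G = "\<lambda>z. K z *\<^sub>R g z + f z *\<^sub>R gradx_part K z"
 show LF: "L2 ?F" by (rule L2_mult_continuous[OF wd(1) \<rho>(1) C1_continuous[OF K]])
 have Lg: "L2 (\<lambda>z. K z * g z $ i)" for i
  by (rule L2_mult_continuous[OF wd(2) _ C1_continuous[OF K], of 0 \<rho>]) (simp add: \<rho>)
 have Lc: "L2 (\<lambda>z. gradx_part K z $ i * f z)" for i
  by (rule L2_mult_continuous[OF wd(1) \<rho>(1) continuous_gradx_part[OF K]])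
 show LG: "L2 (\<lambda>z. ?G z $ i)" for i
  using L2_add[OF Lg[of i] Lc[of i]] by (simp add: mult.commute)
 define d where "d n = 1 / (real n + 1)" for n
 have d0: "d n > 0" for n by (simp add: d_def)
 have dlim: "d \<longlonglongrightarrow> 0" unfolding d_def using LIMSEQ_inverse_real_of_nat by (simp add: inverse_eq_divide add.commute)
 have "\<forall>n. \<exists>\<alpha> :: real \<times> (real^3) \<Rightarrow> real. C1 \<alpha> \<and> (\<forall>z. gradx_part \<alpha> z = 0) \<and> (\<forall>z. 0 \<le> \<alpha> z) \<and> (\<forall>z. \<alpha> z \<le> 1) \<and>
  (\<forall>z. fst z \<in> {2*d n..T-2*d n} \<longrightarrow> \<alpha> z = 1) \<and> (\<forall>z. fst z \<notin> {d n..T-d n} \<longrightarrow> \<alpha> z = 0)"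
  by (rule allI, rule time_cutoff_exists[OF d0], blast)
 from choice[OF this] obtain \<alpha> :: "nat \<Rightarrow> real \<times> (real^3) \<Rightarrow> real" where \<alpha>: "\<And>n. C1 (\<alpha> n)" "\<And>n z. gradx_part (\<alpha> n) z = 0"
  "\<And>n z. 0 \<le> \<alpha> n z" "\<And>n z. \<alpha> n z \<le> 1" "\<And>n z. fst z \<in> {2*d n..T-2*d n} \<Longrightarrow> \<alpha> n z = 1"
  "\<And>n z. fst z \<notin> {d n..T-d n} \<Longrightarrow> \<alpha> n z = 0" by blast
 obtain J where J: "finite J" "\<And>p r. (p, r) \<in> J \<Longrightarrow> inward \<Omega> p r" "closure \<Omega> \<subseteq> (\<Union>(p, r)\<in>J. ball p (r/2))"
  using inward_cover[OF lip] by blast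
 have appr: "approximable ({0<..<T} \<times> \<Omega>) (\<lambda>z. \<alpha> n z * ?F z) (\<lambda>z. \<alpha> n z *\<^sub>R ?G z)" 
  and Lan: "L2 (\<lambda>z. \<alpha> n z * ?F z)" "\<And>i. L2 (\<lambda>z. (\<alpha> n z *\<^sub>R ?G z) $ i)" for n
 proof -
  have c: "C1 (\<lambda>z. \<alpha> n z * K z)" by (intro C1_mult \<alpha> K)
  have "wgrad_on UNIV (\<lambda>z. (\<alpha> n z * K z) * f z) (\<lambda>z. (\<alpha> n z * K z) *\<^sub>R g z + f z *\<^sub>R gradx_part (\<lambda>z. \<alpha> n z * K z) z)"
  proof (rule wgrad_on_mult[OF w c _ \<rho>])
   fix \<phi> :: "real \<times> (real^3) \<Rightarrow> real" assume \<phi>: "C1c_on \<phi> UNIV"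
   then obtain L where L: "compact L" "\<And>z. z \<notin> L \<Longrightarrow> \<phi> z = 0" by (auto simp: C1c_on_iff)
   have L': "compact (L \<inter> ({d n..T-d n} \<times> UNIV))" by (intro compact_Int_closed L(1) closed_Times) auto
   show "C1c_on (\<lambda>z. \<alpha> n z * K z * \<phi> z) ({0<..<T} \<times> UNIV)"
    unfolding C1c_on_iff
   proof (intro conjI exI[of _ "L \<inter> ({d n..T-d n} \<times> UNIV)"] L' allI impI)
    show "C1 (\<lambda>z. \<alpha> n z * K z * \<phi> z)" by (intro C1_mult c C1c_on_C1[OF \<phi>])
    show "L \<inter> ({d n..T-d n} \<times> UNIV) \<subseteq> {0<..<T} \<times> UNIV" using d0[of n] by auto
    show "\<alpha> n z * K z * \<phi> z = 0" if "z \<notin> L \<inter> ({d n..T-d n} \<times> UNIV)" for z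
    proof (cases "z \<in> L")
     case True
     then have "fst z \<notin> {d n..T-d n}" using that by (cases z) auto
     then show ?thesis using \<alpha>(6) by simp
    qed (simp add: L(2))
   qed
  qed
  moreover have "(\<lambda>z. (\<alpha> n z * K z) *\<^sub>R g z + f z *\<^sub>R gradx_part (\<lambda>z. \<alpha> n z * K z) z) = (\<lambda>z. \<alpha> n z *\<^sub>R ?G z)"
   unfolding gradx_part_mult[OF \<alpha>(1) K] \<alpha>(2) by (simp add: scaleR_add_right mult.commute)
  ultimately have w': "wgrad_on UNIV (\<lambda>z. \<alpha> n z * ?F z) (\<lambda>z. \<alpha> n z *\<^sub>R ?G z)" by (simp add: mult.assoc)
  show "L2 (\<lambda>z. \<alpha> n z * ?F z)" "\<And>i. L2 (\<lambda>z. (\<alpha> n z *\<^sub>R ?G z) $ i)" using wgrad_onD[OF w'] by auto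
  show "approximable ({0<..<T} \<times> \<Omega>) (\<lambda>z. \<alpha> n z * ?F z) (\<lambda>z. \<alpha> n z *\<^sub>R ?G z)"
  proof (rule approximable_inward_cover[OF J(1,2) _ _ bnd w'])
   show "0 < d n" "T - d n < T" using d0[of n] by auto
   show "\<alpha> n z * ?F z = 0 \<and> \<alpha> n z *\<^sub>R ?G z = 0" if "z \<notin> {d n..T - d n} \<times> \<Omega>" for z
    using that supp[of z] \<alpha>(6)[of z n] by (cases z) auto
   fix z :: "real \<times> (real^3)" assume z: "snd z \<notin> (\<Union>(p, r)\<in>J. ball p (r/2))"
   then have "snd z \<notin> \<Omega>" using J(3) closure_subset by blast
   then show "\<alpha> n z * ?F z = 0 \<and> \<alpha> n z *\<^sub>R ?G z = 0" using supp[of z] by (cases z) auto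
  qed
 qed
 have a1: "\<alpha> n z * c - c = (\<alpha> n z - 1) * c" for n z and c :: real by (simp add: algebra_simps)
 have conv: "(\<lambda>n. N2 (\<lambda>z. \<alpha> n z * q z - q z)) \<longlonglongrightarrow> 0" if q: "L2 q" "\<And>z. fst z \<notin> {0<..<T} \<Longrightarrow> q z = 0" for q
 proof -
  have "(\<lambda>n. LBINT z. (\<alpha> n z * q z - q z)\<^sup>2) \<longlonglongrightarrow> integral\<^sup>L lborel (\<lambda>z :: real \<times> (real^3). 0)"
  proof (rule integral_dominated_convergence[where w = "\<lambda>z. (q z)\<^sup>2"])
   show "integrable lborel (\<lambda>z. (q z)\<^sup>2)" using q by (simp add: L2_def)
   note [measurable] = L2_measurable[OF q(1)] borel_measurable_continuous_onI[OF C1_continuous[OF \<alpha>(1)]]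
   show "(\<lambda>z. (\<alpha> n z * q z - q z)\<^sup>2) \<in> borel_measurable lborel" for n by measurable
   show "AE z in lborel. norm ((\<alpha> n z * q z - q z)\<^sup>2) \<le> (q z)\<^sup>2" for n
   proof (rule AE_I2)
    fix z :: "real \<times> (real^3)"
    have "(\<alpha> n z - 1)\<^sup>2 \<le> 1" using \<alpha>(3)[of n z] \<alpha>(4)[of n z] by (simp add: abs_square_le_1 abs_le_iff)
    then have "(\<alpha> n z - 1)\<^sup>2 * (q z)\<^sup>2 \<le> 1 * (q z)\<^sup>2" by (intro mult_right_mono) auto
    then show "norm ((\<alpha> n z * q z - q z)\<^sup>2) \<le> (q z)\<^sup>2" by (simp add: a1 power_mult_distrib)
   qed
   show "AE z in lborel. (\<lambda>n. (\<alpha> n z * q z - q z)\<^sup>2) \<longlonglongrightarrow> 0"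
   proof (rule AE_I2)
    fix z :: "real \<times> (real^3)"
    show "(\<lambda>n. (\<alpha> n z * q z - q z)\<^sup>2) \<longlonglongrightarrow> 0"
    proof (cases "fst z \<in> {0<..<T}")
     case True
     then have "\<forall>\<^sub>F n in sequentially. d n < min (fst z) (T - fst z) / 2"
      by (intro order_tendstoD(2)[OF dlim]) simp
     then have "\<forall>\<^sub>F n in sequentially. (\<alpha> n z * q z - q z)\<^sup>2 = 0"
     proof eventually_elim
      case (elim n)
      then have "\<alpha> n z = 1" by (intro \<alpha>(5)) auto
      then show ?case by simp
     qed
     then show ?thesis by (rule tendsto_eventually)
    qed (use q(2) in simp)
   qed
  qed simp
  then show ?thesis by (simp add: N2_def)
 qed
 show "approximable ({0<..<T} \<times> \<Omega>) ?F ?G"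
 proof (rule approximable_limit[OF LF LG])
  fix e :: real assume e: "e > 0"
  have 1: "\<forall>\<^sub>F n in sequentially. N2 (\<lambda>z. \<alpha> n z * ?F z - ?F z) < e"
   using supp by (intro order_tendstoD(2)[OF conv[OF LF] e]) auto
  have 2: "\<forall>\<^sub>F n in sequentially. N2 (\<lambda>z. \<alpha> n z * (?G z $ i) - ?G z $ i) < e" for i
   using supp by (intro order_tendstoD(2)[OF conv[OF LG] e]) auto
  have "\<forall>\<^sub>F n in sequentially. \<forall>i. N2 (\<lambda>z. \<alpha> n z * (?G z $ i) - ?G z $ i) < e"
   using 2 by (rule eventually_all_finite)
  with 1 have "\<forall>\<^sub>F n in sequentially. N2 (\<lambda>z. \<alpha> n z * ?F z - ?F z) < e \<and> (\<forall>i. N2 (\<lambda>z. \<alpha> n z * (?G z $ i) - ?G z $ i) < e)"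
   by (rule eventually_conj)
  then obtain n where n: "N2 (\<lambda>z. \<alpha> n z * ?F z - ?F z) < e" "\<And>i. N2 (\<lambda>z. \<alpha> n z * (?G z $ i) - ?G z $ i) < e"
   by (auto simp: eventually_sequentially)
  show "\<exists>f' g'. approximable ({0<..<T} \<times> \<Omega>) f' g' \<and> L2 f' \<and> (\<forall>i. L2 (\<lambda>z. g' z $ i)) \<and>
    N2 (\<lambda>z. f' z - ?F z) < e \<and> (\<forall>i. N2 (\<lambda>z. g' z $ i - ?G z $ i) < e)"
   using appr[of n] Lan[of n] n by (intro exI[of _ "\<lambda>z. \<alpha> n z * ?F z"] exI[of _ "\<lambda>z. \<alpha> n z *\<^sub>R ?G z"]) simp
 qed
qed

section \<open>The energy inequality\<close>

text \<open>The flux H is kept abstract. The initial value enters through test functions that need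
  not vanish at t = 0. The last clause states that the terminal value is attained in the mean over
  the slice (T - h, T), which is what a difference quotient sees.\<close>

definition weak_evol :: "(real^3) set \<Rightarrow> real \<Rightarrow> (real \<times> (real^3) \<Rightarrow> real) \<Rightarrow> (real \<times> (real^3) \<Rightarrow> real^3) \<Rightarrow>
  (real \<times> (real^3) \<Rightarrow> real^3) \<Rightarrow> (real^3 \<Rightarrow> real) \<Rightarrow> (real^3 \<Rightarrow> real) \<Rightarrow> bool" where
 "weak_evol \<Omega> T w g H W0 WT \<longleftrightarrow> wgrad_on ({0<..<T} \<times> UNIV) w g \<and> (\<forall>i. L2 (\<lambda>z. H z $ i)) \<and> L2 W0 \<and> L2 WT \<and>
  (\<forall>z. z \<notin> {0<..<T} \<times> \<Omega> \<longrightarrow> w z = 0 \<and> g z = 0 \<and> H z = 0) \<and>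
  (\<forall>x. x \<notin> \<Omega> \<longrightarrow> W0 x = 0 \<and> WT x = 0) \<and>
  (\<forall>\<phi>. C1c_on \<phi> ({..<T} \<times> \<Omega>) \<longrightarrow>
   - (LBINT z. w z * dt_part \<phi> z) + (LBINT z. H z \<bullet> gradx_part \<phi> z) - (LBINT x. W0 x * \<phi> (0, x)) = 0) \<and>
  (\<forall>e>0. \<exists>h0>0. \<forall>h. 0 < h \<and> h < h0 \<longrightarrow>
   (LBINT z. indicator {T-h<..<T} (fst z) * (w z - WT (snd z))\<^sup>2) \<le> e * h)"

lemma L2_shift_minus: "L2 f \<Longrightarrow> L2 (\<lambda>z. f (z - c))"
 using L2_shift[of f "- c"] by (simp only: diff_conv_add_uminus)

lemma N2_shift_minus: "N2 (\<lambda>z. f (z - c)) = N2 f"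
 using N2_shift[of f "- c"] by (simp only: diff_conv_add_uminus)

lemma fst_borel_measurable [measurable]: "(fst :: 'a::euclidean_space \<times> 'b::euclidean_space \<Rightarrow> 'a) \<in> borel_measurable borel"
 and snd_borel_measurable [measurable]: "(snd :: 'a::euclidean_space \<times> 'b::euclidean_space \<Rightarrow> 'b) \<in> borel_measurable borel"
 by (intro borel_measurable_continuous_onI continuous_intros)+

lemma emeasure_Icc_finite: "emeasure lborel {a..b::real} < \<infinity>" "emeasure lborel {a..b::real} < top"
 "emeasure lborel {a<..<b::real} < \<infinity>" "emeasure lborel {a<..<b::real} < top"
 using emeasure_bounded_finite[of "{a..b}"] emeasure_bounded_finite[of "{a<..<b}"] by simp_all

lemma L2_tensor:
 fixes q :: "'b::euclidean_space \<Rightarrow> real" and S :: "real set"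
 assumes S: "S \<in> sets borel" "emeasure lborel S < \<infinity>" and q: "L2 q"
 shows "L2 (\<lambda>z. indicator S (fst z) * q (snd z))"
  and "N2 (\<lambda>z. indicator S (fst z) * q (snd z)) = measure lborel S * N2 q"
proof -
 have [measurable]: "q \<in> borel_measurable borel" "S \<in> sets borel" using q S by auto
 have iS: "integrable lborel (\<lambda>t. indicator S t :: real)" using S by (simp add: integrable_indicator_iff)
 have e: "(indicator S t * c)\<^sup>2 = indicator S t * c\<^sup>2" for t and c :: real by (simp add: indicator_def)
 have m: "(\<lambda>z::real \<times> 'b. indicator S (fst z) * (q (snd z))\<^sup>2) \<in> borel_measurable (lborel \<Otimes>\<^sub>M lborel)" by measurable
 have int: "integrable (lborel \<Otimes>\<^sub>M lborel) (\<lambda>z::real \<times> 'b. indicator S (fst z) * (q (snd z))\<^sup>2)"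
  by (rule lborel_pair.Fubini_integrable[OF m]) (use iS L2_integrable_sq[OF q] in auto)
 have m2: "(\<lambda>z::real \<times> 'b. indicator S (fst z) * q (snd z)) \<in> borel_measurable (lborel \<Otimes>\<^sub>M lborel)" by measurable
 show "L2 (\<lambda>z. indicator S (fst z) * q (snd z))"
  unfolding L2_def e using int m2 unfolding lborel_prod by simp
 have "N2 (\<lambda>z. indicator S (fst z) * q (snd z)) = (\<integral>z. indicator S (fst z) * (q (snd z))\<^sup>2 \<partial>(lborel \<Otimes>\<^sub>M lborel))"
  unfolding N2_def e lborel_prod ..
 also have "\<dots> = (LBINT t. LBINT x. indicator S t * (q x)\<^sup>2)"
  using lborel_pair.integral_fst'[OF int] by simp
 also have "\<dots> = measure lborel S * N2 q" using S by (simp add: N2_def)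
 finally show "N2 (\<lambda>z. indicator S (fst z) * q (snd z)) = measure lborel S * N2 q" .
qed

lemma continuous_integral_dominated:
 fixes j :: "'b \<Rightarrow> 'a::euclidean_space \<Rightarrow> real"
 assumes "\<And>w. w \<in> space M \<Longrightarrow> continuous_on UNIV (j w)" "\<And>w z. w \<in> space M \<Longrightarrow> \<bar>j w z\<bar> \<le> g w" "integrable M g"
  "\<And>z. (\<lambda>w. j w z) \<in> borel_measurable M"
 shows "continuous_on UNIV (\<lambda>z. \<integral>w. j w z \<partial>M)"
 unfolding continuous_on_sequentially o_def
proof (intro ballI allI impI; elim conjE)
 fix z :: 'a and X assume X: "X \<longlonglongrightarrow> z"
 show "(\<lambda>i. \<integral>w. j w (X i) \<partial>M) \<longlonglongrightarrow> (\<integral>w. j w z \<partial>M)"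
 proof (rule integral_dominated_convergence[where w = g])
  show "AE w in M. (\<lambda>i. j w (X i)) \<longlonglongrightarrow> j w z"
   using continuous_on_tendsto_compose[OF assms(1) X] by (intro AE_I2) auto
 qed (use assms in auto)
qed

text \<open>Averaging over later times keeps the support below T but lets it reach negative times,
  which is why test functions on ({..<T}) are needed. There is no division by h, so that the time
  derivative is the plain difference of f over a step h.\<close>

definition steklov :: "real \<Rightarrow> (real \<times> (real^3) \<Rightarrow> real) \<Rightarrow> real \<times> (real^3) \<Rightarrow> real" where
 "steklov h f z = (LBINT s. indicator {0..h} s * f (z + (s, 0)))"

lemma steklov_derivative:
 assumes f: "C1c_on f S"
 shows "(steklov h f has_derivative (\<lambda>v. LBINT s. indicator {0..h} s * frechet_derivative f (at (z + (s, 0))) v)) (at z)"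
  and "C1 (steklov h f)"
proof -
 obtain B where B: "B \<ge> 0" "\<And>z. \<bar>f z\<bar> \<le> B" "\<And>z v. \<bar>frechet_derivative f (at z) v\<bar> \<le> B * norm v"
  using C1c_on_bound[OF f] by blast
 note c = C1c_on_C1[OF f]
 have ii: "integrable lborel (\<lambda>s. indicator {0..h} s :: real)"
  by (simp add: integrable_indicator_iff emeasure_Icc_finite)
 have cs: "continuous_on UNIV (\<lambda>s::real. q (z + (s, 0)))" if "continuous_on UNIV q" for q :: "real \<times> (real^3) \<Rightarrow> real" and z
  by (rule continuous_on_compose2[OF that]) (auto intro!: continuous_intros)
 have ms: "(\<lambda>s. indicator {0..h} s * q (z + (s, 0))) \<in> borel_measurable lborel"
  if "continuous_on UNIV q" for q :: "real \<times> (real^3) \<Rightarrow> real" and z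
  using borel_measurable_continuous_onI[OF cs[OF that]] by (auto intro!: borel_measurable_times)
 have iq: "integrable lborel (\<lambda>s. indicator {0..h} s * q (z + (s, 0)))"
  if "continuous_on UNIV q" "\<And>z. \<bar>q z\<bar> \<le> b" for q :: "real \<times> (real^3) \<Rightarrow> real" and z b
 proof (rule Bochner_Integration.integrable_bound)
  show "integrable lborel (\<lambda>s. b * indicator {0..h} s)" using ii by simp
  show "AE s in lborel. norm (indicator {0..h} s * q (z + (s, 0))) \<le> norm (b * indicator {0..h} s)"
  proof (rule AE_I2)
   fix s :: real
   have "\<bar>q (z + (s, 0))\<bar> \<le> \<bar>b\<bar>" using that(2)[of "z + (s, 0)"] by linarith
   then show "norm (indicator {0..h} s * q (z + (s, 0))) \<le> norm (b * indicator {0..h} s)" by (simp add: indicator_def)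
  qed
 qed (rule ms[OF that(1)])
 show *: "(steklov h f has_derivative (\<lambda>v. LBINT s. indicator {0..h} s * frechet_derivative f (at (z + (s, 0))) v)) (at z)" for z
  unfolding steklov_def[abs_def]
 proof (rule has_derivative_integral_dominated(1)[where U = UNIV and g = "\<lambda>s. B * indicator {0..h} s"])
  show "((\<lambda>y. indicator {0..h} s * f (y + (s, 0))) has_derivative (\<lambda>v. indicator {0..h} s * frechet_derivative f (at (y + (s, 0))) v)) (at y)" for s y
   by (rule has_derivative_mult_right[OF has_derivative_shift[OF c]])
  show "integrable lborel (\<lambda>s. indicator {0..h} s * f (y + (s, 0)))" for y
   by (rule iq[OF C1_continuous[OF c] B(2)])
  show "\<bar>indicator {0..h} s * frechet_derivative f (at (y + (s, 0))) v\<bar> \<le> B * indicator {0..h} s * norm v" for s y v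
   using B(3)[of "y + (s, 0)" v] by (simp add: indicator_def)
  show "integrable lborel (\<lambda>s. B * indicator {0..h} s)" using ii by simp
  show "(\<lambda>s. indicator {0..h} s * frechet_derivative f (at (z + (s, 0))) v) \<in> borel_measurable lborel" for v
   by (rule ms[OF C1_continuous_derivative[OF c]])
 qed auto
 show "C1 (steklov h f)"
 proof (rule C1I[OF *])
  show "continuous_on UNIV (\<lambda>z. LBINT s. indicator {0..h} s * frechet_derivative f (at (z + (s, 0))) v)" for v
  proof (rule continuous_integral_dominated[where g = "\<lambda>s. B * norm v * indicator {0..h} s"])
   show "continuous_on UNIV (\<lambda>z. indicator {0..h} s * frechet_derivative f (at (z + (s, 0))) v)" for s
    by (intro continuous_on_mult_left continuous_on_compose2[OF C1_continuous_derivative[OF c]]) (auto intro!: continuous_intros)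
   show "\<bar>indicator {0..h} s * frechet_derivative f (at (z + (s, 0))) v\<bar> \<le> B * norm v * indicator {0..h} s" for s z
    using B(3)[of "z + (s, 0)" v] by (simp add: indicator_def)
   show "(\<lambda>s. indicator {0..h} s * frechet_derivative f (at (z + (s, 0))) v) \<in> borel_measurable lborel" for z
    by (rule ms[OF C1_continuous_derivative[OF c]])
  qed (use ii in simp)
 qed
qed

lemma steklov_parts:
 assumes f: "C1c_on f ({0<..<T} \<times> \<Omega>)" and h: "h > 0"
 shows "gradx_part (steklov h f) z $ i = (LBINT s. indicator {0..h} s * gradx_part f (z + (s, 0)) $ i)"
  and "dt_part (steklov h f) z = f (z + (h, 0)) - f z"
  and "C1c_on (steklov h f) ({..<T} \<times> \<Omega>)"
proof -
 note c = C1c_on_C1[OF f]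
 show "gradx_part (steklov h f) z $ i = (LBINT s. indicator {0..h} s * gradx_part f (z + (s, 0)) $ i)"
  unfolding gradx_part_nth frechet_derivative_eqI[OF steklov_derivative(1)[OF f]] ..
 have "dt_part (steklov h f) z = (LBINT s. indicator {0..h} s *\<^sub>R frechet_derivative f (at (z + (s, 0))) (1, 0))"
  unfolding dt_part_def frechet_derivative_eqI[OF steklov_derivative(1)[OF f]] by simp
 also have "\<dots> = f (z + (h, 0)) - f (z + (0, 0))"
 proof (rule integral_FTC_atLeastAtMost[where F = "\<lambda>s. f (z + (s, 0))"])
  show "((\<lambda>s. f (z + (s, 0))) has_vector_derivative frechet_derivative f (at (z + (s, 0))) (1, 0)) (at s within {0..h})" for s
  proof -
   have "((\<lambda>s. z + (s, 0)) has_derivative (\<lambda>u. (u, 0))) (at s within {0..h})"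
    by (auto intro!: derivative_eq_intros simp: zero_prod_def)
   from has_derivative_compose[OF this C1_has_derivative[OF c]]
   have "((\<lambda>s. f (z + (s, 0))) has_derivative (\<lambda>u. frechet_derivative f (at (z + (s, 0))) (u, 0))) (at s within {0..h})" .
   moreover have "(\<lambda>u. frechet_derivative f (at (z + (s, 0))) (u, 0)) = (\<lambda>u. u *\<^sub>R frechet_derivative f (at (z + (s, 0))) (1, 0))"
   proof
    show "frechet_derivative f (at (z + (s, 0))) (u, 0) = u *\<^sub>R frechet_derivative f (at (z + (s, 0))) (1, 0)" for u
     using linear_scale[OF C1_linear[OF c], of "z + (s, 0)" u "(1, 0)"] by simp
   qed
   ultimately show ?thesis unfolding has_vector_derivative_def by metis
  qed
  show "continuous_on {0..h} (\<lambda>s. frechet_derivative f (at (z + (s, 0))) (1, 0))"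
   by (rule continuous_on_compose2[OF C1_continuous_derivative[OF c]]) (auto intro!: continuous_intros)
 qed (use h in auto)
 also have "z + (0, 0) = z" by (metis add.right_neutral zero_prod_def)
 finally show "dt_part (steklov h f) z = f (z + (h, 0)) - f z" .
 obtain K where K: "compact K" "K \<subseteq> {0<..<T} \<times> \<Omega>" "\<And>z. z \<notin> K \<Longrightarrow> f z = 0" using f unfolding C1c_on_iff by blast
 let ?K = "{a - b | a b. a \<in> K \<and> b \<in> {0..h} \<times> {0 :: real^3}}"
 show "C1c_on (steklov h f) ({..<T} \<times> \<Omega>)" unfolding C1c_on_iff
 proof (intro conjI exI[of _ ?K] allI impI)
  show "C1 (steklov h f)" by (rule steklov_derivative(2)[OF f])
  show "compact ?K" by (intro compact_differences K(1) compact_Times compact_Icc) auto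
  show "?K \<subseteq> {..<T} \<times> \<Omega>" using K(2) by force
  fix z assume z: "z \<notin> ?K"
  have "indicator {0..h} s * f (z + (s, 0)) = 0" for s
  proof (cases "s \<in> {0..h}")
   case True
   have "z + (s, 0) \<notin> K"
   proof
    assume "z + (s, 0) \<in> K"
    then have "(z + (s, 0)) - (s, 0) \<in> ?K" using True by blast
    then show False using z by simp
   qed
   then show ?thesis by (simp add: K(3))
  qed auto
  then show "steklov h f z = 0" unfolding steklov_def by (simp only: Bochner_Integration.integral_zero)
 qed
qed

lemma steklov_swap:
 fixes p q :: "real \<times> (real^3) \<Rightarrow> real"
 assumes p: "L2 p" and q: "L2 q"
 shows "(LBINT z. q z * (LBINT s. indicator {0..h} s * p (z + (s, 0))))
   = (LBINT s. indicator {0..h} s * (LBINT z. q z * p (z + (s, 0))))"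
  and "integrable lborel (\<lambda>s. indicator {0..h} s * (LBINT z. q z * p (z + (s, 0))))"
  and "integrable lborel (\<lambda>z. q z * (LBINT s. indicator {0..h} s * p (z + (s, 0))))"
proof -
 note [measurable] = L2_measurable[OF p] L2_measurable[OF q]
 have ii: "integrable lborel (\<lambda>s. indicator {0..h} s :: real)" by (simp add: integrable_indicator_iff emeasure_Icc_finite)
 let ?f = "\<lambda>(s, z). indicator {0..h} s * (q z * p (z + (s, 0)))"
 have pz: "integrable lborel (\<lambda>z. q z * p (z + (s, 0)))" for s
  by (rule L2_prod_integrable[OF q L2_shift[OF p]])
 have m: "?f \<in> borel_measurable (lborel \<Otimes>\<^sub>M lborel)" by measurable
 have bd: "(LBINT z. norm (q z * p (z + (s, 0)))) \<le> N2 q + N2 p" for s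
 proof -
  have "(LBINT z. norm (q z * p (z + (s, 0)))) \<le> (LBINT z. (q z)\<^sup>2 + (p (z + (s, 0)))\<^sup>2)"
  proof (rule integral_mono)
   show "integrable lborel (\<lambda>z. norm (q z * p (z + (s, 0))))" using pz by simp
   show "integrable lborel (\<lambda>z. (q z)\<^sup>2 + (p (z + (s, 0)))\<^sup>2)"
    using L2_integrable_sq[OF q] L2_integrable_sq[OF L2_shift[OF p]] by simp
   have "2 * \<bar>a * b\<bar> \<le> a\<^sup>2 + b\<^sup>2" for a b :: real
    using zero_le_power2[of "\<bar>a\<bar> - \<bar>b\<bar>"] by (simp add: power2_diff abs_mult)
   then have "\<bar>a * b\<bar> \<le> a\<^sup>2 + b\<^sup>2" for a b :: real by (smt (verit) abs_ge_zero)
   then show "norm (q z * p (z + (s, 0))) \<le> (q z)\<^sup>2 + (p (z + (s, 0)))\<^sup>2" for z by simp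
  qed
  also have "\<dots> = N2 q + N2 (\<lambda>z. p (z + (s, 0)))"
   using L2_integrable_sq[OF q] L2_integrable_sq[OF L2_shift[OF p, of "(s, 0)"]] by (simp add: N2_def)
  finally show ?thesis by (simp add: N2_shift)
 qed
 have int: "integrable (lborel \<Otimes>\<^sub>M lborel) ?f"
 proof (rule lborel_pair.Fubini_integrable[OF m])
  show "integrable lborel (\<lambda>s. LBINT z. norm (?f (s, z)))"
  proof (rule Bochner_Integration.integrable_bound)
   show "integrable lborel (\<lambda>s. (N2 q + N2 p) * indicator {0..h} s)" using ii by simp
   show "(\<lambda>s. LBINT z. norm (?f (s, z))) \<in> borel_measurable lborel" by measurable
   show "AE s in lborel. norm (LBINT z. norm (?f (s, z))) \<le> norm ((N2 q + N2 p) * indicator {0..h} s)"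
    using bd by (intro AE_I2) (auto simp: indicator_def abs_mult)
  qed
  show "AE s in lborel. integrable lborel (\<lambda>z. ?f (s, z))" using pz by (intro AE_I2) simp
 qed
 have int': "integrable (lborel \<Otimes>\<^sub>M lborel) (case_prod (\<lambda>s z. indicator {0..h} s * (q z * p (z + (s, 0)))))"
  using int .
 have e: "(LBINT s. indicator {0..h} s * (q z * p (z + (s, 0)))) = q z * (LBINT s. indicator {0..h} s * p (z + (s, 0)))" for z
  by (subst integral_mult_right_zero[symmetric]) (simp only: mult.left_commute)
 show "(LBINT z. q z * (LBINT s. indicator {0..h} s * p (z + (s, 0))))
   = (LBINT s. indicator {0..h} s * (LBINT z. q z * p (z + (s, 0))))"
  using lborel_pair.Fubini_integral[OF int'] unfolding e by simp
 show "integrable lborel (\<lambda>s. indicator {0..h} s * (LBINT z. q z * p (z + (s, 0))))"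
  using lborel_pair.integrable_fst[OF int'] by simp
 show "integrable lborel (\<lambda>z. q z * (LBINT s. indicator {0..h} s * p (z + (s, 0))))"
  using lborel_pair.integrable_snd[OF int'] unfolding e .
qed

text \<open>The weak equation tested with Steklov averages turns the time derivative into a difference quotient,
 in which the initial value plays the role of the solution at negative times.\<close>

lemma difference_equation:
 assumes ev: "weak_evol \<Omega> T w g H W0 WT" and f: "C1c_on f ({0<..<T} \<times> \<Omega>)" and h: "h > 0"
 shows "(LBINT z. (w z - (w (z - (h, 0)) + indicator {0..h} (fst z) * W0 (snd z))) * f z)
   = - (LBINT s. indicator {0..h} s * (\<Sum>i\<in>UNIV. \<integral>z. H (z - (s, 0)) $ i * gradx_part f z $ i \<partial>lborel))"
proof -
 have w: "L2 w" and H: "\<And>i. L2 (\<lambda>z. H z $ i)" and W0: "L2 W0"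
  and eq: "\<And>\<phi>. C1c_on \<phi> ({..<T} \<times> \<Omega>) \<Longrightarrow> - (LBINT z. w z * dt_part \<phi> z) + (LBINT z. H z \<bullet> gradx_part \<phi> z) - (LBINT x. W0 x * \<phi> (0, x)) = 0"
  using ev unfolding weak_evol_def wgrad_on_def by blast+
 note st = steklov_parts[OF f h]
 have Lf: "L2 f" and Ld: "\<And>i. L2 (\<lambda>z. gradx_part f z $ i)"
  using C1c_on_L2[OF f] by (auto simp: gradx_part_nth)
 have Lt: "L2 (\<lambda>z. indicator {0..h} (fst z) * W0 (snd z))" by (rule L2_tensor(1)[OF _ emeasure_Icc_finite(1) W0]) auto
 have wh: "L2 (\<lambda>z. w (z - (h, 0)))" by (rule L2_shift_minus[OF w])
 have 1: "(LBINT z. w z * dt_part (steklov h f) z) = (LBINT z. w (z - (h, 0)) * f z) - (LBINT z. w z * f z)"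
 proof -
  have "(LBINT z. w z * dt_part (steklov h f) z) = (LBINT z. w z * f (z + (h, 0)) - w z * f z)"
   by (simp add: st(2) algebra_simps)
  also have "\<dots> = (LBINT z. w z * f (z + (h, 0))) - (LBINT z. w z * f z)"
   by (rule Bochner_Integration.integral_diff[OF L2_prod_integrable[OF w L2_shift[OF Lf]] L2_prod_integrable[OF w Lf]])
  also have "(LBINT z. w z * f (z + (h, 0))) = (LBINT z. w (z - (h, 0)) * f z)"
   using lborel_shift_integral[of "\<lambda>z. w (z - (h, 0)) * f z" "(h, 0)"] by simp
  finally show ?thesis .
 qed
 have 2: "(LBINT z. H z \<bullet> gradx_part (steklov h f) z)
   = (LBINT s. indicator {0..h} s * (\<Sum>i\<in>UNIV. \<integral>z. H (z - (s, 0)) $ i * gradx_part f z $ i \<partial>lborel))"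
 proof -
  have sh: "(LBINT z. H z $ i * gradx_part f (z + (s, 0)) $ i) = (LBINT z. H (z - (s, 0)) $ i * gradx_part f z $ i)" for i s
   using lborel_shift_integral[of "\<lambda>z. H (z - (s, 0)) $ i * gradx_part f z $ i" "(s, 0)"] by simp
  have "(LBINT z. H z \<bullet> gradx_part (steklov h f) z)
    = (LBINT z. (\<Sum>i\<in>UNIV. H z $ i * (LBINT s. indicator {0..h} s * gradx_part f (z + (s, 0)) $ i)))"
   by (simp add: inner_vec_def st(1))
  also have "\<dots> = (\<Sum>i\<in>UNIV. \<integral>s. indicator {0..h} s * (LBINT z. H z $ i * gradx_part f (z + (s, 0)) $ i) \<partial>lborel)"
   by (subst Bochner_Integration.integral_sum) (use steklov_swap[OF Ld H] in auto)
  also have "\<dots> = (LBINT s. (\<Sum>i\<in>UNIV. indicator {0..h} s * (LBINT z. H z $ i * gradx_part f (z + (s, 0)) $ i)))"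
   by (subst Bochner_Integration.integral_sum) (use steklov_swap[OF Ld H] in auto)
  finally show ?thesis by (simp add: sum_distrib_left sh)
 qed
 have 3: "(LBINT x. W0 x * steklov h f (0, x)) = (LBINT z. (indicator {0..h} (fst z) * W0 (snd z)) * f z)"
 proof -
  have int: "integrable (lborel \<Otimes>\<^sub>M lborel) (\<lambda>z. (indicator {0..h} (fst z) * W0 (snd z)) * f z)"
   using L2_prod_integrable[OF Lt Lf] unfolding lborel_prod .
  then have int': "integrable (lborel \<Otimes>\<^sub>M lborel) (case_prod (\<lambda>t x. (indicator {0..h} t * W0 x) * f (t, x)))"
   by (simp add: split_beta')
  have "W0 x * steklov h f (0, x) = (LBINT t. (indicator {0..h} t * W0 x) * f (t, x))" for x
   unfolding steklov_def by (subst integral_mult_right_zero[symmetric]) (simp add: mult_ac)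
  then have "(LBINT x. W0 x * steklov h f (0, x)) = (LBINT x. LBINT t. (indicator {0..h} t * W0 x) * f (t, x))" by simp
  also have "\<dots> = integral\<^sup>L (lborel \<Otimes>\<^sub>M lborel) (case_prod (\<lambda>t x. (indicator {0..h} t * W0 x) * f (t, x)))"
   by (rule lborel_pair.integral_snd[OF int'])
  also have "\<dots> = (LBINT z. (indicator {0..h} (fst z) * W0 (snd z)) * f z)"
   unfolding lborel_prod by (simp add: split_beta')
  finally show ?thesis .
 qed
 have "(LBINT z. (w z - (w (z - (h, 0)) + indicator {0..h} (fst z) * W0 (snd z))) * f z)
  = (LBINT z. w z * f z - (w (z - (h, 0)) * f z + (indicator {0..h} (fst z) * W0 (snd z)) * f z))"
  by (simp add: algebra_simps)
 also have "\<dots> = (LBINT z. w z * f z) - ((LBINT z. w (z - (h, 0)) * f z) + (LBINT z. (indicator {0..h} (fst z) * W0 (snd z)) * f z))"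
  using L2_prod_integrable[OF w Lf] L2_prod_integrable[OF wh Lf] L2_prod_integrable[OF Lt Lf] by simp
 finally show ?thesis using eq[OF st(3)] unfolding 1 2 3 by simp
qed

text \<open>The error has to be a small multiple of h although F is approximated only in L2. The
  flux term carries a factor h of its own; the difference term does not, and therefore the
  approximating phi is chosen after h, with accuracy r proportional to h.\<close>

lemma difference_quotient_limit:
 assumes ev: "weak_evol \<Omega> T w g H W0 WT"
  and ap: "approximable ({0<..<T} \<times> \<Omega>) F G" and LF: "L2 F" and LG: "\<And>i. L2 (\<lambda>z. G z $ i)" and e: "e > 0"
 shows "\<exists>h0>0. \<forall>h. 0 < h \<and> h < h0 \<longrightarrow>
  (LBINT z. (w z - (w (z - (h, 0)) + indicator {0..h} (fst z) * W0 (snd z))) * F z)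
   + h * (\<Sum>i\<in>UNIV. \<integral>z. H z $ i * G z $ i \<partial>lborel) \<le> e * h"
proof -
 have w: "L2 w" and H: "\<And>i. L2 (\<lambda>z. H z $ i)" and W0: "L2 W0"
  using ev unfolding weak_evol_def wgrad_on_def by blast+
 define B where "B = (\<Sum>i\<in>UNIV. sqrt (N2 (\<lambda>z. G z $ i))) + 1"
 have B: "B > 0" unfolding B_def by (intro add_nonneg_pos sum_nonneg) auto
 define b where "b = e / (2 * B)"
 have b: "b > 0" using e B by (simp add: b_def)
 \<comment> \<open>The flux occurs averaged over time shifts up to h. Continuity of translations
   compares it with the unshifted flux, with a threshold that does not depend on phi.\<close>
 have "\<forall>i. \<exists>d>0. \<forall>k. norm k < d \<longrightarrow> N2 (\<lambda>z. H (z + k) $ i - H z $ i) < b\<^sup>2"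
  using L2_translation[OF H, of "b\<^sup>2"] b by simp
 from choice[OF this] obtain d where d: "\<And>i. d i > 0" "\<And>i k. norm k < d i \<Longrightarrow> N2 (\<lambda>z. H (z + k) $ i - H z $ i) < b\<^sup>2"
  by blast
 define h0 where "h0 = Min (range d)"
 have h0: "h0 > 0" "\<And>i. h0 \<le> d i" using d by (auto simp: h0_def)
 define c where "c = (\<Sum>i\<in>UNIV. \<integral>z. H z $ i * G z $ i \<partial>lborel)"
 define S where "S = (\<Sum>i\<in>UNIV. sqrt (N2 (\<lambda>z. H z $ i)))"
 have S: "S \<ge> 0" unfolding S_def by (intro sum_nonneg) auto
 show ?thesis
 proof (intro exI[of _ h0] conjI allI impI h0(1))
  fix h assume h: "0 < h \<and> h < h0"
  let ?v = "\<lambda>z. w z - (w (z - (h, 0)) + indicator {0..h} (fst z) * W0 (snd z))"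
  have Lv: "L2 ?v"
   using L2_diff[OF w L2_add[OF L2_shift_minus[OF w, of "(h, 0)"] L2_tensor(1)[OF _ emeasure_Icc_finite(1) W0, of 0 h]]] by simp
  \<comment> \<open>Collects the two places where the accuracy r enters: the difference term with
    \<open>sqrt (N2 ?v)\<close> and the flux term with h S. The summand 1 makes R positive.\<close>
  define R where "R = sqrt (N2 ?v) + h * S + 1"
  have R: "R > 0" using h S by (auto simp: R_def intro!: add_nonneg_pos)
  define r where "r = e * h / (2 * R)"
  have r: "r > 0" using e h R by (simp add: r_def)
  obtain \<phi> where \<phi>: "C1c_on \<phi> ({0<..<T} \<times> \<Omega>)" "N2 (\<lambda>z. \<phi> z - F z) < r\<^sup>2" "\<And>i. N2 (\<lambda>z. gradx_part \<phi> z $ i - G z $ i) < r\<^sup>2"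
   using ap r unfolding approximable_def by (meson zero_less_power)
  have Lf: "L2 \<phi>" and Ld: "\<And>i. L2 (\<lambda>z. gradx_part \<phi> z $ i)"
   using C1c_on_L2[OF \<phi>(1)] by (auto simp: gradx_part_nth)
  define C where "C s = (\<Sum>i\<in>UNIV. \<integral>z. H (z - (s, 0)) $ i * gradx_part \<phi> z $ i \<partial>lborel)" for s :: real
  have Cc: "\<bar>C s - c\<bar> \<le> e / 2 + S * r" if s: "s \<in> {0..h}" for s
  proof -
   have Hs: "L2 (\<lambda>z. H (z - (s, 0)) $ i)" for i by (rule L2_shift_minus[OF H])
   have "\<bar>(LBINT z. H (z - (s, 0)) $ i * gradx_part \<phi> z $ i) - (LBINT z. H z $ i * G z $ i)\<bar>
     \<le> sqrt (N2 (\<lambda>z. H z $ i)) * r + b * sqrt (N2 (\<lambda>z. G z $ i))" for i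
   proof -
    have "(LBINT z. H (z - (s, 0)) $ i * gradx_part \<phi> z $ i) - (LBINT z. H z $ i * G z $ i)
     = (LBINT z. H (z - (s, 0)) $ i * gradx_part \<phi> z $ i - H z $ i * G z $ i)"
     by (rule Bochner_Integration.integral_diff[symmetric]) (intro L2_prod_integrable Hs Ld H LG)+
    also have "\<dots> = (LBINT z. H (z - (s, 0)) $ i * (gradx_part \<phi> z $ i - G z $ i) + (H (z - (s, 0)) $ i - H z $ i) * G z $ i)"
     by (simp add: algebra_simps)
    also have "\<dots> = (LBINT z. H (z - (s, 0)) $ i * (gradx_part \<phi> z $ i - G z $ i)) + (LBINT z. (H (z - (s, 0)) $ i - H z $ i) * G z $ i)"
     by (rule Bochner_Integration.integral_add) (intro L2_prod_integrable L2_diff Hs Ld H LG)+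
    finally have eq: "(LBINT z. H (z - (s, 0)) $ i * gradx_part \<phi> z $ i) - (LBINT z. H z $ i * G z $ i) = \<dots>" .
    have "\<bar>\<integral>z. H (z - (s, 0)) $ i * (gradx_part \<phi> z $ i - G z $ i) \<partial>lborel\<bar>
     \<le> sqrt (N2 (\<lambda>z. H (z - (s, 0)) $ i)) * sqrt (N2 (\<lambda>z. gradx_part \<phi> z $ i - G z $ i))"
     by (intro L2_Cauchy_Schwarz Hs L2_diff Ld LG)
    also have "\<dots> \<le> sqrt (N2 (\<lambda>z. H z $ i)) * r"
    proof (intro mult_mono)
     show "sqrt (N2 (\<lambda>z. H (z - (s, 0)) $ i)) \<le> sqrt (N2 (\<lambda>z. H z $ i))"
      using N2_shift_minus[of "\<lambda>z. H z $ i" "(s, 0)"] by simp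
     show "sqrt (N2 (\<lambda>z. gradx_part \<phi> z $ i - G z $ i)) \<le> r"
      using \<phi>(3)[of i] r by (intro real_le_lsqrt) auto
    qed auto
    finally have 1: "\<bar>\<integral>z. H (z - (s, 0)) $ i * (gradx_part \<phi> z $ i - G z $ i) \<partial>lborel\<bar> \<le> sqrt (N2 (\<lambda>z. H z $ i)) * r" .
    have "\<bar>\<integral>z. (H (z - (s, 0)) $ i - H z $ i) * G z $ i \<partial>lborel\<bar>
     \<le> sqrt (N2 (\<lambda>z. H (z - (s, 0)) $ i - H z $ i)) * sqrt (N2 (\<lambda>z. G z $ i))"
     by (intro L2_Cauchy_Schwarz Hs L2_diff H LG)
    also have "\<dots> \<le> b * sqrt (N2 (\<lambda>z. G z $ i))"
    proof (intro mult_right_mono real_le_lsqrt)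
     have "norm (- (s, 0 :: real^3)) < d i" using s h h0(2)[of i] by (simp add: norm_Pair)
     from d(2)[OF this] show "N2 (\<lambda>z. H (z - (s, 0)) $ i - H z $ i) \<le> b\<^sup>2"
      by (simp only: diff_conv_add_uminus less_imp_le)
    qed (use b in auto)
    finally show ?thesis unfolding eq using 1 by linarith
   qed
   then have "\<bar>C s - c\<bar> \<le> (\<Sum>i\<in>UNIV. sqrt (N2 (\<lambda>z. H z $ i)) * r + b * sqrt (N2 (\<lambda>z. G z $ i)))"
    unfolding C_def c_def sum_subtractf[symmetric] by (intro order_trans[OF sum_abs] sum_mono)
   also have "\<dots> = S * r + b * (B - 1)" by (simp add: S_def B_def sum.distrib sum_distrib_right sum_distrib_left)
   also have "\<dots> \<le> S * r + e / 2"
   proof -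
    have "b * (B - 1) \<le> b * B" using b by simp
    also have "b * B = e / 2" using B by (simp add: b_def)
    finally show ?thesis by simp
   qed
   finally show ?thesis by simp
  qed
  have ii: "integrable lborel (\<lambda>s. indicator {0..h} s :: real)" by (simp add: integrable_indicator_iff emeasure_Icc_finite)
  have iC: "integrable lborel (\<lambda>s. indicator {0..h} s * C s)"
  proof -
   have "integrable lborel (\<lambda>s. indicator {0..h} s * (LBINT z. H (z - (s, 0)) $ i * gradx_part \<phi> z $ i))" for i
   proof -
    have sh: "(LBINT z. H z $ i * gradx_part \<phi> (z + (s, 0)) $ i) = (LBINT z. H (z - (s, 0)) $ i * gradx_part \<phi> z $ i)" for s
     using lborel_shift_integral[of "\<lambda>z. H (z - (s, 0)) $ i * gradx_part \<phi> z $ i" "(s, 0)"] by simp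
    show ?thesis using steklov_swap(2)[OF Ld[of i] H[of i], of h] unfolding sh .
   qed
   then show ?thesis unfolding C_def sum_distrib_left by (intro Bochner_Integration.integrable_sum)
  qed
  have "(LBINT z. ?v z * \<phi> z) + h * c = - (LBINT s. indicator {0..h} s * C s) + (LBINT s. indicator {0..h} s * c)"
   unfolding difference_equation[OF ev \<phi>(1) conjunct1[OF h]] C_def using h by simp
  also have "\<dots> = (LBINT s. indicator {0..h} s * (c - C s))"
   using iC ii by (simp add: right_diff_distrib)
  also have "\<dots> \<le> (LBINT s. indicator {0..h} s * (e / 2 + S * r))"
  proof (rule integral_mono)
   show "integrable lborel (\<lambda>s. indicator {0..h} s * (c - C s))" using iC ii by (simp add: right_diff_distrib)
   show "indicator {0..h} s * (c - C s) \<le> indicator {0..h} s * (e / 2 + S * r)" for s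
    using Cc[of s] by (cases "s \<in> {0..h}") (auto simp: abs_le_iff)
  qed (use ii in simp)
  also have "\<dots> = h * (e / 2 + S * r)" using h by simp
  finally have 1: "(LBINT z. ?v z * \<phi> z) + h * c \<le> h * (e / 2 + S * r)" .
  have "(LBINT z. ?v z * F z) - (LBINT z. ?v z * \<phi> z) = - (LBINT z. ?v z * (\<phi> z - F z))"
   using L2_prod_integrable[OF Lv LF] L2_prod_integrable[OF Lv Lf] by (simp add: right_diff_distrib)
  also have "\<dots> \<le> sqrt (N2 ?v) * sqrt (N2 (\<lambda>z. \<phi> z - F z))"
   using L2_Cauchy_Schwarz[OF Lv L2_diff[OF Lf LF]] by (simp add: abs_le_iff)
  also have "\<dots> \<le> sqrt (N2 ?v) * r"
   using \<phi>(2) r by (intro mult_left_mono real_le_lsqrt) auto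
  finally have "(LBINT z. ?v z * F z) + h * c \<le> h * (e / 2) + r * (sqrt (N2 ?v) + h * S)"
   using 1 by (simp add: algebra_simps)
  also have "\<dots> \<le> h * (e / 2) + r * R" using r by (simp add: R_def)
  also have "r * R = e * h / 2" using R by (simp add: r_def)
  finally show "(LBINT z. ?v z * F z) + h * (\<Sum>i\<in>UNIV. \<integral>z. H z $ i * G z $ i \<partial>lborel) \<le> e * h"
   unfolding c_def by (simp add: algebra_simps)
 qed
qed


lemma linear_limit_le:
 fixes a b c :: real
 assumes h0: "h0 > 0" and le: "\<And>h. 0 < h \<Longrightarrow> h < h0 \<Longrightarrow> a + b * h \<le> c"
 shows "a \<le> c"
proof (rule tendsto_upperbound[where F = "at_right 0"])
 show "((\<lambda>h. a + b * h) \<longlongrightarrow> a) (at_right 0)" by (auto intro!: tendsto_eq_intros)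
 show "\<forall>\<^sub>F h in at_right 0. a + b * h \<le> c"
  using le h0 by (auto simp: eventually_at_right_field)
qed simp

text \<open>The linear term yields the dissipation; the quadratic remainder disappears after
  division by the time step and passage to the limit.\<close>

lemma exp_minus_bound:
 fixes x :: real assumes "x \<ge> 0" shows "1 - exp (- x) \<ge> x - x\<^sup>2 / 2"
proof -
 have "exp (- x) \<le> 1 - x + x\<^sup>2 / 2"
 proof -
  let ?f = "\<lambda>x::real. 1 - x + x\<^sup>2 / 2 - exp (- x)"
  have "?f 0 \<le> ?f x"
  proof (rule DERIV_nonneg_imp_nondecreasing[OF assms])
   fix y :: real assume "0 \<le> y" "y \<le> x"
   have "(?f has_real_derivative (- 1 + y + exp (- y))) (at y)"
    by (auto intro!: derivative_eq_intros)
   moreover have "- 1 + y + exp (- y) \<ge> 0" using exp_ge_add_one_self[of "- y"] by simp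
   ultimately show "\<exists>d. (?f has_real_derivative d) (at y) \<and> 0 \<le> d" by blast
  qed
  then show ?thesis by simp
 qed
 then show ?thesis by simp
qed

text \<open>Tested with K w, the difference term dominates half the difference of squares, and
  shifting the older square by h gains exp (-2 m h) from the decay of K. The strip near T that the
  shift leaves uncompensated is bounded below through WT, and the strip [0, h] carries W0. Division
  by h and h \<rightarrow> 0 give the claim; k0 / 4 instead of k0 / 2 is the price for replacing w
  by WT near T.\<close>

theorem energy_inequality:
 assumes ev: "weak_evol \<Omega> T w g H W0 WT" and lip: "lipschitz_domain \<Omega>" and T: "T > 0"
  and K: "C1 K" "\<And>z. K z \<ge> 0" and m: "m \<ge> 0"
  and decay: "\<And>t x h. h \<ge> 0 \<Longrightarrow> K (t + h, x) \<le> exp (- (2 * m * h)) * K (t, x)"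
  and \<delta>: "\<delta> > 0" and k0: "k0 \<ge> 0" "\<And>t x. T - \<delta> < t \<Longrightarrow> t < T \<Longrightarrow> x \<in> \<Omega> \<Longrightarrow> k0 \<le> K (t, x)"
  and k1: "\<And>t x. 0 \<le> t \<Longrightarrow> t \<le> \<delta> \<Longrightarrow> x \<in> \<Omega> \<Longrightarrow> K (t, x) \<le> k1"
 shows "k0 / 4 * N2 WT + m * (LBINT z. K z * (w z)\<^sup>2)
   + (\<Sum>i\<in>UNIV. \<integral>z. H z $ i * (K z *\<^sub>R g z + w z *\<^sub>R gradx_part K z) $ i \<partial>lborel) \<le> k1 / 2 * N2 W0"
proof -
 have wg: "wgrad_on ({0<..<T} \<times> UNIV) w g" and W0: "L2 W0" and WT: "L2 WT"
  and supp: "\<And>z. z \<notin> {0<..<T} \<times> \<Omega> \<Longrightarrow> w z = 0 \<and> g z = 0"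
  and suppH: "\<And>z. z \<notin> {0<..<T} \<times> \<Omega> \<Longrightarrow> H z = 0"
  and supp0: "\<And>x. x \<notin> \<Omega> \<Longrightarrow> W0 x = 0 \<and> WT x = 0"
  and trm: "\<And>e. e > 0 \<Longrightarrow> \<exists>h0>0. \<forall>h. 0 < h \<and> h < h0 \<longrightarrow>
   (LBINT z. indicator {T-h<..<T} (fst z) * (w z - WT (snd z))\<^sup>2) \<le> e * h"
  using ev unfolding weak_evol_def by blast+
 note w = wgrad_onD(1)[OF wg]
 have bnd: "bounded \<Omega>" using lip by (simp add: lipschitz_domain_def)
 have "bounded ({-1..T+1} \<times> \<Omega>)" by (intro bounded_Times bnd) auto
 then obtain \<rho> where \<rho>0: "\<forall>z\<in>{-1..T+1} \<times> \<Omega>. norm z \<le> \<rho>" unfolding bounded_iff by blast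
 have \<rho>: "z \<notin> {-1..T+1} \<times> \<Omega>" if "z \<notin> cball 0 \<rho>" for z using that \<rho>0 by auto
 have cK: "continuous_on UNIV K" by (rule C1_continuous[OF K(1)])
 have [measurable]: "K \<in> borel_measurable borel" by (rule borel_measurable_continuous_onI[OF cK])
 note [measurable] = L2_measurable[OF w] L2_measurable[OF W0] L2_measurable[OF WT]
 let ?F = "\<lambda>z. K z * w z" and ?G = "\<lambda>z. K z *\<^sub>R g z + w z *\<^sub>R gradx_part K z"
 note ap = approximable_multiplier[OF lip T wg supp K(1)]
 define A where "A = (LBINT z. K z * (w z)\<^sup>2)"
 define c where "c = (\<Sum>i\<in>UNIV. \<integral>z. H z $ i * ?G z $ i \<partial>lborel)"
 have LKw: "L2 ?F" by (rule ap(2))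
 have iKw: "integrable lborel (\<lambda>z. K z * (w z)\<^sup>2)"
  using L2_prod_integrable[OF LKw w] by (simp add: power2_eq_square mult.assoc)
 have main: "k0 / 4 * N2 WT + m * A + c \<le> k1 / 2 * N2 W0 + e * (1 + k0 / 2)" if e: "e > 0" for e
 proof -
  obtain h1 where h1: "h1 > 0" "\<And>h. 0 < h \<Longrightarrow> h < h1 \<Longrightarrow>
   (LBINT z. (w z - (w (z - (h, 0)) + indicator {0..h} (fst z) * W0 (snd z))) * ?F z) + h * c \<le> e * h"
   using difference_quotient_limit[OF ev ap(1) LKw ap(3) e] unfolding c_def by blast
  obtain h2 where h2: "h2 > 0" "\<And>h. 0 < h \<Longrightarrow> h < h2 \<Longrightarrow>
   (LBINT z. indicator {T-h<..<T} (fst z) * (w z - WT (snd z))\<^sup>2) \<le> e * h" using trm[OF e] by blast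
  \<comment> \<open>The last entry keeps 1 - 2 m h nonnegative, which is needed when the lower bound
    for A2 is multiplied by it.\<close>
  define h3 where "h3 = Min {h1, h2, \<delta>, T, 1, 1 / (2 * m + 1)}"
  \<comment> \<open>Sorted into a constant and a multiple of h, so that
    \<open>linear_limit_le\<close> can remove the latter; e stays fixed until h has gone to
    0.\<close>
  have main1: "(1/2) * (2 * m * A + k0 * (N2 WT / 2 - e) - k1 * N2 W0) + c
    + (- (m\<^sup>2 * A) - m * (k0 * (N2 WT / 2 - e))) * h \<le> e" if h: "0 < h" "h < h3" for h
  proof -
   have hh: "h < h1" "h < h2" "h < \<delta>" "h < T" "h < 1" "h < 1 / (2 * m + 1)" using h(2) by (auto simp: h3_def)
   have mh: "2 * m * h \<le> 1" using hh(6) m h(1) by (simp add: field_simps)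
   let ?p = "\<lambda>z. w (z - (h, 0))" and ?q = "\<lambda>z. indicator {0..h} (fst z) * W0 (snd z)"
   let ?I = "\<lambda>z. indicator {0<..<T} (fst z) :: real"
   have Lp: "L2 ?p" by (rule L2_shift_minus[OF w])
   have Lq: "L2 ?q" and Nq: "N2 ?q = h * N2 W0"
    using L2_tensor[OF _ emeasure_Icc_finite(1) W0, of 0 h] h by auto
   have sp: "?p z = 0" "?q z = 0" if "z \<notin> cball 0 \<rho>" for z
   proof -
    have z: "z \<notin> {-1..T+1} \<times> \<Omega>" using \<rho>[OF that] .
    have "z - (h, 0) \<notin> {0<..<T} \<times> \<Omega>" using z h hh by (cases z) auto
    then show "?p z = 0" using supp by blast
    show "?q z = 0" using z supp0 h hh by (cases z) (auto simp: indicator_def)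
   qed
   have LKp: "L2 (\<lambda>z. K z * ?p z)" by (rule L2_mult_continuous[OF Lp sp(1) cK])
   have LKq: "L2 (\<lambda>z. K z * ?q z)" by (rule L2_mult_continuous[OF Lq sp(2) cK])
   have iKp: "integrable lborel (\<lambda>z. K z * (?p z)\<^sup>2)"
    using L2_prod_integrable[OF LKp Lp] by (simp add: power2_eq_square mult.assoc)
   have iKq: "integrable lborel (\<lambda>z. K z * (?q z)\<^sup>2)"
    using L2_prod_integrable[OF LKq Lq] by (simp add: power2_eq_square mult.assoc)
   have ind: "integrable lborel (\<lambda>z. indicator S (fst z) * f z)" if "integrable lborel f" "S \<in> sets borel" for f :: "real \<times> (real^3) \<Rightarrow> real" and S
   proof (rule Bochner_Integration.integrable_bound[OF that(1)])
    have [measurable]: "f \<in> borel_measurable borel" "S \<in> sets borel" using that by auto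
    show "(\<lambda>z. indicator S (fst z) * f z) \<in> borel_measurable lborel"
     by measurable
   qed (auto simp: indicator_def)
   define A2 where "A2 = (LBINT z. indicator {T-h..} (fst z) * (K z * (w z)\<^sup>2))"
   have A1: "(LBINT z. indicator {..<T-h} (fst z) * (K z * (w z)\<^sup>2)) = A - A2"
   proof -
    have "A = (LBINT z. indicator {..<T-h} (fst z) * (K z * (w z)\<^sup>2) + indicator {T-h..} (fst z) * (K z * (w z)\<^sup>2))"
     unfolding A_def by (intro Bochner_Integration.integral_cong) (auto simp: indicator_def)
    also have "\<dots> = (LBINT z. indicator {..<T-h} (fst z) * (K z * (w z)\<^sup>2)) + A2"
     unfolding A2_def by (rule Bochner_Integration.integral_add) (intro ind iKw; simp)+
    finally show ?thesis by simp
   qed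
   have lower: "(1/2) * (?I z * (K z * (w z)\<^sup>2) - ?I z * (K z * (?p z)\<^sup>2) - ?I z * (K z * (?q z)\<^sup>2)) \<le> (w z - (?p z + ?q z)) * ?F z" for z
   proof (cases "fst z \<in> {0<..<T}")
    case True
    \<comment> \<open>The shifted solution vanishes up to time h and the initial strip ends at h, so
      the square of their sum has no mixed term.\<close>
    have dis: "?p z * ?q z = 0"
    proof (cases "fst z \<le> h")
     case True
     then have "z - (h, 0) \<notin> {0<..<T} \<times> \<Omega>" by (cases z) auto
     then show ?thesis using supp by simp
    qed (simp add: indicator_def)
    have "(?p z + ?q z)\<^sup>2 = (?p z)\<^sup>2 + (?q z)\<^sup>2" using dis by (simp add: power2_sum)
    moreover have "(a - b) * a \<ge> (a\<^sup>2 - b\<^sup>2) / 2" for a b :: real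
     using zero_le_power2[of "a - b"] by (simp add: power2_eq_square field_simps)
    ultimately have "((w z)\<^sup>2 - ((?p z)\<^sup>2 + (?q z)\<^sup>2)) / 2 \<le> (w z - (?p z + ?q z)) * w z" by metis
    then have "K z * (((w z)\<^sup>2 - ((?p z)\<^sup>2 + (?q z)\<^sup>2)) / 2) \<le> K z * ((w z - (?p z + ?q z)) * w z)"
     using K(2) by (rule mult_left_mono)
    then show ?thesis using True by (simp add: field_simps)
   next
    case False
    then have "w z = 0" using supp[of z] by (cases z) auto
    then show ?thesis using False by simp
   qed
   have "(1/2) * ((LBINT z. ?I z * (K z * (w z)\<^sup>2)) - (LBINT z. ?I z * (K z * (?p z)\<^sup>2)) - (LBINT z. ?I z * (K z * (?q z)\<^sup>2)))
     = (LBINT z. (1/2) * (?I z * (K z * (w z)\<^sup>2) - ?I z * (K z * (?p z)\<^sup>2) - ?I z * (K z * (?q z)\<^sup>2)))"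
    using ind[OF iKw, of "{0<..<T}"] ind[OF iKp, of "{0<..<T}"] ind[OF iKq, of "{0<..<T}"] by simp
   also have "\<dots> \<le> (LBINT z. (w z - (?p z + ?q z)) * ?F z)"
   proof (rule integral_mono[OF _ _ lower])
    show "integrable lborel (\<lambda>z. (1/2) * (?I z * (K z * (w z)\<^sup>2) - ?I z * (K z * (?p z)\<^sup>2) - ?I z * (K z * (?q z)\<^sup>2)))"
     using ind[OF iKw, of "{0<..<T}"] ind[OF iKp, of "{0<..<T}"] ind[OF iKq, of "{0<..<T}"] by simp
    show "integrable lborel (\<lambda>z. (w z - (?p z + ?q z)) * ?F z)"
     by (rule L2_prod_integrable[OF L2_diff[OF w L2_add[OF Lp Lq]] LKw])
   qed
   also have "\<dots> \<le> e * h - h * c" using h1(2)[OF h(1) hh(1)] by simp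
   finally have E1: "(1/2) * ((LBINT z. ?I z * (K z * (w z)\<^sup>2)) - (LBINT z. ?I z * (K z * (?p z)\<^sup>2)) - (LBINT z. ?I z * (K z * (?q z)\<^sup>2))) \<le> e * h - h * c" .
   have EA: "(LBINT z. ?I z * (K z * (w z)\<^sup>2)) = A" unfolding A_def
   proof (intro Bochner_Integration.integral_cong refl)
    show "?I z * (K z * (w z)\<^sup>2) = K z * (w z)\<^sup>2" for z using supp[of z] by (cases z) (auto simp: indicator_def)
   qed
   have EB: "(LBINT z. ?I z * (K z * (?p z)\<^sup>2)) \<le> exp (- (2 * m * h)) * (A - A2)"
   proof -
    have "(LBINT z. ?I z * (K z * (?p z)\<^sup>2)) = (LBINT z. ?I (z + (h, 0)) * (K (z + (h, 0)) * (w z)\<^sup>2))"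
     using lborel_shift_integral[of "\<lambda>z. ?I z * (K z * (?p z)\<^sup>2)" "(h, 0)"] by simp
    also have "\<dots> \<le> (LBINT z. exp (- (2 * m * h)) * (indicator {..<T-h} (fst z) * (K z * (w z)\<^sup>2)))"
    proof (rule integral_mono)
     show "integrable lborel (\<lambda>z. ?I (z + (h, 0)) * (K (z + (h, 0)) * (w z)\<^sup>2))"
      using lborel_shift_integrable[OF ind[OF iKp, of "{0<..<T}"], of "(h, 0)"] by simp
     show "integrable lborel (\<lambda>z. exp (- (2 * m * h)) * (indicator {..<T-h} (fst z) * (K z * (w z)\<^sup>2)))"
      using ind[OF iKw, of "{..<T-h}"] by simp
     fix z :: "real \<times> (real^3)"
     have i1: "K (z + (h, 0)) * (w z)\<^sup>2 \<le> (exp (- (2 * m * h)) * K z) * (w z)\<^sup>2"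
      using decay[of h "fst z" "snd z"] h by (intro mult_right_mono) (cases z, auto)
     have i2: "?I (z + (h, 0)) \<le> indicator {..<T-h} (fst z)" by (simp add: indicator_def)
     have i3: "0 \<le> K (z + (h, 0)) * (w z)\<^sup>2" by (intro mult_nonneg_nonneg K) simp
     have "?I (z + (h, 0)) * (K (z + (h, 0)) * (w z)\<^sup>2) \<le> indicator {..<T-h} (fst z) * ((exp (- (2 * m * h)) * K z) * (w z)\<^sup>2)"
      by (rule mult_mono[OF i2 i1 _ i3]) simp
     then show "?I (z + (h, 0)) * (K (z + (h, 0)) * (w z)\<^sup>2) \<le> exp (- (2 * m * h)) * (indicator {..<T-h} (fst z) * (K z * (w z)\<^sup>2))"
      by (simp add: mult_ac)
    qed
    also have "\<dots> = exp (- (2 * m * h)) * (A - A2)" using A1 by simp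
    finally show ?thesis .
   qed
   have EC: "(LBINT z. ?I z * (K z * (?q z)\<^sup>2)) \<le> k1 * (h * N2 W0)"
   proof -
    have "(LBINT z. ?I z * (K z * (?q z)\<^sup>2)) \<le> (LBINT z. k1 * (?q z)\<^sup>2)"
    proof (rule integral_mono)
     show "integrable lborel (\<lambda>z. ?I z * (K z * (?q z)\<^sup>2))" by (rule ind[OF iKq]) simp
     show "integrable lborel (\<lambda>z. k1 * (?q z)\<^sup>2)" using L2_integrable_sq[OF Lq] by simp
     show "?I z * (K z * (?q z)\<^sup>2) \<le> k1 * (?q z)\<^sup>2" for z
     proof (cases "?q z = 0")
      case False
      then have z: "0 \<le> fst z" "fst z \<le> h" "snd z \<in> \<Omega>" using supp0 by (auto simp: indicator_def split: if_splits)
      then have "K z \<le> k1" using k1[of "fst z" "snd z"] hh by simp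
      then have "K z * (?q z)\<^sup>2 \<le> k1 * (?q z)\<^sup>2" by (rule mult_right_mono) simp
      moreover have "?I z * (K z * (?q z)\<^sup>2) \<le> K z * (?q z)\<^sup>2" using K(2)[of z] by (simp add: indicator_def)
      ultimately show ?thesis by linarith
     next
      case True
      show ?thesis unfolding True by simp
     qed
    qed
    also have "\<dots> = k1 * (h * N2 W0)" using Nq by (simp add: N2_def)
    finally show ?thesis .
   qed
   have A2: "A2 \<ge> k0 * (h * (N2 WT / 2 - e))" and A20: "A2 \<ge> 0"
   proof -
    let ?J = "\<lambda>z. indicator {T-h<..<T} (fst z) :: real"
    have LT: "L2 (\<lambda>z. ?J z * WT (snd z))" and NT: "N2 (\<lambda>z. ?J z * WT (snd z)) = h * N2 WT"
     using L2_tensor[OF _ emeasure_Icc_finite(3) WT, of "T-h" T] h by auto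
    have Jsq: "(?J z * r)\<^sup>2 = ?J z * r\<^sup>2" for z r by (simp add: indicator_def)
    have Lw: "L2 (\<lambda>z. ?J z * w z)"
     by (rule L2_bound(1)[OF _ w, of _ 1]) (measurable, auto simp: indicator_def)
    have iw: "integrable lborel (\<lambda>z. ?J z * (w z)\<^sup>2)" using L2_integrable_sq[OF Lw] by (simp add: Jsq)
    have iT: "integrable lborel (\<lambda>z. ?J z * (WT (snd z))\<^sup>2)" using L2_integrable_sq[OF LT] by (simp add: Jsq)
    have id: "integrable lborel (\<lambda>z. ?J z * (w z - WT (snd z))\<^sup>2)"
     using L2_integrable_sq[OF L2_diff[OF Lw LT]] by (simp add: Jsq right_diff_distrib[symmetric])
    have "k0 * (h * (N2 WT / 2 - e)) \<le> k0 * ((LBINT z. ?J z * (WT (snd z))\<^sup>2) / 2 - (LBINT z. ?J z * (w z - WT (snd z))\<^sup>2))"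
    proof (rule mult_left_mono[OF _ k0(1)])
     have "(LBINT z. ?J z * (WT (snd z))\<^sup>2) = h * N2 WT" using NT by (simp add: N2_def Jsq)
     then show "h * (N2 WT / 2 - e) \<le> (LBINT z. ?J z * (WT (snd z))\<^sup>2) / 2 - (LBINT z. ?J z * (w z - WT (snd z))\<^sup>2)"
      using h2(2)[OF h(1) hh(2)] by (simp add: algebra_simps)
    qed
    also have "\<dots> = (LBINT z. k0 * ((?J z * (WT (snd z))\<^sup>2) / 2 - ?J z * (w z - WT (snd z))\<^sup>2))"
     using iT id by simp
    also have "\<dots> \<le> A2" unfolding A2_def
    proof (rule integral_mono)
     show "integrable lborel (\<lambda>z. k0 * ((?J z * (WT (snd z))\<^sup>2) / 2 - ?J z * (w z - WT (snd z))\<^sup>2))" using iT id by simp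
     show "integrable lborel (\<lambda>z. indicator {T-h..} (fst z) * (K z * (w z)\<^sup>2))" by (rule ind[OF iKw]) simp
     fix z :: "real \<times> (real^3)"
     show "k0 * ((?J z * (WT (snd z))\<^sup>2) / 2 - ?J z * (w z - WT (snd z))\<^sup>2) \<le> indicator {T-h..} (fst z) * (K z * (w z)\<^sup>2)"
     proof (cases "fst z \<in> {T-h<..<T} \<and> snd z \<in> \<Omega>")
      case True
      \<comment> \<open>Here the factor 2 is lost: w is replaced by WT at the cost of their squared
        distance, which the terminal clause of \<open>weak_evol\<close> bounds by e h.\<close>
      have "a\<^sup>2 / 2 - (b - a)\<^sup>2 \<le> b\<^sup>2" for a b :: real
       using zero_le_power2[of "a - 2 * b"] by (simp add: power2_eq_square field_simps)
      then have "k0 * ((WT (snd z))\<^sup>2 / 2 - (w z - WT (snd z))\<^sup>2) \<le> k0 * (w z)\<^sup>2" using k0(1) by (intro mult_left_mono)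
      also have "\<dots> \<le> K z * (w z)\<^sup>2" using k0(2)[of "fst z" "snd z"] True hh by (intro mult_right_mono) auto
      finally show ?thesis using True by simp
     next
      case False
      then have "fst z \<notin> {T-h<..<T} \<or> (w z = 0 \<and> WT (snd z) = 0)" using supp[of z] supp0[of "snd z"] by (cases z) auto
      then have "k0 * ((?J z * (WT (snd z))\<^sup>2) / 2 - ?J z * (w z - WT (snd z))\<^sup>2) = 0" by auto
      moreover have "0 \<le> indicator {T-h..} (fst z) * (K z * (w z)\<^sup>2)" by (intro mult_nonneg_nonneg K) auto
      ultimately show ?thesis by linarith
     qed
    qed
    finally show "A2 \<ge> k0 * (h * (N2 WT / 2 - e))" .
    show "A2 \<ge> 0" unfolding A2_def using K(2) by (intro integral_nonneg_AE) simp
   qed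
   have A0: "A \<ge> 0" unfolding A_def using K(2) by (intro integral_nonneg_AE) simp
   have "(1/2) * (A - exp (- (2 * m * h)) * (A - A2) - k1 * (h * N2 W0)) \<le> e * h - h * c"
   proof -
    have gen: "(1/2) * (a - b - d) \<le> r \<Longrightarrow> a = a' \<Longrightarrow> b \<le> b' \<Longrightarrow> d \<le> d' \<Longrightarrow> (1/2) * (a' - b' - d') \<le> r" for a b d a' b' d' r :: real
     by (simp add: field_simps)
    show ?thesis by (rule gen[OF E1 EA EB EC])
   qed
   moreover have "A - exp (- (2 * m * h)) * (A - A2) = (1 - exp (- (2 * m * h))) * A + exp (- (2 * m * h)) * A2" by (simp add: algebra_simps)
   moreover have "(2 * m * h - 2 * m\<^sup>2 * h\<^sup>2) * A \<le> (1 - exp (- (2 * m * h))) * A"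
    using exp_minus_bound[of "2 * m * h"] m h A0 by (intro mult_right_mono) (auto simp: power_mult_distrib mult.commute)
   moreover have "(1 - 2 * m * h) * (k0 * (h * (N2 WT / 2 - e))) \<le> exp (- (2 * m * h)) * A2"
   proof -
    have "(1 - 2 * m * h) * (k0 * (h * (N2 WT / 2 - e))) \<le> (1 - 2 * m * h) * A2" using mh A2 by (intro mult_left_mono) auto
    also have "\<dots> \<le> exp (- (2 * m * h)) * A2" using exp_ge_add_one_self[of "- (2 * m * h)"] A20 by (intro mult_right_mono) auto
    finally show ?thesis .
   qed
   ultimately have "(1/2) * ((2 * m * h - 2 * m\<^sup>2 * h\<^sup>2) * A + (1 - 2 * m * h) * (k0 * (h * (N2 WT / 2 - e))) - k1 * (h * N2 W0)) \<le> e * h - h * c"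
   proof -
    have gen: "(1/2) * (l - k) \<le> r \<Longrightarrow> l = p + q \<Longrightarrow> p' \<le> p \<Longrightarrow> q' \<le> q \<Longrightarrow> (1/2) * (p' + q' - k) \<le> r" for l k r p q p' q' :: real
     by (simp add: field_simps)
    show "(1/2) * (A - exp (- (2 * m * h)) * (A - A2) - k1 * (h * N2 W0)) \<le> e * h - h * c \<Longrightarrow>
     A - exp (- (2 * m * h)) * (A - A2) = (1 - exp (- (2 * m * h))) * A + exp (- (2 * m * h)) * A2 \<Longrightarrow>
     (2 * m * h - 2 * m\<^sup>2 * h\<^sup>2) * A \<le> (1 - exp (- (2 * m * h))) * A \<Longrightarrow>
     (1 - 2 * m * h) * (k0 * (h * (N2 WT / 2 - e))) \<le> exp (- (2 * m * h)) * A2 \<Longrightarrow> ?thesis" by (rule gen)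
   qed
   then have "h * ((1/2) * (2 * m * A + k0 * (N2 WT / 2 - e) - k1 * N2 W0) + c
    + (- (m\<^sup>2 * A) - m * (k0 * (N2 WT / 2 - e))) * h) \<le> h * e"
    by (simp add: field_simps power2_eq_square)
   then show ?thesis using h(1) by simp
  qed
  have h3: "h3 > 0" using h1(1) h2(1) \<delta> T m by (auto simp: h3_def)
  have "(1/2) * (2 * m * A + k0 * (N2 WT / 2 - e) - k1 * N2 W0) + c \<le> e" by (rule linear_limit_le[OF h3 main1])
  then show ?thesis by (simp add: field_simps)
 qed
 have "k0 / 4 * N2 WT + m * A + c \<le> k1 / 2 * N2 W0"
 proof (rule field_le_epsilon)
  fix r :: real assume r: "r > 0"
  have k: "1 + k0 / 2 > 0" using k0 by simp
  have "k0 / 4 * N2 WT + m * A + c \<le> k1 / 2 * N2 W0 + (r / (1 + k0 / 2)) * (1 + k0 / 2)"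
   using r k by (intro main) simp
  then show "k0 / 4 * N2 WT + m * A + c \<le> k1 / 2 * N2 W0 + r" using k by simp
 qed
 then show ?thesis unfolding A_def c_def .
qed

section \<open>Borel representatives of weak solutions\<close>

text \<open>A weak solution is given by Lebesgue measurable functions on S and by set integrals. A
  representative is Borel on the whole space and zero off S, so that it can be shifted, convolved
  and integrated against \<open>lborel\<close> freely.\<close>

definition rep :: "'a::euclidean_space set \<Rightarrow> ('a \<Rightarrow> real) \<Rightarrow> ('a \<Rightarrow> real) \<Rightarrow> bool" where
 "rep S f f' \<longleftrightarrow> S \<in> sets borel \<and> f' \<in> borel_measurable borel \<and> (\<forall>z. z \<notin> S \<longrightarrow> f' z = 0) \<and>
   (AE z in lborel. z \<in> S \<longrightarrow> f z = f' z)"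

lemma rep_exists:
 assumes S: "S \<in> sets borel" and f: "f \<in> borel_measurable (lebesgue_on S)"
 obtains f' where "rep S f f'"
proof -
 have SL: "S \<in> sets lebesgue" using S by simp
 have "(\<lambda>z. if z \<in> S then f z else 0) \<in> borel_measurable lebesgue"
  using f SL by (subst (asm) measurable_restrict_space_iff[where c = 0]) auto
 then obtain f1 where f1: "f1 \<in> borel_measurable lborel" "AE z in lborel. (if z \<in> S then f z else 0) = f1 z"
  using completion_ex_borel_measurable_real by blast
 have "rep S f (\<lambda>z. indicator S z * f1 z)" unfolding rep_def
 proof (intro conjI)
  show "(\<lambda>z. indicator S z * f1 z) \<in> borel_measurable borel" using S f1(1) by (auto intro!: borel_measurable_times)
  show "AE z in lborel. z \<in> S \<longrightarrow> f z = indicator S z * f1 z" using f1(2) by eventually_elim auto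
 qed (use S in auto)
 then show thesis by (rule that)
qed

lemma repD:
 assumes "rep S f f'"
 shows "S \<in> sets borel" "f' \<in> borel_measurable borel" "\<And>z. z \<notin> S \<Longrightarrow> f' z = 0" "AE z in lborel. z \<in> S \<longrightarrow> f z = f' z"
 using assms by (auto simp: rep_def)

lemma rep_map2:
 assumes "rep S f f'" "rep S g g'" "case_prod h \<in> borel_measurable (borel \<Otimes>\<^sub>M borel)" "h 0 0 = 0"
 shows "rep S (\<lambda>z. h (f z) (g z)) (\<lambda>z. h (f' z) (g' z))"
 unfolding rep_def
proof (intro conjI allI impI)
 show "S \<in> sets borel" using assms(1) by (rule repD)
 have "(\<lambda>z. case_prod h (f' z, g' z)) \<in> borel_measurable borel"
  by (rule measurable_compose[OF measurable_Pair[OF repD(2)[OF assms(1)] repD(2)[OF assms(2)]] assms(3)])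
 then show "(\<lambda>z. h (f' z) (g' z)) \<in> borel_measurable borel" by simp
 show "h (f' z) (g' z) = 0" if "z \<notin> S" for z using repD(3)[OF assms(1) that] repD(3)[OF assms(2) that] assms(4) by simp
 show "AE z in lborel. z \<in> S \<longrightarrow> h (f z) (g z) = h (f' z) (g' z)"
  using repD(4)[OF assms(1)] repD(4)[OF assms(2)] by eventually_elim auto
qed

lemma rep_mult: "rep S f f' \<Longrightarrow> rep S g g' \<Longrightarrow> rep S (\<lambda>z. f z * g z) (\<lambda>z. f' z * g' z)"
 by (rule rep_map2[of S f f' g g' "\<lambda>a b. a * b"]) (auto simp: split_beta')

lemma rep_add: "rep S f f' \<Longrightarrow> rep S g g' \<Longrightarrow> rep S (\<lambda>z. f z + g z) (\<lambda>z. f' z + g' z)"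
 by (rule rep_map2[of S f f' g g' "\<lambda>a b. a + b"]) (auto simp: split_beta')

lemma rep_diff: "rep S f f' \<Longrightarrow> rep S g g' \<Longrightarrow> rep S (\<lambda>z. f z - g z) (\<lambda>z. f' z - g' z)"
 by (rule rep_map2[of S f f' g g' "\<lambda>a b. a - b"]) (auto simp: split_beta')

lemma rep_sum:
 assumes "S \<in> sets borel" "finite I" "\<And>i. i \<in> I \<Longrightarrow> rep S (f i) (f' i)"
 shows "rep S (\<lambda>z. \<Sum>i\<in>I. f i z) (\<lambda>z. \<Sum>i\<in>I. f' i z)"
 using assms(2,3)
proof (induction I rule: finite_induct)
 case empty then show ?case using assms(1) by (simp add: rep_def)
next
 case (insert i I) then show ?case by (simp add: rep_add)
qed

lemma rep_power2: "rep S f f' \<Longrightarrow> rep S (\<lambda>z. (f z)\<^sup>2) (\<lambda>z. (f' z)\<^sup>2)"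
 unfolding power2_eq_square by (rule rep_mult)

lemma rep_mult_borel:
 assumes "rep S f f'" "p \<in> borel_measurable borel" shows "rep S (\<lambda>z. f z * p z) (\<lambda>z. f' z * p z)"
 using assms unfolding rep_def by (auto intro!: borel_measurable_times elim!: eventually_mono)

lemma rep_AE_cong:
 assumes "rep S f f'" "AE z in lborel. z \<in> S \<longrightarrow> h z = f z" shows "rep S h f'"
 using assms unfolding rep_def by (auto elim: eventually_elim2)

lemma rep_set_integral:
 assumes r: "rep S q q'"
 shows "(LINT z:S|lebesgue. q z) = (LBINT z. q' z)" and "set_integrable lebesgue S q \<longleftrightarrow> integrable lborel q'"
proof -
 note rd = repD[OF r]
 have ql: "q' \<in> borel_measurable lebesgue" using rd(2) by (simp add: measurable_completion)
 have "AE z in lborel. indicator S z *\<^sub>R q z = q' z"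
  using rd(4) by eventually_elim (use rd(3) in \<open>auto simp: indicator_def\<close>)
 then have ae: "AE z in lebesgue. indicator S z *\<^sub>R q z = q' z" by (rule AE_completion)
 have m: "(\<lambda>z. indicator S z *\<^sub>R q z) \<in> borel_measurable lebesgue"
  by (rule borel_measurable_AE[OF ql]) (use ae in eventually_elim, simp)
 show "(LINT z:S|lebesgue. q z) = (LBINT z. q' z)"
  unfolding set_lebesgue_integral_def
  using integral_cong_AE[OF m ql ae] integral_completion[of q' lborel] rd(2) by simp
 show "set_integrable lebesgue S q \<longleftrightarrow> integrable lborel q'"
  unfolding set_integrable_def
  using integrable_cong_AE[OF m ql ae] integrable_completion[of q' lborel] rd(2) by simp
qed

definition repv :: "'a::euclidean_space set \<Rightarrow> ('a \<Rightarrow> real^3) \<Rightarrow> ('a \<Rightarrow> real^3) \<Rightarrow> bool" where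
 "repv S f f' \<longleftrightarrow> (\<forall>i. rep S (\<lambda>z. f z $ i) (\<lambda>z. f' z $ i))"

lemma repv_AE: "repv S f f' \<Longrightarrow> AE z in lborel. z \<in> S \<longrightarrow> f z = f' z"
proof -
 assume r: "repv S f f'"
 have "AE z in lborel. \<forall>i. z \<in> S \<longrightarrow> f z $ i = f' z $ i"
  using r by (intro eventually_all_finite) (auto simp: repv_def rep_def)
 then show ?thesis by eventually_elim (auto simp: vec_eq_iff)
qed

lemma repv_zero: "repv S f f' \<Longrightarrow> z \<notin> S \<Longrightarrow> f' z = 0"
 by (auto simp: repv_def rep_def vec_eq_iff)

lemma repv_exists:
 assumes S: "S \<in> sets borel" and f: "f \<in> borel_measurable (lebesgue_on S)"
 obtains f' where "repv S f f'"
proof -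
 have "\<exists>f'. rep S (\<lambda>z. f z $ i) f'" for i
 proof -
  have "(\<lambda>z. f z $ i) \<in> borel_measurable (lebesgue_on S)"
   by (rule measurable_compose[OF f]) (intro borel_measurable_continuous_onI continuous_intros)
  then show ?thesis using rep_exists[OF S] by metis
 qed
 then obtain f' where "\<And>i. rep S (\<lambda>z. f z $ i) (f' i)" by metis
 then have "repv S f (\<lambda>z. \<chi> i. f' i z)" by (simp add: repv_def)
 then show thesis by (rule that)
qed

lemma repv_inner_borel:
 assumes r: "repv S f f'" and p: "\<And>i. (\<lambda>z. p z $ i) \<in> borel_measurable borel"
 shows "rep S (\<lambda>z. f z \<bullet> p z) (\<lambda>z. f' z \<bullet> p z)"
 unfolding inner_vec_def inner_real_def
 by (rule rep_sum) (use r p in \<open>auto simp: repv_def intro: rep_mult_borel repD(1)\<close>)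

lemma repv_norm2:
 assumes r: "repv S f f'" shows "rep S (\<lambda>z. (norm (f z))\<^sup>2) (\<lambda>z. (norm (f' z))\<^sup>2)"
 unfolding power2_norm_eq_inner inner_vec_def inner_real_def
 by (rule rep_sum) (use r in \<open>auto simp: repv_def intro: rep_mult repD(1)\<close>)

lemma repv_L2:
 assumes r: "repv S f f'" and i: "set_integrable lebesgue S (\<lambda>z. (norm (f z))\<^sup>2)"
 shows "L2 (\<lambda>z. f' z $ i)"
 unfolding L2_def
proof (rule conjI)
 have n: "integrable lborel (\<lambda>z. (norm (f' z))\<^sup>2)" using i rep_set_integral(2)[OF repv_norm2[OF r]] by simp
 show m: "(\<lambda>z. f' z $ i) \<in> borel_measurable borel" using r by (auto simp: repv_def rep_def)
 show "integrable lborel (\<lambda>z. (f' z $ i)\<^sup>2)"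
 proof (rule Bochner_Integration.integrable_bound[OF n])
  show "(\<lambda>z. (f' z $ i)\<^sup>2) \<in> borel_measurable lborel" using m by simp
  have "(f' z $ i)\<^sup>2 \<le> (norm (f' z))\<^sup>2" for z using power_mono[OF component_le_norm_cart[of "f' z" i], of 2] by simp
  then show "AE z in lborel. norm ((f' z $ i)\<^sup>2) \<le> norm ((norm (f' z))\<^sup>2)" by (intro AE_I2) simp
 qed
qed

text \<open>The representative w agrees with W t only for almost every time t. Hence continuity of W
  at T as a map into L2 carries over not pointwise in time but in the mean over the last strip,
  which explains the terminal clause of \<open>weak_evol\<close>.\<close>

theorem weak_sol_weak_evol:
 assumes lip: "lipschitz_domain \<Omega>" and T: "T > 0" and ws: "weak_sol \<Omega> T \<gamma> F W0 W G"
  and \<gamma>: "rep ({0<..<T} \<times> \<Omega>) (\<lambda>z. \<gamma> (fst z) (snd z)) \<gamma>b" "\<And>z. \<bar>\<gamma>b z\<bar> \<le> M"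
  and F: "repv ({0<..<T} \<times> \<Omega>) (\<lambda>z. F (fst z) (snd z)) Fb" "\<And>i. L2 (\<lambda>z. Fb z $ i)"
 obtains w g W0b WT where "weak_evol \<Omega> T w g (\<lambda>z. \<gamma>b z *\<^sub>R g z + Fb z) W0b WT"
  "rep ({0<..<T} \<times> \<Omega>) (\<lambda>z. W (fst z) (snd z)) w" "repv ({0<..<T} \<times> \<Omega>) (\<lambda>z. G (fst z) (snd z)) g"
  "rep \<Omega> (W T) WT" "rep \<Omega> (W 0) W0b" "rep \<Omega> W0 W0b"
proof -
 let ?Q = "{0<..<T} \<times> \<Omega>"
 have oO: "open \<Omega>" using lip by (simp add: lipschitz_domain_def)
 have QB: "?Q \<in> sets borel" using oO by (intro borel_open open_Times) auto
 have OB: "\<Omega> \<in> sets borel" using oO by simp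
 note ws' = ws[unfolded weak_sol_def]
 have Wm: "(\<lambda>z. W (fst z) (snd z)) \<in> borel_measurable (lebesgue_on ?Q)" using ws' by (simp add: split_beta')
 have Gm: "(\<lambda>z. G (fst z) (snd z)) \<in> borel_measurable (lebesgue_on ?Q)" using ws' by (simp add: split_beta')
 have Wi: "set_integrable lebesgue ?Q (\<lambda>z. (W (fst z) (snd z))\<^sup>2)" using ws' by (simp add: split_beta')
 have Gi: "set_integrable lebesgue ?Q (\<lambda>z. (norm (G (fst z) (snd z)))\<^sup>2)" using ws' by (simp add: split_beta')
 have gr: "\<And>\<phi> i. C1c_on \<phi> ({0<..<T} \<times> UNIV) \<Longrightarrow> (LINT z:?Q|lebesgue. W (fst z) (snd z) * gradx_part \<phi> z $ i)
    = - (LINT z:?Q|lebesgue. G (fst z) (snd z) $ i * \<phi> z)" using ws' by blast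
 have sl: "\<And>t. t \<in> {0..T} \<Longrightarrow> W t \<in> borel_measurable (lebesgue_on \<Omega>)"
  "\<And>t. t \<in> {0..T} \<Longrightarrow> set_integrable lebesgue \<Omega> (\<lambda>x. (W t x)\<^sup>2)"
  "\<And>t. t \<in> {0..T} \<Longrightarrow> ((\<lambda>s. LINT x:\<Omega>|lebesgue. (W s x - W t x)\<^sup>2) \<longlongrightarrow> 0) (at t within {0..T})"
  using ws' by blast+
 have ini: "AE x in lebesgue. x \<in> \<Omega> \<longrightarrow> W 0 x = W0 x" using ws' by blast
 have weq: "\<And>\<phi>. C1c_on \<phi> ({..<T} \<times> \<Omega>) \<Longrightarrow> - (LINT z:?Q|lebesgue. W (fst z) (snd z) * dt_part \<phi> z)
    + (LINT z:?Q|lebesgue. \<gamma> (fst z) (snd z) * (G (fst z) (snd z) \<bullet> gradx_part \<phi> z))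
    - (LINT x:\<Omega>|lebesgue. W0 x * \<phi> (0, x)) = - (LINT z:?Q|lebesgue. F (fst z) (snd z) \<bullet> gradx_part \<phi> z)"
  using ws' by blast
 obtain w where w: "rep ?Q (\<lambda>z. W (fst z) (snd z)) w" using rep_exists[OF QB Wm] .
 obtain g where g: "repv ?Q (\<lambda>z. G (fst z) (snd z)) g" using repv_exists[OF QB Gm] .
 have T0: "0 \<in> {0..T}" "T \<in> {0..T}" using T by auto
 obtain W0b where W0b: "rep \<Omega> (W 0) W0b" using rep_exists[OF OB sl(1)[OF T0(1)]] .
 obtain WT where WT: "rep \<Omega> (W T) WT" using rep_exists[OF OB sl(1)[OF T0(2)]] .
 have W0r: "rep \<Omega> W0 W0b"
 proof (rule rep_AE_cong[OF W0b])
  show "AE z in lborel. z \<in> \<Omega> \<longrightarrow> W0 z = W 0 z"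
   using ini unfolding AE_completion_iff by eventually_elim auto
 qed
 have Lw: "L2 w" unfolding L2_def using repD(2)[OF w] rep_set_integral(2)[OF rep_power2[OF w]] Wi by simp
 have Lg: "L2 (\<lambda>z. g z $ i)" for i by (rule repv_L2[OF g Gi])
 have L0: "L2 W0b" unfolding L2_def using repD(2)[OF W0b] rep_set_integral(2)[OF rep_power2[OF W0b]] sl(2)[OF T0(1)] by simp
 have LT: "L2 WT" unfolding L2_def using repD(2)[OF WT] rep_set_integral(2)[OF rep_power2[OF WT]] sl(2)[OF T0(2)] by simp
 have L\<gamma>g: "L2 (\<lambda>z. \<gamma>b z * g z $ i)" for i
 proof (rule L2_bound(1)[OF _ Lg[of i], of _ M])
  show "(\<lambda>z. \<gamma>b z * g z $ i) \<in> borel_measurable borel" using repD(2)[OF \<gamma>(1)] Lg[of i] by (auto intro!: borel_measurable_times)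
  show "\<bar>\<gamma>b z * g z $ i\<bar> \<le> M * \<bar>g z $ i\<bar>" for z using \<gamma>(2)[of z] by (simp add: abs_mult mult_right_mono)
 qed
 have dm: "(\<lambda>z. frechet_derivative \<phi> (at z) v) \<in> borel_measurable borel" if "C1 \<phi>" for \<phi> :: "real \<times> (real^3) \<Rightarrow> real" and v
  by (rule borel_measurable_continuous_onI[OF C1_continuous_derivative[OF that]])
 have "weak_evol \<Omega> T w g (\<lambda>z. \<gamma>b z *\<^sub>R g z + Fb z) W0b WT"
  unfolding weak_evol_def
 proof (intro conjI allI impI)
  show "wgrad_on ({0<..<T} \<times> UNIV) w g" unfolding wgrad_on_def
  proof (intro conjI allI impI Lw Lg)
   fix \<phi> :: "real \<times> (real^3) \<Rightarrow> real" and i assume \<phi>: "C1c_on \<phi> ({0<..<T} \<times> UNIV)"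
   note c = C1c_on_C1[OF \<phi>]
   have 1: "rep ?Q (\<lambda>z. W (fst z) (snd z) * gradx_part \<phi> z $ i) (\<lambda>z. w z * gradx_part \<phi> z $ i)"
    unfolding gradx_part_nth by (rule rep_mult_borel[OF w dm[OF c]])
   have 2: "rep ?Q (\<lambda>z. G (fst z) (snd z) $ i * \<phi> z) (\<lambda>z. g z $ i * \<phi> z)"
    by (rule rep_mult_borel[OF _ borel_measurable_continuous_onI[OF C1_continuous[OF c]]]) (use g in \<open>auto simp: repv_def\<close>)
   show "(LBINT z. w z * gradx_part \<phi> z $ i) = - (LBINT z. g z $ i * \<phi> z)"
    using gr[OF \<phi>, of i] rep_set_integral(1)[OF 1] rep_set_integral(1)[OF 2] by simp
  qed
  show "L2 W0b" "L2 WT" by (rule L0, rule LT)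
  show "L2 (\<lambda>z. (\<gamma>b z *\<^sub>R g z + Fb z) $ i)" for i using L2_add[OF L\<gamma>g[of i] F(2)[of i]] by simp
  show "w z = 0" "g z = 0" "\<gamma>b z *\<^sub>R g z + Fb z = 0" if "z \<notin> ?Q" for z
   using repD(3)[OF w that] repv_zero[OF g that] repv_zero[OF F(1) that] by auto
  show "W0b x = 0" "WT x = 0" if "x \<notin> \<Omega>" for x using repD(3)[OF W0b that] repD(3)[OF WT that] by auto
  fix \<phi> :: "real \<times> (real^3) \<Rightarrow> real" assume \<phi>: "C1c_on \<phi> ({..<T} \<times> \<Omega>)"
  note c = C1c_on_C1[OF \<phi>]
  have gm: "(\<lambda>z. gradx_part \<phi> z $ i) \<in> borel_measurable borel" for i unfolding gradx_part_nth by (rule dm[OF c])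
  have Lgp: "L2 (\<lambda>z. gradx_part \<phi> z $ i)" for i unfolding gradx_part_nth by (rule C1c_on_L2(2)[OF \<phi>])
  have 1: "rep ?Q (\<lambda>z. W (fst z) (snd z) * dt_part \<phi> z) (\<lambda>z. w z * dt_part \<phi> z)"
   unfolding dt_part_def by (rule rep_mult_borel[OF w dm[OF c]])
  have 2: "rep ?Q (\<lambda>z. \<gamma> (fst z) (snd z) * (G (fst z) (snd z) \<bullet> gradx_part \<phi> z)) (\<lambda>z. \<gamma>b z * (g z \<bullet> gradx_part \<phi> z))"
   by (rule rep_mult[OF \<gamma>(1) repv_inner_borel[OF g gm]])
  have 3: "rep ?Q (\<lambda>z. F (fst z) (snd z) \<bullet> gradx_part \<phi> z) (\<lambda>z. Fb z \<bullet> gradx_part \<phi> z)"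
   by (rule repv_inner_borel[OF F(1) gm])
  have "(\<lambda>x. \<phi> (0, x)) \<in> borel_measurable borel"
   by (intro borel_measurable_continuous_onI continuous_on_compose2[OF C1_continuous[OF c]]) (auto intro!: continuous_intros)
  then have 4: "rep \<Omega> (\<lambda>x. W0 x * \<phi> (0, x)) (\<lambda>x. W0b x * \<phi> (0, x))" by (rule rep_mult_borel[OF W0r])
  have i2: "integrable lborel (\<lambda>z. \<gamma>b z * (g z \<bullet> gradx_part \<phi> z))"
  proof -
   have "(\<lambda>z. \<gamma>b z * (g z \<bullet> gradx_part \<phi> z)) = (\<lambda>z. \<Sum>i\<in>UNIV. (\<gamma>b z * g z $ i) * gradx_part \<phi> z $ i)"
    by (simp add: inner_vec_def sum_distrib_left mult.assoc)
   then show ?thesis using L2_prod_integrable[OF L\<gamma>g Lgp] by simp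
  qed
  have i3: "integrable lborel (\<lambda>z. Fb z \<bullet> gradx_part \<phi> z)"
   unfolding inner_vec_def inner_real_def using L2_prod_integrable[OF F(2) Lgp] by simp
  have "(LBINT z. (\<gamma>b z *\<^sub>R g z + Fb z) \<bullet> gradx_part \<phi> z)
    = (LBINT z. \<gamma>b z * (g z \<bullet> gradx_part \<phi> z)) + (LBINT z. Fb z \<bullet> gradx_part \<phi> z)"
   using i2 i3 by (simp add: inner_add_left)
  then show "- (LBINT z. w z * dt_part \<phi> z) + (LBINT z. (\<gamma>b z *\<^sub>R g z + Fb z) \<bullet> gradx_part \<phi> z)
    - (LBINT x. W0b x * \<phi> (0, x)) = 0"
   using weq[OF \<phi>] unfolding rep_set_integral(1)[OF 1] rep_set_integral(1)[OF 2] rep_set_integral(1)[OF 3] rep_set_integral(1)[OF 4]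
   by simp
 next
  fix e :: real assume e: "e > 0"
  have "\<forall>\<^sub>F s in at T within {0..T}. (LINT x:\<Omega>|lebesgue. (W s x - W T x)\<^sup>2) < e"
   using order_tendstoD(2)[OF sl(3)[OF T0(2)] e] .
  then obtain d where d: "d > 0" "\<And>s. s \<in> {0..T} \<Longrightarrow> s \<noteq> T \<Longrightarrow> dist s T < d \<Longrightarrow> (LINT x:\<Omega>|lebesgue. (W s x - W T x)\<^sup>2) < e"
   unfolding eventually_at by blast
  show "\<exists>h0>0. \<forall>h. 0 < h \<and> h < h0 \<longrightarrow> (LBINT z. indicator {T-h<..<T} (fst z) * (w z - WT (snd z))\<^sup>2) \<le> e * h"
  proof (intro exI[of _ "min d T"] conjI allI impI)
   fix h assume h: "0 < h \<and> h < min d T"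
   let ?J = "\<lambda>z. indicator {T-h<..<T} (fst z) :: real"
   have Jsq: "(?J z * r)\<^sup>2 = ?J z * r\<^sup>2" for z r by (simp add: indicator_def)
   have LT': "L2 (\<lambda>z. ?J z * WT (snd z))" using L2_tensor(1)[OF _ emeasure_Icc_finite(3) LT, of "T-h" T] by auto
   have [measurable]: "w \<in> borel_measurable borel" "WT \<in> borel_measurable borel" using Lw LT by auto
   have Lw': "L2 (\<lambda>z. ?J z * w z)"
    by (rule L2_bound(1)[OF _ Lw, of _ 1]) (measurable, auto simp: indicator_def)
   have "integrable lborel (\<lambda>z. ?J z * (w z - WT (snd z))\<^sup>2)"
    using L2_integrable_sq[OF L2_diff[OF Lw' LT']] by (simp add: Jsq right_diff_distrib[symmetric])
   then have int: "integrable (lborel \<Otimes>\<^sub>M lborel) (\<lambda>z. ?J z * (w z - WT (snd z))\<^sup>2)" unfolding lborel_prod .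
   have ae: "AE t in lborel. AE x in lborel. (t, x) \<in> ?Q \<longrightarrow> W t x = w (t, x)"
    using lborel_pair.AE_pair[of "\<lambda>z. z \<in> ?Q \<longrightarrow> W (fst z) (snd z) = w z"] repD(4)[OF w] unfolding lborel_prod by simp
   have "(LBINT z. ?J z * (w z - WT (snd z))\<^sup>2) = (LBINT t. LBINT x. ?J (t, x) * (w (t, x) - WT x)\<^sup>2)"
    using lborel_pair.integral_fst'[OF int] unfolding lborel_prod by simp
   also have "\<dots> \<le> (LBINT t. indicator {T-h<..<T} t * e)"
   proof (rule integral_mono_AE)
    show "integrable lborel (\<lambda>t. LBINT x. ?J (t, x) * (w (t, x) - WT x)\<^sup>2)"
     using lborel_pair.integrable_fst'[OF int] by simp
    show "integrable lborel (\<lambda>t. indicator {T-h<..<T} t * e)" by (simp add: integrable_indicator_iff emeasure_Icc_finite)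
    show "AE t in lborel. (LBINT x. ?J (t, x) * (w (t, x) - WT x)\<^sup>2) \<le> indicator {T-h<..<T} t * e"
     using ae
    proof eventually_elim
     case (elim t)
     show ?case
     proof (cases "t \<in> {T-h<..<T}")
      case True
      then have t: "t \<in> {0<..<T}" "dist t T < d" using h by (auto simp: dist_real_def)
      have wt: "rep \<Omega> (W t) (\<lambda>x. w (t, x))" unfolding rep_def
      proof (intro conjI allI impI OB)
       show "(\<lambda>x. w (t, x)) \<in> borel_measurable borel"
        by (rule measurable_compose[of "\<lambda>x. (t, x)" borel borel w]) (intro borel_measurable_continuous_onI continuous_intros, simp)
       show "w (t, x) = 0" if "x \<notin> \<Omega>" for x using repD(3)[OF w, of "(t, x)"] that by auto
       show "AE x in lborel. x \<in> \<Omega> \<longrightarrow> W t x = w (t, x)" using elim by eventually_elim (use t in auto)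
      qed
      have "(LBINT x. (w (t, x) - WT x)\<^sup>2) = (LINT x:\<Omega>|lebesgue. (W t x - W T x)\<^sup>2)"
       by (rule rep_set_integral(1)[OF rep_power2[OF rep_diff[OF wt WT]], symmetric])
      also have "\<dots> < e" using d(2)[of t] t by auto
      finally show ?thesis using True by simp
     qed simp
    qed
   qed
   also have "\<dots> = e * h" using h by simp
   finally show "(LBINT z. ?J z * (w z - WT (snd z))\<^sup>2) \<le> e * h" .
  qed (use d T in auto)
 qed
 then show thesis using w g WT W0b W0r by (rule that)
qed

section \<open>Asymptotics of heat potentials along a Lipschitz curve\<close>

lemma integrable_exp_Ioi:
 assumes a: "a > (0::real)" shows "integrable lborel (\<lambda>r. indicator {0<..} r * exp (- a * r))"
proof -
 have "(\<lambda>x. exp (- a * x)) integrable_on {0..}" using integrable_on_exp_minus_to_infinity[OF a] .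
 then have "(\<lambda>x. exp (- a * x)) absolutely_integrable_on {0..}"
  by (rule nonnegative_absolutely_integrable_1) simp
 then have "integrable lebesgue (\<lambda>x. indicator {0..} x * exp (- a * x))" by (simp add: set_integrable_def)
 then have i: "integrable lborel (\<lambda>x. indicator {0..} x * exp (- a * x))"
  by (subst (asm) integrable_completion) auto
 show ?thesis
  by (rule Bochner_Integration.integrable_bound[OF i]) (auto simp: indicator_def)
qed

text \<open>The left side is largest at s = b / p, and the right side is its value there; the
  inequality ln x <= x - 1 with x = b / (p s) proves it.\<close>

lemma exp_powr_bound:
 fixes b p s :: real
 assumes "b > 0" "p > 0" "s > 0"
 shows "exp (- b / s) * s powr (- p) \<le> exp (- p - p * ln (b / p))"
proof -
 have "ln ((b / p) * (1 / s)) \<le> (b / p) * (1 / s) - 1" using assms by (intro ln_le_minus_one) simp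
 moreover have "ln ((b / p) * (1 / s)) = ln (b / p) - ln s" using assms by (subst ln_mult) (auto simp: ln_div)
 ultimately have "p * (ln (b / p) - ln s) \<le> p * ((b / p) * (1 / s) - 1)" using assms by (intro mult_left_mono) auto
 moreover have "p * ((b / p) * (1 / s) - 1) = b / s - p" using assms by (simp add: right_diff_distrib)
 ultimately have "- b / s - p * ln s \<le> - p - p * ln (b / p)" by (simp add: right_diff_distrib)
 then have "exp (- b / s - p * ln s) \<le> exp (- p - p * ln (b / p))" by (simp only: exp_le_cancel_iff)
 moreover have "exp (- b / s - p * ln s) = exp (- b / s) * s powr (- p)"
  using assms by (simp add: powr_def exp_diff exp_minus divide_inverse)
 ultimately show ?thesis by (simp only:)
qed

lemma integrable_exp_exp_powr:
 fixes a b p :: real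
 assumes "a > 0" "b > 0" "p > 0"
 shows "integrable lborel (\<lambda>s. indicator {0<..} s * (exp (- a * s) * (exp (- b / s) * s powr (- p))))"
proof (rule Bochner_Integration.integrable_bound)
 let ?K = "exp (- p - p * ln (b / p))"
 show "integrable lborel (\<lambda>s. ?K * (indicator {0<..} s * exp (- a * s)))" using integrable_exp_Ioi[OF assms(1)] by simp
 show "AE s in lborel. norm (indicator {0<..} s * (exp (- a * s) * (exp (- b / s) * s powr (- p)))) \<le> norm (?K * (indicator {0<..} s * exp (- a * s)))"
 proof (rule AE_I2)
  fix s :: real
  show "norm (indicator {0<..} s * (exp (- a * s) * (exp (- b / s) * s powr (- p)))) \<le> norm (?K * (indicator {0<..} s * exp (- a * s)))"
  proof (cases "s > 0")
   case True
   have "exp (- a * s) * (exp (- b / s) * s powr (- p)) \<le> exp (- a * s) * ?K"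
    using exp_powr_bound[OF assms(2,3) True] by (intro mult_left_mono) auto
   then show ?thesis using True by (simp add: abs_mult mult.commute)
  qed simp
 qed
qed measurable

text \<open>Under s = (R / (2 tau)) r the exponent -tau^2 s - R^2 / (4 s) becomes -tau R - lam (r -
  1)^2 / r with lam = tau R / 2; this is the second factor. The power -5/2 is that of the gradient
  of the heat kernel in space dimension three.\<close>

definition kker :: "real \<Rightarrow> real \<Rightarrow> real" where
 "kker lam r = indicator {0<..} r * (exp (- lam * ((r - 1)\<^sup>2 / r)) * r powr (-5/2))"

definition ZZ :: "real \<Rightarrow> real" where
 "ZZ lam = (LBINT r. kker lam r)"

lemma kker_nonneg: "kker lam r \<ge> 0" by (simp add: kker_def)

lemma kker_measurable [measurable]: "kker lam \<in> borel_measurable borel"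
 unfolding kker_def by measurable

lemma kker_integrable:
 assumes A: "A \<ge> 0" and lam: "lam \<ge> A + 1"
 shows "integrable lborel (\<lambda>r. kker lam r * exp (A * r))"
proof -
 have eq: "kker lam r * exp (A * r) = exp (2 * lam) * (indicator {0<..} r * (exp (- (lam - A) * r) * (exp (- lam / r) * r powr (- (5/2)))))" for r
 proof (cases "r > 0")
  case True
  have "- lam * ((r - 1)\<^sup>2 / r) + A * r = 2 * lam + (- (lam - A) * r + - lam / r)" using True
   by (simp add: power2_eq_square field_simps)
  then have "exp (- lam * ((r - 1)\<^sup>2 / r)) * exp (A * r) = exp (2 * lam) * (exp (- (lam - A) * r) * exp (- lam / r))"
   by (simp only: exp_add[symmetric])
  then show ?thesis using True by (simp add: kker_def mult_ac)
 qed (simp add: kker_def)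
 show ?thesis unfolding eq using integrable_exp_exp_powr[of "lam - A" lam "5/2"] A lam by simp
qed

lemma kker_integrable0: "lam \<ge> 1 \<Longrightarrow> integrable lborel (kker lam)"
 using kker_integrable[of 0 lam] by simp

text \<open>Keeps only r between 1 and 1 + t, where the phase is at most t^2. A fixed t is enough
  against exponentially small tails; t = 1 / sqrt lam gives the exact order.\<close>

lemma ZZ_lower:
 assumes t: "0 < t" "t \<le> 1" and lam: "lam \<ge> 1"
 shows "ZZ lam \<ge> t * (2 powr (-5/2) * exp (- lam * t\<^sup>2))"
proof -
 have "t * (2 powr (-5/2) * exp (- lam * t\<^sup>2)) = (LBINT r. indicator {1..1+t} r * (2 powr (-5/2) * exp (- lam * t\<^sup>2)))"
  using t by simp
 also have "\<dots> \<le> ZZ lam" unfolding ZZ_def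
 proof (rule integral_mono)
  show "integrable lborel (\<lambda>r. indicator {1..1+t} r * (2 powr (-5/2) * exp (- lam * t\<^sup>2)))"
   by (simp add: integrable_indicator_iff emeasure_Icc_finite)
  show "integrable lborel (kker lam)" by (rule kker_integrable0[OF lam])
  show "indicator {1..1+t} r * (2 powr (-5/2) * exp (- lam * t\<^sup>2)) \<le> kker lam r" for r
  proof (cases "r \<in> {1..1+t}")
   case True
   have "(r - 1)\<^sup>2 / r \<le> (r - 1)\<^sup>2 / 1" using True by (intro divide_left_mono) auto
   also have "\<dots> \<le> t\<^sup>2" using True by (auto intro: power_mono)
   finally have "lam * ((r - 1)\<^sup>2 / r) \<le> lam * t\<^sup>2" using lam by (intro mult_left_mono) auto
   then have 1: "exp (- lam * t\<^sup>2) \<le> exp (- lam * ((r - 1)\<^sup>2 / r))" by simp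
   have 2: "2 powr (-5/2) \<le> r powr (-5/2)" using True t by (intro powr_mono2') auto
   have "2 powr (-5/2) * exp (- lam * t\<^sup>2) \<le> r powr (-5/2) * exp (- lam * ((r - 1)\<^sup>2 / r))"
    by (rule mult_mono[OF 2 1]) auto
   then show ?thesis using True by (simp add: kker_def mult.commute)
  qed (simp add: kker_nonneg)
 qed
 finally show ?thesis .
qed

text \<open>The bound is the value of the phase at r = 1 + eta, where it has reached it on the right
  of 1; on the left the division by r < 1 only helps.\<close>

lemma quadratic_gap:
 fixes r \<eta> :: real
 assumes "r > 0" "\<eta> > 0" "\<bar>r - 1\<bar> > \<eta>"
 shows "(r - 1)\<^sup>2 / r \<ge> \<eta>\<^sup>2 / (1 + \<eta>)"
proof (cases "r \<ge> 1")
 case True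
 define d where "d = r - 1"
 have d: "d > \<eta>" "r = 1 + d" using assms True by (auto simp: d_def)
 have "\<eta>\<^sup>2 * (1 + d) \<le> d\<^sup>2 * (1 + \<eta>)"
 proof -
  have "d\<^sup>2 * (1 + \<eta>) - \<eta>\<^sup>2 * (1 + d) = (d - \<eta>) * (d + \<eta> + d * \<eta>)" by (simp add: power2_eq_square algebra_simps)
  moreover have "\<dots> \<ge> 0" using d assms by (intro mult_nonneg_nonneg) auto
  ultimately show ?thesis by linarith
 qed
 then show ?thesis using d assms by (simp add: divide_simps)
next
 case False
 have "\<eta>\<^sup>2 \<le> (r - 1)\<^sup>2" using assms by (metis abs_le_square_iff abs_of_pos less_imp_le)
 then have "\<eta>\<^sup>2 / (1 + \<eta>) \<le> (r - 1)\<^sup>2 / 1" using assms by (intro frac_le) auto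
 also have "\<dots> \<le> (r - 1)\<^sup>2 / r" using False assms by (intro divide_left_mono) auto
 finally show ?thesis .
qed

text \<open>Laplace's method: the mass of the kernel concentrates at the saddle point 1.\<close>

lemma kker_concentration:
 assumes A: "A \<ge> 0" and B: "B \<ge> 0" and e: "e > 0" and \<eta>: "\<eta> > 0"
 shows "\<exists>lam0\<ge>A + 1. \<forall>lam\<ge>lam0. \<forall>h. h \<in> borel_measurable borel \<and> (\<forall>r>0. 0 \<le> h r \<and> h r \<le> B * exp (A * r)) \<and>
   (\<forall>r>0. \<bar>r - 1\<bar> \<le> \<eta> \<longrightarrow> h r \<le> e) \<longrightarrow>
   integrable lborel (\<lambda>r. kker lam r * h r) \<and> (LBINT r. kker lam r * h r) \<le> 2 * e * ZZ lam"
proof -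
 \<comment> \<open>Away from 1 the kernel is compared with the kernel of this fixed parameter,
   against which exp (A r) is still integrable; the remaining part of the exponent supplies the
   decay exp (-(lam - l0) c). Nothing here depends on h.\<close>
 define l0 where "l0 = A + 1"
 define c where "c = \<eta>\<^sup>2 / (1 + \<eta>)"
 have c: "c > 0" using \<eta> by (simp add: c_def)
 define C1 where "C1 = (LBINT r. kker l0 r * (B * exp (A * r)))"
 have i0: "integrable lborel (\<lambda>r. kker l0 r * (B * exp (A * r)))"
  using kker_integrable[OF A, of l0] by (simp add: l0_def mult.left_commute)
 have C1: "C1 \<ge> 0" unfolding C1_def using B kker_nonneg by (intro integral_nonneg_AE) simp
 \<comment> \<open>With t^2 <= c/2 the total mass is at least of order exp (-lam c / 2), whereas the
   tail is at most of order exp (-lam c).\<close>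
 define t where "t = min 1 (sqrt (c / 2))"
 have t: "0 < t" "t \<le> 1" using c by (auto simp: t_def)
 have t2: "t\<^sup>2 \<le> c / 2"
 proof -
  have "t\<^sup>2 \<le> (sqrt (c / 2))\<^sup>2" using t c by (intro power_mono) (auto simp: t_def)
  then show ?thesis using c by simp
 qed
 define k where "k = e * t * 2 powr (-5/2)"
 have k: "k > 0" using e t by (simp add: k_def)
 define X where "X = (exp (l0 * c) * C1 + 1) / k"
 have X: "X > 0" using k C1 by (auto simp: X_def intro!: divide_pos_pos add_nonneg_pos mult_nonneg_nonneg)
 show ?thesis
 proof (intro exI[of _ "max l0 (max 1 (2 * X / c))"] conjI allI impI; (elim conjE)?)
  show "A + 1 \<le> max l0 (max 1 (2 * X / c))" by (simp add: l0_def)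
  fix lam h assume lam: "max l0 (max 1 (2 * X / c)) \<le> lam"
   and h: "h \<in> borel_measurable borel" "\<forall>r>0. 0 \<le> h r \<and> h r \<le> B * exp (A * r)" "\<forall>r>0. \<bar>r - 1\<bar> \<le> \<eta> \<longrightarrow> h r \<le> e"
  have lam': "lam \<ge> l0" "lam \<ge> 1" "lam * c / 2 \<ge> X" using lam c by (auto simp: field_simps)
  note [measurable] = h(1)
  have bd: "kker lam r * h r \<le> e * kker lam r + exp (- (lam - l0) * c) * (kker l0 r * (B * exp (A * r)))" for r
  proof (cases "r > 0")
   case True
   show ?thesis
   proof (cases "\<bar>r - 1\<bar> \<le> \<eta>")
    case T: True
    then have "kker lam r * h r \<le> kker lam r * e" using h(3) True kker_nonneg by (intro mult_left_mono) auto
    moreover have "0 \<le> exp (- (lam - l0) * c) * (kker l0 r * (B * exp (A * r)))" using B kker_nonneg by (intro mult_nonneg_nonneg) auto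
    ultimately show ?thesis by (simp add: mult.commute)
   next
    case F: False
    then have "c \<le> (r - 1)\<^sup>2 / r" unfolding c_def using quadratic_gap[OF True \<eta>] by simp
    then have *: "(lam - l0) * c \<le> (lam - l0) * ((r - 1)\<^sup>2 / r)" using lam' by (intro mult_left_mono) auto
    have "(lam - l0) * c \<le> (lam - l0) * q \<Longrightarrow> - lam * q \<le> - (lam - l0) * c + - l0 * q" for q by (simp add: algebra_simps)
    from this[OF *] have "- lam * ((r - 1)\<^sup>2 / r) \<le> - (lam - l0) * c + - l0 * ((r - 1)\<^sup>2 / r)" .
    then have "exp (- lam * ((r - 1)\<^sup>2 / r)) \<le> exp (- (lam - l0) * c) * exp (- l0 * ((r - 1)\<^sup>2 / r))" by (simp only: exp_add[symmetric] exp_le_cancel_iff)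
    then have "exp (- lam * ((r - 1)\<^sup>2 / r)) * r powr (-5/2) \<le> (exp (- (lam - l0) * c) * exp (- l0 * ((r - 1)\<^sup>2 / r))) * r powr (-5/2)"
     by (rule mult_right_mono) simp
    then have "kker lam r \<le> exp (- (lam - l0) * c) * kker l0 r" using True by (simp add: kker_def mult_ac)
    then have "kker lam r * h r \<le> (exp (- (lam - l0) * c) * kker l0 r) * (B * exp (A * r))"
     using h(2) True by (intro mult_mono) (auto simp: kker_nonneg)
    moreover have "0 \<le> e * kker lam r" using e kker_nonneg by simp
    ultimately show ?thesis by (simp add: mult_ac)
   qed
  qed (simp add: kker_def)
  have ib: "integrable lborel (\<lambda>r. e * kker lam r + exp (- (lam - l0) * c) * (kker l0 r * (B * exp (A * r))))"
   using kker_integrable0[OF lam'(2)] i0 by (intro Bochner_Integration.integrable_add integrable_mult_right) auto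
  show ih: "integrable lborel (\<lambda>r. kker lam r * h r)"
  proof (rule Bochner_Integration.integrable_bound[OF ib])
   show "AE r in lborel. norm (kker lam r * h r) \<le> norm (e * kker lam r + exp (- (lam - l0) * c) * (kker l0 r * (B * exp (A * r))))"
   proof (rule AE_I2)
    fix r :: real
    have "0 \<le> kker lam r * h r" using h(2) by (cases "r > 0") (auto simp: kker_nonneg kker_def)
    then show "norm (kker lam r * h r) \<le> norm (e * kker lam r + exp (- (lam - l0) * c) * (kker l0 r * (B * exp (A * r))))"
     using bd[of r] by simp
   qed
  qed measurable
  have "(LBINT r. kker lam r * h r) \<le> (LBINT r. e * kker lam r + exp (- (lam - l0) * c) * (kker l0 r * (B * exp (A * r))))"
   by (rule integral_mono[OF ih ib bd])
  also have "\<dots> = e * ZZ lam + exp (- (lam - l0) * c) * C1"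
   unfolding ZZ_def C1_def using kker_integrable0[OF lam'(2)] i0 by (subst Bochner_Integration.integral_add) auto
  also have "exp (- (lam - l0) * c) * C1 \<le> e * ZZ lam"
  proof -
   have "exp (lam * c / 2) \<ge> X" using exp_ge_add_one_self[of "lam * c / 2"] lam'(3) by linarith
   then have "exp (l0 * c) * C1 \<le> k * exp (lam * c / 2)"
    using k by (simp add: X_def field_simps)
   then have "exp (- lam * c) * (exp (l0 * c) * C1) \<le> exp (- lam * c) * (k * exp (lam * c / 2))" by (rule mult_left_mono) simp
   then have "exp (- (lam - l0) * c) * C1 \<le> k * exp (- lam * (c / 2))"
   proof -
    have "exp (- lam * c) * exp (l0 * c) = exp (- (lam - l0) * c)" by (simp only: exp_add[symmetric]) (simp add: algebra_simps)
    moreover have "exp (- lam * c) * exp (lam * c / 2) = exp (- lam * (c / 2))" by (simp only: exp_add[symmetric]) (simp add: algebra_simps)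
    ultimately show "exp (- lam * c) * (exp (l0 * c) * C1) \<le> exp (- lam * c) * (k * exp (lam * c / 2)) \<Longrightarrow> ?thesis"
     by (metis mult.assoc mult.left_commute)
   qed
   also have "\<dots> \<le> k * exp (- lam * t\<^sup>2)" using k t2 lam'(2) by (intro mult_left_mono) auto
   also have "\<dots> = e * (t * (2 powr (-5/2) * exp (- lam * t\<^sup>2)))" by (simp add: k_def)
   also have "\<dots> \<le> e * ZZ lam" using ZZ_lower[OF t lam'(2)] e by (intro mult_left_mono) auto
   finally show ?thesis .
  qed
  finally show "(LBINT r. kker lam r * h r) \<le> 2 * e * ZZ lam" by simp
 qed
qed

lemma integrable_exp_abs: "integrable lborel (\<lambda>u::real. exp (- \<bar>u\<bar>))"
proof -
 have i: "integrable lborel (\<lambda>r. indicator {0<..} r * exp (- r :: real))" using integrable_exp_Ioi[of 1] by simp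
 from lborel_reflect_integrable[OF this, of 0]
 have "integrable lborel (\<lambda>r. indicator {0<..} (- r) * exp (r :: real))" by simp
 then have s: "integrable lborel (\<lambda>r. indicator {0<..} r * exp (- r) + indicator {0<..} (- r) * exp (r :: real) + indicator {0..0} r)"
  using i by (intro Bochner_Integration.integrable_add) (auto simp: integrable_indicator_iff)
 show ?thesis
  by (rule Bochner_Integration.integrable_bound[OF s]) (auto simp: indicator_def)
qed

text \<open>By concentration at most half of the mass lies outside |r - 1| <= 1/2. Inside, r <= 2
  bounds the kernel by a Gaussian in sqrt lam (r - 1), whose integral has the order of 1 / sqrt
  lam.\<close>

lemma ZZ_bounds:
 obtains c1 c2 l where "c1 > 0" "c2 > 0" "l \<ge> 1" "\<And>lam. lam \<ge> l \<Longrightarrow> c1 / sqrt lam \<le> ZZ lam" "\<And>lam. lam \<ge> l \<Longrightarrow> ZZ lam \<le> c2 / sqrt lam"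
proof -
 define Gc where "Gc = integral\<^sup>L lborel (\<lambda>u::real. exp (- u\<^sup>2 / 2))"
 have gi: "integrable lborel (\<lambda>u::real. exp (- u\<^sup>2 / 2))"
 proof (rule Bochner_Integration.integrable_bound)
  show "integrable lborel (\<lambda>u::real. exp (1/2) * exp (- \<bar>u\<bar>))" using integrable_exp_abs by simp
  show "AE u in lborel. norm (exp (- u\<^sup>2 / 2)) \<le> norm (exp (1/2) * exp (- \<bar>u::real\<bar>))"
  proof (rule AE_I2)
   fix u :: real
   have "- u\<^sup>2 / 2 \<le> 1/2 + - \<bar>u\<bar>" using zero_le_power2[of "\<bar>u\<bar> - 1"] by (simp add: power2_diff)
   then have "exp (- u\<^sup>2 / 2) \<le> exp (1/2) * exp (- \<bar>u\<bar>)" by (simp only: exp_add[symmetric] exp_le_cancel_iff)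
   then show "norm (exp (- u\<^sup>2 / 2)) \<le> norm (exp (1/2) * exp (- \<bar>u\<bar>))" by (simp add: abs_mult)
  qed
 qed measurable
 have Gc: "Gc \<ge> 0" unfolding Gc_def by (intro integral_nonneg_AE) simp
 obtain l where l: "l \<ge> 1" "\<And>lam h. lam \<ge> l \<Longrightarrow> h \<in> borel_measurable borel \<Longrightarrow> (\<And>r. r > 0 \<Longrightarrow> 0 \<le> h r \<and> h r \<le> 1) \<Longrightarrow>
   (\<And>r. r > 0 \<Longrightarrow> \<bar>r - 1\<bar> \<le> 1/2 \<Longrightarrow> h r \<le> 1/4) \<Longrightarrow> (LBINT r. kker lam r * h r) \<le> (1/2) * ZZ lam"
  using kker_concentration[of 0 1 "1/4" "1/2"] by auto
 show thesis
 \<comment> \<open>The first constant is \<open>ZZ_lower\<close> at t = 1 / sqrt lam; the summand 1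
   in the second makes it visibly positive.\<close>
 proof (rule that[of "2 powr (-5/2) * exp (-1)" "2 * 2 powr (5/2) * (Gc + 1)" l])
  fix lam assume lam: "lam \<ge> l"
  have lam1: "lam \<ge> 1" using lam l by simp
  have "(1 / sqrt lam) * (2 powr (-5/2) * exp (- lam * (1 / sqrt lam)\<^sup>2)) \<le> ZZ lam"
   using lam1 by (intro ZZ_lower) auto
  then show "2 powr (-5/2) * exp (-1) / sqrt lam \<le> ZZ lam" using lam1 by (simp add: power_divide)
  let ?h = "\<lambda>r. indicator {r. \<bar>r - 1\<bar> > 1/2} r :: real"
  have [measurable]: "{r::real. \<bar>r - 1\<bar> > 1/2} \<in> sets borel" by measurable
  have "(LBINT r. kker lam r * ?h r) \<le> (1/2) * ZZ lam"
   by (rule l(2)[OF lam]) (auto simp: indicator_def)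
  moreover have "ZZ lam = (LBINT r. kker lam r * ?h r) + (LBINT r. kker lam r * (1 - ?h r))"
  proof -
   have 1: "integrable lborel (\<lambda>r. kker lam r * ?h r)"
    by (rule Bochner_Integration.integrable_bound[OF kker_integrable0[OF lam1]]) (auto simp: indicator_def)
   have 2: "integrable lborel (\<lambda>r. kker lam r * (1 - ?h r))"
    by (rule Bochner_Integration.integrable_bound[OF kker_integrable0[OF lam1]]) (auto simp: indicator_def)
   show ?thesis unfolding ZZ_def Bochner_Integration.integral_add[OF 1 2, symmetric]
    by (simp add: algebra_simps)
  qed
  ultimately have "ZZ lam \<le> 2 * (LBINT r. kker lam r * (1 - ?h r))" by simp
  also have "(LBINT r. kker lam r * (1 - ?h r)) \<le> (LBINT r. 2 powr (5/2) * exp (- (sqrt lam * (r - 1))\<^sup>2 / 2))"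
  proof (rule integral_mono)
   show "integrable lborel (\<lambda>r. kker lam r * (1 - ?h r))"
    by (rule Bochner_Integration.integrable_bound[OF kker_integrable0[OF lam1]]) (auto simp: indicator_def)
   have "integrable lborel (\<lambda>r. exp (- (- sqrt lam + sqrt lam * r)\<^sup>2 / 2))"
    using lborel_integrable_real_affine[OF gi, of "sqrt lam" "- sqrt lam"] lam1 by simp
   then show "integrable lborel (\<lambda>r. 2 powr (5/2) * exp (- (sqrt lam * (r - 1))\<^sup>2 / 2))"
    by (simp add: algebra_simps)
   show "kker lam r * (1 - ?h r) \<le> 2 powr (5/2) * exp (- (sqrt lam * (r - 1))\<^sup>2 / 2)" for r
   proof (cases "\<bar>r - 1\<bar> \<le> 1/2")
    case True
    then have r: "1/2 \<le> r" "r \<le> 3/2" by linarith+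
    have "(r - 1)\<^sup>2 / 2 \<le> (r - 1)\<^sup>2 / r" using r by (intro divide_left_mono) auto
    then have "lam * ((r - 1)\<^sup>2 / 2) \<le> lam * ((r - 1)\<^sup>2 / r)" using lam1 by (intro mult_left_mono) auto
    then have 1: "exp (- lam * ((r - 1)\<^sup>2 / r)) \<le> exp (- (sqrt lam * (r - 1))\<^sup>2 / 2)"
     using lam1 by (simp add: power_mult_distrib)
    have "r powr (-5/2) \<le> (1/2) powr (-5/2)" using r by (intro powr_mono2') auto
    also have "(1/2::real) powr (-5/2) = 2 powr (5/2)" by (simp add: powr_def ln_div)
    finally have 2: "r powr (-5/2) \<le> 2 powr (5/2)" .
    have "r powr (-5/2) * exp (- lam * ((r - 1)\<^sup>2 / r)) \<le> 2 powr (5/2) * exp (- (sqrt lam * (r - 1))\<^sup>2 / 2)"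
     by (rule mult_mono[OF 2 1]) auto
    then show ?thesis using True r by (simp add: kker_def mult.commute)
   qed simp
  qed
  also have "\<dots> = 2 powr (5/2) * (Gc / sqrt lam)"
  proof -
   have "Gc = \<bar>sqrt lam\<bar> *\<^sub>R (LBINT r. exp (- (- sqrt lam + sqrt lam * r)\<^sup>2 / 2))"
    unfolding Gc_def using lam1 by (intro lborel_integral_real_affine) auto
   then have "(LBINT r. exp (- (sqrt lam * (r - 1))\<^sup>2 / 2)) = Gc / sqrt lam" using lam1
    by (simp add: field_simps)
   then show ?thesis by simp
  qed
  finally have "ZZ lam \<le> 2 * (2 powr (5/2) * (Gc / sqrt lam))" by simp
  also have "\<dots> \<le> 2 * 2 powr (5/2) * (Gc + 1) / sqrt lam" using lam1 by (simp add: field_simps)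
  finally show "ZZ lam \<le> 2 * 2 powr (5/2) * (Gc + 1) / sqrt lam" .
 qed (use l Gc in auto)
qed

section \<open>The radial kernel of a source at rest\<close>

definition mker :: "real \<Rightarrow> real \<Rightarrow> real \<Rightarrow> real" where
 "mker \<tau> R s = indicator {0<..} s * (exp (- \<tau>\<^sup>2 * s - R\<^sup>2 / (4 * s)) * s powr (-3/2) * (R / (2 * s)))"

text \<open>For a source at rest at distance R this is the length of \<open>gpot\<close>. A moving
  source changes it, to leading order, by an exponential factor only.\<close>

definition NN :: "real \<Rightarrow> real \<Rightarrow> real" where
 "NN \<tau> R = (LBINT s. mker \<tau> R s)"

lemma mker_nonneg: "R \<ge> 0 \<Longrightarrow> mker \<tau> R s \<ge> 0" by (auto simp: mker_def indicator_def)

lemma mker_measurable [measurable]: "mker \<tau> R \<in> borel_measurable borel"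
 unfolding mker_def by measurable

lemma powr_shift:
 fixes s R :: real assumes "s > 0"
 shows "s powr (-3/2) * (R / (2 * s)) = (R / 2) * s powr (-5/2)"
proof -
 have "s powr (-5/2) = s powr (-3/2) * s powr (-1)" by (simp only: powr_add[symmetric]) simp
 also have "s powr (-1) = 1 / s" using powr_neg_one[OF assms] .
 finally show ?thesis by simp
qed

lemma mker_scale:
 assumes "\<tau> > 0" "R > 0"
 shows "mker \<tau> R (R / (2 * \<tau>) * r) = exp (- \<tau> * R) * (R / 2) * (R / (2 * \<tau>)) powr (-5/2) * kker (\<tau> * R / 2) r"
proof (cases "r > 0")
 case True
 let ?s = "R / (2 * \<tau>) * r"
 have s: "?s > 0" using True assms by simp
 have e: "- \<tau>\<^sup>2 * ?s - R\<^sup>2 / (4 * ?s) = - \<tau> * R + - (\<tau> * R / 2) * ((r - 1)\<^sup>2 / r)"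
  using assms True by (simp add: field_simps power2_eq_square)
 have p: "?s powr (-3/2) * (R / (2 * ?s)) = (R / 2) * ((R / (2 * \<tau>)) powr (-5/2) * r powr (-5/2))"
 proof -
  have "?s powr (-3/2) * (R / (2 * ?s)) = (R / 2) * ?s powr (-5/2)" by (rule powr_shift[OF s])
  also have "?s powr (-5/2) = (R / (2 * \<tau>)) powr (-5/2) * r powr (-5/2)" by (rule powr_mult)
  finally show ?thesis .
 qed
 have "mker \<tau> R ?s = exp (- \<tau>\<^sup>2 * ?s - R\<^sup>2 / (4 * ?s)) * (?s powr (-3/2) * (R / (2 * ?s)))"
  using s by (simp add: mker_def)
 also have "\<dots> = (exp (- \<tau> * R) * exp (- (\<tau> * R / 2) * ((r - 1)\<^sup>2 / r))) * ((R / 2) * ((R / (2 * \<tau>)) powr (-5/2) * r powr (-5/2)))"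
  unfolding e p exp_add ..
 also have "\<dots> = exp (- \<tau> * R) * (R / 2) * (R / (2 * \<tau>)) powr (-5/2) * kker (\<tau> * R / 2) r"
  using True by (simp add: kker_def mult_ac)
 finally show ?thesis .
next
 case False
 then have "R / (2 * \<tau>) * r \<le> 0" using assms by (intro mult_nonneg_nonpos) auto
 then have "\<not> R / (2 * \<tau>) * r > 0" by linarith
 then have "mker \<tau> R (R / (2 * \<tau>) * r) = 0" unfolding mker_def by (simp only: indicator_simps greaterThan_iff not_False_eq_True mult_zero_left)
 then show ?thesis using False by (simp add: kker_def)
qed

lemma mker_integral_scale:
 assumes "\<tau> > 0" "R > 0"
 shows "(LBINT s. mker \<tau> R s * h s) = exp (- \<tau> * R) * (R / 2) * (R / (2 * \<tau>)) powr (-3/2) *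
      (LBINT r. kker (\<tau> * R / 2) r * h (R / (2 * \<tau>) * r))"
  and "integrable lborel (\<lambda>s. mker \<tau> R s * h s) \<longleftrightarrow> integrable lborel (\<lambda>r. kker (\<tau> * R / 2) r * h (R / (2 * \<tau>) * r))"
proof -
 let ?s0 = "R / (2 * \<tau>)" and ?c = "exp (- \<tau> * R) * (R / 2) * (R / (2 * \<tau>)) powr (-5/2)"
 have s0: "?s0 > 0" using assms by simp
 have eq: "mker \<tau> R (0 + ?s0 * r) * h (0 + ?s0 * r) = ?c * (kker (\<tau> * R / 2) r * h (?s0 * r))" for r
  using mker_scale[OF assms, of r] by (simp add: mult.assoc)
 have p: "?s0 * ?s0 powr (-5/2) = ?s0 powr (-3/2)"
 proof -
  have "?s0 * ?s0 powr (-5/2) = ?s0 powr 1 * ?s0 powr (-5/2)" using s0 by (simp only: powr_one[OF less_imp_le])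
  also have "\<dots> = ?s0 powr (-3/2)" by (simp only: powr_add[symmetric]) simp
  finally show ?thesis .
 qed
 have "(LBINT s. mker \<tau> R s * h s) = \<bar>?s0\<bar> *\<^sub>R (LBINT r. mker \<tau> R (0 + ?s0 * r) * h (0 + ?s0 * r))"
  using s0 by (intro lborel_integral_real_affine) auto
 also have "\<dots> = ?s0 * (?c * (LBINT r. kker (\<tau> * R / 2) r * h (?s0 * r)))"
  unfolding eq abs_of_pos[OF s0] by simp
 also have "\<dots> = exp (- \<tau> * R) * (R / 2) * (?s0 * ?s0 powr (-5/2)) * (LBINT r. kker (\<tau> * R / 2) r * h (?s0 * r))"
  by (simp only: mult_ac)
 finally show "(LBINT s. mker \<tau> R s * h s) = exp (- \<tau> * R) * (R / 2) * (R / (2 * \<tau>)) powr (-3/2) *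
      (LBINT r. kker (\<tau> * R / 2) r * h (R / (2 * \<tau>) * r))" unfolding p .
 have c0: "?c \<noteq> 0" using assms s0 by simp
 have "integrable lborel (\<lambda>s. mker \<tau> R s * h s) \<longleftrightarrow> integrable lborel (\<lambda>r. mker \<tau> R (0 + ?s0 * r) * h (0 + ?s0 * r))"
  using s0 by (subst lborel_integrable_real_affine_iff) auto
 also have "\<dots> \<longleftrightarrow> integrable lborel (\<lambda>r. kker (\<tau> * R / 2) r * h (R / (2 * \<tau>) * r))"
  unfolding eq using c0 integrable_mult_left_iff[of lborel ?c "\<lambda>r. kker (\<tau> * R / 2) r * h (?s0 * r)"] by blast
 finally show "integrable lborel (\<lambda>s. mker \<tau> R s * h s) \<longleftrightarrow> integrable lborel (\<lambda>r. kker (\<tau> * R / 2) r * h (R / (2 * \<tau>) * r))" .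
qed

lemma NN_eq:
 assumes "\<tau> > 0" "R > 0"
 shows "NN \<tau> R = exp (- \<tau> * R) * (R / 2) * (R / (2 * \<tau>)) powr (-3/2) * ZZ (\<tau> * R / 2)"
 using mker_integral_scale(1)[OF assms, of "\<lambda>_. 1"] by (simp add: NN_def ZZ_def)

text \<open>The powers combine exactly: (R/2) (R / (2 tau))^(-3/2) (tau R / 2)^(-1/2) = 2 tau / R.
  The resulting order is that of the leading term of the gradient of p.\<close>

lemma NN_bounds:
 obtains c1 c2 l where "c1 > 0" "c2 > 0" "l \<ge> 1" "\<And>\<tau> R. \<tau> > 0 \<Longrightarrow> R > 0 \<Longrightarrow> \<tau> * R / 2 \<ge> l \<Longrightarrow> c1 * (exp (- \<tau> * R) * \<tau> / R) \<le> NN \<tau> R"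
  "\<And>\<tau> R. \<tau> > 0 \<Longrightarrow> R > 0 \<Longrightarrow> \<tau> * R / 2 \<ge> l \<Longrightarrow> NN \<tau> R \<le> c2 * (exp (- \<tau> * R) * \<tau> / R)"
proof -
 obtain c1 c2 l where c: "c1 > 0" "c2 > 0" "l \<ge> 1" "\<And>lam. lam \<ge> l \<Longrightarrow> c1 / sqrt lam \<le> ZZ lam" "\<And>lam. lam \<ge> l \<Longrightarrow> ZZ lam \<le> c2 / sqrt lam"
  using ZZ_bounds by blast
 have E: "(R / 2) * (R / (2 * \<tau>)) powr (-3/2) / sqrt (\<tau> * R / 2) = 2 * \<tau> / R" if "\<tau> > 0" "R > 0" for \<tau> R :: real
 proof -
  let ?s = "R / (2 * \<tau>)"
  have s: "?s > 0" using that by simp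
  have "?s powr (-3/2) = inverse (?s * sqrt ?s)"
  proof -
   have "?s powr (3/2) = ?s powr 1 * ?s powr (1/2)" by (simp only: powr_add[symmetric]) simp
   also have "\<dots> = ?s * sqrt ?s" using s by (simp only: powr_one[OF less_imp_le] powr_half_sqrt[OF less_imp_le])
   finally show ?thesis using powr_minus[of ?s "3/2"] by simp
  qed
  moreover have "sqrt ?s * sqrt (\<tau> * R / 2) = R / 2"
  proof -
   have "sqrt ?s * sqrt (\<tau> * R / 2) = sqrt ((R / 2)\<^sup>2)" using that by (simp only: real_sqrt_mult[symmetric]) (simp add: field_simps power2_eq_square)
   then show ?thesis using that by simp
  qed
  moreover have "h * inverse (s * a) / b = h / (s * (a * b))" for h s a b :: real
   by (simp only: divide_inverse inverse_mult_distrib mult.assoc)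
  ultimately have "(R / 2) * ?s powr (-3/2) / sqrt (\<tau> * R / 2) = (R / 2) / (?s * (R / 2))"
   by metis
  also have "\<dots> = 2 * \<tau> / R" using that by simp
  finally show ?thesis .
 qed
 show thesis
 proof (rule that[of "2 * c1" "2 * c2" l])
  fix \<tau> R :: real assume t: "\<tau> > 0" "R > 0" "\<tau> * R / 2 \<ge> l"
  let ?P = "exp (- \<tau> * R) * (R / 2) * (R / (2 * \<tau>)) powr (-3/2)"
  have P: "?P \<ge> 0" using t by simp
  have e: "?P * (c / sqrt (\<tau> * R / 2)) = 2 * c * (exp (- \<tau> * R) * \<tau> / R)" for c
  proof -
   have "?P * (c / sqrt (\<tau> * R / 2)) = exp (- \<tau> * R) * c * ((R / 2) * (R / (2 * \<tau>)) powr (-3/2) / sqrt (\<tau> * R / 2))" by simp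
   then show ?thesis unfolding E[OF t(1,2)] by simp
  qed
  show "2 * c1 * (exp (- \<tau> * R) * \<tau> / R) \<le> NN \<tau> R"
   unfolding e[symmetric] NN_eq[OF t(1,2)] using c(4)[OF t(3)] P by (rule mult_left_mono)
  show "NN \<tau> R \<le> 2 * c2 * (exp (- \<tau> * R) * \<tau> / R)"
   unfolding e[symmetric] NN_eq[OF t(1,2)] using c(5)[OF t(3)] P by (rule mult_left_mono)
 qed (use c in auto)
qed

text \<open>Common frame for both potentials: the backward one uses q s = y (t - s) and no phase,
  the forward one q s = y (t + s) with omega s = rho (t + s) - rho t. Estimates that involve the
  curve only through L and mu are automatically uniform in t.\<close>

definition curve_data :: "real \<Rightarrow> real \<Rightarrow> (real \<Rightarrow> real^3) \<Rightarrow> (real \<Rightarrow> real) \<Rightarrow> bool" where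
 "curve_data L \<mu> q \<omega> \<longleftrightarrow> L \<ge> 0 \<and> \<mu> \<ge> 0 \<and> (\<forall>s s'. norm (q s - q s') \<le> L * \<bar>s - s'\<bar>) \<and>
   (\<forall>s s'. \<bar>\<omega> s - \<omega> s'\<bar> \<le> \<mu> * \<bar>s - s'\<bar>) \<and> \<omega> 0 = 0"

definition pker :: "real \<Rightarrow> (real \<Rightarrow> real) \<Rightarrow> (real \<Rightarrow> real^3) \<Rightarrow> real^3 \<Rightarrow> real \<Rightarrow> real" where
 "pker \<tau> \<omega> q x s = indicator {0<..} s *
   (exp (- \<tau>\<^sup>2 * s - \<tau> * \<omega> s) * exp (- ((norm (x - q s))\<^sup>2) / (4 * s)) * s powr (-3/2))"

definition pot :: "real \<Rightarrow> (real \<Rightarrow> real) \<Rightarrow> (real \<Rightarrow> real^3) \<Rightarrow> real^3 \<Rightarrow> real" where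
 "pot \<tau> \<omega> q x = (LBINT s. pker \<tau> \<omega> q x s)"

text \<open>Minus the gradient of \<open>pot\<close>, see \<open>pot_has_derivative\<close>; with
  this sign it points away from the source when the source rests.\<close>

definition gpot :: "real \<Rightarrow> (real \<Rightarrow> real) \<Rightarrow> (real \<Rightarrow> real^3) \<Rightarrow> real^3 \<Rightarrow> real^3" where
 "gpot \<tau> \<omega> q x = (LBINT s. (pker \<tau> \<omega> q x s / (2 * s)) *\<^sub>R (x - q s))"

lemma curve_data_measurable:
 assumes "curve_data L \<mu> q \<omega>"
 shows "q \<in> borel_measurable borel" "\<omega> \<in> borel_measurable borel"
proof -
 have "L-lipschitz_on UNIV q" using assms by (intro lipschitz_onI) (auto simp: curve_data_def dist_norm)
 then show "q \<in> borel_measurable borel" by (intro borel_measurable_continuous_onI lipschitz_on_continuous_on)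
 have "\<mu>-lipschitz_on UNIV \<omega>" using assms by (intro lipschitz_onI) (auto simp: curve_data_def dist_norm)
 then show "\<omega> \<in> borel_measurable borel" by (intro borel_measurable_continuous_onI lipschitz_on_continuous_on)
qed

lemma curve_data_bounds:
 assumes c: "curve_data L \<mu> q \<omega>" and s: "s \<ge> 0"
 shows "norm (q 0 - q s) \<le> L * s" "\<bar>\<omega> s\<bar> \<le> \<mu> * s"
proof -
 have "norm (q 0 - q s) \<le> L * \<bar>0 - s\<bar>" "\<bar>\<omega> s - \<omega> 0\<bar> \<le> \<mu> * \<bar>s - 0\<bar>" "\<omega> 0 = 0"
  using c unfolding curve_data_def by blast+
 then show "norm (q 0 - q s) \<le> L * s" "\<bar>\<omega> s\<bar> \<le> \<mu> * s" using s by auto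
qed

lemma pker_measurable [measurable]:
 assumes [measurable]: "q \<in> borel_measurable borel" "\<omega> \<in> borel_measurable borel"
 shows "pker \<tau> \<omega> q x \<in> borel_measurable borel"
 unfolding pker_def by measurable

lemma pker_nonneg: "pker \<tau> \<omega> q x s \<ge> 0" by (simp add: pker_def)

text \<open>From |x - q s| >= R1 - L s follows |x - q s|^2 >= R1^2 - 2 R1 L s; if R1 < L s, the
  right side is at most 0. After division by 4 s the motion of the source costs only the constant
  factor exp (R1 L / 2), and the Gaussian damping at small s survives.\<close>

lemma pker_bound:
 assumes c: "curve_data L \<mu> q \<omega>" and \<tau>: "\<tau> \<ge> 0" and s: "s > 0" and R: "R1 \<ge> 0" "R1 \<le> norm (x - q 0)"
 shows "pker \<tau> \<omega> q x s \<le> exp (R1 * L / 2) * (exp (- (\<tau>\<^sup>2 - \<tau> * \<mu>) * s) * exp (- (R1\<^sup>2 / 4) / s)) * s powr (-3/2)"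
proof -
 note cb = curve_data_bounds[OF c less_imp_le[OF s]]
 have L: "L \<ge> 0" using c by (simp add: curve_data_def)
 have "norm (x - q 0) \<le> norm (x - q s) + norm (q 0 - q s)"
  using norm_triangle_ineq4[of "x - q s" "q 0 - q s"] by simp
 then have d: "R1 - L * s \<le> norm (x - q s)" using cb(1) R by linarith
 have "R1\<^sup>2 - 2 * R1 * L * s \<le> (norm (x - q s))\<^sup>2"
 proof (cases "R1 - L * s \<ge> 0")
  case True
  have "(R1 - L * s)\<^sup>2 \<le> (norm (x - q s))\<^sup>2" using d True by (intro power_mono) auto
  moreover have "(R1 - L * s)\<^sup>2 = R1\<^sup>2 - 2 * R1 * L * s + (L * s)\<^sup>2" by (simp add: power2_diff)
  moreover have "(L * s)\<^sup>2 \<ge> 0" by simp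
  ultimately show ?thesis by linarith
 next
  case False
  then have "R1 * R1 \<le> R1 * (L * s)" using R by (intro mult_left_mono) auto
  moreover have "0 \<le> R1 * (L * s)" using R L s by simp
  ultimately have "R1\<^sup>2 - 2 * R1 * L * s \<le> 0" by (simp add: power2_eq_square)
  then show ?thesis by (smt (verit) zero_le_power2)
 qed
 then have "(R1\<^sup>2 - 2 * R1 * L * s) / (4 * s) \<le> (norm (x - q s))\<^sup>2 / (4 * s)" using s by (intro divide_right_mono) auto
 moreover have "(R1\<^sup>2 - 2 * R1 * L * s) / (4 * s) = (R1\<^sup>2 / 4) / s - R1 * L / 2" using s by (simp add: field_simps)
 ultimately have 1: "- ((norm (x - q s))\<^sup>2) / (4 * s) \<le> R1 * L / 2 + - (R1\<^sup>2 / 4) / s" by simp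
 have "\<tau> * \<bar>\<omega> s\<bar> \<le> \<tau> * (\<mu> * s)" using cb(2) \<tau> by (rule mult_left_mono)
 moreover have "\<tau> * - \<omega> s \<le> \<tau> * \<bar>\<omega> s\<bar>" using \<tau> by (intro mult_left_mono) auto
 ultimately have 2: "- \<tau>\<^sup>2 * s - \<tau> * \<omega> s \<le> - (\<tau>\<^sup>2 - \<tau> * \<mu>) * s" by (simp add: algebra_simps)
 have "exp (- \<tau>\<^sup>2 * s - \<tau> * \<omega> s) * exp (- ((norm (x - q s))\<^sup>2) / (4 * s))
   \<le> exp (- (\<tau>\<^sup>2 - \<tau> * \<mu>) * s) * exp (R1 * L / 2 + - (R1\<^sup>2 / 4) / s)"
  using 1 2 by (intro mult_mono) (simp_all only: exp_le_cancel_iff exp_ge_zero)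
 also have "\<dots> = exp (R1 * L / 2) * (exp (- (\<tau>\<^sup>2 - \<tau> * \<mu>) * s) * exp (- (R1\<^sup>2 / 4) / s))"
  by (simp only: exp_add mult_ac)
 finally have "exp (- \<tau>\<^sup>2 * s - \<tau> * \<omega> s) * exp (- ((norm (x - q s))\<^sup>2) / (4 * s)) * s powr (-3/2)
  \<le> exp (R1 * L / 2) * (exp (- (\<tau>\<^sup>2 - \<tau> * \<mu>) * s) * exp (- (R1\<^sup>2 / 4) / s)) * s powr (-3/2)"
  by (rule mult_right_mono) simp
 then show ?thesis using s by (simp add: pker_def)
qed

lemma pker_dominated:
 assumes c: "curve_data L \<mu> q \<omega>" and \<tau>: "\<tau> > \<mu>" "\<tau> > 0" and R1: "R1 > 0"
 obtains g where "integrable lborel g"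
  "\<And>x s. R1 \<le> norm (x - q 0) \<Longrightarrow> pker \<tau> \<omega> q x s \<le> g s"
  "\<And>x s. R1 \<le> norm (x - q 0) \<Longrightarrow> norm (x - q 0) \<le> R2 \<Longrightarrow> pker \<tau> \<omega> q x s / (2 * s) * norm (x - q s) \<le> g s"
proof -
 define a where "a = \<tau>\<^sup>2 - \<tau> * \<mu>"
 have a: "a > 0" using \<tau> by (simp add: a_def power2_eq_square)
 define b where "b = R1\<^sup>2 / 4"
 have b: "b > 0" using R1 by (simp add: b_def)
 have L: "L \<ge> 0" using c by (simp add: curve_data_def)
 define I where "I p s = indicator {0<..} s * (exp (- a * s) * (exp (- b / s) * s powr (- p)))" for p s :: real
 have iI: "integrable lborel (I p)" if "p > 0" for p
  unfolding I_def using integrable_exp_exp_powr[OF a b that] .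
 have I0: "I p s \<ge> 0" for p s by (simp add: I_def)
 define E where "E = exp (R1 * L / 2)"
 have E: "E > 0" by (simp add: E_def)
 have pb: "pker \<tau> \<omega> q x s \<le> E * I (3/2) s" if "R1 \<le> norm (x - q 0)" for x s
 proof (cases "s > 0")
  case True
  from pker_bound[OF c less_imp_le[OF \<tau>(2)] True less_imp_le[OF R1] that] True show ?thesis
   by (simp add: I_def E_def a_def b_def mult_ac)
 next
  case False then show ?thesis using E I0 by (simp add: pker_def)
 qed
 define g where "g s = E * I (3/2) s + E * (\<bar>R2\<bar> * I (5/2) s + L * I (3/2) s)" for s
 show thesis
 proof (rule that[of g])
  show "integrable lborel g" unfolding g_def
   using iI[of "3/2"] iI[of "5/2"] by simp
  fix x s assume R: "R1 \<le> norm (x - q 0)"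
  have g2: "0 \<le> E * (\<bar>R2\<bar> * I (5/2) s + L * I (3/2) s)" using E L I0 by simp
  show "pker \<tau> \<omega> q x s \<le> g s" using pb[OF R, of s] g2 by (simp add: g_def)
  assume R': "norm (x - q 0) \<le> R2"
  show "pker \<tau> \<omega> q x s / (2 * s) * norm (x - q s) \<le> g s"
  proof (cases "s > 0")
   case True
   have "norm (x - q s) \<le> norm (x - q 0) + norm (q 0 - q s)"
    using norm_triangle_ineq[of "x - q 0" "q 0 - q s"] by simp
   then have n: "norm (x - q s) \<le> \<bar>R2\<bar> + L * s" using R' curve_data_bounds(1)[OF c less_imp_le[OF True]] by linarith
   have p5: "I (3/2) s / s = I (5/2) s"
   proof -
    have "s powr (-5/2) = s powr (-3/2) * s powr (-1)" by (simp only: powr_add[symmetric]) simp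
    also have "s powr (-1) = 1 / s" using powr_neg_one[OF True] .
    finally show ?thesis by (simp add: I_def)
   qed
   have "pker \<tau> \<omega> q x s / (2 * s) * norm (x - q s) \<le> (E * I (3/2) s) / (2 * s) * (\<bar>R2\<bar> + L * s)"
    using pb[OF R, of s] n True E I0 by (intro mult_mono divide_right_mono) (auto simp: pker_nonneg)
   also have "\<dots> = (1/2) * (E * (\<bar>R2\<bar> * (I (3/2) s / s) + L * I (3/2) s))"
    using True by (simp add: field_simps)
   also have "\<dots> = (1/2) * (E * (\<bar>R2\<bar> * I (5/2) s + L * I (3/2) s))" unfolding p5 ..
   also have "\<dots> \<le> E * (\<bar>R2\<bar> * I (5/2) s + L * I (3/2) s)" using g2 by simp
   also have "\<dots> \<le> g s" using E I0 by (simp add: g_def)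
   finally show ?thesis .
  next
   case False
   then have "pker \<tau> \<omega> q x s / (2 * s) * norm (x - q s) = 0" by (simp add: pker_def)
   moreover have "g s \<ge> 0" using g2 E I0[of "3/2" s] by (simp add: g_def)
   ultimately show ?thesis by linarith
  qed
 qed
qed

lemma gpot_integrable:
 assumes c: "curve_data L \<mu> q \<omega>" and \<tau>: "\<tau> > \<mu>" "\<tau> > 0" and x: "x \<noteq> q 0"
 shows "integrable lborel (\<lambda>s. (pker \<tau> \<omega> q x s / (2 * s)) *\<^sub>R (x - q s))" "integrable lborel (pker \<tau> \<omega> q x)"
proof -
 note [measurable] = curve_data_measurable[OF c]
 have R1: "norm (x - q 0) > 0" using x by simp
 obtain g where g: "integrable lborel g"
  "\<And>s. pker \<tau> \<omega> q x s \<le> g s" "\<And>s. pker \<tau> \<omega> q x s / (2 * s) * norm (x - q s) \<le> g s"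
  using pker_dominated[OF c \<tau> R1] by (metis order_refl)
 have nn: "0 \<le> pker \<tau> \<omega> q x s / (2 * s)" for s by (cases "s > 0") (auto simp: pker_nonneg pker_def)
 show "integrable lborel (\<lambda>s. (pker \<tau> \<omega> q x s / (2 * s)) *\<^sub>R (x - q s))"
 proof (rule Bochner_Integration.integrable_bound[OF g(1)])
  show "AE s in lborel. norm ((pker \<tau> \<omega> q x s / (2 * s)) *\<^sub>R (x - q s)) \<le> norm (g s)"
  proof (rule AE_I2)
   fix s
   have "norm ((pker \<tau> \<omega> q x s / (2 * s)) *\<^sub>R (x - q s)) = pker \<tau> \<omega> q x s / (2 * s) * norm (x - q s)"
    unfolding norm_scaleR abs_of_nonneg[OF nn] ..
   then show "norm ((pker \<tau> \<omega> q x s / (2 * s)) *\<^sub>R (x - q s)) \<le> norm (g s)" using g(3)[of s] by simp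
  qed
 qed measurable
 show "integrable lborel (pker \<tau> \<omega> q x)"
 proof (rule Bochner_Integration.integrable_bound[OF g(1)])
  show "AE s in lborel. norm (pker \<tau> \<omega> q x s) \<le> norm (g s)"
   using g(2) by (intro AE_I2) (simp add: abs_of_nonneg[OF pker_nonneg] order_trans[OF _ abs_ge_self])
 qed measurable
qed

lemma pot_has_derivative:
 assumes c: "curve_data L \<mu> q \<omega>" and \<tau>: "\<tau> > \<mu>" "\<tau> > 0" and x: "x \<noteq> q 0"
 shows "(pot \<tau> \<omega> q has_derivative (\<lambda>v. - (gpot \<tau> \<omega> q x \<bullet> v))) (at x)"
proof -
 note [measurable] = curve_data_measurable[OF c]
 define R where "R = norm (x - q 0)"
 have R: "R > 0" using x by (simp add: R_def)
 have R2: "R / 2 > 0" using R by simp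
 obtain g where g: "integrable lborel g"
  "\<And>z s. R / 2 \<le> norm (z - q 0) \<Longrightarrow> pker \<tau> \<omega> q z s \<le> g s"
  "\<And>z s. R / 2 \<le> norm (z - q 0) \<Longrightarrow> norm (z - q 0) \<le> 2 * R \<Longrightarrow> pker \<tau> \<omega> q z s / (2 * s) * norm (z - q s) \<le> g s"
  using pker_dominated[OF c \<tau> R2] by blast
 have nn: "0 \<le> pker \<tau> \<omega> q z s / (2 * s)" for z s by (cases "s > 0") (auto simp: pker_nonneg pker_def)
 have z: "R / 2 \<le> norm (z - q 0)" "norm (z - q 0) \<le> 2 * R" if "z \<in> ball x (R / 2)" for z
 proof -
  have "norm (x - z) < R / 2" using that by (simp add: dist_norm)
  moreover have "norm (x - q 0) \<le> norm (x - z) + norm (z - q 0)" using norm_triangle_ineq[of "x - z" "z - q 0"] by simp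
  moreover have "norm (z - q 0) \<le> norm (x - z) + norm (x - q 0)" using norm_triangle_ineq4[of "x - q 0" "x - z"] by simp
  ultimately show "R / 2 \<le> norm (z - q 0)" "norm (z - q 0) \<le> 2 * R" unfolding R_def[symmetric] by auto
 qed
 let ?d = "\<lambda>s z v. - (pker \<tau> \<omega> q z s / (2 * s) * ((z - q s) \<bullet> v))"
 have "((\<lambda>z. LBINT s. pker \<tau> \<omega> q z s) has_derivative (\<lambda>v. LBINT s. ?d s x v)) (at x)"
 proof (rule has_derivative_integral_dominated(1)[where U = "ball x (R / 2)" and g = g])
  show "((\<lambda>z. pker \<tau> \<omega> q z s) has_derivative ?d s z) (at z)" for s z
  proof (cases "s > 0")
   case True
   have "((\<lambda>z. exp (- ((z - q s) \<bullet> (z - q s)) / (4 * s))) has_derivative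
     (\<lambda>v. exp (- ((z - q s) \<bullet> (z - q s)) / (4 * s)) * (- (2 * ((z - q s) \<bullet> v)) / (4 * s)))) (at z)"
    using True by (auto intro!: derivative_eq_intros simp: inner_commute)
   from has_derivative_mult_right[OF this, of "exp (- \<tau>\<^sup>2 * s - \<tau> * \<omega> s) * s powr (-3/2)"] True
   show ?thesis unfolding pker_def power2_norm_eq_inner by (simp add: mult_ac)
  qed (simp add: pker_def)
  show "integrable lborel (pker \<tau> \<omega> q z)" if "z \<in> ball x (R / 2)" for z
   using z(1)[OF that] R2 by (intro gpot_integrable(2)[OF c \<tau>]) auto
  show "\<bar>?d s z v\<bar> \<le> g s * norm v" if "z \<in> ball x (R / 2)" for s z v
  proof -
   have "\<bar>?d s z v\<bar> = pker \<tau> \<omega> q z s / (2 * s) * \<bar>(z - q s) \<bullet> v\<bar>"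
    unfolding abs_minus_cancel abs_mult abs_of_nonneg[OF nn] ..
   also have "\<dots> \<le> pker \<tau> \<omega> q z s / (2 * s) * (norm (z - q s) * norm v)"
    by (rule mult_left_mono[OF Cauchy_Schwarz_ineq2 nn])
   also have "\<dots> = (pker \<tau> \<omega> q z s / (2 * s) * norm (z - q s)) * norm v" by simp
   also have "\<dots> \<le> g s * norm v" using g(3)[OF z[OF that]] by (rule mult_right_mono) simp
   finally show ?thesis .
  qed
  show "(\<lambda>s. ?d s x v) \<in> borel_measurable lborel" for v by measurable
 qed (use R g(1) in auto)
 moreover have "(LBINT s. ?d s x v) = - (gpot \<tau> \<omega> q x \<bullet> v)" for v
 proof -
  have "gpot \<tau> \<omega> q x \<bullet> v = (LBINT s. ((pker \<tau> \<omega> q x s / (2 * s)) *\<^sub>R (x - q s)) \<bullet> v)"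
   unfolding gpot_def by (rule integral_inner_left[symmetric]) (rule gpot_integrable(1)[OF c \<tau> x])
  then show ?thesis by simp
 qed
 ultimately show ?thesis unfolding pot_def[abs_def] by simp
qed

lemma grad_cmult_pot:
 assumes c: "curve_data L \<mu> q \<omega>" and \<tau>: "\<tau> > \<mu>" "\<tau> > 0" and x: "x \<noteq> q 0"
 shows "grad (\<lambda>x. a * pot \<tau> \<omega> q x) x = - a *\<^sub>R gpot \<tau> \<omega> q x"
proof -
 have "((\<lambda>x. a * pot \<tau> \<omega> q x) has_derivative (\<lambda>v. a * - (gpot \<tau> \<omega> q x \<bullet> v))) (at x)"
  by (rule has_derivative_mult_right[OF pot_has_derivative[OF assms]])
 then show ?thesis by (simp add: grad_def frechet_derivative_eqI vec_eq_iff inner_axis)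
qed

lemma exp_near_one: "\<bar>d\<bar> \<le> 1 \<Longrightarrow> \<bar>exp d - 1\<bar> \<le> 2 * \<bar>d\<bar>" for d :: real
proof (cases "d \<ge> 0")
 case True
 assume "\<bar>d\<bar> \<le> 1"
 then have "exp d \<le> 1 + d + d\<^sup>2" using True by (intro exp_bound) auto
 moreover have "d\<^sup>2 \<le> d" using True \<open>\<bar>d\<bar> \<le> 1\<close> by (simp add: power2_eq_square mult_left_le)
 ultimately show ?thesis using True by simp
next
 case False
 then have "\<bar>d\<bar> = - d" "exp d \<le> 1" by auto
 then show ?thesis using exp_ge_add_one_self[of d] False by linarith
qed

text \<open>The mean velocity (q 0 - q s) / s of a Lipschitz curve need not converge as s
  \<rightarrow> 0, but it varies slowly relative to s: between s0 r and s0 it changes by at most 2 L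
  |r - 1| / r. This replaces differentiability at the saddle point.\<close>

lemma difference_slope:
 fixes q :: "real \<Rightarrow> real^3"
 assumes q: "\<And>s s'. norm (q s - q s') \<le> L * \<bar>s - s'\<bar>" and s: "s > 0" "s0 > 0"
 shows "norm ((1 / s) *\<^sub>R (q 0 - q s) - (1 / s0) *\<^sub>R (q 0 - q s0)) \<le> 2 * L * \<bar>s - s0\<bar> / s"
  and "norm ((1 / s) *\<^sub>R (q 0 - q s) - (1 / s0) *\<^sub>R (q 0 - q s0)) \<le> 2 * L"
proof -
 have e: "(1 / s) *\<^sub>R (q 0 - q s) - (1 / s0) *\<^sub>R (q 0 - q s0) = (1 / s) *\<^sub>R (q s0 - q s) + (1 / s - 1 / s0) *\<^sub>R (q 0 - q s0)"
  by (simp add: algebra_simps)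
 have n1: "norm ((1 / s) *\<^sub>R (q s0 - q s)) \<le> (1 / s) * (L * \<bar>s - s0\<bar>)"
  using q[of s0 s] s by (simp add: abs_minus_commute divide_right_mono)
 have "norm ((1 / s - 1 / s0) *\<^sub>R (q 0 - q s0)) \<le> \<bar>1 / s - 1 / s0\<bar> * (L * s0)"
  using q[of 0 s0] s by (simp add: mult_left_mono)
 also have "\<bar>1 / s - 1 / s0\<bar> = \<bar>s - s0\<bar> / (s * s0)"
 proof -
  have "1 / s - 1 / s0 = (s0 - s) / (s * s0)" using s by (simp add: field_simps)
  then show ?thesis using s by (simp add: abs_minus_commute)
 qed
 also have "\<bar>s - s0\<bar> / (s * s0) * (L * s0) = (1 / s) * (L * \<bar>s - s0\<bar>)" using s by simp
 finally have n2: "norm ((1 / s - 1 / s0) *\<^sub>R (q 0 - q s0)) \<le> (1 / s) * (L * \<bar>s - s0\<bar>)" .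
 have "norm ((1 / s) *\<^sub>R (q 0 - q s) - (1 / s0) *\<^sub>R (q 0 - q s0)) \<le> (1 / s) * (L * \<bar>s - s0\<bar>) + (1 / s) * (L * \<bar>s - s0\<bar>)"
  unfolding e using n1 n2 by (intro order_trans[OF norm_triangle_ineq] add_mono)
 then show "norm ((1 / s) *\<^sub>R (q 0 - q s) - (1 / s0) *\<^sub>R (q 0 - q s0)) \<le> 2 * L * \<bar>s - s0\<bar> / s" by simp
 have "norm ((1 / r) *\<^sub>R (q 0 - q r)) \<le> L" if "r > 0" for r
  using q[of 0 r] that by (simp add: divide_le_eq)
 from this[OF s(1)] this[OF s(2)]
 show "norm ((1 / s) *\<^sub>R (q 0 - q s) - (1 / s0) *\<^sub>R (q 0 - q s0)) \<le> 2 * L"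
  using norm_triangle_ineq4[of "(1 / s) *\<^sub>R (q 0 - q s)" "(1 / s0) *\<^sub>R (q 0 - q s0)"] by linarith
qed


text \<open>Expanding |x - q s|^2 about R^2 factors the integrand into the kernel at rest and exp
  (theta s) V s. The quantity Theta is theta at the saddle point s0 without its quadratic term, and
  e replaces V. The relative error H is small near s0 by \<open>difference_slope\<close> and grows
  at most exponentially elsewhere, so \<open>kker_concentration\<close> applies. Since lam0 there
  does not depend on h, tau0 depends neither on the curve nor on the point.\<close>

lemma gpot_asymptotics:
 assumes \<delta>: "\<delta> > 0" and L: "L \<ge> 0" and \<mu>: "\<mu> \<ge> 0" and \<epsilon>: "\<epsilon> > 0" and Rm: "Rm > 0"
 shows "\<exists>\<tau>0\<ge>1. \<tau>0 > \<mu> \<and> (\<forall>\<tau>\<ge>\<tau>0. \<forall>q \<omega> x R \<Theta>. curve_data L \<mu> q \<omega> \<and> R = norm (x - q 0) \<and> \<delta> \<le> R \<and> R \<le> Rm \<and>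
   \<Theta> = - \<tau> * \<omega> (R / (2 * \<tau>)) - \<tau> * (sgn (x - q 0) \<bullet> (q 0 - q (R / (2 * \<tau>)))) \<longrightarrow>
   norm (gpot \<tau> \<omega> q x - (exp \<Theta> * NN \<tau> R) *\<^sub>R sgn (x - q 0)) \<le> \<epsilon> * (exp \<Theta> * NN \<tau> R))"
proof -
 \<comment> \<open>Collects phase, mean velocity and quadratic term in |theta (s0 r) - Theta| <= A0
   (1 + r); A adds the linear growth of V, estimated by exp (L r).\<close>
 define A0 where "A0 = \<mu> * Rm / 2 + Rm * L + L\<^sup>2 * Rm / 8"
 have A0: "A0 \<ge> 0" using L \<mu> Rm by (simp add: A0_def)
 define A where "A = A0 + L"
 define B where "B = 2 * exp A0"
 have A: "A \<ge> 0" and B: "B \<ge> 0" using A0 L by (auto simp: A_def B_def)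
 \<comment> \<open>Near the saddle point, for |r - 1| <= eta, phase and mean velocity together
   contribute at most c eta; eta is then chosen to make this epsilon1 / 16.\<close>
 define c where "c = \<mu> * Rm / 2 + 2 * Rm * L + 1"
 have c: "c \<ge> 1" using L \<mu> Rm by (simp add: c_def)
 define \<epsilon>1 where "\<epsilon>1 = min \<epsilon> 1"
 have \<epsilon>1: "\<epsilon>1 > 0" "\<epsilon>1 \<le> 1" "\<epsilon>1 \<le> \<epsilon>" using \<epsilon> by (auto simp: \<epsilon>1_def)
 define \<eta> where "\<eta> = \<epsilon>1 / (16 * c)"
 have \<eta>: "\<eta> > 0" using \<epsilon>1 c by (simp add: \<eta>_def)
 have \<eta>2: "\<eta> \<le> 1/2"
 proof -
  have "\<epsilon>1 / (16 * c) \<le> 1 / 2" using \<epsilon>1 c by (simp add: divide_le_eq)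
  then show ?thesis by (simp add: \<eta>_def)
 qed
 have c\<eta>: "c * \<eta> = \<epsilon>1 / 16" using c by (simp add: \<eta>_def)
 obtain lam0 where lam0: "lam0 \<ge> A + 1" "\<And>lam h. lam \<ge> lam0 \<Longrightarrow> h \<in> borel_measurable borel \<Longrightarrow> (\<And>r. r > 0 \<Longrightarrow> 0 \<le> h r \<and> h r \<le> B * exp (A * r)) \<Longrightarrow>
   (\<And>r. r > 0 \<Longrightarrow> \<bar>r - 1\<bar> \<le> \<eta> \<Longrightarrow> h r \<le> \<epsilon>1 / 2) \<Longrightarrow>
   integrable lborel (\<lambda>r. kker lam r * h r) \<and> (LBINT r. kker lam r * h r) \<le> 2 * (\<epsilon>1 / 2) * ZZ lam"
  using kker_concentration[OF A B, of "\<epsilon>1 / 2" \<eta>] \<epsilon>1 \<eta> by auto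
 \<comment> \<open>After 1, the entries ensure convergence of the integrals, the condition tau R / 2
   >= lam0, smallness of the quadratic term of theta and smallness of the deviation of V from
   e.\<close>
 define \<tau>0 where "\<tau>0 = Max {1, \<mu> + 1, 2 * lam0 / \<delta>, 16 * (L\<^sup>2 * Rm + 1) / \<epsilon>1, 16 * (L + 1) / \<epsilon>1}"
 have \<tau>0: "1 \<le> \<tau>0" "\<mu> + 1 \<le> \<tau>0" "2 * lam0 / \<delta> \<le> \<tau>0" "16 * (L\<^sup>2 * Rm + 1) / \<epsilon>1 \<le> \<tau>0" "16 * (L + 1) / \<epsilon>1 \<le> \<tau>0"
  by (auto simp: \<tau>0_def)
 show ?thesis
 proof (intro exI[of _ \<tau>0] conjI allI impI; (elim conjE)?)
  show "1 \<le> \<tau>0" "\<mu> < \<tau>0" using \<tau>0 by auto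
  fix \<tau> q \<omega> x R \<Theta>
  assume \<tau>: "\<tau>0 \<le> \<tau>" and cd: "curve_data L \<mu> q \<omega>" and R_def: "R = norm (x - q 0)" and R: "\<delta> \<le> R" "R \<le> Rm"
   and \<Theta>: "\<Theta> = - \<tau> * \<omega> (R / (2 * \<tau>)) - \<tau> * (sgn (x - q 0) \<bullet> (q 0 - q (R / (2 * \<tau>))))"
  note [measurable] = curve_data_measurable[OF cd]
  have q: "\<And>s s'. norm (q s - q s') \<le> L * \<bar>s - s'\<bar>" and \<omega>: "\<And>s s'. \<bar>\<omega> s - \<omega> s'\<bar> \<le> \<mu> * \<bar>s - s'\<bar>"
   using cd by (auto simp: curve_data_def)
  have t1: "\<tau> \<ge> 1" "\<tau> > \<mu>" "\<tau> > 0" using \<tau> \<tau>0 by auto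
  have R0: "R > 0" using R \<delta> by simp
  have lam: "\<tau> * R / 2 \<ge> lam0"
  proof -
   have "2 * lam0 / \<delta> * \<delta> \<le> \<tau> * R" using \<tau> \<tau>0(3) R t1 \<delta> by (intro mult_mono) auto
   then show ?thesis using \<delta> by simp
  qed
  have small: "L\<^sup>2 * Rm / \<tau> \<le> \<epsilon>1 / 16" "L / \<tau> \<le> \<epsilon>1 / 16"
  proof -
   have "16 * (L\<^sup>2 * Rm + 1) \<le> \<tau> * \<epsilon>1" "16 * (L + 1) \<le> \<tau> * \<epsilon>1"
    using order_trans[OF \<tau>0(4) \<tau>] order_trans[OF \<tau>0(5) \<tau>] \<epsilon>1 by (auto simp: divide_le_eq)
   then show "L\<^sup>2 * Rm / \<tau> \<le> \<epsilon>1 / 16" "L / \<tau> \<le> \<epsilon>1 / 16" using t1 by (auto simp: divide_le_eq mult.commute)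
  qed
  define e where "e = sgn (x - q 0)"
  have e: "norm e = 1" "x - q 0 = R *\<^sub>R e" using R0 by (auto simp: e_def R_def norm_sgn sgn_div_norm)
  define s0 where "s0 = R / (2 * \<tau>)"
  have s0: "s0 > 0" using R0 t1 by (simp add: s0_def)
  have x0: "x \<noteq> q 0" using R0 R_def by auto
  define \<theta> where "\<theta> s = - \<tau> * \<omega> s - (R / 2) * (e \<bullet> ((1 / s) *\<^sub>R (q 0 - q s))) - (norm (q 0 - q s))\<^sup>2 / (4 * s)" for s
  define V where "V s = e + (1 / R) *\<^sub>R (q 0 - q s)" for s
  define H where "H s = norm (exp (\<theta> s - \<Theta>) *\<^sub>R V s - e)" for s
  \<comment> \<open>Uses tau = R / (2 s0), which brings Theta into the shape of theta at s0.\<close>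
  have \<Theta>': "\<Theta> = - \<tau> * \<omega> s0 - (R / 2) * (e \<bullet> ((1 / s0) *\<^sub>R (q 0 - q s0)))"
   unfolding \<Theta> e_def[symmetric] s0_def[symmetric] using R0 t1 by (simp add: s0_def)
  have integrand: "(pker \<tau> \<omega> q x s / (2 * s)) *\<^sub>R (x - q s) = mker \<tau> R s *\<^sub>R (exp (\<theta> s) *\<^sub>R V s)" for s
  proof (cases "s > 0")
   case True
   have xq: "x - q s = R *\<^sub>R V s" using e(2) R0 by (simp add: V_def scaleR_add_right algebra_simps)
   have "(norm (x - q s))\<^sup>2 = (norm (R *\<^sub>R e + (q 0 - q s)))\<^sup>2" using e(2) by (metis add.commute diff_add_cancel diff_add_eq)
   also have "\<dots> = R\<^sup>2 + 2 * (R * (e \<bullet> (q 0 - q s))) + (norm (q 0 - q s))\<^sup>2"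
    using e(1)[unfolded norm_eq_1] unfolding power2_norm_eq_inner
    by (simp add: inner_add_left inner_add_right inner_commute power2_eq_square[of R])
   finally have n: "(norm (x - q s))\<^sup>2 = R\<^sup>2 + 2 * (R * (e \<bullet> (q 0 - q s))) + (norm (q 0 - q s))\<^sup>2" .
   have "(- \<tau>\<^sup>2 * s - \<tau> * \<omega> s) + - ((norm (x - q s))\<^sup>2) / (4 * s) = (- \<tau>\<^sup>2 * s - R\<^sup>2 / (4 * s)) + \<theta> s"
    unfolding n \<theta>_def inner_scaleR_right using True by (simp add: field_simps)
   then have ex: "exp (- \<tau>\<^sup>2 * s - \<tau> * \<omega> s) * exp (- ((norm (x - q s))\<^sup>2) / (4 * s)) = exp (- \<tau>\<^sup>2 * s - R\<^sup>2 / (4 * s)) * exp (\<theta> s)"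
    by (simp only: exp_add[symmetric])
   have pk: "pker \<tau> \<omega> q x s = exp (- \<tau>\<^sup>2 * s - R\<^sup>2 / (4 * s)) * exp (\<theta> s) * s powr (-3/2)"
    unfolding pker_def ex using True by simp
   show ?thesis unfolding pk mker_def xq using True by (simp add: mult_ac)
  qed (simp add: pker_def mker_def)
  have gi: "integrable lborel (\<lambda>s. mker \<tau> R s *\<^sub>R (exp (\<theta> s) *\<^sub>R V s))"
   using gpot_integrable(1)[OF cd t1(2,3) x0] unfolding integrand .
  have mi: "integrable lborel (mker \<tau> R)"
   using mker_integral_scale(2)[OF t1(3) R0, of "\<lambda>_. 1"] kker_integrable0[of "\<tau> * R / 2"] lam lam0(1) A by simp
  have \<theta>m [measurable]: "\<theta> \<in> borel_measurable borel" unfolding \<theta>_def by measurable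
  have Vm [measurable]: "V \<in> borel_measurable borel" unfolding V_def by measurable
  have Hm [measurable]: "H \<in> borel_measurable borel" unfolding H_def by measurable
  have d\<theta>: "\<bar>\<theta> s - \<Theta>\<bar> \<le> \<tau> * (\<mu> * \<bar>s - s0\<bar>) + (R / 2) * norm ((1 / s) *\<^sub>R (q 0 - q s) - (1 / s0) *\<^sub>R (q 0 - q s0)) + L\<^sup>2 * s / 4" if s: "s > 0" for s
  proof -
   have "\<theta> s - \<Theta> = - (\<tau> * (\<omega> s - \<omega> s0)) - (R / 2) * (e \<bullet> ((1 / s) *\<^sub>R (q 0 - q s) - (1 / s0) *\<^sub>R (q 0 - q s0))) - (norm (q 0 - q s))\<^sup>2 / (4 * s)"
    unfolding \<theta>_def \<Theta>' inner_diff_right by (simp add: algebra_simps)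
   moreover have "\<bar>\<tau> * (\<omega> s - \<omega> s0)\<bar> \<le> \<tau> * (\<mu> * \<bar>s - s0\<bar>)"
    using \<omega>[of s s0] t1 by (simp add: abs_mult)
   moreover have "\<bar>(R / 2) * (e \<bullet> ((1 / s) *\<^sub>R (q 0 - q s) - (1 / s0) *\<^sub>R (q 0 - q s0)))\<bar>
     \<le> (R / 2) * norm ((1 / s) *\<^sub>R (q 0 - q s) - (1 / s0) *\<^sub>R (q 0 - q s0))"
   proof -
    have "\<bar>e \<bullet> ((1 / s) *\<^sub>R (q 0 - q s) - (1 / s0) *\<^sub>R (q 0 - q s0))\<bar> \<le> norm ((1 / s) *\<^sub>R (q 0 - q s) - (1 / s0) *\<^sub>R (q 0 - q s0))"
     using Cauchy_Schwarz_ineq2[of e "(1 / s) *\<^sub>R (q 0 - q s) - (1 / s0) *\<^sub>R (q 0 - q s0)"] e(1) by simp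
    from mult_left_mono[OF this, of "R / 2"] R0 show ?thesis by (simp only: abs_mult) simp
   qed
   moreover have "0 \<le> (norm (q 0 - q s))\<^sup>2 / (4 * s)" using s by simp
   moreover have "(norm (q 0 - q s))\<^sup>2 / (4 * s) \<le> L\<^sup>2 * s / 4"
   proof -
    have "(norm (q 0 - q s))\<^sup>2 \<le> (L * s)\<^sup>2" using q[of 0 s] s by (intro power_mono) auto
    then have "(norm (q 0 - q s))\<^sup>2 / (4 * s) \<le> (L * s)\<^sup>2 / (4 * s)" using s by (intro divide_right_mono) auto
    also have "(L * s)\<^sup>2 / (4 * s) = L\<^sup>2 * s / 4" using s by (simp add: power2_eq_square)
    finally show ?thesis .
   qed
   ultimately show ?thesis by linarith
  qed
  have Vn: "norm (V (s0 * r) - e) \<le> L * r / (2 * \<tau>)" if "r > 0" for r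
  proof -
   have "norm (V (s0 * r) - e) = norm (q 0 - q (s0 * r)) / R" using R0 by (simp add: V_def divide_inverse mult.commute)
   also have "\<dots> \<le> (L * (s0 * r)) / R" using q[of 0 "s0 * r"] s0 that R0 by (intro divide_right_mono) (auto simp: abs_mult)
   also have "\<dots> = L * r / (2 * \<tau>)" using R0 by (simp add: s0_def)
   finally show ?thesis .
  qed
  have dr: "\<tau> * (\<mu> * \<bar>s0 * r - s0\<bar>) \<le> \<mu> * Rm / 2 * \<bar>r - 1\<bar>" for r
  proof -
   have "s0 * r - s0 = s0 * (r - 1)" by (simp add: algebra_simps)
   then have "\<tau> * (\<mu> * \<bar>s0 * r - s0\<bar>) = \<mu> * R / 2 * \<bar>r - 1\<bar>" using s0 t1 R0 by (simp add: abs_mult s0_def)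
   also have "\<dots> \<le> \<mu> * Rm / 2 * \<bar>r - 1\<bar>" using R \<mu> by (intro mult_right_mono divide_right_mono mult_left_mono) auto
   finally show ?thesis .
  qed
  have Hb: "H (s0 * r) \<le> exp (\<theta> (s0 * r) - \<Theta>) * (L * r / (2 * \<tau>)) + \<bar>exp (\<theta> (s0 * r) - \<Theta>) - 1\<bar>" if "r > 0" for r
  proof -
   have "exp (\<theta> (s0 * r) - \<Theta>) *\<^sub>R V (s0 * r) - e = exp (\<theta> (s0 * r) - \<Theta>) *\<^sub>R (V (s0 * r) - e) + (exp (\<theta> (s0 * r) - \<Theta>) - 1) *\<^sub>R e"
    by (simp add: algebra_simps)
   then have "H (s0 * r) \<le> norm (exp (\<theta> (s0 * r) - \<Theta>) *\<^sub>R (V (s0 * r) - e)) + norm ((exp (\<theta> (s0 * r) - \<Theta>) - 1) *\<^sub>R e)"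
    unfolding H_def using norm_triangle_ineq by metis
   also have "\<dots> = exp (\<theta> (s0 * r) - \<Theta>) * norm (V (s0 * r) - e) + \<bar>exp (\<theta> (s0 * r) - \<Theta>) - 1\<bar>" using e(1) by simp
   also have "\<dots> \<le> exp (\<theta> (s0 * r) - \<Theta>) * (L * r / (2 * \<tau>)) + \<bar>exp (\<theta> (s0 * r) - \<Theta>) - 1\<bar>"
    using Vn[OF that] by (intro add_right_mono mult_left_mono) auto
   finally show ?thesis .
  qed
  have sq: "L\<^sup>2 * (s0 * r) / 4 \<le> (L\<^sup>2 * Rm / \<tau>) * r / 8" if "r > 0" for r
  proof -
   have "L\<^sup>2 * (s0 * r) / 4 = (L\<^sup>2 * R / \<tau>) * r / 8" by (simp add: s0_def)
   also have "\<dots> \<le> (L\<^sup>2 * Rm / \<tau>) * r / 8" using R t1 that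
    by (intro divide_right_mono mult_right_mono mult_left_mono) auto
   finally show ?thesis .
  qed
  have main: "integrable lborel (\<lambda>r. kker (\<tau> * R / 2) r * H (s0 * r)) \<and>
    (LBINT r. kker (\<tau> * R / 2) r * H (s0 * r)) \<le> 2 * (\<epsilon>1 / 2) * ZZ (\<tau> * R / 2)"
  proof (rule lam0(2)[OF lam])
   show "(\<lambda>r. H (s0 * r)) \<in> borel_measurable borel" by measurable
   fix r :: real assume r: "r > 0"
   have sr: "s0 * r > 0" using s0 r by simp
   show "0 \<le> H (s0 * r) \<and> H (s0 * r) \<le> B * exp (A * r)"
   proof
    show "0 \<le> H (s0 * r)" by (simp add: H_def)
    have "(R / 2) * norm ((1 / (s0 * r)) *\<^sub>R (q 0 - q (s0 * r)) - (1 / s0) *\<^sub>R (q 0 - q s0)) \<le> (Rm / 2) * (2 * L)"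
     using difference_slope(2)[OF q sr s0] R R0 L by (intro mult_mono) auto
    moreover have "(L\<^sup>2 * Rm / \<tau>) * r / 8 \<le> L\<^sup>2 * Rm / 8 * r"
    proof -
     have "L\<^sup>2 * Rm / \<tau> \<le> L\<^sup>2 * Rm / 1" using t1 Rm L by (intro divide_left_mono) auto
     from mult_right_mono[OF this, of "r / 8"] r show ?thesis by simp
    qed
    moreover have "\<mu> * Rm / 2 * \<bar>r - 1\<bar> \<le> \<mu> * Rm / 2 * (1 + r)" using \<mu> Rm r by (intro mult_left_mono) auto
    ultimately have "\<bar>\<theta> (s0 * r) - \<Theta>\<bar> \<le> \<mu> * Rm / 2 * (1 + r) + Rm * L + L\<^sup>2 * Rm / 8 * r"
     using d\<theta>[OF sr] dr[of r] sq[OF r] by linarith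
    also have "\<dots> \<le> A0 * (1 + r)"
    proof -
     have "0 \<le> Rm * L * r + L\<^sup>2 * Rm / 8" using Rm L r by simp
     moreover have "A0 * (1 + r) - (\<mu> * Rm / 2 * (1 + r) + Rm * L + L\<^sup>2 * Rm / 8 * r) = Rm * L * r + L\<^sup>2 * Rm / 8"
      by (simp add: A0_def field_simps)
     ultimately show ?thesis by linarith
    qed
    finally have dd: "\<bar>\<theta> (s0 * r) - \<Theta>\<bar> \<le> A0 * (1 + r)" .
    have E1: "exp (\<theta> (s0 * r) - \<Theta>) \<le> exp (A0 * (1 + r))" using dd by (simp add: abs_le_iff)
    have E2: "\<bar>exp (\<theta> (s0 * r) - \<Theta>) - 1\<bar> \<le> exp (A0 * (1 + r))"
    proof -
     have "1 \<le> exp (A0 * (1 + r))" using A0 r by simp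
     moreover have "exp (\<theta> (s0 * r) - \<Theta>) > 0" by simp
     ultimately show ?thesis using E1 by linarith
    qed
    have E3: "L * r / (2 * \<tau>) \<le> L * r"
    proof -
     have "L * r / (2 * \<tau>) \<le> L * r / 1" using t1 L r by (intro divide_left_mono) auto
     then show ?thesis by simp
    qed
    have "H (s0 * r) \<le> exp (A0 * (1 + r)) * (L * r) + exp (A0 * (1 + r))"
    proof -
     have "exp (\<theta> (s0 * r) - \<Theta>) * (L * r / (2 * \<tau>)) \<le> exp (A0 * (1 + r)) * (L * r)"
      using L r t1 by (intro mult_mono[OF E1 E3]) auto
     then show ?thesis using Hb[OF r] E2 by linarith
    qed
    also have "\<dots> = exp (A0 * (1 + r)) * (1 + L * r)" by (simp add: algebra_simps)
    also have "\<dots> \<le> exp (A0 * (1 + r)) * exp (L * r)" using exp_ge_add_one_self[of "L * r"] by (intro mult_left_mono) auto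
    also have "\<dots> = exp A0 * exp (A * r)" by (simp only: exp_add[symmetric]) (simp add: A_def algebra_simps)
    also have "\<dots> \<le> B * exp (A * r)" by (simp add: B_def)
    finally show "H (s0 * r) \<le> B * exp (A * r)" .
   qed
   assume r1: "\<bar>r - 1\<bar> \<le> \<eta>"
   have r2: "1/2 \<le> r" "r \<le> 2" using r1 \<eta>2 by linarith+
   have "norm ((1 / (s0 * r)) *\<^sub>R (q 0 - q (s0 * r)) - (1 / s0) *\<^sub>R (q 0 - q s0)) \<le> 2 * L * \<bar>s0 * r - s0\<bar> / (s0 * r)"
    by (rule difference_slope(1)[OF q sr s0])
   also have "\<dots> = 2 * L * \<bar>r - 1\<bar> / r"
   proof -
    have "s0 * r - s0 = s0 * (r - 1)" by (simp add: algebra_simps)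
    then show ?thesis using s0 by (simp add: abs_mult)
   qed
   also have "\<dots> \<le> 2 * L * \<eta> / (1/2)" using r1 r2 L \<eta> by (intro frac_le mult_left_mono) auto
   finally have slope: "norm ((1 / (s0 * r)) *\<^sub>R (q 0 - q (s0 * r)) - (1 / s0) *\<^sub>R (q 0 - q s0)) \<le> 4 * L * \<eta>" by simp
   have "(R / 2) * norm ((1 / (s0 * r)) *\<^sub>R (q 0 - q (s0 * r)) - (1 / s0) *\<^sub>R (q 0 - q s0)) \<le> (Rm / 2) * (4 * L * \<eta>)"
    using slope R R0 by (intro mult_mono) auto
   moreover have "\<mu> * Rm / 2 * \<bar>r - 1\<bar> \<le> \<mu> * Rm / 2 * \<eta>" using r1 \<mu> Rm by (intro mult_left_mono) auto
   moreover have "(L\<^sup>2 * Rm / \<tau>) * r / 8 \<le> (\<epsilon>1 / 16) * 2 / 8" using small(1) r2 r Rm L t1 \<epsilon>1 by (intro divide_right_mono mult_mono) auto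
   ultimately have "\<bar>\<theta> (s0 * r) - \<Theta>\<bar> \<le> \<mu> * Rm / 2 * \<eta> + (Rm / 2) * (4 * L * \<eta>) + \<epsilon>1 / 64"
    using d\<theta>[OF sr] dr[of r] sq[OF r] by linarith
   also have "\<dots> \<le> c * \<eta> + \<epsilon>1 / 64" using \<eta> by (simp add: c_def algebra_simps)
   also have "\<dots> = \<epsilon>1 / 16 + \<epsilon>1 / 64" unfolding c\<eta> ..
   finally have dd: "\<bar>\<theta> (s0 * r) - \<Theta>\<bar> \<le> \<epsilon>1 * 5 / 64" by simp
   have "\<bar>\<theta> (s0 * r) - \<Theta>\<bar> \<le> 1" using dd \<epsilon>1 by linarith
   from exp_near_one[OF this] have E2: "\<bar>exp (\<theta> (s0 * r) - \<Theta>) - 1\<bar> \<le> \<epsilon>1 * 10 / 64"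
    by (rule order_trans) (use dd in simp)
   have E1: "exp (\<theta> (s0 * r) - \<Theta>) \<le> 2" using abs_le_D1[OF E2] \<epsilon>1 by linarith
   have E3: "L * r / (2 * \<tau>) \<le> \<epsilon>1 / 16"
   proof -
    have "L * r / (2 * \<tau>) = (L / \<tau>) * (r / 2)" by simp
    also have "\<dots> \<le> (\<epsilon>1 / 16) * 1" using small(2) r2 r L t1 \<epsilon>1 by (intro mult_mono) auto
    finally show ?thesis by simp
   qed
   have E4: "exp (\<theta> (s0 * r) - \<Theta>) * (L * r / (2 * \<tau>)) \<le> 2 * (\<epsilon>1 / 16)" using E1 E3 L r t1 by (intro mult_mono) auto
   have "H (s0 * r) \<le> 2 * (\<epsilon>1 / 16) + \<epsilon>1 * 10 / 64" by (rule order_trans[OF Hb[OF r] add_mono[OF E4 E2]])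
   then show "H (s0 * r) \<le> \<epsilon>1 / 2" using \<epsilon>1 by simp
  qed
  have iH: "integrable lborel (\<lambda>s. mker \<tau> R s * H s)"
   using main unfolding s0_def by (subst mker_integral_scale(2)[OF t1(3) R0]) simp
  have NH: "(LBINT s. mker \<tau> R s * H s) \<le> \<epsilon>1 * NN \<tau> R"
  proof -
   let ?P = "exp (- \<tau> * R) * (R / 2) * (R / (2 * \<tau>)) powr (-3/2)"
   have "(LBINT s. mker \<tau> R s * H s) = ?P * (LBINT r. kker (\<tau> * R / 2) r * H (s0 * r))"
    unfolding s0_def by (rule mker_integral_scale(1)[OF t1(3) R0])
   also have "\<dots> \<le> ?P * (\<epsilon>1 * ZZ (\<tau> * R / 2))" using main R0 by (intro mult_left_mono) auto
   also have "\<dots> = \<epsilon>1 * NN \<tau> R" unfolding NN_eq[OF t1(3) R0] by simp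
   finally show ?thesis .
  qed
  have NN0: "NN \<tau> R \<ge> 0" unfolding NN_def using R0 by (intro integral_nonneg_AE) (simp add: mker_nonneg)
  have diff: "mker \<tau> R s *\<^sub>R (exp (\<theta> s) *\<^sub>R V s) - mker \<tau> R s *\<^sub>R (exp \<Theta> *\<^sub>R e) = (exp \<Theta> * mker \<tau> R s) *\<^sub>R (exp (\<theta> s - \<Theta>) *\<^sub>R V s - e)" for s
   by (simp add: exp_diff algebra_simps)
  have mi': "integrable lborel (\<lambda>s. mker \<tau> R s *\<^sub>R (exp \<Theta> *\<^sub>R e))" using mi by simp
  have "gpot \<tau> \<omega> q x - (exp \<Theta> * NN \<tau> R) *\<^sub>R e = (LBINT s. mker \<tau> R s *\<^sub>R (exp (\<theta> s) *\<^sub>R V s)) - (LBINT s. mker \<tau> R s *\<^sub>R (exp \<Theta> *\<^sub>R e))"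
   unfolding gpot_def integrand NN_def using mi by (simp add: mult.commute)
  also have "\<dots> = (LBINT s. mker \<tau> R s *\<^sub>R (exp (\<theta> s) *\<^sub>R V s) - mker \<tau> R s *\<^sub>R (exp \<Theta> *\<^sub>R e))"
   by (rule Bochner_Integration.integral_diff[OF gi mi', symmetric])
  finally have gd: "gpot \<tau> \<omega> q x - (exp \<Theta> * NN \<tau> R) *\<^sub>R e = \<dots>" .
  have "norm (gpot \<tau> \<omega> q x - (exp \<Theta> * NN \<tau> R) *\<^sub>R e) \<le> (LBINT s. norm (mker \<tau> R s *\<^sub>R (exp (\<theta> s) *\<^sub>R V s) - mker \<tau> R s *\<^sub>R (exp \<Theta> *\<^sub>R e)))"
   unfolding gd by (rule integral_norm_bound)
  also have "\<dots> = (LBINT s. exp \<Theta> * (mker \<tau> R s * H s))"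
   unfolding diff H_def using R0 by (simp add: abs_mult mker_nonneg mult.assoc)
  also have "\<dots> = exp \<Theta> * (LBINT s. mker \<tau> R s * H s)" by simp
  also have "\<dots> \<le> exp \<Theta> * (\<epsilon>1 * NN \<tau> R)" using NH by (intro mult_left_mono) auto
  also have "\<dots> \<le> exp \<Theta> * (\<epsilon> * NN \<tau> R)" using \<epsilon>1 NN0 by (intro mult_left_mono mult_right_mono) auto
  finally show "norm (gpot \<tau> \<omega> q x - (exp \<Theta> * NN \<tau> R) *\<^sub>R sgn (x - q 0)) \<le> \<epsilon> * (exp \<Theta> * NN \<tau> R)"
   by (simp add: e_def mult.left_commute)
 qed
qed

section \<open>Square integrability of the potentials\<close>

lemma nn_integral_gaussian_finite: "(\<integral>\<^sup>+u. ennreal (exp (- (u::real)\<^sup>2 / 2)) \<partial>lborel) < \<infinity>"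
proof -
 have "integrable lborel (\<lambda>u::real. exp (1/2) * exp (- \<bar>u\<bar>))" using integrable_exp_abs by simp
 then have i: "(\<integral>\<^sup>+u. ennreal (norm (exp (1/2) * exp (- \<bar>u::real\<bar>))) \<partial>lborel) < \<infinity>" by (simp only: integrable_iff_bounded)
 have "(\<integral>\<^sup>+u. ennreal (exp (- (u::real)\<^sup>2 / 2)) \<partial>lborel) \<le> (\<integral>\<^sup>+u. ennreal (norm (exp (1/2) * exp (- \<bar>u::real\<bar>))) \<partial>lborel)"
 proof (intro nn_integral_mono ennreal_leI)
  fix u :: real
  have "- u\<^sup>2 / 2 \<le> 1/2 + - \<bar>u\<bar>" using zero_le_power2[of "\<bar>u\<bar> - 1"] by (simp add: power2_diff)
  then have "exp (- u\<^sup>2 / 2) \<le> exp (1/2) * exp (- \<bar>u\<bar>)" by (simp only: exp_add[symmetric] exp_le_cancel_iff)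
  then show "exp (- u\<^sup>2 / 2) \<le> norm (exp (1/2) * exp (- \<bar>u\<bar>))" by (simp add: abs_mult)
 qed
 with i show ?thesis by (rule le_less_trans[rotated])
qed

lemma nn_integral_gaussian_3d:
 fixes c :: "real^3"
 assumes s: "s > 0"
 shows "(\<integral>\<^sup>+x. ennreal (exp (- ((norm (x - c))\<^sup>2) / (2 * s))) \<partial>lborel)
   = (ennreal (sqrt s) * (\<integral>\<^sup>+u. ennreal (exp (- (u::real)\<^sup>2 / 2)) \<partial>lborel)) ^ 3"
proof -
 have "(\<integral>\<^sup>+x. ennreal (exp (- ((norm (x - c))\<^sup>2) / (2 * s))) \<partial>lborel) = (\<integral>\<^sup>+x. ennreal (exp (- ((norm (x::real^3))\<^sup>2) / (2 * s))) \<partial>lborel)"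
  using lborel_shift_nn_integral[of "\<lambda>x. ennreal (exp (- ((norm x)\<^sup>2) / (2 * s)))" "- c"] by simp
 also have "\<dots> = (\<integral>\<^sup>+x. (\<Prod>b\<in>Basis. ennreal (exp (- ((x::real^3) \<bullet> b)\<^sup>2 / (2 * s)))) \<partial>lborel)"
 proof (rule nn_integral_cong)
  fix x :: "real^3"
  have "(norm x)\<^sup>2 = (\<Sum>b\<in>Basis. (x \<bullet> b)\<^sup>2)"
   using euclidean_inner[of x x] by (simp only: power2_norm_eq_inner) (simp add: power2_eq_square)
  then have "- ((norm x)\<^sup>2) / (2 * s) = (\<Sum>b\<in>Basis. - (x \<bullet> b)\<^sup>2 / (2 * s))"
   by (simp only: sum_negf[symmetric] sum_divide_distrib)
  then have "exp (- ((norm x)\<^sup>2) / (2 * s)) = (\<Prod>b\<in>Basis. exp (- (x \<bullet> b)\<^sup>2 / (2 * s)))" by (simp only: exp_sum finite_Basis)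
  then show "ennreal (exp (- ((norm x)\<^sup>2) / (2 * s))) = (\<Prod>b\<in>Basis. ennreal (exp (- (x \<bullet> b)\<^sup>2 / (2 * s))))"
   by (simp only: prod_ennreal[OF exp_ge_zero])
 qed
 also have "\<dots> = (\<Prod>b\<in>(Basis :: (real^3) set). (\<integral>\<^sup>+u. ennreal (exp (- u\<^sup>2 / (2 * s))) \<partial>lborel))"
  by (rule nn_integral_lborel_prod) auto
 also have "(\<integral>\<^sup>+u. ennreal (exp (- u\<^sup>2 / (2 * s))) \<partial>lborel) = ennreal (sqrt s) * (\<integral>\<^sup>+u. ennreal (exp (- (u::real)\<^sup>2 / 2)) \<partial>lborel)"
 proof -
  have "(\<integral>\<^sup>+u. ennreal (exp (- u\<^sup>2 / (2 * s))) \<partial>lborel) = ennreal \<bar>sqrt s\<bar> * (\<integral>\<^sup>+u. ennreal (exp (- (0 + sqrt s * u)\<^sup>2 / (2 * s))) \<partial>lborel)"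
   using s by (intro nn_integral_real_affine) auto
  moreover have "- (0 + sqrt s * u)\<^sup>2 / (2 * s) = - u\<^sup>2 / 2" for u using s by (simp add: power_mult_distrib)
  moreover have "\<bar>sqrt s\<bar> = sqrt s" using s by simp
  ultimately show ?thesis by (simp only:)
 qed
 finally show ?thesis by simp
qed

lemma nn_integral_exp_powr_finite:
 "(\<integral>\<^sup>+s. ennreal (indicator {0<..} s * (exp (- s) * s powr (-3/4))) \<partial>lborel) < \<infinity>"
proof -
 have "(\<integral>\<^sup>+s. ennreal (indicator {0<..} s * (exp (- s) * s powr (-3/4))) \<partial>lborel)
   \<le> (\<integral>\<^sup>+s. ennreal (indicator {0..} s * s powr (1/4 - 1) / exp s) \<partial>lborel)"
 proof (intro nn_integral_mono ennreal_leI)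
  fix s :: real
  have "exp (- s) = 1 / exp s" "(1/4 - 1 :: real) = -3/4" by (simp_all add: exp_minus inverse_eq_divide)
  then show "indicator {0<..} s * (exp (- s) * s powr (-3/4)) \<le> indicator {0..} s * s powr (1/4 - 1) / exp s"
   by (cases "s > 0") (simp_all add: indicator_def)
 qed
 also have "\<dots> = ennreal (Gamma (1/4))" using Gamma_conv_nn_integral_real[of "1/4"] by simp
 finally show ?thesis by (simp add: order.strict_trans1[OF _ ennreal_less_top])
qed

text \<open>Cauchy-Schwarz in s with s^(-3/2) = s^(-3/8) s^(-9/8). The first factor squares to the
  integrable s^(-3/4); the second squares to s^(-9/4), and the spatial Gaussian integral of order
  s^(3/2) makes this s^(-3/4) again. The bound holds across the singularity at q 0, as required at t
  = T, when the source may lie inside the domain.\<close>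

lemma pot_L2_bound:
 "\<exists>C\<ge>0. \<forall>L \<mu> q \<omega> \<tau>. curve_data L \<mu> q \<omega> \<and> \<tau> > 0 \<and> \<tau>\<^sup>2 - \<tau> * \<mu> \<ge> 1 \<longrightarrow> L2 (pot \<tau> \<omega> q) \<and> N2 (pot \<tau> \<omega> q) \<le> C"
proof -
 let ?F = "\<integral>\<^sup>+s. ennreal (indicator {0<..} s * (exp (- s) * s powr (-3/4))) \<partial>lborel"
 let ?G = "(\<integral>\<^sup>+u. ennreal (exp (- (u::real)\<^sup>2 / 2)) \<partial>lborel)"
 have fin: "?F * (?F * ?G ^ 3) < \<infinity>"
  using nn_integral_exp_powr_finite nn_integral_gaussian_finite by (simp add: ennreal_mult_less_top power_less_top_ennreal)
 define C where "C = enn2real (?F * (?F * ?G ^ 3))"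
 have C: "ennreal C = ?F * (?F * ?G ^ 3)" unfolding C_def using fin by simp
 have main: "L2 (pot \<tau> \<omega> q) \<and> N2 (pot \<tau> \<omega> q) \<le> C"
  if cd: "curve_data L \<mu> q \<omega>" and \<tau>: "\<tau> > 0" "\<tau>\<^sup>2 - \<tau> * \<mu> \<ge> 1" for L \<mu> q \<omega> \<tau>
 proof -
  note [measurable] = curve_data_measurable[OF cd]
  have mp: "(\<lambda>(x, s). pker \<tau> \<omega> q x s) \<in> borel_measurable (borel \<Otimes>\<^sub>M borel)"
   unfolding pker_def split_beta' by measurable
  have [measurable]: "pot \<tau> \<omega> q \<in> borel_measurable borel"
   unfolding pot_def[abs_def] by (rule lborel.borel_measurable_lebesgue_integral) (use mp in \<open>simp add: split_beta' measurable_lborel1\<close>)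
  let ?f = "\<lambda>s. ennreal (indicator {0<..} s * (exp (- s / 2) * s powr (-3/8)))"
  let ?h = "\<lambda>x s. ennreal (indicator {0<..} s * (exp (- s / 2) * s powr (-9/8) * exp (- ((norm (x - q s))\<^sup>2) / (4 * s))))"
  have pk: "ennreal (pker \<tau> \<omega> q x s) \<le> ?f s * ?h x s" for x s
  proof (cases "s > 0")
   case True
   have cb: "\<bar>\<omega> s\<bar> \<le> \<mu> * s" using curve_data_bounds(2)[OF cd] True by simp
   have "\<tau> * - \<omega> s \<le> \<tau> * (\<mu> * s)" using cb \<tau> by (intro mult_left_mono) auto
   moreover have "1 * s \<le> (\<tau>\<^sup>2 - \<tau> * \<mu>) * s" using \<tau> True by (intro mult_right_mono) auto
   ultimately have e: "- \<tau>\<^sup>2 * s - \<tau> * \<omega> s \<le> - s" by (simp add: algebra_simps)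
   have p: "s powr (-3/2) = s powr (-3/8) * s powr (-9/8)" by (simp only: powr_add[symmetric]) simp
   have h: "exp (- s) = exp (- s / 2) * exp (- s / 2)" by (simp only: exp_add[symmetric]) simp
   have "pker \<tau> \<omega> q x s \<le> exp (- s) * (exp (- ((norm (x - q s))\<^sup>2) / (4 * s)) * s powr (-3/2))"
    using e True by (simp add: pker_def mult.assoc mult_right_mono)
   also have "\<dots> = (exp (- s / 2) * s powr (-3/8)) * (exp (- s / 2) * s powr (-9/8) * exp (- ((norm (x - q s))\<^sup>2) / (4 * s)))"
    unfolding p h by (simp only: mult_ac)
   finally show ?thesis using True by (simp add: ennreal_mult[symmetric] ennreal_leI)
  qed (simp add: pker_def)
  have f2: "(?f s)\<^sup>2 = ennreal (indicator {0<..} s * (exp (- s) * s powr (-3/4)))" for s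
  proof (cases "s > 0")
   case True
   have "(exp (- s / 2) * s powr (-3/8))\<^sup>2 = (exp (- s / 2) * exp (- s / 2)) * (s powr (-3/8) * s powr (-3/8))"
    by (simp only: power2_eq_square mult_ac)
   also have "\<dots> = exp (- s) * s powr (-3/4)" by (simp only: exp_add[symmetric] powr_add[symmetric]) simp
   finally show ?thesis using True by (simp add: ennreal_power)
  qed simp
  have h2: "(?h x s)\<^sup>2 = ennreal (indicator {0<..} s * (exp (- s) * s powr (-9/4))) * ennreal (exp (- ((norm (x - q s))\<^sup>2) / (2 * s)))" for x s
  proof (cases "s > 0")
   case True
   have "(exp (- s / 2) * s powr (-9/8) * exp (- ((norm (x - q s))\<^sup>2) / (4 * s)))\<^sup>2
     = (exp (- s / 2) * exp (- s / 2)) * (s powr (-9/8) * s powr (-9/8)) * (exp (- ((norm (x - q s))\<^sup>2) / (4 * s)) * exp (- ((norm (x - q s))\<^sup>2) / (4 * s)))"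
    by (simp only: power2_eq_square mult_ac)
   also have "\<dots> = exp (- s) * s powr (-9/4) * exp (- ((norm (x - q s))\<^sup>2) / (2 * s))"
   proof -
    have "- ((norm (x - q s))\<^sup>2) / (4 * s) + - ((norm (x - q s))\<^sup>2) / (4 * s) = - ((norm (x - q s))\<^sup>2) / (2 * s)" by (simp add: field_simps)
    moreover have "- s / 2 + - s / 2 = - s" by simp
    moreover have "(-9/8) + (-9/8) = (-9/4 :: real)" by simp
    ultimately show ?thesis by (simp only: exp_add[symmetric] powr_add[symmetric])
   qed
   finally show ?thesis using True by (simp add: ennreal_power ennreal_mult[symmetric])
  qed simp
  have pp: "ennreal ((pot \<tau> \<omega> q x)\<^sup>2) \<le> ?F * (\<integral>\<^sup>+s. (?h x s)\<^sup>2 \<partial>lborel)" for x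
  proof -
   have p0: "pot \<tau> \<omega> q x \<ge> 0" unfolding pot_def by (intro integral_nonneg_AE) (simp add: pker_nonneg)
   have "ennreal (pot \<tau> \<omega> q x) \<le> (\<integral>\<^sup>+s. ennreal (pker \<tau> \<omega> q x s) \<partial>lborel)"
   proof (cases "integrable lborel (pker \<tau> \<omega> q x)")
    case True
    then show ?thesis unfolding pot_def by (subst nn_integral_eq_integral) (auto simp: pker_nonneg)
   qed (simp add: pot_def not_integrable_integral_eq)
   also have "\<dots> \<le> (\<integral>\<^sup>+s. ?f s * ?h x s \<partial>lborel)" by (intro nn_integral_mono pk)
   finally have "ennreal (pot \<tau> \<omega> q x) \<le> (\<integral>\<^sup>+s. ?f s * ?h x s \<partial>lborel)" .
   then have "(ennreal (pot \<tau> \<omega> q x))\<^sup>2 \<le> (\<integral>\<^sup>+s. ?f s * ?h x s \<partial>lborel)\<^sup>2" by (rule power_mono) simp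
   also have "\<dots> \<le> (\<integral>\<^sup>+s. (?f s)\<^sup>2 \<partial>lborel) * (\<integral>\<^sup>+s. (?h x s)\<^sup>2 \<partial>lborel)"
    by (rule Cauchy_Schwarz_nn_integral) measurable
   finally show ?thesis unfolding f2 using p0 by (simp add: ennreal_power)
  qed
  have "(\<integral>\<^sup>+x. ennreal ((pot \<tau> \<omega> q x)\<^sup>2) \<partial>lborel) \<le> (\<integral>\<^sup>+x. ?F * (\<integral>\<^sup>+s. (?h x s)\<^sup>2 \<partial>lborel) \<partial>lborel)"
   by (intro nn_integral_mono pp)
  also have "\<dots> = ?F * (\<integral>\<^sup>+x. (\<integral>\<^sup>+s. (?h x s)\<^sup>2 \<partial>lborel) \<partial>lborel)"
   by (rule nn_integral_cmult) measurable
  also have "(\<integral>\<^sup>+x. (\<integral>\<^sup>+s. (?h x s)\<^sup>2 \<partial>lborel) \<partial>lborel) = (\<integral>\<^sup>+s. (\<integral>\<^sup>+x. (?h x s)\<^sup>2 \<partial>lborel) \<partial>lborel)"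
   by (rule lborel_pair.Fubini') measurable
  also have "\<dots> = (\<integral>\<^sup>+s. ennreal (indicator {0<..} s * (exp (- s) * s powr (-3/4))) * ?G ^ 3 \<partial>lborel)"
  proof (rule nn_integral_cong)
   fix s :: real
   show "(\<integral>\<^sup>+x. (?h x s)\<^sup>2 \<partial>lborel) = ennreal (indicator {0<..} s * (exp (- s) * s powr (-3/4))) * ?G ^ 3"
   proof (cases "s > 0")
    case True
    have "(\<integral>\<^sup>+x. (?h x s)\<^sup>2 \<partial>lborel) = ennreal (indicator {0<..} s * (exp (- s) * s powr (-9/4))) * (ennreal (sqrt s) * ?G) ^ 3"
     unfolding h2 by (subst nn_integral_cmult) (measurable, simp only: nn_integral_gaussian_3d[OF True])
    also have "\<dots> = ennreal (exp (- s) * s powr (-9/4) * sqrt s ^ 3) * ?G ^ 3"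
     using True by (simp add: power_mult_distrib ennreal_power ennreal_mult mult.assoc)
    also have "exp (- s) * s powr (-9/4) * sqrt s ^ 3 = exp (- s) * s powr (-3/4)"
    proof -
     have "sqrt s ^ 3 = s powr (1/2) * (s powr (1/2) * s powr (1/2))" using True by (simp add: powr_half_sqrt power3_eq_cube)
     also have "\<dots> = s powr (3/2)" by (simp only: powr_add[symmetric]) simp
     finally have "s powr (-9/4) * sqrt s ^ 3 = s powr (-9/4) * s powr (3/2)" by simp
     also have "\<dots> = s powr (-3/4)" by (simp only: powr_add[symmetric]) simp
     finally show ?thesis by simp
    qed
    finally show ?thesis using True by simp
   qed simp
  qed
  also have "\<dots> = ?F * ?G ^ 3" by (rule nn_integral_multc) measurable
  finally have fin2: "(\<integral>\<^sup>+x. ennreal ((pot \<tau> \<omega> q x)\<^sup>2) \<partial>lborel) \<le> ennreal C" unfolding C .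
  have "L2 (pot \<tau> \<omega> q)" unfolding L2_def
  proof (intro conjI integrableI_bounded)
   show "(\<integral>\<^sup>+ x. ennreal (norm ((pot \<tau> \<omega> q x)\<^sup>2)) \<partial>lborel) < \<infinity>"
    using fin2 by (simp add: order.strict_trans1[OF _ ennreal_less_top])
  qed measurable
  moreover have "N2 (pot \<tau> \<omega> q) \<le> C"
   unfolding N2_def using fin2 by (subst integral_eq_nn_integral) (auto intro: enn2real_leI simp: C_def)
  ultimately show ?thesis ..
 qed
 show ?thesis using main by (intro exI[of _ C]) (auto simp: C_def)
qed

section \<open>The weight of the energy estimate\<close>

lemma derivative_bound_of_lipschitz:
 fixes F :: "'a::euclidean_space \<Rightarrow> real"
 assumes F: "C1 F" and b: "\<And>s. \<bar>F (z + s *\<^sub>R v) - F z\<bar> \<le> C * \<bar>s\<bar>"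
 shows "\<bar>frechet_derivative F (at z) v\<bar> \<le> C"
proof -
 have "((\<lambda>s. z + s *\<^sub>R v) has_derivative (\<lambda>s. s *\<^sub>R v)) (at 0)"
  by (auto intro!: derivative_eq_intros)
 moreover have "(F has_derivative frechet_derivative F (at z)) (at (z + 0 *\<^sub>R v))" using C1_has_derivative[OF F] by simp
 ultimately have "((\<lambda>s. F (z + s *\<^sub>R v)) has_derivative (\<lambda>s. frechet_derivative F (at z) (s *\<^sub>R v))) (at 0)"
  by (rule has_derivative_compose)
 moreover have "(\<lambda>s. frechet_derivative F (at z) (s *\<^sub>R v)) = (\<lambda>s. frechet_derivative F (at z) v * s)"
  using linear_scale[OF C1_linear[OF F]] by (auto simp: fun_eq_iff mult.commute)
 ultimately have "((\<lambda>s. F (z + s *\<^sub>R v)) has_real_derivative frechet_derivative F (at z) v) (at 0)"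
  by (simp add: has_field_derivative_def)
 then have "((\<lambda>s. (F (z + s *\<^sub>R v) - F z) / s) \<longlongrightarrow> frechet_derivative F (at z) v) (at 0)"
  by (simp add: DERIV_def)
 then have "((\<lambda>s. \<bar>(F (z + s *\<^sub>R v) - F z) / s\<bar>) \<longlongrightarrow> \<bar>frechet_derivative F (at z) v\<bar>) (at 0)"
  by (rule tendsto_rabs)
 moreover have "\<forall>\<^sub>F s in at 0. \<bar>(F (z + s *\<^sub>R v) - F z) / s\<bar> \<le> C"
  unfolding eventually_at
 proof (intro exI[of _ 1] conjI ballI impI)
  fix s :: real assume "s \<noteq> 0 \<and> dist s 0 < 1"
  then show "\<bar>(F (z + s *\<^sub>R v) - F z) / s\<bar> \<le> C" using b[of s] by (simp add: divide_le_eq)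
 qed simp
 ultimately show ?thesis by (rule tendsto_upperbound) simp
qed

text \<open>\<open>log_weight\<close> is only Lipschitz, whereas the multiplier K has to be C^1. An
  average of translates keeps the constants in time and in space separately, and the spatial one
  bounds the gradient.\<close>

lemma mollify_lipschitz:
 fixes f :: "real \<times> (real^3) \<Rightarrow> real"
 assumes f: "\<And>t x t' x'. \<bar>f (t, x) - f (t', x')\<bar> \<le> A * \<bar>t - t'\<bar> + B * norm (x - x')"
  and A: "A \<ge> 0" and B: "B \<ge> 0" and e: "e > 0"
 obtains F where "C1 F" "\<And>z. \<bar>F z - f z\<bar> \<le> e"
  "\<And>t x t' x'. \<bar>F (t, x) - F (t', x')\<bar> \<le> A * \<bar>t - t'\<bar> + B * norm (x - x')"
  "\<And>z. norm (gradx_part F z) \<le> B"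
proof -
 define r where "r = e / (A + B + 1)"
 have r: "r > 0" using A B e by (simp add: r_def)
 have "(A + B)-lipschitz_on UNIV f"
 proof (rule lipschitz_onI)
  fix z z' :: "real \<times> (real^3)"
  have "\<bar>f z - f z'\<bar> \<le> A * \<bar>fst z - fst z'\<bar> + B * norm (snd z - snd z')" using f[of "fst z" "snd z" "fst z'" "snd z'"] by simp
  also have "\<dots> \<le> A * dist z z' + B * dist z z'"
   using dist_fst_le[of z z'] dist_snd_le[of z z'] A B by (intro add_mono mult_left_mono) (auto simp: dist_norm)
  finally show "dist (f z) (f z') \<le> (A + B) * dist z z'" by (simp add: dist_real_def algebra_simps)
 qed (use A B in auto)
 then have cf: "continuous_on UNIV f" by (rule lipschitz_on_continuous_on)
 have lf: "locint f" by (rule continuous_locint[OF cf])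
 have [measurable]: "f \<in> borel_measurable borel" by (rule borel_measurable_continuous_onI[OF cf])
 obtain k where k: "kernel k (0 :: real \<times> (real^3)) r" using kernel_exists[OF r] .
 note kd = kernelD[OF k]
 let ?F = "conv k f"
 have C: "C1 ?F" by (rule conv_has_derivative(2)[of k 0 r]) (use kd lf in auto)
 have Fe: "?F z = (LBINT h. k h * f (z - h))" for z by (rule conv_flip) (use kd in auto)
 have i: "integrable lborel (\<lambda>h. k h * f (z - h))" for z
 proof -
  have "integrable lborel (\<lambda>w. k (z - w) * f w)" by (rule conv_integrable[where a = 0 and r = r]) (auto simp: kd lf)
  from lborel_reflect_integrable[OF this, of z] show ?thesis by simp
 qed
 have bnd: "\<bar>(LBINT h. k h * f (z - h)) - (LBINT h. k h * c h)\<bar> \<le> b"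
  if ic: "integrable lborel (\<lambda>h. k h * c h)" and b: "\<And>h. h \<in> ball 0 r \<Longrightarrow> \<bar>f (z - h) - c h\<bar> \<le> b" for z c b
 proof -
  have "(LBINT h. k h * f (z - h)) - (LBINT h. k h * c h) = (LBINT h. k h * (f (z - h) - c h))"
   using i ic by (simp add: right_diff_distrib)
  also have "\<bar>\<dots>\<bar> \<le> (LBINT h. \<bar>k h * (f (z - h) - c h)\<bar>)" by (rule integral_abs_bound)
  also have "\<dots> \<le> (LBINT h. k h * b)"
  proof (rule integral_mono)
   show "integrable lborel (\<lambda>h. \<bar>k h * (f (z - h) - c h)\<bar>)" using i[of z] ic by (simp add: right_diff_distrib)
   show "\<bar>k h * (f (z - h) - c h)\<bar> \<le> k h * b" for h
    using b[of h] kd(2)[of h] kd(3)[of h] by (cases "h \<in> ball 0 r") (auto simp: abs_mult mult_left_mono)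
  qed (use kd(6) in simp)
  also have "\<dots> = b" using kd(5) by simp
  finally show ?thesis .
 qed
 have L: "\<bar>?F (t, x) - ?F (t', x')\<bar> \<le> A * \<bar>t - t'\<bar> + B * norm (x - x')" for t x t' x'
  unfolding Fe
 proof (rule bnd[OF i])
  fix h :: "real \<times> (real^3)"
  show "\<bar>f ((t, x) - h) - f ((t', x') - h)\<bar> \<le> A * \<bar>t - t'\<bar> + B * norm (x - x')"
   using f[of "t - fst h" "x - snd h" "t' - fst h" "x' - snd h"] by (cases h) simp
 qed
 show thesis
 proof (rule that[OF C _ L])
  fix z
  have ikc: "integrable lborel (\<lambda>h. k h * f z)" using kd(6) by simp
  have "(LBINT h. k h * f z) = f z" using kd(5) by simp
  then show "\<bar>?F z - f z\<bar> \<le> e"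
   using bnd[OF ikc, of z e] unfolding Fe
  proof -
   assume *: "(\<And>h. h \<in> ball 0 r \<Longrightarrow> \<bar>f (z - h) - f z\<bar> \<le> e) \<Longrightarrow> \<bar>(LBINT h. k h * f (z - h)) - (LBINT h. k h * f z)\<bar> \<le> e"
    and **: "(LBINT h. k h * f z) = f z"
   have "\<bar>f (z - h) - f z\<bar> \<le> e" if "h \<in> ball 0 r" for h
   proof -
    have n: "norm (fst h) \<le> r" "norm (snd h) \<le> r"
     using that dist_fst_le[of h 0] dist_snd_le[of h 0] by simp_all
    have "\<bar>f (z - h) - f z\<bar> \<le> A * \<bar>fst h\<bar> + B * norm (snd h)"
     using f[of "fst z - fst h" "snd z - snd h" "fst z" "snd z"] by (cases z; cases h) simp
    also have "\<dots> \<le> A * r + B * r" using n A B by (intro add_mono mult_left_mono) auto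
    also have "\<dots> \<le> (A + B + 1) * r" using r by (simp add: algebra_simps)
    also have "\<dots> = e" using A B by (simp add: r_def)
    finally show ?thesis .
   qed
   from *[OF this] show "\<bar>(LBINT h. k h * f (z - h)) - f z\<bar> \<le> e" unfolding ** .
  qed
  \<comment> \<open>The derivative in the direction of the gradient v is v \<bullet> v; the
    Lipschitz bound in this direction is B norm v, hence norm v <= B.\<close>
  let ?v = "gradx_part ?F z"
  have "(\<Sum>i\<in>UNIV. ?v $ i * frechet_derivative ?F (at z) (0, axis i 1)) = frechet_derivative ?F (at z) (\<Sum>i\<in>UNIV. ?v $ i *\<^sub>R (0, axis i 1))"
   by (simp only: linear_sum[OF C1_linear[OF C]] linear_scale[OF C1_linear[OF C]] real_scaleR_def)
  also have "(\<Sum>i\<in>UNIV. ?v $ i *\<^sub>R (0 :: real, axis i 1 :: real^3)) = (0, \<Sum>i\<in>UNIV. ?v $ i *\<^sub>R axis i 1)"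
   by (simp add: sum_prod)
  also have "(\<Sum>i\<in>UNIV. ?v $ i *\<^sub>R axis i 1) = ?v" by (simp add: basis_expansion scalar_mult_eq_scaleR[symmetric])
  finally have "?v \<bullet> ?v = frechet_derivative ?F (at z) (0, ?v)" by (simp add: inner_vec_def gradx_part_nth)
  moreover have "\<bar>frechet_derivative ?F (at z) (0, ?v)\<bar> \<le> B * norm ?v"
  proof (rule derivative_bound_of_lipschitz[OF C])
   fix s :: real
   show "\<bar>?F (z + s *\<^sub>R (0, ?v)) - ?F z\<bar> \<le> B * norm ?v * \<bar>s\<bar>"
    using L[of "fst z" "snd z + s *\<^sub>R ?v" "fst z" "snd z"] by (cases z) (simp add: mult_ac)
  qed
  ultimately have "norm ?v * norm ?v \<le> B * norm ?v" by (simp add: power2_norm_eq_inner[symmetric] power2_eq_square)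
  then show "norm ?v \<le> B" using B by (cases "norm ?v = 0") auto
 qed
qed

text \<open>The logarithm of the ratio of the leading factors of kappa times \<open>fgpot\<close>
  and of \<open>bgpot\<close>, see \<open>log_weight_split\<close>, both taken at the saddle point
  s. The first term compares the forward with the backward displacement of the curve, the second is
  the exponent of kappa at the time t + s.\<close>

definition log_weight :: "(real \<Rightarrow> real^3) \<Rightarrow> real \<Rightarrow> real \<Rightarrow> real \<Rightarrow> real \<times> (real^3) \<Rightarrow> real" where
 "log_weight y \<tau> \<mu> \<theta> z = (let t = fst z; x = snd z; s = norm (x - y t) / (2 * \<tau>) in
   \<tau> * (sgn (x - y t) \<bullet> (y (t + s) - y (t - s))) - \<tau> * \<mu> * \<bar>t + s - \<theta>\<bar>)"

text \<open>The direction is not Lipschitz at the origin, but it becomes so after multiplication by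
  the norm; the displacement of the curve supplies that factor below.\<close>

lemma sgn_diff_bound:
 fixes v v' :: "'a::real_normed_vector"
 shows "norm v' * norm (sgn v - sgn v') \<le> 2 * norm (v - v')"
proof -
 have "norm v' *\<^sub>R (sgn v - sgn v') = (v - v') + (norm v' - norm v) *\<^sub>R sgn v"
  by (cases "v = 0"; cases "v' = 0") (simp_all add: sgn_div_norm algebra_simps)
 then have "norm v' * norm (sgn v - sgn v') = norm ((v - v') + (norm v' - norm v) *\<^sub>R sgn v)"
  by (metis abs_norm_cancel norm_scaleR)
 also have "\<dots> \<le> norm (v - v') + norm ((norm v' - norm v) *\<^sub>R sgn v)" by (rule norm_triangle_ineq)
 also have "norm ((norm v' - norm v) *\<^sub>R sgn v) \<le> \<bar>norm v' - norm v\<bar>" by (simp add: norm_sgn)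
 also have "\<bar>norm v' - norm v\<bar> \<le> norm (v - v')" by (metis norm_minus_commute norm_triangle_ineq3)
 finally show ?thesis by simp
qed

text \<open>Makes the exponential of the weight comparable with kappa uniformly in tau: in a time of
  order R / tau both the curve and |t - theta| change by order R / tau, which the factor tau makes
  bounded.\<close>

lemma log_weight_bound:
 assumes y: "\<And>s s'. norm (y s - y s') \<le> L * \<bar>s - s'\<bar>" and \<tau>: "\<tau> > 0" and \<mu>: "\<mu> \<ge> 0" and L: "L \<ge> 0"
 shows "\<bar>log_weight y \<tau> \<mu> \<theta> (t, x) + \<tau> * \<mu> * \<bar>t - \<theta>\<bar>\<bar> \<le> (L + \<mu> / 2) * norm (x - y t)"
proof -
 define s where "s = norm (x - y t) / (2 * \<tau>)"
 have s: "s \<ge> 0" "\<tau> * s = norm (x - y t) / 2" using \<tau> by (auto simp: s_def)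
 have "\<bar>sgn (x - y t) \<bullet> (y (t + s) - y (t - s))\<bar> \<le> norm (sgn (x - y t)) * norm (y (t + s) - y (t - s))" by (rule Cauchy_Schwarz_ineq2)
 also have "\<dots> \<le> 1 * (L * (2 * s))" using y[of "t + s" "t - s"] s by (intro mult_mono) (auto simp: norm_sgn)
 finally have "\<bar>\<tau> * (sgn (x - y t) \<bullet> (y (t + s) - y (t - s)))\<bar> \<le> \<tau> * (L * (2 * s))"
  using \<tau> by (simp add: abs_mult)
 also have "\<dots> = L * norm (x - y t)" using s(2) by (metis (no_types, opaque_lifting) mult.assoc mult.left_commute nonzero_mult_div_cancel_left times_divide_eq_right zero_neq_numeral)
 finally have 1: "\<bar>\<tau> * (sgn (x - y t) \<bullet> (y (t + s) - y (t - s)))\<bar> \<le> L * norm (x - y t)" .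
 have "\<bar>\<tau> * \<mu> * \<bar>t + s - \<theta>\<bar> - \<tau> * \<mu> * \<bar>t - \<theta>\<bar>\<bar> = \<tau> * \<mu> * \<bar>\<bar>t + s - \<theta>\<bar> - \<bar>t - \<theta>\<bar>\<bar>"
  using \<tau> \<mu> by (simp add: abs_mult right_diff_distrib[symmetric])
 also have "\<dots> \<le> \<tau> * \<mu> * s" using \<tau> \<mu> s by (intro mult_left_mono) auto
 also have "\<dots> = \<mu> * (\<tau> * s)" by simp
 also have "\<dots> = \<mu> / 2 * norm (x - y t)" unfolding s(2) by simp
 finally have 2: "\<bar>\<tau> * \<mu> * \<bar>t + s - \<theta>\<bar> - \<tau> * \<mu> * \<bar>t - \<theta>\<bar>\<bar> \<le> \<mu> / 2 * norm (x - y t)" .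
 have e: "log_weight y \<tau> \<mu> \<theta> (t, x) + \<tau> * \<mu> * \<bar>t - \<theta>\<bar> = \<tau> * (sgn (x - y t) \<bullet> (y (t + s) - y (t - s))) - (\<tau> * \<mu> * \<bar>t + s - \<theta>\<bar> - \<tau> * \<mu> * \<bar>t - \<theta>\<bar>)"
  by (simp add: log_weight_def Let_def s_def)
 have "\<bar>a - b\<bar> \<le> p + q" if "\<bar>a\<bar> \<le> p" "\<bar>b\<bar> \<le> q" for a b p q :: real using that by linarith
 from this[OF 1 2] show ?thesis unfolding e by (simp add: algebra_simps)
qed

text \<open>The singular direction sgn (x - y t) multiplies a displacement d with tau norm d <= L
  norm (x - y t), so \<open>sgn_diff_bound\<close> yields a spatial constant free of tau. In time a
  constant of order tau remains; for large tau it is dominated by the rate 2 tau^2 of the full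
  weight K.\<close>

lemma log_weight_lipschitz:
 assumes y: "\<And>s s'. norm (y s - y s') \<le> L * \<bar>s - s'\<bar>" and \<tau>: "\<tau> \<ge> 1" and \<mu>: "\<mu> \<ge> 0" and L: "L \<ge> 0"
 shows "\<bar>log_weight y \<tau> \<mu> \<theta> (t, x) - log_weight y \<tau> \<mu> \<theta> (t', x')\<bar>
   \<le> \<tau> * (2 * L + \<mu> + 3 * L\<^sup>2 + \<mu> * L / 2) * \<bar>t - t'\<bar> + (3 * L + \<mu> / 2) * norm (x - x')"
proof -
 define v v' where "v = x - y t" and "v' = x' - y t'"
 define s s' where "s = norm v / (2 * \<tau>)" and "s' = norm v' / (2 * \<tau>)"
 define d d' where "d = y (t + s) - y (t - s)" and "d' = y (t' + s') - y (t' - s')"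
 have \<tau>0: "\<tau> > 0" using \<tau> by simp
 have dv: "norm (v - v') \<le> norm (x - x') + L * \<bar>t - t'\<bar>"
 proof -
  have "v - v' = (x - x') - (y t - y t')" by (simp add: v_def v'_def)
  then show ?thesis using norm_triangle_ineq4[of "x - x'" "y t - y t'"] y[of t t'] by simp
 qed
 have ds: "\<tau> * \<bar>s - s'\<bar> \<le> norm (v - v') / 2"
 proof -
  have "s - s' = (norm v - norm v') / (2 * \<tau>)" by (simp add: s_def s'_def diff_divide_distrib)
  then have "\<tau> * \<bar>s - s'\<bar> = \<bar>norm v - norm v'\<bar> / 2" using \<tau>0 by (simp add: abs_mult)
  also have "\<dots> \<le> norm (v - v') / 2" using norm_triangle_ineq3[of v v'] by simp
  finally show ?thesis .
 qed
 have dd: "norm (d - d') \<le> 2 * L * (\<bar>t - t'\<bar> + \<bar>s - s'\<bar>)"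
 proof -
  have "d - d' = (y (t + s) - y (t' + s')) - (y (t - s) - y (t' - s'))" by (simp add: d_def d'_def)
  then have "norm (d - d') \<le> norm (y (t + s) - y (t' + s')) + norm (y (t - s) - y (t' - s'))" by (metis norm_triangle_ineq4)
  also have "\<dots> \<le> L * \<bar>(t + s) - (t' + s')\<bar> + L * \<bar>(t - s) - (t' - s')\<bar>" by (intro add_mono y)
  also have "\<dots> \<le> L * (\<bar>t - t'\<bar> + \<bar>s - s'\<bar>) + L * (\<bar>t - t'\<bar> + \<bar>s - s'\<bar>)" using L by (intro add_mono mult_left_mono) auto
  finally show ?thesis by simp
 qed
 have s'0: "s' \<ge> 0" using \<tau>0 by (simp add: s'_def)
 have d'n: "\<tau> * norm d' \<le> L * norm v'"
 proof -
  have "norm d' \<le> L * (2 * s')" using y[of "t' + s'" "t' - s'"] s'0 by (simp add: d'_def)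
  then have "\<tau> * norm d' \<le> \<tau> * (L * (2 * s'))" using \<tau>0 by (intro mult_left_mono) auto
  also have "\<dots> = L * norm v'" using \<tau>0 by (simp add: s'_def)
  finally show ?thesis .
 qed
 have "\<bar>sgn v \<bullet> d - sgn v' \<bullet> d'\<bar> = \<bar>sgn v \<bullet> (d - d') + (sgn v - sgn v') \<bullet> d'\<bar>" by (simp add: inner_diff_left inner_diff_right)
 also have "\<dots> \<le> \<bar>sgn v \<bullet> (d - d')\<bar> + \<bar>(sgn v - sgn v') \<bullet> d'\<bar>" by (rule abs_triangle_ineq)
 also have "\<dots> \<le> norm (sgn v) * norm (d - d') + norm (sgn v - sgn v') * norm d'" by (intro add_mono Cauchy_Schwarz_ineq2)
 also have "norm (sgn v) * norm (d - d') \<le> norm (d - d')" by (simp add: norm_sgn)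
 finally have "\<bar>sgn v \<bullet> d - sgn v' \<bullet> d'\<bar> \<le> norm (d - d') + norm (sgn v - sgn v') * norm d'" by simp
 then have "\<tau> * \<bar>sgn v \<bullet> d - sgn v' \<bullet> d'\<bar> \<le> \<tau> * (norm (d - d') + norm (sgn v - sgn v') * norm d')" using \<tau>0 by (intro mult_left_mono) auto
 also have "\<dots> = \<tau> * norm (d - d') + norm (sgn v - sgn v') * (\<tau> * norm d')" by (simp add: algebra_simps)
 also have "\<dots> \<le> \<tau> * (2 * L * (\<bar>t - t'\<bar> + \<bar>s - s'\<bar>)) + norm (sgn v - sgn v') * (L * norm v')"
  using dd d'n \<tau>0 by (intro add_mono mult_left_mono) auto
 also have "\<dots> = 2 * L * \<tau> * \<bar>t - t'\<bar> + 2 * L * (\<tau> * \<bar>s - s'\<bar>) + L * (norm v' * norm (sgn v - sgn v'))" by (simp add: algebra_simps)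
 also have "\<dots> \<le> 2 * L * \<tau> * \<bar>t - t'\<bar> + 2 * L * (norm (v - v') / 2) + L * (2 * norm (v - v'))"
 proof -
  have "2 * L * (\<tau> * \<bar>s - s'\<bar>) \<le> 2 * L * (norm (v - v') / 2)" using L by (intro mult_left_mono[OF ds]) simp
  moreover have "L * (norm v' * norm (sgn v - sgn v')) \<le> L * (2 * norm (v - v'))" by (rule mult_left_mono[OF sgn_diff_bound L])
  ultimately show ?thesis by linarith
 qed
 also have "\<dots> = 2 * L * \<tau> * \<bar>t - t'\<bar> + 3 * L * norm (v - v')" by simp
 finally have 1: "\<tau> * \<bar>sgn v \<bullet> d - sgn v' \<bullet> d'\<bar> \<le> 2 * L * \<tau> * \<bar>t - t'\<bar> + 3 * L * norm (v - v')" .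
 have "\<tau> * \<mu> * \<bar>\<bar>t + s - \<theta>\<bar> - \<bar>t' + s' - \<theta>\<bar>\<bar> \<le> \<tau> * \<mu> * (\<bar>t - t'\<bar> + \<bar>s - s'\<bar>)" using \<tau>0 \<mu> by (intro mult_left_mono) auto
 also have "\<dots> = \<tau> * \<mu> * \<bar>t - t'\<bar> + \<mu> * (\<tau> * \<bar>s - s'\<bar>)" by (simp add: algebra_simps)
 also have "\<dots> \<le> \<tau> * \<mu> * \<bar>t - t'\<bar> + \<mu> * (norm (v - v') / 2)" using ds \<mu> by (intro add_left_mono mult_left_mono) auto
 finally have 2: "\<tau> * \<mu> * \<bar>\<bar>t + s - \<theta>\<bar> - \<bar>t' + s' - \<theta>\<bar>\<bar> \<le> \<tau> * \<mu> * \<bar>t - t'\<bar> + \<mu> * (norm (v - v') / 2)" .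
 have e: "log_weight y \<tau> \<mu> \<theta> (t, x) - log_weight y \<tau> \<mu> \<theta> (t', x') = \<tau> * (sgn v \<bullet> d - sgn v' \<bullet> d') - \<tau> * \<mu> * (\<bar>t + s - \<theta>\<bar> - \<bar>t' + s' - \<theta>\<bar>)"
  by (simp add: log_weight_def Let_def v_def v'_def s_def s'_def d_def d'_def algebra_simps)
 have "\<bar>log_weight y \<tau> \<mu> \<theta> (t, x) - log_weight y \<tau> \<mu> \<theta> (t', x')\<bar>
   \<le> \<bar>\<tau> * (sgn v \<bullet> d - sgn v' \<bullet> d')\<bar> + \<bar>\<tau> * \<mu> * (\<bar>t + s - \<theta>\<bar> - \<bar>t' + s' - \<theta>\<bar>)\<bar>" unfolding e by (rule abs_triangle_ineq4)
 also have "\<dots> = \<tau> * \<bar>sgn v \<bullet> d - sgn v' \<bullet> d'\<bar> + \<tau> * \<mu> * \<bar>\<bar>t + s - \<theta>\<bar> - \<bar>t' + s' - \<theta>\<bar>\<bar>" using \<tau>0 \<mu> by (simp add: abs_mult)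
 also have "\<dots> \<le> (2 * L * \<tau> * \<bar>t - t'\<bar> + 3 * L * norm (v - v')) + (\<tau> * \<mu> * \<bar>t - t'\<bar> + \<mu> * (norm (v - v') / 2))" by (intro add_mono 1 2)
 also have "\<dots> = \<tau> * (2 * L + \<mu>) * \<bar>t - t'\<bar> + (3 * L + \<mu> / 2) * norm (v - v')" by (simp add: algebra_simps)
 also have "\<dots> \<le> \<tau> * (2 * L + \<mu>) * \<bar>t - t'\<bar> + (3 * L + \<mu> / 2) * (norm (x - x') + L * \<bar>t - t'\<bar>)"
  using dv L \<mu> by (intro add_left_mono mult_left_mono) auto
 also have "\<dots> = \<tau> * (2 * L + \<mu>) * \<bar>t - t'\<bar> + (3 * L + \<mu> / 2) * norm (x - x') + 1 * ((3 * L\<^sup>2 + \<mu> * L / 2) * \<bar>t - t'\<bar>)"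
  by (simp add: algebra_simps power2_eq_square)
 also have "\<dots> \<le> \<tau> * (2 * L + \<mu>) * \<bar>t - t'\<bar> + (3 * L + \<mu> / 2) * norm (x - x') + \<tau> * ((3 * L\<^sup>2 + \<mu> * L / 2) * \<bar>t - t'\<bar>)"
  using \<tau> L \<mu> by (intro add_left_mono mult_right_mono) auto
 also have "\<dots> = \<tau> * (2 * L + \<mu> + 3 * L\<^sup>2 + \<mu> * L / 2) * \<bar>t - t'\<bar> + (3 * L + \<mu> / 2) * norm (x - x')" by (simp add: algebra_simps)
 finally show ?thesis .
qed

lemma rho_eq:
 assumes \<theta>: "\<theta> > 0" and t: "t \<ge> 0"
 shows "rho \<mu> \<theta> t = \<mu> * (\<bar>t - \<theta>\<bar> - \<theta>)"
proof -
 have c: "interval_lebesgue_integrable lborel (ereal a) (ereal b) (eta \<mu> \<theta>)" for a b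
 proof -
  have i: "integrable lborel (\<lambda>x. indicator {p<..<q} x * eta \<mu> \<theta> x)" for p q :: real
  proof (rule Bochner_Integration.integrable_bound)
   show "integrable lborel (\<lambda>x. \<bar>\<mu>\<bar> * indicator {p<..<q} x)" by (simp add: integrable_indicator_iff emeasure_Icc_finite)
   show "(\<lambda>x. indicator {p<..<q} x * eta \<mu> \<theta> x) \<in> borel_measurable lborel" unfolding eta_def sgn_real_def by measurable
   show "AE x in lborel. norm (indicator {p<..<q} x * eta \<mu> \<theta> x) \<le> norm (\<bar>\<mu>\<bar> * indicator {p<..<q} x)"
    by (intro AE_I2) (auto simp: eta_def indicator_def sgn_real_def)
  qed
  show ?thesis using i[of a b] i[of b a] by (simp add: interval_lebesgue_integrable_def set_integrable_def)
 qed
 have neg: "(LBINT s=ereal a..ereal b. eta \<mu> \<theta> s) = - \<mu> * (b - a)" if "a \<le> b" "b \<le> \<theta>" for a b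
 proof -
  have "(LBINT s=ereal a..ereal b. eta \<mu> \<theta> s) = (LBINT s=ereal a..ereal b. - \<mu>)"
   using that by (intro interval_integral_cong) (auto simp: eta_def einterval_iff)
  then show ?thesis by simp
 qed
 have pos: "(LBINT s=ereal a..ereal b. eta \<mu> \<theta> s) = \<mu> * (b - a)" if "a \<le> b" "\<theta> \<le> a" for a b
 proof -
  have "(LBINT s=ereal a..ereal b. eta \<mu> \<theta> s) = (LBINT s=ereal a..ereal b. \<mu>)"
   using that by (intro interval_integral_cong) (auto simp: eta_def einterval_iff)
  then show ?thesis by simp
 qed
 show ?thesis
 proof (cases "t \<le> \<theta>")
  case True
  then show ?thesis using neg[of 0 t] t by (simp add: rho_def zero_ereal_def algebra_simps)
 next
  case False
  have "(LBINT s=ereal 0..ereal \<theta>. eta \<mu> \<theta> s) + (LBINT s=ereal \<theta>..ereal t. eta \<mu> \<theta> s) = (LBINT s=ereal 0..ereal t. eta \<mu> \<theta> s)"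
   by (rule interval_integral_sum) (use \<theta> False c[of 0 t] in \<open>simp add: min_def max_def\<close>)
  then show ?thesis using neg[of 0 \<theta>] pos[of \<theta> t] \<theta> False by (simp add: rho_def zero_ereal_def algebra_simps)
 qed
qed

section \<open>Weighted estimates for the reflected solution\<close>

lemma gradx_part_time_shift:
 assumes "C1 \<Psi>" shows "C1 (\<lambda>z. \<Psi> z - c * fst z)" "gradx_part (\<lambda>z. \<Psi> z - c * fst z) z = gradx_part \<Psi> z"
proof -
 show "C1 (\<lambda>z. \<Psi> z - c * fst z)" by (intro C1_diff assms C1_cmult C1_fst)
 have "((\<lambda>z. \<Psi> z - c * fst z) has_derivative (\<lambda>v. frechet_derivative \<Psi> (at z) v - c * fst v)) (at z)"
  by (intro has_derivative_diff C1_has_derivative[OF assms] has_derivative_mult_right has_derivative_fst has_derivative_ident)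
 then show "gradx_part (\<lambda>z. \<Psi> z - c * fst z) z = gradx_part \<Psi> z"
  by (simp add: vec_eq_iff gradx_part_nth frechet_derivative_eqI)
qed

lemma mult_le_half_squares: "a * b \<le> (a\<^sup>2 + b\<^sup>2) / 2" for a b :: real
 using zero_le_power2[of "a - b"] by (simp add: power2_diff)

lemma integrable_inner_L2:
 assumes "\<And>i. L2 (\<lambda>z. f z $ i)" "\<And>i. L2 (\<lambda>z. g z $ i)"
 shows "integrable lborel (\<lambda>z. f z \<bullet> (g z :: real^3))"
 unfolding inner_vec_def inner_real_def
 by (intro Bochner_Integration.integrable_sum L2_prod_integrable assms)

text \<open>Here a stands for gamma, u for the gradient of the incident wave, and w with gradient g
  for the reflected wave. The conditions on tau and epsilon say that K decays at rate at least
  tau^2, that its logarithmic gradient is at most epsilon tau, and that epsilon C <= 1/2.\<close>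

locale reflected =
 fixes \<Omega> :: "(real^3) set" and T :: real and w :: "real \<times> (real^3) \<Rightarrow> real" and g u :: "real \<times> (real^3) \<Rightarrow> real^3"
  and a :: "real \<times> (real^3) \<Rightarrow> real" and W0 WT :: "real^3 \<Rightarrow> real" and \<Psi> :: "real \<times> (real^3) \<Rightarrow> real" and \<tau> B A1 C \<epsilon> Bu :: real
 assumes ev: "weak_evol \<Omega> T w g (\<lambda>z. a z *\<^sub>R g z + (a z - 1) *\<^sub>R u z) W0 WT"
  and lip: "lipschitz_domain \<Omega>" and T: "T > 0"
  and \<Psi>: "C1 \<Psi>" "\<And>t x h. h \<ge> 0 \<Longrightarrow> \<Psi> (t + h, x) \<le> \<Psi> (t, x) + A1 * h" "\<And>z. norm (gradx_part \<Psi> z) \<le> B"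
  and \<tau>: "\<tau> > 0" "A1 \<le> \<tau>\<^sup>2" "B \<le> \<epsilon> * \<tau>" and \<epsilon>: "\<epsilon> > 0" "2 * \<epsilon> * C \<le> 1" and C: "C \<ge> 1"
  and a: "a \<in> borel_measurable borel" "\<And>z. 0 \<le> a z" "\<And>z. a z \<le> C" "\<And>z. z \<in> {0<..<T} \<times> \<Omega> \<Longrightarrow> 1 / C \<le> a z"
  and u: "\<And>i. (\<lambda>z. u z $ i) \<in> borel_measurable borel" "\<And>z. norm (u z) \<le> Bu" "\<And>z. z \<notin> {0<..<T} \<times> \<Omega> \<Longrightarrow> u z = 0"
begin

text \<open>The factor exp (-2 tau^2 t) is the quotient of the prefactors exp (-tau^2 t) of
  \<open>U_star\<close> and exp (tau^2 t) of \<open>U_tau\<close>.\<close>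

definition K where "K z = exp (\<Psi> z - 2 * \<tau>\<^sup>2 * fst z)"
definition M where "M = (LBINT z. K z * (\<bar>a z - 1\<bar> * (u z \<bullet> u z)))"
definition AA where "AA = (LBINT z. K z * (a z * (g z \<bullet> g z)))"
text \<open>The cross term between incident and reflected wave. Unlike M and AA it has no sign of
  its own.\<close>

definition S where "S = (LBINT z. K z * ((a z - 1) * (u z \<bullet> g z)))"

lemma K_pos: "K z > 0" by (simp add: K_def)

lemma C1_K: "C1 K" unfolding K_def by (rule C1_exp[OF gradx_part_time_shift(1)[OF \<Psi>(1)]])

lemma gradx_K: "gradx_part K z = K z *\<^sub>R gradx_part \<Psi> z"
 unfolding K_def gradx_part_exp[OF gradx_part_time_shift(1)[OF \<Psi>(1)]] gradx_part_time_shift(2)[OF \<Psi>(1)] ..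

lemma wg: "wgrad_on ({0<..<T} \<times> UNIV) w g" and supp: "\<And>z. z \<notin> {0<..<T} \<times> \<Omega> \<Longrightarrow> w z = 0 \<and> g z = 0"
 using ev unfolding weak_evol_def by blast+

lemma D_le: "\<bar>a z - 1\<bar> \<le> C" using a(2)[of z] a(3)[of z] C by linarith

lemma D_le_a: "z \<in> {0<..<T} \<times> \<Omega> \<Longrightarrow> \<bar>a z - 1\<bar> \<le> C * a z"
proof -
 assume "z \<in> {0<..<T} \<times> \<Omega>"
 then have "1 / C \<le> a z" by (rule a(4))
 then have 1: "1 \<le> C * a z" using C by (simp add: divide_le_eq mult.commute)
 have "1 * a z \<le> C * a z" using C a(2) by (rule mult_right_mono)
 then show ?thesis using 1 a(2)[of z] by (simp add: abs_le_iff)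
qed

lemma K_measurable: "K \<in> borel_measurable borel"
 by (rule borel_measurable_continuous_onI[OF C1_continuous[OF C1_K]])

lemma ball_support: obtains \<rho> where "\<And>z. z \<notin> cball 0 \<rho> \<Longrightarrow> z \<notin> {0<..<T} \<times> \<Omega>"
proof -
 have "bounded ({0<..<T} \<times> \<Omega>)" using lip by (intro bounded_Times) (auto simp: lipschitz_domain_def)
 then obtain \<rho> where "\<forall>z\<in>{0<..<T} \<times> \<Omega>. norm z \<le> \<rho>" unfolding bounded_iff by blast
 then show thesis by (intro that[of \<rho>]) auto
qed

lemma L2_u: "L2 (\<lambda>z. u z $ i)"
proof -
 obtain \<rho> where \<rho>: "\<And>z. z \<notin> cball 0 \<rho> \<Longrightarrow> z \<notin> {0<..<T} \<times> \<Omega>" using ball_support by blast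
 show ?thesis
 proof (rule bounded_support_L2[OF u(1), of i Bu 0 \<rho>])
  show "\<bar>u z $ i\<bar> \<le> Bu" for z using component_le_norm_cart[of "u z" i] u(2)[of z] by linarith
  show "u z $ i = 0" if "z \<notin> cball 0 \<rho>" for z using u(3)[OF \<rho>[OF that]] by simp
 qed
qed

lemma L2_g: "L2 (\<lambda>z. g z $ i)" and L2_w: "L2 w"
 using wgrad_onD[OF wg] by auto

lemma L2_K: assumes "L2 f" "\<And>z. z \<notin> {0<..<T} \<times> \<Omega> \<Longrightarrow> f z = 0" shows "L2 (\<lambda>z. K z * f z)"
proof -
 obtain \<rho> where \<rho>: "\<And>z. z \<notin> cball 0 \<rho> \<Longrightarrow> z \<notin> {0<..<T} \<times> \<Omega>" using ball_support by blast
 show ?thesis by (rule L2_mult_continuous[OF assms(1) _ C1_continuous[OF C1_K], of 0 \<rho>]) (use assms(2) \<rho> in blast)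
qed

lemma L2_bdd: assumes "L2 f" "b \<in> borel_measurable borel" "\<And>z. \<bar>b z\<bar> \<le> c" shows "L2 (\<lambda>z. b z * f z)"
 by (rule L2_bound(1)[OF _ assms(1), of _ c]) (use assms in \<open>auto simp: abs_mult intro!: mult_right_mono borel_measurable_times\<close>)

lemma int_M: "integrable lborel (\<lambda>z. K z * (\<bar>a z - 1\<bar> * (u z \<bullet> u z)))"
proof -
 have "integrable lborel (\<lambda>z. (\<bar>a z - 1\<bar> *\<^sub>R u z) \<bullet> (K z *\<^sub>R u z))"
 proof (rule integrable_inner_L2)
  show "L2 (\<lambda>z. (\<bar>a z - 1\<bar> *\<^sub>R u z) $ i)" for i
   using L2_bdd[OF L2_u[of i], of "\<lambda>z. \<bar>a z - 1\<bar>" C] a(1) D_le by simp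
  show "L2 (\<lambda>z. (K z *\<^sub>R u z) $ i)" for i using L2_K[OF L2_u[of i]] u(3) by simp
 qed
 then show ?thesis by (simp add: mult_ac)
qed

lemma int_A: "integrable lborel (\<lambda>z. K z * (a z * (g z \<bullet> g z)))"
proof -
 have "integrable lborel (\<lambda>z. (a z *\<^sub>R g z) \<bullet> (K z *\<^sub>R g z))"
 proof (rule integrable_inner_L2)
  show "L2 (\<lambda>z. (a z *\<^sub>R g z) $ i)" for i
   using L2_bdd[OF L2_g[of i] a(1), of C] a(2,3) by simp
  show "L2 (\<lambda>z. (K z *\<^sub>R g z) $ i)" for i using L2_K[OF L2_g[of i]] supp by simp
 qed
 then show ?thesis by (simp add: mult_ac)
qed

lemma int_S: "integrable lborel (\<lambda>z. K z * ((a z - 1) * (u z \<bullet> g z)))"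
proof -
 have "integrable lborel (\<lambda>z. ((a z - 1) *\<^sub>R u z) \<bullet> (K z *\<^sub>R g z))"
 proof (rule integrable_inner_L2)
  show "L2 (\<lambda>z. ((a z - 1) *\<^sub>R u z) $ i)" for i
   using L2_bdd[OF L2_u[of i], of "\<lambda>z. a z - 1" C] a(1) D_le by simp
  show "L2 (\<lambda>z. (K z *\<^sub>R g z) $ i)" for i using L2_K[OF L2_g[of i]] supp by simp
 qed
 then show ?thesis by (simp add: mult_ac)
qed

lemma int_w: "integrable lborel (\<lambda>z. K z * (w z)\<^sup>2)"
 using L2_prod_integrable[OF L2_K[OF L2_w] L2_w] supp by (simp add: power2_eq_square mult.assoc)

lemma M_nonneg: "M \<ge> 0" unfolding M_def by (intro integral_nonneg_AE AE_I2 mult_nonneg_nonneg less_imp_le[OF K_pos]) auto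

lemma A_nonneg: "AA \<ge> 0" unfolding AA_def by (intro integral_nonneg_AE AE_I2 mult_nonneg_nonneg less_imp_le[OF K_pos] a(2)) auto

text \<open>The product rule for K w produces terms with w and the gradient of K, of size epsilon
  tau K |w|. Young's inequality distributes them over epsilon shares of the densities of AA and M
  and over tau^2 / 2 times w^2; the last share is what the decay of K in time pays for.\<close>

lemma flux_lower:
 "(1 - \<epsilon>) * (K z * (a z * (g z \<bullet> g z))) + K z * ((a z - 1) * (u z \<bullet> g z)) - \<tau>\<^sup>2 / 2 * (K z * (w z)\<^sup>2) - \<epsilon> * (K z * (\<bar>a z - 1\<bar> * (u z \<bullet> u z)))
  \<le> (a z *\<^sub>R g z + (a z - 1) *\<^sub>R u z) \<bullet> (K z *\<^sub>R g z + w z *\<^sub>R gradx_part K z)"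
proof -
 define b where "b = gradx_part \<Psi> z"
 define G U v D where "G = norm (g z)" and "U = norm (u z)" and "v = \<bar>w z\<bar>" and "D = \<bar>a z - 1\<bar>"
 have nb: "norm b \<le> \<epsilon> * \<tau>" using \<Psi>(3)[of z] \<tau>(3) by (simp add: b_def)
 have nn: "G \<ge> 0" "U \<ge> 0" "v \<ge> 0" "D \<ge> 0" by (auto simp: G_def U_def v_def D_def)
 have D: "D \<le> C" using D_le by (simp add: D_def)
 have gb: "\<bar>g z \<bullet> b\<bar> \<le> G * (\<epsilon> * \<tau>)" and ub: "\<bar>u z \<bullet> b\<bar> \<le> U * (\<epsilon> * \<tau>)"
  using Cauchy_Schwarz_ineq2[of "g z" b] Cauchy_Schwarz_ineq2[of "u z" b] mult_left_mono[OF nb norm_ge_zero[of "g z"]] mult_left_mono[OF nb norm_ge_zero[of "u z"]]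
  by (auto simp: G_def U_def)
 have 1: "\<bar>a z * w z * (g z \<bullet> b)\<bar> \<le> (\<epsilon> / 2) * (a z * G\<^sup>2) + (\<epsilon> * C / 2) * (\<tau>\<^sup>2 * v\<^sup>2)"
 proof -
  have "\<bar>a z * w z * (g z \<bullet> b)\<bar> = a z * v * \<bar>g z \<bullet> b\<bar>" using a(2)[of z] by (simp add: abs_mult v_def)
  also have "\<dots> \<le> a z * v * (G * (\<epsilon> * \<tau>))" using gb nn a(2)[of z] by (intro mult_left_mono) auto
  also have "\<dots> = (\<epsilon> * a z) * (G * (\<tau> * v))" by (simp only: mult_ac)
  also have "\<dots> \<le> (\<epsilon> * a z) * ((G\<^sup>2 + (\<tau> * v)\<^sup>2) / 2)" using \<epsilon> a(2)[of z] by (intro mult_left_mono mult_le_half_squares) auto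
  also have "\<dots> = (\<epsilon> / 2) * (a z * G\<^sup>2) + (\<epsilon> / 2) * (a z * (\<tau>\<^sup>2 * v\<^sup>2))" by (simp add: field_simps power_mult_distrib)
  also have "\<dots> \<le> (\<epsilon> / 2) * (a z * G\<^sup>2) + (\<epsilon> / 2) * (C * (\<tau>\<^sup>2 * v\<^sup>2))"
   using \<epsilon> a(3)[of z] by (intro add_left_mono mult_left_mono mult_right_mono) auto
  finally show ?thesis by (simp add: mult_ac)
 qed
 have 2: "\<bar>(a z - 1) * w z * (u z \<bullet> b)\<bar> \<le> (\<epsilon> / 2) * (D * U\<^sup>2) + (\<epsilon> * C / 2) * (\<tau>\<^sup>2 * v\<^sup>2)"
 proof -
  have "\<bar>(a z - 1) * w z * (u z \<bullet> b)\<bar> = D * v * \<bar>u z \<bullet> b\<bar>" by (simp add: abs_mult v_def D_def)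
  also have "\<dots> \<le> D * v * (U * (\<epsilon> * \<tau>))" using ub nn by (intro mult_left_mono) auto
  also have "\<dots> = (\<epsilon> * D) * (U * (\<tau> * v))" by (simp only: mult_ac)
  also have "\<dots> \<le> (\<epsilon> * D) * ((U\<^sup>2 + (\<tau> * v)\<^sup>2) / 2)" using \<epsilon> nn by (intro mult_left_mono mult_le_half_squares) auto
  also have "\<dots> = (\<epsilon> / 2) * (D * U\<^sup>2) + (\<epsilon> / 2) * (D * (\<tau>\<^sup>2 * v\<^sup>2))" by (simp add: field_simps power_mult_distrib)
  also have "\<dots> \<le> (\<epsilon> / 2) * (D * U\<^sup>2) + (\<epsilon> / 2) * (C * (\<tau>\<^sup>2 * v\<^sup>2))"
   using \<epsilon> D by (intro add_left_mono mult_left_mono mult_right_mono) auto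
  finally show ?thesis by (simp add: mult_ac)
 qed
 have 3: "(\<epsilon> * C) * (\<tau>\<^sup>2 * v\<^sup>2) \<le> (1 / 2) * (\<tau>\<^sup>2 * v\<^sup>2)" using \<epsilon>(2) by (intro mult_right_mono) auto
 have 4: "0 \<le> (\<epsilon> / 2) * (a z * G\<^sup>2)" "0 \<le> (\<epsilon> / 2) * (D * U\<^sup>2)" using \<epsilon> a(2)[of z] nn by auto
 have "(1 - \<epsilon>) * (a z * G\<^sup>2) + (a z - 1) * (u z \<bullet> g z) - \<tau>\<^sup>2 / 2 * v\<^sup>2 - \<epsilon> * (D * U\<^sup>2)
   \<le> a z * G\<^sup>2 + (a z - 1) * (u z \<bullet> g z) + a z * w z * (g z \<bullet> b) + (a z - 1) * w z * (u z \<bullet> b)"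
 proof -
  have "(1 - \<epsilon>) * (a z * G\<^sup>2) = a z * G\<^sup>2 - 2 * ((\<epsilon> / 2) * (a z * G\<^sup>2))" "\<epsilon> * (D * U\<^sup>2) = 2 * ((\<epsilon> / 2) * (D * U\<^sup>2))"
   "(\<epsilon> * C) * (\<tau>\<^sup>2 * v\<^sup>2) = 2 * ((\<epsilon> * C / 2) * (\<tau>\<^sup>2 * v\<^sup>2))" "\<tau>\<^sup>2 / 2 * v\<^sup>2 = (1/2) * (\<tau>\<^sup>2 * v\<^sup>2)" by (simp_all add: algebra_simps)
  then show ?thesis using abs_le_D2[OF 1] abs_le_D2[OF 2] 3 4 by linarith
 qed
 from mult_left_mono[OF this less_imp_le[OF K_pos[of z]]]
 show ?thesis
  unfolding gradx_K b_def[symmetric]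
  by (simp add: inner_add_left inner_add_right power2_norm_eq_inner G_def U_def v_def D_def algebra_simps)
qed

text \<open>Applies \<open>energy_inequality\<close> with m = tau^2 / 2, as K decays at rate at
  least tau^2. The dissipation then cancels exactly the negative w^2 term of
  \<open>flux_lower\<close>.\<close>

lemma energy:
 assumes \<delta>: "\<delta> > 0" and k0: "k0 \<ge> 0" "\<And>t x. T - \<delta> < t \<Longrightarrow> t < T \<Longrightarrow> x \<in> \<Omega> \<Longrightarrow> k0 \<le> K (t, x)"
  and k1: "\<And>t x. 0 \<le> t \<Longrightarrow> t \<le> \<delta> \<Longrightarrow> x \<in> \<Omega> \<Longrightarrow> K (t, x) \<le> k1"
 shows "k0 / 4 * N2 WT + (1 - \<epsilon>) * AA + S \<le> k1 / 2 * N2 W0 + \<epsilon> * M"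
proof -
 let ?H = "\<lambda>z. a z *\<^sub>R g z + (a z - 1) *\<^sub>R u z" and ?G = "\<lambda>z. K z *\<^sub>R g z + w z *\<^sub>R gradx_part K z"
 have decay: "K (t + h, x) \<le> exp (- (2 * (\<tau>\<^sup>2 / 2) * h)) * K (t, x)" if h: "h \<ge> 0" for t x h
 proof -
  have "A1 * h \<le> \<tau>\<^sup>2 * h" using \<tau>(2) h by (rule mult_right_mono)
  then have "\<Psi> (t + h, x) - 2 * \<tau>\<^sup>2 * (t + h) \<le> - (2 * (\<tau>\<^sup>2 / 2) * h) + (\<Psi> (t, x) - 2 * \<tau>\<^sup>2 * t)"
   using \<Psi>(2)[OF h, of t x] by (simp add: algebra_simps)
  then show ?thesis by (simp only: K_def exp_add[symmetric] fst_conv exp_le_cancel_iff)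
 qed
 have E: "k0 / 4 * N2 WT + \<tau>\<^sup>2 / 2 * (LBINT z. K z * (w z)\<^sup>2) + (\<Sum>i\<in>UNIV. \<integral>z. ?H z $ i * ?G z $ i \<partial>lborel) \<le> k1 / 2 * N2 W0"
  using energy_inequality[OF ev lip T C1_K less_imp_le[OF K_pos] _ decay \<delta> k0 k1] by simp
 have LH: "L2 (\<lambda>z. ?H z $ i)" for i using ev unfolding weak_evol_def by blast
 have LG: "L2 (\<lambda>z. ?G z $ i)" for i by (rule approximable_multiplier(3)[OF lip T wg supp C1_K])
 have "(\<Sum>i\<in>UNIV. \<integral>z. ?H z $ i * ?G z $ i \<partial>lborel) = (LBINT z. ?H z \<bullet> ?G z)"
  unfolding inner_vec_def inner_real_def
  by (rule Bochner_Integration.integral_sum[symmetric]) (rule L2_prod_integrable[OF LH LG])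
 moreover have "(1 - \<epsilon>) * AA + S - \<tau>\<^sup>2 / 2 * (LBINT z. K z * (w z)\<^sup>2) - \<epsilon> * M
  = (LBINT z. (1 - \<epsilon>) * (K z * (a z * (g z \<bullet> g z))) + K z * ((a z - 1) * (u z \<bullet> g z)) - \<tau>\<^sup>2 / 2 * (K z * (w z)\<^sup>2) - \<epsilon> * (K z * (\<bar>a z - 1\<bar> * (u z \<bullet> u z))))"
  unfolding AA_def S_def M_def using int_A int_S int_w int_M by simp
 moreover have "\<dots> \<le> (LBINT z. ?H z \<bullet> ?G z)"
 proof (rule integral_mono[OF _ _ flux_lower])
  show "integrable lborel (\<lambda>z. (1 - \<epsilon>) * (K z * (a z * (g z \<bullet> g z))) + K z * ((a z - 1) * (u z \<bullet> g z)) - \<tau>\<^sup>2 / 2 * (K z * (w z)\<^sup>2) - \<epsilon> * (K z * (\<bar>a z - 1\<bar> * (u z \<bullet> u z))))"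
   using int_A int_S int_w int_M by simp
  show "integrable lborel (\<lambda>z. ?H z \<bullet> ?G z)" by (rule integrable_inner_L2[OF LH LG])
 qed
 ultimately show ?thesis using E by linarith
qed

text \<open>Young's inequality between the densities of AA and M, made possible by |a - 1|^2 <= q a
  |a - 1|. When a >= 1 one may take q = 1 - 1/C, which is below 1.\<close>

lemma S_bound:
 assumes q: "q \<ge> 0" "\<And>z. z \<in> {0<..<T} \<times> \<Omega> \<Longrightarrow> \<bar>a z - 1\<bar> \<le> q * a z"
 shows "\<bar>S\<bar> \<le> (AA + q * M) / 2"
proof -
 have bd: "\<bar>K z * ((a z - 1) * (u z \<bullet> g z))\<bar> \<le> (1/2) * (K z * (a z * (g z \<bullet> g z))) + (q/2) * (K z * (\<bar>a z - 1\<bar> * (u z \<bullet> u z)))" for z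
 proof (cases "z \<in> {0<..<T} \<times> \<Omega>")
  case True
  define D where "D = \<bar>a z - 1\<bar>"
  have D: "0 \<le> D" "D \<le> q * a z" using q(2)[OF True] by (auto simp: D_def)
  have "D * (norm (u z) * norm (g z)) \<le> (a z * (norm (g z))\<^sup>2 + q * D * (norm (u z))\<^sup>2) / 2"
  proof (rule power2_le_imp_le)
   have "(D * (norm (u z) * norm (g z)))\<^sup>2 = (D * D) * ((norm (u z))\<^sup>2 * (norm (g z))\<^sup>2)" by (simp add: power2_eq_square mult_ac)
   also have "\<dots> \<le> (D * (q * a z)) * ((norm (u z))\<^sup>2 * (norm (g z))\<^sup>2)" using D by (intro mult_right_mono mult_left_mono) auto
   also have "\<dots> = (a z * (norm (g z))\<^sup>2) * (q * D * (norm (u z))\<^sup>2)" by (simp only: mult_ac)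
   also have "\<dots> \<le> ((a z * (norm (g z))\<^sup>2 + q * D * (norm (u z))\<^sup>2) / 2)\<^sup>2"
   proof -
    have "x * y \<le> ((x + y) / 2)\<^sup>2" for x y :: real
     using zero_le_power2[of "x - y"] by (simp add: power2_eq_square field_simps)
    then show ?thesis .
   qed
   finally show "(D * (norm (u z) * norm (g z)))\<^sup>2 \<le> ((a z * (norm (g z))\<^sup>2 + q * D * (norm (u z))\<^sup>2) / 2)\<^sup>2" .
   show "0 \<le> (a z * (norm (g z))\<^sup>2 + q * D * (norm (u z))\<^sup>2) / 2" using a(2)[of z] q D by (intro divide_nonneg_pos add_nonneg_nonneg mult_nonneg_nonneg) auto
  qed
  moreover have "\<bar>(a z - 1) * (u z \<bullet> g z)\<bar> \<le> D * (norm (u z) * norm (g z))"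
   unfolding abs_mult D_def by (intro mult_left_mono Cauchy_Schwarz_ineq2) auto
  ultimately have "\<bar>(a z - 1) * (u z \<bullet> g z)\<bar> \<le> (a z * (norm (g z))\<^sup>2 + q * D * (norm (u z))\<^sup>2) / 2" by linarith
  from mult_left_mono[OF this less_imp_le[OF K_pos[of z]]]
  have "K z * \<bar>(a z - 1) * (u z \<bullet> g z)\<bar> \<le> K z * ((a z * (norm (g z))\<^sup>2 + q * D * (norm (u z))\<^sup>2) / 2)" .
  also have "K z * \<bar>(a z - 1) * (u z \<bullet> g z)\<bar> = \<bar>K z * ((a z - 1) * (u z \<bullet> g z))\<bar>"
   using K_pos[of z] by (simp add: abs_mult)
  finally show ?thesis by (simp add: power2_norm_eq_inner D_def field_simps)
 next
  case False
  then show ?thesis using supp u(3) by simp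
 qed
 have "\<bar>S\<bar> \<le> (LBINT z. \<bar>K z * ((a z - 1) * (u z \<bullet> g z))\<bar>)" unfolding S_def by (rule integral_abs_bound)
 also have "\<dots> \<le> (LBINT z. (1/2) * (K z * (a z * (g z \<bullet> g z))) + (q/2) * (K z * (\<bar>a z - 1\<bar> * (u z \<bullet> u z))))"
  using int_S int_A int_M by (intro integral_mono bd integrable_abs Bochner_Integration.integrable_add integrable_mult_right)
 also have "\<dots> = (AA + q * M) / 2" unfolding AA_def M_def using int_A int_M by (simp add: add_divide_distrib)
 finally show ?thesis .
qed

text \<open>If kappa us were equal to K u, the volume integral would be sigma M + S; the constant
  sign of a - 1 is what turns its quadratic part into sigma M. The relative error epsilon' is paid
  in M and AA.\<close>

lemma indicator_functional:
 fixes us :: "real \<times> (real^3) \<Rightarrow> real^3" and \<kappa> :: "real \<times> (real^3) \<Rightarrow> real"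
 assumes us: "\<And>i. (\<lambda>z. us z $ i) \<in> borel_measurable borel" "\<kappa> \<in> borel_measurable borel" and \<epsilon>': "\<epsilon>' \<ge> 0"
  and E: "\<And>z. z \<in> {0<..<T} \<times> \<Omega> \<Longrightarrow> norm (\<kappa> z *\<^sub>R us z - K z *\<^sub>R u z) \<le> \<epsilon>' * (K z * norm (u z))"
  and us0: "\<And>z. z \<notin> {0<..<T} \<times> \<Omega> \<Longrightarrow> us z = 0"
  and \<sigma>: "\<bar>\<sigma>\<bar> = 1" "\<And>z. z \<in> {0<..<T} \<times> \<Omega> \<Longrightarrow> a z - 1 = \<sigma> * \<bar>a z - 1\<bar>"
 shows "\<bar>(LBINT z. (a z - 1) * ((u z + g z) \<bullet> us z) * \<kappa> z) - (\<sigma> * M + S)\<bar> \<le> \<epsilon>' * (2 * M + C * AA)"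
proof -
 let ?R = "\<lambda>z. (a z - 1) * ((u z + g z) \<bullet> (\<kappa> z *\<^sub>R us z - K z *\<^sub>R u z))"
 have split: "(a z - 1) * ((u z + g z) \<bullet> us z) * \<kappa> z
   = (\<sigma> * (K z * (\<bar>a z - 1\<bar> * (u z \<bullet> u z))) + K z * ((a z - 1) * (u z \<bullet> g z))) + ?R z" for z
 proof (cases "z \<in> {0<..<T} \<times> \<Omega>")
  case True
  have "(a z - 1) * ((u z + g z) \<bullet> us z) * \<kappa> z = ((a z - 1) * (K z * (u z \<bullet> u z)) + K z * ((a z - 1) * (u z \<bullet> g z))) + ?R z"
   by (simp add: inner_add_left inner_diff_right inner_commute[of "g z" "u z"] algebra_simps)
  also have "(a z - 1) * (K z * (u z \<bullet> u z)) = (\<sigma> * \<bar>a z - 1\<bar>) * (K z * (u z \<bullet> u z))" by (simp only: \<sigma>(2)[OF True, symmetric])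
  finally show ?thesis by (simp add: mult_ac)
 qed (simp add: us0 u(3) supp)
 have bd: "\<bar>?R z\<bar> \<le> \<epsilon>' * (2 * (K z * (\<bar>a z - 1\<bar> * (u z \<bullet> u z))) + C * (K z * (a z * (g z \<bullet> g z))))" for z
 proof (cases "z \<in> {0<..<T} \<times> \<Omega>")
  case True
  define D U G where "D = \<bar>a z - 1\<bar>" and "U = norm (u z)" and "G = norm (g z)"
  have nn: "0 \<le> D" "0 \<le> U" "0 \<le> G" by (auto simp: D_def U_def G_def)
  have "\<bar>?R z\<bar> \<le> D * (norm (u z + g z) * norm (\<kappa> z *\<^sub>R us z - K z *\<^sub>R u z))"
   unfolding abs_mult D_def by (intro mult_left_mono Cauchy_Schwarz_ineq2) auto
  also have "\<dots> \<le> D * ((U + G) * (\<epsilon>' * (K z * U)))"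
   using E[OF True] nn by (intro mult_left_mono mult_mono) (auto simp: U_def G_def norm_triangle_ineq)
  also have "\<dots> = \<epsilon>' * (K z * (D * (U\<^sup>2 + U * G)))" by (simp add: power2_eq_square algebra_simps)
  also have "\<dots> \<le> \<epsilon>' * (K z * (2 * (D * U\<^sup>2) + C * (a z * G\<^sup>2)))"
  proof (intro mult_left_mono)
   have "D * (U * G) \<le> D * ((U\<^sup>2 + G\<^sup>2) / 2)" using nn by (intro mult_left_mono mult_le_half_squares)
   moreover have "D * G\<^sup>2 \<le> (C * a z) * G\<^sup>2" using D_le_a[OF True] by (intro mult_right_mono) (auto simp: D_def)
   moreover have "0 \<le> D * U\<^sup>2" "0 \<le> C * (a z * G\<^sup>2)" using nn C a(2)[of z] by auto
   moreover have "D * ((U\<^sup>2 + G\<^sup>2) / 2) = (D * U\<^sup>2) / 2 + (D * G\<^sup>2) / 2" "D * (U\<^sup>2 + U * G) = D * U\<^sup>2 + D * (U * G)"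
    "(C * a z) * G\<^sup>2 = C * (a z * G\<^sup>2)" by (simp_all add: field_simps)
   ultimately show "D * (U\<^sup>2 + U * G) \<le> 2 * (D * U\<^sup>2) + C * (a z * G\<^sup>2)" by linarith
  qed (use \<epsilon>' K_pos[of z] in auto)
  finally show ?thesis by (simp add: D_def U_def G_def power2_norm_eq_inner algebra_simps)
 qed (simp add: us0 u(3) supp)
 have ib: "integrable lborel (\<lambda>z. \<epsilon>' * (2 * (K z * (\<bar>a z - 1\<bar> * (u z \<bullet> u z))) + C * (K z * (a z * (g z \<bullet> g z)))))"
  using int_M int_A by simp
 have mg: "(\<lambda>z. g z $ i) \<in> borel_measurable borel" for i using L2_g by (rule L2_measurable)
 have iR: "integrable lborel ?R"
 proof (rule Bochner_Integration.integrable_bound[OF ib])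
  note [measurable] = us a(1) u(1) mg K_measurable
  show "?R \<in> borel_measurable lborel" unfolding inner_vec_def inner_real_def by simp
  show "AE z in lborel. norm (?R z) \<le> norm (\<epsilon>' * (2 * (K z * (\<bar>a z - 1\<bar> * (u z \<bullet> u z))) + C * (K z * (a z * (g z \<bullet> g z)))))"
   using order_trans[OF bd abs_ge_self] by (intro AE_I2) (simp only: real_norm_def)
 qed
 have i1: "integrable lborel (\<lambda>z. \<sigma> * (K z * (\<bar>a z - 1\<bar> * (u z \<bullet> u z))) + K z * ((a z - 1) * (u z \<bullet> g z)))"
  using int_M int_S by simp
 have "(LBINT z. (a z - 1) * ((u z + g z) \<bullet> us z) * \<kappa> z) = (\<sigma> * M + S) + (LBINT z. ?R z)"
  unfolding split Bochner_Integration.integral_add[OF i1 iR] M_def S_def using int_M int_S by simp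
 then have "\<bar>(LBINT z. (a z - 1) * ((u z + g z) \<bullet> us z) * \<kappa> z) - (\<sigma> * M + S)\<bar> = \<bar>\<integral>z. ?R z \<partial>lborel\<bar>" by simp
 also have "\<dots> \<le> (LBINT z. \<bar>?R z\<bar>)" by (rule integral_abs_bound)
 also have "\<dots> \<le> (LBINT z. \<epsilon>' * (2 * (K z * (\<bar>a z - 1\<bar> * (u z \<bullet> u z))) + C * (K z * (a z * (g z \<bullet> g z)))))"
  by (rule integral_mono[OF integrable_abs[OF iR] ib bd])
 also have "\<dots> = \<epsilon>' * (2 * M + C * AA)" unfolding M_def AA_def using int_M int_A by simp
 finally show ?thesis .
qed

end

text \<open>For sigma = 1, the energy bound and the bound on S give A <= q M up to small terms,
  hence |S| <= q M with q = 1 - 1/C, and S cannot cancel M. For sigma = -1, the energy bound makes S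
  nonpositive up to small terms, so S reinforces -M and the size of q is irrelevant to the lower
  bound. The bound on Nk controls the terminal value of the wave.\<close>

lemma two_sided_from_energy:
 fixes M A S J I0 Nk C \<sigma> q \<epsilon> \<epsilon>' :: real
 assumes C: "C > 1" and nn: "M \<ge> 0" "A \<ge> 0" "I0 \<ge> 0" "Nk \<ge> 0"
  and \<epsilon>: "\<epsilon> = 1 / (8 * C)" "\<epsilon>' = 1 / (4 * C * (2 + C + 2 * C\<^sup>2))"
  and en: "Nk + (1 - \<epsilon>) * A + S \<le> I0 + \<epsilon> * M" and S: "\<bar>S\<bar> \<le> (A + q * M) / 2"
  and J: "\<bar>J - (\<sigma> * M + S)\<bar> \<le> \<epsilon>' * (2 * M + C * A)"
  and cs: "(\<sigma> = 1 \<and> q = 1 - 1 / C) \<or> (\<sigma> = -1 \<and> q = C)"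
 shows "1 / (2 * C) * M - 3 * I0 \<le> \<bar>J\<bar>" and "\<bar>J\<bar> \<le> (4 + 2 * C) * M + 3 * I0" and "Nk \<le> (2 + 2 * C) * M + 3 * I0"
proof -
 define p where "p = 1 / C"
 have p: "p > 0" "p < 1" "p * C = 1" using C by (auto simp: p_def)
 have e: "\<epsilon> = p / 8" by (simp add: \<epsilon> p_def)
 have "2 + C + 2 * C\<^sup>2 > 0" using C by (simp add: add_pos_nonneg)
 moreover have "1 / (4 * C * X) * X = 1 / C / 4 \<and> 1 / (4 * C * X) \<ge> 0" if "X > 0" for X using that C by simp
 ultimately have e': "\<epsilon>' * (2 + C + 2 * C\<^sup>2) = p / 4" and e'0: "\<epsilon>' \<ge> 0" unfolding \<epsilon>(2) p_def by blast+
 have e'1: "\<epsilon>' * 2 + \<epsilon>' * C + \<epsilon>' * (2 * C\<^sup>2) = p / 4" using e' by (simp add: distrib_left)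
 have en2: "\<epsilon>' * C \<ge> 0" "\<epsilon>' * (2 * C\<^sup>2) \<ge> 0" using e'0 C by auto
 have qC: "q \<le> C" "q \<ge> 0" using cs C p unfolding p_def by linarith+
 have qM: "q * M \<le> C * M" "0 \<le> q * M" using qC nn by (auto intro: mult_right_mono)
 have pA: "p * A \<le> 1 * A" "p * M \<le> 1 * M" "0 \<le> p * A" "0 \<le> p * M" using p nn mult_right_mono[of p 1 A] mult_right_mono[of p 1 M] by auto
 have en': "Nk + A - (p * A) / 8 + S \<le> I0 + (p * M) / 8" using en by (simp add: e algebra_simps)
 have SS: "S \<le> (A + q * M) / 2" "- S \<le> (A + q * M) / 2" using S by auto
 have A1: "A \<le> 4 * I0 + M + 2 * (q * M)" using en' SS pA nn by argo
 have A2: "A \<le> 4 * I0 + M + 2 * (C * M)" using A1 qM by linarith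
 \<comment> \<open>Origin of epsilon': inserting A <= 4 I0 + M + 2 C M gives M the coefficient 2 + C
   + 2 C^2, and epsilon' reduces it to 1 / (4 C).\<close>
 have rest: "\<epsilon>' * (2 * M + C * A) \<le> (p / 4) * M + I0"
 proof -
  have "\<epsilon>' * C * A \<le> \<epsilon>' * C * (4 * I0 + M + 2 * (C * M))" using A2 en2 by (intro mult_left_mono)
  moreover have "\<epsilon>' * C * (4 * I0) \<le> 1 * I0"
  proof -
   have "\<epsilon>' * C * 4 \<le> 1" using e'1 en2 e'0 p by linarith
   from mult_right_mono[OF this nn(3)] show ?thesis by (simp add: mult_ac)
  qed
  moreover have "\<epsilon>' * 2 * M + \<epsilon>' * C * M + \<epsilon>' * (2 * C\<^sup>2) * M = (p / 4) * M" unfolding e'1[symmetric] by (simp add: algebra_simps)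
  moreover have "\<epsilon>' * (2 * M + C * A) = \<epsilon>' * 2 * M + \<epsilon>' * C * A"
   "\<epsilon>' * C * (4 * I0 + M + 2 * (C * M)) = \<epsilon>' * C * (4 * I0) + \<epsilon>' * C * M + \<epsilon>' * (2 * C\<^sup>2) * M" by (simp_all add: algebra_simps power2_eq_square)
  ultimately show ?thesis by linarith
 qed
 have JJ: "J - (\<sigma> * M + S) \<le> (p / 4) * M + I0" "(\<sigma> * M + S) - J \<le> (p / 4) * M + I0" using J rest by linarith+
 have "(p / 2) * M - 3 * I0 \<le> \<bar>J\<bar>"
  using cs
 proof
  assume s: "\<sigma> = 1 \<and> q = 1 - 1 / C"
  then have "q = 1 - p" by (simp add: p_def)
  then have q: "q * M = M - p * M" by (simp add: left_diff_distrib)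
  have "(1 - p / 4) * A \<le> 2 * I0 + (p * M) / 4 + q * M"
   using en' SS nn by (simp add: algebra_simps)
  \<comment> \<open>The bracket is the intended bound for A. Multiplying it back by 1 - p / 4 avoids
    a division.\<close>
  moreover have "(1 - p / 4) * (4 * I0 + M - (p * M) / 2) \<ge> 2 * I0 + (p * M) / 4 + q * M"
  proof -
   have "(1 - p / 4) * (4 * I0 + M - (p * M) / 2) = 4 * I0 + M - (p * M) / 2 - p * I0 - (p * M) / 4 + p * (p * M) / 8" by (simp add: algebra_simps)
   moreover have "p * I0 \<le> 1 * I0" "0 \<le> p * (p * M)" using p nn mult_right_mono[of p 1 I0] by auto
   ultimately show ?thesis unfolding q using pA nn by argo
  qed
  ultimately have "(1 - p / 4) * A \<le> (1 - p / 4) * (4 * I0 + M - (p * M) / 2)" by linarith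
  then have "A \<le> 4 * I0 + M - (p * M) / 2" by (rule mult_left_le_imp_le) (use p in simp)
  moreover have "M + S - J \<le> (p * M) / 4 + I0" using JJ(2) s by simp
  moreover have "- S \<le> (A + (M - p * M)) / 2" using SS(2) unfolding q .
  ultimately have "(p * M) / 2 - 3 * I0 \<le> J" by argo
  then show ?thesis by simp
 next
  assume s: "\<sigma> = -1 \<and> q = C"
  have "S \<le> I0 + (p * M) / 8" using en' pA nn by linarith
  moreover have "J \<le> - M + S + (p * M) / 4 + I0" using JJ(1) s by simp
  ultimately have "- J \<ge> M - (p * M) / 8 - (p * M) / 4 - 2 * I0" by linarith
  then have "(p * M) / 2 - 3 * I0 \<le> - J" using pA nn by linarith
  then show ?thesis by simp
 qed
 then show "1 / (2 * C) * M - 3 * I0 \<le> \<bar>J\<bar>" by (simp add: p_def)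
 have "\<bar>\<sigma> * M\<bar> \<le> M" using cs nn by auto
 moreover have "(p / 4) * M \<le> M" using pA nn by simp
 ultimately show "\<bar>J\<bar> \<le> (4 + 2 * C) * M + 3 * I0" using JJ S A2 qM nn by (simp add: algebra_simps) 
 show "Nk \<le> (2 + 2 * C) * M + 3 * I0"
 proof -
  have "Nk \<le> I0 + (p * M) / 8 + (A + q * M) / 2" using en' SS pA nn by linarith
  moreover have "(2 + 2 * C) * M = 2 * M + 2 * (C * M)" by (simp add: distrib_right)
  ultimately show ?thesis using A2 qM pA nn by argo
 qed
qed

section \<open>Potentials of the moving source\<close>

definition csrc :: real where "csrc = 1 / (8 * pi powr (3/2))"

lemma csrc_pos: "csrc > 0" by (simp add: csrc_def)

text \<open>Closed form of the increment of rho from t to t + s for t, s >= 0 and theta > 0, by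
  \<open>rho_eq\<close>.\<close>

definition fwd_phase :: "real \<Rightarrow> real \<Rightarrow> real \<Rightarrow> real \<Rightarrow> real" where
 "fwd_phase \<mu> \<theta> t s = \<mu> * (\<bar>t + s - \<theta>\<bar> - \<bar>t - \<theta>\<bar>)"

abbreviation bpot where "bpot y \<tau> t \<equiv> pot \<tau> (\<lambda>_. 0) (\<lambda>s. y (t - s))"
abbreviation bgpot where "bgpot y \<tau> t \<equiv> gpot \<tau> (\<lambda>_. 0) (\<lambda>s. y (t - s))"
abbreviation fpot where "fpot y \<tau> \<mu> \<theta> t \<equiv> pot \<tau> (fwd_phase \<mu> \<theta> t) (\<lambda>s. y (t + s))"
abbreviation fgpot where "fgpot y \<tau> \<mu> \<theta> t \<equiv> gpot \<tau> (fwd_phase \<mu> \<theta> t) (\<lambda>s. y (t + s))"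

lemma u_tau_eq: "u_tau y \<tau> t x = csrc * bpot y \<tau> t x"
 unfolding u_tau_def csrc_def pot_def pker_def set_lebesgue_integral_def by simp

lemma u_star_eq:
 assumes "\<theta> > 0" "t \<ge> 0"
 shows "u_star y \<tau> \<mu> \<theta> t x = csrc * fpot y \<tau> \<mu> \<theta> t x"
proof -
 have "indicator {0<..} s *\<^sub>R (exp (- (\<tau>\<^sup>2) * s - \<tau> * (rho \<mu> \<theta> (t + s) - rho \<mu> \<theta> t)) * exp (- ((norm (x - y (t + s)))\<^sup>2) / (4 * s)) * s powr (-3/2))
   = pker \<tau> (fwd_phase \<mu> \<theta> t) (\<lambda>s. y (t + s)) x s" for s
 proof (cases "s > 0")
  case True
  have "rho \<mu> \<theta> (t + s) - rho \<mu> \<theta> t = fwd_phase \<mu> \<theta> t s"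
   using True assms by (simp add: rho_eq fwd_phase_def right_diff_distrib)
  then show ?thesis by (simp add: pker_def)
 qed (simp add: pker_def)
 then show ?thesis unfolding u_star_def csrc_def pot_def set_lebesgue_integral_def by simp
qed

lemma curve_data_backward:
 assumes "L \<ge> 0" "\<And>s s'. norm (y s - y s') \<le> L * \<bar>s - s'\<bar>"
 shows "curve_data L 0 (\<lambda>s. y (t - s)) (\<lambda>_. 0)"
 using assms(1) assms(2)[of "t - s" "t - s'" for s s'] by (simp add: curve_data_def abs_minus_commute)

lemma curve_data_forward:
 assumes "L \<ge> 0" "\<mu> \<ge> 0" "\<And>s s'. norm (y s - y s') \<le> L * \<bar>s - s'\<bar>"
 shows "curve_data L \<mu> (\<lambda>s. y (t + s)) (fwd_phase \<mu> \<theta> t)"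
proof -
 have "\<bar>fwd_phase \<mu> \<theta> t s - fwd_phase \<mu> \<theta> t s'\<bar> \<le> \<mu> * \<bar>s - s'\<bar>" for s s'
 proof -
  have "fwd_phase \<mu> \<theta> t s - fwd_phase \<mu> \<theta> t s' = \<mu> * (\<bar>t + s - \<theta>\<bar> - \<bar>t + s' - \<theta>\<bar>)"
   by (simp add: fwd_phase_def algebra_simps)
  moreover have "\<bar>\<bar>t + s - \<theta>\<bar> - \<bar>t + s' - \<theta>\<bar>\<bar> \<le> \<bar>s - s'\<bar>" by linarith
  ultimately show ?thesis using assms(2) by (simp add: abs_mult mult_left_mono)
 qed
 then show ?thesis using assms(1,2) assms(3)[of "t + s" "t + s'" for s s'] by (simp add: curve_data_def fwd_phase_def)
qed

lemma grad_U_tau: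
 assumes "L \<ge> 0" "\<And>s s'. norm (y s - y s') \<le> L * \<bar>s - s'\<bar>" "\<tau> > 0" "x \<noteq> y t"
 shows "grad (U_tau y \<tau> t) x = - (exp (\<tau>\<^sup>2 * t) * csrc) *\<^sub>R bgpot y \<tau> t x"
proof -
 have "U_tau y \<tau> t = (\<lambda>x. (exp (\<tau>\<^sup>2 * t) * csrc) * bpot y \<tau> t x)" by (simp add: fun_eq_iff U_tau_def u_tau_eq)
 then show ?thesis using grad_cmult_pot[OF curve_data_backward[OF assms(1,2)], of \<tau> x t] assms(3,4) by simp
qed

lemma grad_U_star:
 assumes "L \<ge> 0" "\<mu> \<ge> 0" "\<And>s s'. norm (y s - y s') \<le> L * \<bar>s - s'\<bar>" "\<tau> > 0" "\<tau> > \<mu>" "x \<noteq> y t" "\<theta> > 0" "t \<ge> 0"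
 shows "grad (U_star y \<tau> \<mu> \<theta> t) x = - (exp (- (\<tau>\<^sup>2) * t) * csrc) *\<^sub>R fgpot y \<tau> \<mu> \<theta> t x"
proof -
 have "U_star y \<tau> \<mu> \<theta> t = (\<lambda>x. (exp (- (\<tau>\<^sup>2) * t) * csrc) * fpot y \<tau> \<mu> \<theta> t x)"
  using assms by (simp add: fun_eq_iff U_star_def u_star_eq)
 then show ?thesis using grad_cmult_pot[OF curve_data_forward[OF assms(1,2,3)], of \<tau> x t] assms by simp
qed

text \<open>The length of the gradient of exp (-tau R) / R at distance R from the source.\<close>

definition gradp :: "real \<Rightarrow> real \<Rightarrow> real" where
 "gradp \<tau> R = exp (- \<tau> * R) * (\<tau> / R + 1 / R\<^sup>2)"

lemma norm_grad_p_tau: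
 assumes "x \<noteq> z" "\<tau> \<ge> 0"
 shows "norm (grad (p_tau \<tau> z) x) = gradp \<tau> (norm (x - z))"
proof -
 let ?R = "norm (x - z)"
 have R: "?R > 0" using assms by simp
 have n: "((\<lambda>x. norm (x - z)) has_derivative (\<lambda>v. v \<bullet> sgn (x - z))) (at x)"
 proof -
  have "x - z \<noteq> 0" using assms by simp
  then have "(norm has_derivative (\<lambda>v. v \<bullet> sgn (x - z))) (at (x - z))" by (rule has_derivative_norm)
  moreover have "((\<lambda>x. x - z) has_derivative (\<lambda>v. v)) (at x)" by (auto intro!: derivative_eq_intros)
  ultimately show ?thesis by (rule has_derivative_compose[where f = "\<lambda>x. x - z" and g = norm, rotated])
 qed
 have d: "((\<lambda>r. exp (- \<tau> * r) / r) has_real_derivative - gradp \<tau> ?R) (at ?R)"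
  using R by (auto intro!: derivative_eq_intros simp: gradp_def field_simps power2_eq_square)
 have "(p_tau \<tau> z has_derivative (\<lambda>v. - gradp \<tau> ?R * (v \<bullet> sgn (x - z)))) (at x)"
  using has_derivative_compose[OF n d[unfolded has_field_derivative_def]] by (simp add: p_tau_def[abs_def])
 then have "grad (p_tau \<tau> z) x = (- gradp \<tau> ?R) *\<^sub>R sgn (x - z)"
  by (simp add: grad_def vec_eq_iff frechet_derivative_eqI inner_axis_axis inner_axis')
 then show ?thesis using R assms(2) by (simp add: norm_sgn gradp_def)
qed

lemma gpot_measurable:
 fixes Q :: "real \<times> (real^3) \<Rightarrow> real \<Rightarrow> real^3" and Om :: "real \<times> (real^3) \<Rightarrow> real \<Rightarrow> real"
 assumes "continuous_on UNIV (\<lambda>p. Q (fst p) (snd p))" "continuous_on UNIV (\<lambda>p. Om (fst p) (snd p))"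
 shows "(\<lambda>z. gpot \<tau> (Om z) (Q z) (snd z)) \<in> borel_measurable borel"
proof -
 have [measurable]: "(\<lambda>p. Q (fst p) (snd p)) \<in> borel_measurable (borel \<Otimes>\<^sub>M borel)" "(\<lambda>p. Om (fst p) (snd p)) \<in> borel_measurable (borel \<Otimes>\<^sub>M borel)"
  using assms by (auto simp: borel_prod intro: borel_measurable_continuous_onI)
 have mp: "(\<lambda>p. (pker \<tau> (Om (fst p)) (Q (fst p)) (snd (fst p)) (snd p) / (2 * snd p)) *\<^sub>R (snd (fst p) - Q (fst p) (snd p)))
   \<in> borel_measurable ((borel :: (real \<times> (real^3)) measure) \<Otimes>\<^sub>M borel)"
  unfolding pker_def by measurable
 show ?thesis unfolding gpot_def
  by (rule lborel.borel_measurable_lebesgue_integral) (use mp in \<open>simp add: split_beta' measurable_lborel1\<close>)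
qed

text \<open>Both vectors are compared with the common leading term in direction e, of length E n.
  Since n <= 2 norm g1, all errors become multiples of norm g1; the constant 18 is 6 from summing
  them times 3 from E <= 3 F.\<close>

lemma perturbed_vector_bound:
 fixes g1 g2 e :: "'a::real_normed_vector"
 assumes e: "norm e = 1" and n: "n \<ge> 0" and \<epsilon>: "0 \<le> \<epsilon>" "\<epsilon> \<le> 1/2" and E: "E \<ge> 0" "E \<le> 3 * F" "\<bar>F - E\<bar> \<le> 2 * \<epsilon> * E"
  and g1: "norm (g1 - n *\<^sub>R e) \<le> \<epsilon> * n" and g2: "norm (k *\<^sub>R g2 - (E * n) *\<^sub>R e) \<le> \<epsilon> * (E * n)"
 shows "norm (k *\<^sub>R g2 - F *\<^sub>R g1) \<le> 18 * \<epsilon> * (F * norm g1)" "n / 2 \<le> norm g1" "norm g1 \<le> 2 * n"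
proof -
 have en: "\<epsilon> * n \<le> n / 2" using mult_right_mono[OF \<epsilon>(2) n] by simp
 have ne: "norm (n *\<^sub>R e) = n" using e n by simp
 have 1: "n - norm g1 \<le> \<epsilon> * n" using norm_triangle_ineq2[of "n *\<^sub>R e" g1] g1 unfolding ne norm_minus_commute[of "n *\<^sub>R e"] by linarith
 have 2: "norm g1 - n \<le> \<epsilon> * n" using norm_triangle_ineq2[of g1 "n *\<^sub>R e"] g1 unfolding ne by linarith
 show lo: "n / 2 \<le> norm g1" and "norm g1 \<le> 2 * n" using 1 2 en n by linarith+
 have "k *\<^sub>R g2 - F *\<^sub>R g1 = (k *\<^sub>R g2 - (E * n) *\<^sub>R e) - (F - E) *\<^sub>R g1 - E *\<^sub>R (g1 - n *\<^sub>R e)" by (simp add: algebra_simps)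
 then have "norm (k *\<^sub>R g2 - F *\<^sub>R g1) \<le> norm (k *\<^sub>R g2 - (E * n) *\<^sub>R e) + norm ((F - E) *\<^sub>R g1) + norm (E *\<^sub>R (g1 - n *\<^sub>R e))"
  by (metis norm_triangle_le_diff norm_triangle_ineq4 add_right_mono)
 also have "\<dots> \<le> \<epsilon> * (E * n) + (2 * \<epsilon> * E) * norm g1 + E * (\<epsilon> * n)"
  using g2 E mult_right_mono[OF E(3) norm_ge_zero[of g1]] mult_left_mono[OF g1 E(1)] by (intro add_mono) auto
 also have "\<dots> = 2 * ((\<epsilon> * E) * n) + 2 * ((\<epsilon> * E) * norm g1)" by (simp add: algebra_simps)
 also have "\<dots> \<le> 6 * ((\<epsilon> * E) * norm g1)"
 proof -
  have "(\<epsilon> * E) * n \<le> (\<epsilon> * E) * (2 * norm g1)" using lo E(1) \<epsilon>(1) by (intro mult_left_mono) auto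
  then show ?thesis by linarith
 qed
 also have "\<dots> \<le> 6 * ((\<epsilon> * (3 * F)) * norm g1)" using E \<epsilon> by (intro mult_left_mono mult_right_mono) auto
 finally show "norm (k *\<^sub>R g2 - F *\<^sub>R g1) \<le> 18 * \<epsilon> * (F * norm g1)" by (simp add: mult_ac)
qed

text \<open>In logarithms: kappa times the exponential factor of the forward gradient equals the
  weight times that of the backward gradient.\<close>

lemma log_weight_split:
 assumes "s = norm (x - y t) / (2 * \<tau>)"
 shows "- \<tau> * \<mu> * \<bar>t - \<theta>\<bar> + (- \<tau> * fwd_phase \<mu> \<theta> t s - \<tau> * (sgn (x - y t) \<bullet> (y t - y (t + s))))
  = log_weight y \<tau> \<mu> \<theta> (t, x) + (- \<tau> * (sgn (x - y t) \<bullet> (y t - y (t - s))))"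
 unfolding log_weight_def Let_def fst_conv snd_conv assms[symmetric] fwd_phase_def
 by (simp add: inner_diff_right algebra_simps)

text \<open>The number psi stands for any value close to \<open>log_weight\<close>, so that the
  estimates can be used for the mollified weight.\<close>

definition potential_estimates where
 "potential_estimates y \<tau> \<mu> \<theta> \<epsilon> b0 b1 B t x \<psi> \<longleftrightarrow>
    norm (kappa \<tau> \<mu> \<theta> t *\<^sub>R fgpot y \<tau> \<mu> \<theta> t x - exp \<psi> *\<^sub>R bgpot y \<tau> t x) \<le> 18 * \<epsilon> * (exp \<psi> * norm (bgpot y \<tau> t x)) \<and>
    b0 * ((gradp \<tau> (norm (x - y t)))\<^sup>2 * kappa \<tau> \<mu> \<theta> t) \<le> exp \<psi> * (norm (bgpot y \<tau> t x))\<^sup>2 \<and>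
    exp \<psi> * (norm (bgpot y \<tau> t x))\<^sup>2 \<le> b1 * ((gradp \<tau> (norm (x - y t)))\<^sup>2 * kappa \<tau> \<mu> \<theta> t) \<and>
    norm (bgpot y \<tau> t x) \<le> B * \<tau>"

text \<open>The constants precede epsilon, because epsilon is later fixed in terms of C while b0 and
  b1 enter the final constant. They come from the bounds for NN, for the backward exponent Theta1
  and for the weight; only the threshold tau0 depends on epsilon.\<close>

lemma potential_asymptotics:
 assumes y: "\<And>s s'. norm (y s - y s') \<le> L * \<bar>s - s'\<bar>" and L: "L \<ge> 0" and \<mu>: "\<mu> \<ge> 0" and \<delta>: "\<delta> > 0" and Rm: "Rm > 0"
 obtains b0 b1 B where "b0 > 0" "b1 > 0" "B > 0"
  "\<And>\<epsilon>. 0 < \<epsilon> \<Longrightarrow> \<epsilon> \<le> 1/2 \<Longrightarrow> \<exists>\<tau>0\<ge>1. \<tau>0 > \<mu> \<and> (\<forall>\<tau>\<ge>\<tau>0. \<forall>t x \<psi>. \<delta> \<le> norm (x - y t) \<and> norm (x - y t) \<le> Rm \<and>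
    \<bar>\<psi> - log_weight y \<tau> \<mu> \<theta> (t, x)\<bar> \<le> \<epsilon> \<longrightarrow>
    potential_estimates y \<tau> \<mu> \<theta> \<epsilon> b0 b1 B t x \<psi>)"
proof -
 obtain c1 c2 l where c: "c1 > 0" "c2 > 0" "l \<ge> 1"
  and Nlo: "\<And>\<tau> R. \<tau> > 0 \<Longrightarrow> R > 0 \<Longrightarrow> \<tau> * R / 2 \<ge> l \<Longrightarrow> c1 * (exp (- \<tau> * R) * \<tau> / R) \<le> NN \<tau> R"
  and Nup: "\<And>\<tau> R. \<tau> > 0 \<Longrightarrow> R > 0 \<Longrightarrow> \<tau> * R / 2 \<ge> l \<Longrightarrow> NN \<tau> R \<le> c2 * (exp (- \<tau> * R) * \<tau> / R)"
  by (rule NN_bounds) blast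
 define EL where "EL = exp (L * Rm / 2)"
 \<comment> \<open>Bounds the distance of psi from the exponent of kappa:
   \<open>log_weight_bound\<close> plus 1 for the distance of psi from the weight.\<close>
 define cm where "cm = (L + \<mu> / 2) * Rm + 1"
 define A0 where "A0 = c1 / (2 * EL * (1 + 1 / \<delta>))"
 define B0 where "B0 = 2 * c2 * EL"
 have EL: "EL > 0" by (simp add: EL_def)
 have "1 + 1 / \<delta> > 0" using \<delta> by (simp add: add_pos_pos)
 then have A0: "A0 > 0" using c EL by (simp add: A0_def)
 have B0: "B0 > 0" using c EL by (simp add: B0_def)
 show thesis
 proof (rule that[of "exp (- cm) * A0\<^sup>2" "exp cm * B0\<^sup>2" "B0 / \<delta>"])
  fix \<epsilon> :: real assume \<epsilon>: "0 < \<epsilon>" "\<epsilon> \<le> 1/2"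
  obtain \<tau>1 where \<tau>1: "\<tau>1 \<ge> 1" "\<tau>1 > 0"
   and as1: "\<And>\<tau> q \<omega> x R \<Theta>. \<tau> \<ge> \<tau>1 \<Longrightarrow> curve_data L 0 q \<omega> \<Longrightarrow> R = norm (x - q 0) \<Longrightarrow> \<delta> \<le> R \<Longrightarrow> R \<le> Rm \<Longrightarrow>
    \<Theta> = - \<tau> * \<omega> (R / (2 * \<tau>)) - \<tau> * (sgn (x - q 0) \<bullet> (q 0 - q (R / (2 * \<tau>)))) \<Longrightarrow>
    norm (gpot \<tau> \<omega> q x - (exp \<Theta> * NN \<tau> R) *\<^sub>R sgn (x - q 0)) \<le> \<epsilon> * (exp \<Theta> * NN \<tau> R)"
   using gpot_asymptotics[OF \<delta> L order_refl \<epsilon>(1) Rm] by blast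
  obtain \<tau>2 where \<tau>2: "\<tau>2 \<ge> 1" "\<tau>2 > \<mu>"
   and as2: "\<And>\<tau> q \<omega> x R \<Theta>. \<tau> \<ge> \<tau>2 \<Longrightarrow> curve_data L \<mu> q \<omega> \<Longrightarrow> R = norm (x - q 0) \<Longrightarrow> \<delta> \<le> R \<Longrightarrow> R \<le> Rm \<Longrightarrow>
    \<Theta> = - \<tau> * \<omega> (R / (2 * \<tau>)) - \<tau> * (sgn (x - q 0) \<bullet> (q 0 - q (R / (2 * \<tau>)))) \<Longrightarrow>
    norm (gpot \<tau> \<omega> q x - (exp \<Theta> * NN \<tau> R) *\<^sub>R sgn (x - q 0)) \<le> \<epsilon> * (exp \<Theta> * NN \<tau> R)"
   using gpot_asymptotics[OF \<delta> L \<mu> \<epsilon>(1) Rm] by blast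
  show "\<exists>\<tau>0\<ge>1. \<tau>0 > \<mu> \<and> (\<forall>\<tau>\<ge>\<tau>0. \<forall>t x \<psi>. \<delta> \<le> norm (x - y t) \<and> norm (x - y t) \<le> Rm \<and>
    \<bar>\<psi> - log_weight y \<tau> \<mu> \<theta> (t, x)\<bar> \<le> \<epsilon> \<longrightarrow>
    potential_estimates y \<tau> \<mu> \<theta> \<epsilon> (exp (- cm) * A0\<^sup>2) (exp cm * B0\<^sup>2) (B0 / \<delta>) t x \<psi>)"
   unfolding potential_estimates_def
  proof (intro exI[of _ "max (max \<tau>1 \<tau>2) (2 * l / \<delta>)"] conjI allI impI)
   fix \<tau> t x \<psi> assume "max (max \<tau>1 \<tau>2) (2 * l / \<delta>) \<le> \<tau>"
   then have \<tau>: "\<tau> \<ge> \<tau>1" "\<tau> \<ge> \<tau>2" "2 * l / \<delta> \<le> \<tau>" "\<tau> \<ge> 1" "\<tau> > 0" using \<tau>1 by auto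
   define R s e lw where "R = norm (x - y t)" and "s = R / (2 * \<tau>)" and "e = sgn (x - y t)" and "lw = log_weight y \<tau> \<mu> \<theta> (t, x)"
   assume "\<delta> \<le> norm (x - y t) \<and> norm (x - y t) \<le> Rm \<and> \<bar>\<psi> - log_weight y \<tau> \<mu> \<theta> (t, x)\<bar> \<le> \<epsilon>"
   then have R: "\<delta> \<le> R" "R \<le> Rm" "R > 0" and \<psi>: "\<bar>\<psi> - lw\<bar> \<le> \<epsilon>" using \<delta> by (auto simp: R_def lw_def)
   define \<Theta>1 where "\<Theta>1 = - \<tau> * 0 - \<tau> * (e \<bullet> (y t - y (t - s)))"
   define \<Theta>2 where "\<Theta>2 = - \<tau> * fwd_phase \<mu> \<theta> t s - \<tau> * (e \<bullet> (y t - y (t + s)))"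
   define n where "n = exp \<Theta>1 * NN \<tau> R"
   define X where "X = exp (- \<tau> * R) * \<tau> / R"
   have X: "X > 0" using \<tau> R by (simp add: X_def)
   have tR: "\<tau> * R / 2 \<ge> l"
   proof -
    have "2 * l \<le> \<tau> * \<delta>" using \<tau>(3) \<delta> by (simp add: divide_le_eq)
    also have "\<dots> \<le> \<tau> * R" using R \<tau> by (intro mult_left_mono) auto
    finally show ?thesis by simp
   qed
   have N: "c1 * X \<le> NN \<tau> R" "NN \<tau> R \<le> c2 * X" using Nlo[OF \<tau>(5) R(3) tR] Nup[OF \<tau>(5) R(3) tR] by (auto simp: X_def)
   have N0: "NN \<tau> R > 0" using N(1) c X by (meson less_le_trans mult_pos_pos)
   have n0: "n > 0" using N0 by (simp add: n_def)
   have e: "norm e = 1" using R by (simp add: e_def norm_sgn R_def)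
   have g1: "norm (bgpot y \<tau> t x - n *\<^sub>R e) \<le> \<epsilon> * n"
    using as1[OF \<tau>(1) curve_data_backward[OF L y, of t], of R x \<Theta>1] R
    by (simp add: R_def s_def e_def \<Theta>1_def n_def)
   have g2: "norm (fgpot y \<tau> \<mu> \<theta> t x - (exp \<Theta>2 * NN \<tau> R) *\<^sub>R e) \<le> \<epsilon> * (exp \<Theta>2 * NN \<tau> R)"
    using as2[OF \<tau>(2) curve_data_forward[OF L \<mu> y, of t \<theta>], of R x \<Theta>2] R
    by (simp add: R_def s_def e_def \<Theta>2_def)
   have kE: "kappa \<tau> \<mu> \<theta> t * exp \<Theta>2 = exp lw * exp \<Theta>1"
    using log_weight_split[of s x y t \<tau> \<mu> \<theta>] unfolding kappa_def exp_add[symmetric] lw_def \<Theta>1_def \<Theta>2_def e_def s_def R_def by simp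
   have k0: "kappa \<tau> \<mu> \<theta> t > 0" by (simp add: kappa_def)
   have g2': "norm (kappa \<tau> \<mu> \<theta> t *\<^sub>R fgpot y \<tau> \<mu> \<theta> t x - (exp lw * n) *\<^sub>R e) \<le> \<epsilon> * (exp lw * n)"
   proof -
    have En: "exp lw * n = kappa \<tau> \<mu> \<theta> t * (exp \<Theta>2 * NN \<tau> R)" unfolding n_def using kE by (simp add: mult.assoc[symmetric])
    have "kappa \<tau> \<mu> \<theta> t *\<^sub>R fgpot y \<tau> \<mu> \<theta> t x - (exp lw * n) *\<^sub>R e = kappa \<tau> \<mu> \<theta> t *\<^sub>R (fgpot y \<tau> \<mu> \<theta> t x - (exp \<Theta>2 * NN \<tau> R) *\<^sub>R e)"
     unfolding En by (simp add: scaleR_diff_right)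
    then have "norm (kappa \<tau> \<mu> \<theta> t *\<^sub>R fgpot y \<tau> \<mu> \<theta> t x - (exp lw * n) *\<^sub>R e) = kappa \<tau> \<mu> \<theta> t * norm (fgpot y \<tau> \<mu> \<theta> t x - (exp \<Theta>2 * NN \<tau> R) *\<^sub>R e)"
     using k0 by simp
    also have "\<dots> \<le> kappa \<tau> \<mu> \<theta> t * (\<epsilon> * (exp \<Theta>2 * NN \<tau> R))" using g2 k0 by (intro mult_left_mono) auto
    finally show ?thesis unfolding En by (simp add: mult_ac)
   qed
   have F1: "exp lw \<le> 3 * exp \<psi>"
   proof -
    have "exp lw \<le> exp (1 + \<psi>)" using \<psi> \<epsilon> by simp
    also have "\<dots> = exp 1 * exp \<psi>" by (rule exp_add)
    also have "\<dots> \<le> 3 * exp \<psi>" using exp_le by (intro mult_right_mono) auto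
    finally show ?thesis .
   qed
   have F2: "\<bar>exp \<psi> - exp lw\<bar> \<le> 2 * \<epsilon> * exp lw"
   proof -
    have "exp \<psi> - exp lw = (exp (\<psi> - lw) - 1) * exp lw" by (simp add: exp_diff field_simps)
    moreover have "\<bar>\<psi> - lw\<bar> \<le> 1" using \<psi> \<epsilon> by simp
    then have "\<bar>exp (\<psi> - lw) - 1\<bar> \<le> 2 * \<epsilon>" using exp_near_one[of "\<psi> - lw"] \<psi> by argo
    ultimately show ?thesis by (simp add: abs_mult)
   qed
   note pv = perturbed_vector_bound[OF e less_imp_le[OF n0] less_imp_le[OF \<epsilon>(1)] \<epsilon>(2) exp_ge_zero F1 F2 g1 g2']
   have g: "n / 2 \<le> norm (bgpot y \<tau> t x)" "norm (bgpot y \<tau> t x) \<le> 2 * n" by (rule pv)+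
   show "norm (kappa \<tau> \<mu> \<theta> t *\<^sub>R fgpot y \<tau> \<mu> \<theta> t x - exp \<psi> *\<^sub>R bgpot y \<tau> t x) \<le> 18 * \<epsilon> * (exp \<psi> * norm (bgpot y \<tau> t x))"
    by (rule pv)
   have \<Theta>1: "\<bar>\<Theta>1\<bar> \<le> L * Rm / 2"
   proof -
    have "\<bar>e \<bullet> (y t - y (t - s))\<bar> \<le> norm e * norm (y t - y (t - s))" by (rule Cauchy_Schwarz_ineq2)
    also have "\<dots> \<le> L * s" using y[of t "t - s"] R \<tau> by (simp add: e s_def)
    finally have "\<tau> * \<bar>e \<bullet> (y t - y (t - s))\<bar> \<le> \<tau> * (L * s)" using \<tau> by (intro mult_left_mono) auto
    also have "\<tau> * (L * s) = L * R / 2" using \<tau> by (simp add: s_def)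
    also have "\<dots> \<le> L * Rm / 2" using R L by (simp add: mult_left_mono)
    finally show ?thesis using \<tau> by (simp add: \<Theta>1_def abs_mult)
   qed
   have eT: "exp \<Theta>1 \<le> EL" "1 / EL \<le> exp \<Theta>1" using \<Theta>1 by (auto simp: EL_def exp_minus[symmetric] inverse_eq_divide[symmetric])
   have up: "norm (bgpot y \<tau> t x) \<le> B0 * X"
   proof -
    have "n \<le> EL * (c2 * X)" unfolding n_def using eT N N0 EL by (intro mult_mono) auto
    then show ?thesis using g(2) by (simp add: B0_def mult_ac)
   qed
   have lo: "A0 * ((1 + 1 / \<delta>) * X) \<le> norm (bgpot y \<tau> t x)"
   proof -
    have "1 / EL * (c1 * X) \<le> n" unfolding n_def using eT N N0 X c by (intro mult_mono) auto
    then have h: "1 / EL * (c1 * X) / 2 \<le> n / 2" by (rule divide_right_mono) simp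
    have "1 + 1 / \<delta> \<noteq> 0" using \<delta> divide_pos_pos[of 1 \<delta>] by linarith
    then have "A0 * ((1 + 1 / \<delta>) * X) = 1 / EL * (c1 * X) / 2" by (simp add: A0_def)
    also note h
    also note g(1)
    finally show ?thesis .
   qed
   have gp: "X \<le> gradp \<tau> R" "gradp \<tau> R \<le> (1 + 1 / \<delta>) * X"
   proof -
    have ge: "gradp \<tau> R = X + exp (- \<tau> * R) * (1 / R\<^sup>2)" by (simp add: gradp_def X_def distrib_left)
    then show "X \<le> gradp \<tau> R" by simp
    have "1 / R\<^sup>2 = 1 / R * (1 / R)" by (simp add: power2_eq_square)
    also have "\<dots> \<le> 1 / \<delta> * (\<tau> / R)" using R \<delta> \<tau> by (intro mult_mono divide_left_mono divide_right_mono) auto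
    finally have "exp (- \<tau> * R) * (1 / R\<^sup>2) \<le> exp (- \<tau> * R) * (1 / \<delta> * (\<tau> / R))" by (intro mult_left_mono) auto
    also have "\<dots> = 1 / \<delta> * X" by (simp add: X_def)
    finally show "gradp \<tau> R \<le> (1 + 1 / \<delta>) * X" unfolding ge by (simp add: distrib_right)
   qed
   have lw: "\<bar>lw + \<tau> * \<mu> * \<bar>t - \<theta>\<bar>\<bar> \<le> (L + \<mu> / 2) * Rm"
   proof -
    have "(L + \<mu> / 2) * R \<le> (L + \<mu> / 2) * Rm" using R L \<mu> by (intro mult_left_mono) auto
    then show ?thesis using log_weight_bound[OF y \<tau>(5) \<mu> L, of \<theta> t x] unfolding lw_def R_def by linarith
   qed
   have ek: "exp (- cm) * kappa \<tau> \<mu> \<theta> t \<le> exp \<psi>" "exp \<psi> \<le> exp cm * kappa \<tau> \<mu> \<theta> t"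
    using lw \<psi> \<epsilon> by (auto simp: kappa_def exp_add[symmetric] cm_def)
   have "A0 * gradp \<tau> R \<le> norm (bgpot y \<tau> t x)" by (rule order_trans[OF mult_left_mono[OF gp(2) less_imp_le[OF A0]] lo])
   then have "(A0 * gradp \<tau> R)\<^sup>2 \<le> (norm (bgpot y \<tau> t x))\<^sup>2" using A0 gp X by (intro power_mono) auto
   then have "(exp (- cm) * kappa \<tau> \<mu> \<theta> t) * (A0 * gradp \<tau> R)\<^sup>2 \<le> exp \<psi> * (norm (bgpot y \<tau> t x))\<^sup>2"
    using ek k0 by (intro mult_mono) auto
   then show "exp (- cm) * A0\<^sup>2 * ((gradp \<tau> (norm (x - y t)))\<^sup>2 * kappa \<tau> \<mu> \<theta> t) \<le> exp \<psi> * (norm (bgpot y \<tau> t x))\<^sup>2"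
    by (simp add: R_def power_mult_distrib mult_ac)
   have "norm (bgpot y \<tau> t x) \<le> B0 * gradp \<tau> R" by (rule order_trans[OF up mult_left_mono[OF gp(1) less_imp_le[OF B0]]])
   then have "(norm (bgpot y \<tau> t x))\<^sup>2 \<le> (B0 * gradp \<tau> R)\<^sup>2" by (intro power_mono) auto
   then have "exp \<psi> * (norm (bgpot y \<tau> t x))\<^sup>2 \<le> (exp cm * kappa \<tau> \<mu> \<theta> t) * (B0 * gradp \<tau> R)\<^sup>2"
    using ek k0 by (intro mult_mono) auto
   then show "exp \<psi> * (norm (bgpot y \<tau> t x))\<^sup>2 \<le> exp cm * B0\<^sup>2 * ((gradp \<tau> (norm (x - y t)))\<^sup>2 * kappa \<tau> \<mu> \<theta> t)"
    by (simp add: R_def power_mult_distrib mult_ac)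
   have "X \<le> \<tau> / \<delta>"
   proof -
    have "exp (- \<tau> * R) * (\<tau> / R) \<le> 1 * (\<tau> / \<delta>)" using R \<tau> \<delta> by (intro mult_mono divide_left_mono) auto
    then show ?thesis by (simp add: X_def)
   qed
   then have "B0 * X \<le> B0 / \<delta> * \<tau>" using mult_left_mono[of X "\<tau> / \<delta>" B0] B0 by simp
   with up show "norm (bgpot y \<tau> t x) \<le> B0 / \<delta> * \<tau>" by (rule order_trans)
  qed (use \<tau>1 \<tau>2 in auto)
 qed (use A0 B0 \<delta> in auto)
qed

lemma open_not_AE_empty:
 fixes S :: "'a::euclidean_space set"
 assumes "open S" "AE x in lborel. x \<notin> S"
 shows "S = {}"
proof (rule ccontr)
 assume "S \<noteq> {}"
 then have "\<not> negligible S" using assms(1) open_not_negligible by blast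
 moreover have "S \<in> null_sets lborel" using assms by (subst AE_iff_null_sets) auto
 then have "negligible S" using null_sets_completionI negligible_iff_null_sets by blast
 ultimately show False by blast
qed

text \<open>The terminal value of the wave is not small by itself; the energy only bounds Z by a
  multiple of M and I0. What is tiny is its coefficient beta, and Young's inequality with parameter
  eta separates the two.\<close>

lemma combine_with_boundary:
 fixes M I0 J b \<beta> Z b2 C \<epsilon>2 :: real
 assumes C: "C > 1" and M: "M \<ge> 0" and I0: "0 \<le> I0" "I0 \<le> \<epsilon>2 * M" and \<epsilon>2: "\<epsilon>2 = 1 / (64 * C\<^sup>2 * (3 + 2 * C))"
  and J: "1 / (2 * C) * M - 3 * I0 \<le> \<bar>J\<bar>" "\<bar>J\<bar> \<le> (4 + 2 * C) * M + 3 * I0"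
  and Z: "0 \<le> Z" "Z \<le> (2 + 2 * C) * M + 3 * I0" and \<beta>: "\<beta>\<^sup>2 \<le> \<epsilon>2 * M" and b2: "b2 \<le> \<epsilon>2 * M"
  and b: "\<bar>b\<bar> \<le> \<beta> * sqrt Z + b2"
 shows "M / (4 * C) \<le> \<bar>J + b\<bar>" "\<bar>J + b\<bar> \<le> (5 + 2 * C) * M"
proof -
 define p where "p = 1 / C"
 have p: "p > 0" "p < 1" using C by (auto simp: p_def)
 \<comment> \<open>Chosen so that eta Z <= M / (16 C); then epsilon2 = eta / (4 C) makes beta^2 / (4
   eta) at most M / (16 C) as well.\<close>
 define \<eta> where "\<eta> = p / (16 * (3 + 2 * C))"
 have "p / (16 * Y) > 0 \<and> p / (16 * Y) * Y = p / 16" if "Y > 0" for Y using that p by simp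
 from this[of "3 + 2 * C"] have \<eta>: "\<eta> > 0" "\<eta> * (3 + 2 * C) = p / 16" using C by (auto simp: \<eta>_def)
 have e1: "\<epsilon>2 = \<eta> * (p / 4)" using C by (simp add: \<epsilon>2 \<eta>_def p_def power2_eq_square)
 have "\<eta> \<le> p / 16 * (1 / 3)" using p C unfolding \<eta>_def by (simp add: field_simps)
 then have e2: "\<eta> \<le> p / 48" by simp
 have "\<eta> * (p / 4) \<le> (p / 48) * 1" using e2 p by (intro mult_mono) auto
 then have e3: "\<epsilon>2 \<le> p / 48" by (simp add: e1)
 have eM: "\<epsilon>2 * M \<le> p / 48 * M" using e3 M by (rule mult_right_mono)
 have pM: "0 \<le> p * M" "p * M \<le> M" using p M mult_right_mono[of p 1 M] by auto
 have Z3: "Z \<le> (3 + 2 * C) * M" using Z(2) I0 eM pM by (simp add: distrib_right)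
 have "\<beta> * sqrt Z \<le> \<eta> * Z + \<beta>\<^sup>2 / (4 * \<eta>)"
 proof -
  have "0 \<le> (2 * \<eta> * sqrt Z - \<beta>)\<^sup>2" by simp
  also have "\<dots> = 4 * \<eta>\<^sup>2 * Z - 4 * \<eta> * (\<beta> * sqrt Z) + \<beta>\<^sup>2" using Z(1) by (simp add: power2_diff power_mult_distrib algebra_simps)
  finally have "4 * \<eta> * (\<beta> * sqrt Z) \<le> 4 * \<eta> * (\<eta> * Z) + \<beta>\<^sup>2" by (simp add: power2_eq_square algebra_simps)
  also have "\<dots> = 4 * \<eta> * (\<eta> * Z + \<beta>\<^sup>2 / (4 * \<eta>))" using \<eta>(1) by (simp add: field_simps)
  finally show ?thesis using \<eta>(1) by simp
 qed
 also have "\<dots> \<le> p / 16 * M + p / 16 * M"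
 proof (rule add_mono)
  show "\<eta> * Z \<le> p / 16 * M" using mult_left_mono[OF Z3 less_imp_le[OF \<eta>(1)]] \<eta>(2) by (simp add: mult.assoc[symmetric])
  have "\<beta>\<^sup>2 / (4 * \<eta>) \<le> \<epsilon>2 * M / (4 * \<eta>)" using \<beta> \<eta>(1) by (intro divide_right_mono) auto
  also have "\<dots> = p / 16 * M" using \<eta>(1) by (simp add: e1)
  finally show "\<beta>\<^sup>2 / (4 * \<eta>) \<le> p / 16 * M" .
 qed
 finally have bb: "\<bar>b\<bar> \<le> p * M / 8 + p * M / 48" using b b2 eM by (simp add: field_simps)
 have I: "I0 \<le> p * M / 48" using I0 eM by simp
 have 1: "1 / (2 * C) * M = p * M / 2" "M / (4 * C) = p * M / 4" by (simp_all add: p_def)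
 show "M / (4 * C) \<le> \<bar>J + b\<bar>" using J(1) bb I pM unfolding 1 by argo
 have "(5 + 2 * C) * M = (4 + 2 * C) * M + M" by (simp add: distrib_right)
 then show "\<bar>J + b\<bar> \<le> (5 + 2 * C) * M" using J(2) bb I pM by argo
qed

lemma N2_diff_bound_rep:
 assumes v: "v \<in> borel_measurable (lebesgue_on \<Omega>)" "set_integrable lebesgue \<Omega> (\<lambda>x. (v x)\<^sup>2)" and \<Omega>: "\<Omega> \<in> sets borel"
  and U: "L2 U" and W: "rep \<Omega> (\<lambda>x. v x - U x) W0"
 shows "N2 W0 \<le> 2 * (LINT x:\<Omega>|lebesgue. (v x)\<^sup>2) + 2 * N2 U"
proof -
 obtain vb where vb: "rep \<Omega> v vb" by (rule rep_exists[OF \<Omega> v(1)])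
 let ?U = "\<lambda>x. indicator \<Omega> x * U x"
 have mU: "?U \<in> borel_measurable borel" using \<Omega> L2_measurable[OF U] by (intro borel_measurable_times borel_measurable_indicator)
 have rU: "rep \<Omega> U ?U" unfolding rep_def using \<Omega> mU by auto
 have LU: "L2 ?U" and NU: "N2 ?U \<le> 1\<^sup>2 * N2 U" by (rule L2_bound[OF mU U, of 1], simp add: indicator_def)+
 have Lv: "L2 vb" and Nv: "N2 vb = (LINT x:\<Omega>|lebesgue. (v x)\<^sup>2)"
  using rep_set_integral[OF rep_power2[OF vb]] v(2) repD(2)[OF vb] by (auto simp: L2_def N2_def)
 have "N2 W0 = N2 (\<lambda>x. vb x - ?U x)"
  using rep_set_integral(1)[OF rep_power2[OF W]] rep_set_integral(1)[OF rep_power2[OF rep_diff[OF vb rU]]] by (simp add: N2_def)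
 also have "\<dots> \<le> 2 * N2 vb + 2 * N2 ?U" by (rule N2_diff_le[OF Lv LU])
 finally show ?thesis using NU Nv by simp
qed

section \<open>The two-sided estimate\<close>

lemma exp_neg_le_inverse: "t > 0 \<Longrightarrow> c \<ge> 0 \<Longrightarrow> e > 0 \<Longrightarrow> c / e \<le> t \<Longrightarrow> c * exp (- t) \<le> e" for t c e :: real
proof -
 assume t: "t > 0" and c: "c \<ge> 0" and e: "e > 0" and ct: "c / e \<le> t"
 have 1: "c \<le> e * t" using ct e by (simp add: divide_le_eq mult.commute)
 have "t \<le> exp t" using exp_ge_add_one_self[of t] by linarith
 then have "e * t \<le> e * exp t" using e by (intro mult_left_mono) auto
 with 1 have "c \<le> e * exp t" by linarith
 then show ?thesis by (simp add: exp_minus field_simps)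
qed

text \<open>The coefficient a is a Borel version of gamma that equals 1 within delta of the curve,
  so the singularity of the potentials never meets the factor a - 1. The last assumption is what
  condition (C-D) contributes: the inclusion has positive measure in every time window around
  theta.\<close>

locale moving_source =
 fixes \<Omega> :: "(real^3) set" and T :: real and \<gamma> :: "real \<Rightarrow> real^3 \<Rightarrow> real" and y :: "real \<Rightarrow> real^3"
  and a :: "real \<times> (real^3) \<Rightarrow> real" and L \<delta> Rm C \<sigma> \<theta> :: real
 assumes lip: "lipschitz_domain \<Omega>" and T: "T > 0"
  and y: "\<And>s s'. norm (y s - y s') \<le> L * \<bar>s - s'\<bar>" and L: "L \<ge> 0"
  and \<delta>: "\<delta> > 0" and Rm: "Rm > 0" "\<And>t x. t \<in> {0..T} \<Longrightarrow> x \<in> \<Omega> \<Longrightarrow> norm (x - y t) \<le> Rm"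
  and C: "C > 1" and a: "a \<in> borel_measurable borel" "\<And>z. 1 / C \<le> a z" "\<And>z. a z \<le> C"
  and a1: "\<And>z. z \<notin> {0<..<T} \<times> \<Omega> \<or> norm (snd z - y (fst z)) < \<delta> \<Longrightarrow> a z = 1"
  and \<sigma>: "(\<sigma> = 1 \<and> (\<forall>z. 1 \<le> a z)) \<or> (\<sigma> = -1 \<and> (\<forall>z. a z \<le> 1))"
  and \<gamma>: "AE z in lborel. z \<in> {0<..<T} \<times> \<Omega> \<longrightarrow> \<gamma> (fst z) (snd z) = a z"
  and \<gamma>1: "\<And>z. z \<in> {0<..<T} \<times> \<Omega> \<Longrightarrow> norm (snd z - y (fst z)) < \<delta> \<Longrightarrow> \<gamma> (fst z) (snd z) = 1"
  and \<theta>: "0 < \<theta>" "\<theta> < T"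
  and nontrivial: "\<And>e. e > 0 \<Longrightarrow> \<not> (AE z in lborel. \<theta> - e < fst z \<and> fst z < \<theta> + e \<longrightarrow> a z = 1)"
begin

abbreviation Q where "Q \<equiv> {0<..<T} \<times> \<Omega>"
abbreviation R where "R z \<equiv> norm (snd z - y (fst z))"

text \<open>The gradient of \<open>U_tau\<close>, set to zero near the source, where it is
  multiplied by a - 1 = 0. The truncation makes it bounded, as the locale \<open>reflected\<close>
  demands.\<close>

definition u where
 "u \<tau> z = (if z \<in> Q \<and> \<delta> \<le> R z then - (exp (\<tau>\<^sup>2 * fst z) * csrc) *\<^sub>R bgpot y \<tau> (fst z) (snd z) else 0)"
definition us where
 "us \<tau> \<mu> z = (if z \<in> Q \<and> \<delta> \<le> R z then - (exp (- (\<tau>\<^sup>2) * fst z) * csrc) *\<^sub>R fgpot y \<tau> \<mu> \<theta> (fst z) (snd z) else 0)"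
definition hP where
 "hP \<tau> \<mu> z = (gradp \<tau> (R z))\<^sup>2 * kappa \<tau> \<mu> \<theta> (fst z)"

lemma open_Q: "open Q" and open_\<Omega>: "open \<Omega>"
 using lip by (auto simp: lipschitz_domain_def intro: open_Times)

lemma Q_borel [measurable]: "Q \<in> sets borel" using open_Q by simp

lemma y_continuous: "continuous_on S y"
proof -
 have "L-lipschitz_on UNIV y" using y L by (auto simp: lipschitz_on_def dist_norm)
 then show ?thesis using lipschitz_on_continuous_on continuous_on_subset by blast
qed

lemma R_measurable [measurable]: "R \<in> borel_measurable borel"
 by (intro borel_measurable_continuous_onI continuous_intros continuous_on_compose2[OF y_continuous[of UNIV]]) auto

lemma X_measurable [measurable]: "Measurable.pred borel (\<lambda>z. z \<in> Q \<and> \<delta> \<le> R z)"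
 using R_measurable by measurable

lemma kappa_measurable [measurable]: "(\<lambda>z::real \<times> (real^3). kappa \<tau> \<mu> \<theta> (fst z)) \<in> borel_measurable borel"
 unfolding kappa_def by (intro borel_measurable_continuous_onI continuous_intros)

lemma u_measurable [measurable]: "u \<tau> \<in> borel_measurable borel"
proof -
 have "(\<lambda>z. bgpot y \<tau> (fst z) (snd z)) \<in> borel_measurable borel"
  by (rule gpot_measurable) (auto intro!: continuous_intros continuous_on_compose2[OF y_continuous[of UNIV]])
 then show ?thesis unfolding u_def[abs_def] by measurable
qed

lemma us_measurable [measurable]: "us \<tau> \<mu> \<in> borel_measurable borel"
proof -
 have "(\<lambda>z. fgpot y \<tau> \<mu> \<theta> (fst z) (snd z)) \<in> borel_measurable borel"
  unfolding fwd_phase_def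
  by (rule gpot_measurable) (auto intro!: continuous_intros continuous_on_compose2[OF y_continuous[of UNIV]])
 then show ?thesis unfolding us_def[abs_def] by measurable
qed

lemma hP_measurable [measurable]: "hP \<tau> \<mu> \<in> borel_measurable borel"
 unfolding hP_def[abs_def] gradp_def by measurable

lemma component_measurable: "f \<in> borel_measurable borel \<Longrightarrow> (\<lambda>z. f z $ i) \<in> borel_measurable borel" for f :: "real \<times> (real^3) \<Rightarrow> real^3"
 by (rule measurable_compose[OF _ borel_measurable_continuous_onI[OF linear_continuous_on[OF bounded_linear_vec_nth]]])

lemma hP_nonneg: "hP \<tau> \<mu> z \<ge> 0" by (simp add: hP_def kappa_def)

lemma abs_a: "\<bar>a z - 1\<bar> \<le> C" using a(2)[of z] a(3)[of z] C by (simp add: abs_le_iff) (smt (verit) divide_pos_pos)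

lemma P_eq:
 assumes "\<tau> \<ge> 0" shows "P_int \<Omega> T \<gamma> y \<tau> \<mu> \<theta> = (LBINT z. \<bar>a z - 1\<bar> * hP \<tau> \<mu> z)"
proof -
 have "rep Q (\<lambda>z. \<bar>\<gamma> (fst z) (snd z) - 1\<bar> * (norm (grad (p_Sigma y \<tau> (fst z)) (snd z)))\<^sup>2 * kappa \<tau> \<mu> \<theta> (fst z)) (\<lambda>z. \<bar>a z - 1\<bar> * hP \<tau> \<mu> z)" (is "rep Q ?f ?g")
  unfolding rep_def
 proof (intro conjI)
  note [measurable] = a(1)
  show "(\<lambda>z. \<bar>a z - 1\<bar> * hP \<tau> \<mu> z) \<in> borel_measurable borel" by measurable
  show "AE z in lborel. z \<in> Q \<longrightarrow> ?f z = ?g z"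
   using \<gamma>
  proof eventually_elim
   case (elim z)
   show ?case
   proof
    assume z: "z \<in> Q"
    show "?f z = ?g z"
    proof (cases "R z < \<delta>")
     case True
     then show ?thesis using \<gamma>1[OF z] a1[of z] by simp
    next
     case False
     then have "snd z \<noteq> y (fst z)" using \<delta> by auto
     moreover have "p_Sigma y \<tau> (fst z) = p_tau \<tau> (y (fst z))" by (simp add: fun_eq_iff p_Sigma_def)
     ultimately show ?thesis using norm_grad_p_tau[of "snd z" "y (fst z)" \<tau>] assms elim z by (simp add: hP_def)
    qed
   qed
  qed
 qed (use a1 Q_borel in auto)
 from rep_set_integral(1)[OF this] show ?thesis unfolding P_int_def .
qed

text \<open>Keeps only times within e of theta, where kappa >= exp (-tau mu e), and uses that the
  gradient of p is at least exp (-tau Rm) / Rm on the domain. Positivity of c rests on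
  \<open>nontrivial\<close>.\<close>

lemma P_lower:
 assumes e: "e > 0"
 obtains c where "c > 0" "\<And>\<tau> \<mu>. \<tau> \<ge> 1 \<Longrightarrow> \<mu> \<ge> 0 \<Longrightarrow> integrable lborel (\<lambda>z. \<bar>a z - 1\<bar> * hP \<tau> \<mu> z) \<Longrightarrow>
  c * exp (- \<tau> * (2 * Rm + \<mu> * e)) \<le> (LBINT z. \<bar>a z - 1\<bar> * hP \<tau> \<mu> z)"
proof -
 let ?f = "\<lambda>z :: real \<times> (real^3). indicator {\<theta> - e<..<\<theta> + e} (fst z) * \<bar>a z - 1\<bar>"
 note [measurable] = a(1)
 have mf: "?f \<in> borel_measurable borel" by measurable
 have "bounded Q" using lip by (intro bounded_Times) (auto simp: lipschitz_domain_def)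
 then have iQ: "integrable lborel (\<lambda>z. C * indicator Q z)"
  using emeasure_bounded_finite[of Q] Q_borel by (intro integrable_mult_right integrable_real_indicator) auto
 have "norm (?f z) \<le> norm (C * indicator Q z)" for z
  using abs_a[of z] a1[of z] C by (cases "z \<in> Q") (auto simp: indicator_def)
 then have i: "integrable lborel ?f"
  by (intro Bochner_Integration.integrable_bound[OF iQ]) (use mf in auto)
 have "(LBINT z. ?f z) \<noteq> 0"
 proof
  assume "(LBINT z. ?f z) = 0"
  then have "AE z in lborel. ?f z = 0" using integral_nonneg_eq_0_iff_AE[OF i] by auto
  then have "AE z in lborel. \<theta> - e < fst z \<and> fst z < \<theta> + e \<longrightarrow> a z = 1" by eventually_elim (auto simp: indicator_def)
  then show False using nontrivial[OF e] by blast
 qed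
 moreover have "(LBINT z. ?f z) \<ge> 0" by (intro integral_nonneg_AE AE_I2) auto
 ultimately have "(LBINT z. ?f z) > 0" unfolding less_le by simp
 then have pos: "(LBINT z. ?f z) / Rm\<^sup>2 > 0" using Rm(1) by (intro divide_pos_pos) auto
 show thesis
 proof (rule that[OF pos])
  fix \<tau> \<mu> :: real assume \<tau>: "\<tau> \<ge> 1" and \<mu>: "\<mu> \<ge> 0" and ih: "integrable lborel (\<lambda>z. \<bar>a z - 1\<bar> * hP \<tau> \<mu> z)"
  define E where "E = exp (- \<tau> * (2 * Rm + \<mu> * e)) / Rm\<^sup>2"
  have "E * ?f z \<le> \<bar>a z - 1\<bar> * hP \<tau> \<mu> z" for z
  proof (cases "fst z \<in> {\<theta> - e<..<\<theta> + e} \<and> z \<in> Q \<and> \<delta> \<le> R z")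
   case True
   have R: "0 < R z" "R z \<le> Rm" using True \<delta> Rm(2)[of "fst z" "snd z"] by auto
   have "exp (- \<tau> * Rm) * (1 / Rm) \<le> exp (- \<tau> * R z) * (\<tau> / R z + 1 / (R z)\<^sup>2)"
   proof (intro mult_mono)
    show "exp (- \<tau> * Rm) \<le> exp (- \<tau> * R z)" using R \<tau> by simp
    have "1 / Rm \<le> \<tau> / R z" using R \<tau> by (intro frac_le) auto
    then show "1 / Rm \<le> \<tau> / R z + 1 / (R z)\<^sup>2" by (simp add: add_increasing2)
   qed (use R Rm in auto)
   then have "(exp (- \<tau> * Rm) * (1 / Rm))\<^sup>2 \<le> (gradp \<tau> (R z))\<^sup>2" unfolding gradp_def using Rm by (intro power_mono) auto
   moreover have "exp (- \<tau> * \<mu> * e) \<le> kappa \<tau> \<mu> \<theta> (fst z)"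
   proof -
    have "(\<tau> * \<mu>) * \<bar>fst z - \<theta>\<bar> \<le> (\<tau> * \<mu>) * e" using True \<tau> \<mu> by (intro mult_left_mono) auto
    then show ?thesis by (simp add: kappa_def)
   qed
   ultimately have "(exp (- \<tau> * Rm) * (1 / Rm))\<^sup>2 * exp (- \<tau> * \<mu> * e) \<le> hP \<tau> \<mu> z" unfolding hP_def by (intro mult_mono) auto
   moreover have "(exp (- \<tau> * Rm) * (1 / Rm))\<^sup>2 * exp (- \<tau> * \<mu> * e) = E"
    by (simp add: E_def power2_eq_square field_simps exp_add[symmetric] mult_exp_exp)
   ultimately have "E * \<bar>a z - 1\<bar> \<le> hP \<tau> \<mu> z * \<bar>a z - 1\<bar>" by (intro mult_right_mono) auto
   then show ?thesis using True by (simp add: mult.commute)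
  next
   case False
   then show ?thesis using a1[of z] hP_nonneg[of \<tau> \<mu> z] by (cases "z \<in> Q \<and> \<delta> \<le> R z") auto
  qed
  then have "(LBINT z. E * ?f z) \<le> (LBINT z. \<bar>a z - 1\<bar> * hP \<tau> \<mu> z)" using i ih by (intro integral_mono) auto
  then show "(LBINT z. ?f z) / Rm\<^sup>2 * exp (- \<tau> * (2 * Rm + \<mu> * e)) \<le> (LBINT z. \<bar>a z - 1\<bar> * hP \<tau> \<mu> z)"
   by (simp add: E_def mult.commute)
 qed
qed

lemma flux_rep:
 assumes "\<tau> > 0"
 shows "repv Q (\<lambda>z. (\<gamma> (fst z) (snd z) - 1) *\<^sub>R grad (U_tau y \<tau> (fst z)) (snd z)) (\<lambda>z. (a z - 1) *\<^sub>R u \<tau> z)"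
 unfolding repv_def rep_def
proof (intro allI conjI)
 fix i
 note [measurable] = a(1)
 have "(\<lambda>z. (a z - 1) *\<^sub>R u \<tau> z) \<in> borel_measurable borel" by measurable
 then show "(\<lambda>z. ((a z - 1) *\<^sub>R u \<tau> z) $ i) \<in> borel_measurable borel" by (rule component_measurable)
 show "AE z in lborel. z \<in> Q \<longrightarrow> ((\<gamma> (fst z) (snd z) - 1) *\<^sub>R grad (U_tau y \<tau> (fst z)) (snd z)) $ i = ((a z - 1) *\<^sub>R u \<tau> z) $ i"
  using \<gamma>
 proof eventually_elim
  case (elim z)
  have "(\<gamma> (fst z) (snd z) - 1) *\<^sub>R grad (U_tau y \<tau> (fst z)) (snd z) = (a z - 1) *\<^sub>R u \<tau> z" if z: "z \<in> Q"
  proof (cases "R z < \<delta>")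
   case True
   then show ?thesis using \<gamma>1[OF z] a1[of z] by simp
  next
   case False
   then have "snd z \<noteq> y (fst z)" using \<delta> by auto
   then show ?thesis using grad_U_tau[OF L y assms] False elim z by (simp add: u_def)
  qed
  then show ?case by simp
 qed
qed (use a1 Q_borel in auto)

lemma volume_term:
 assumes \<tau>: "\<tau> > 0" "\<tau> > \<mu>" and \<mu>: "\<mu> \<ge> 0" and g: "repv Q (\<lambda>z. G (fst z) (snd z)) g"
 shows "(LINT z:Q|lebesgue. (\<gamma> (fst z) (snd z) - 1) * ((grad (U_tau y \<tau> (fst z)) (snd z) + G (fst z) (snd z))
      \<bullet> grad (U_star y \<tau> \<mu> \<theta> (fst z)) (snd z)) * kappa \<tau> \<mu> \<theta> (fst z))
  = (LBINT z. (a z - 1) * ((u \<tau> z + g z) \<bullet> us \<tau> \<mu> z) * kappa \<tau> \<mu> \<theta> (fst z))" (is "(LINT z:Q|lebesgue. ?f z) = integral\<^sup>L lborel ?g")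
proof (rule rep_set_integral(1))
 have mg: "(\<lambda>z. g z $ i) \<in> borel_measurable borel" for i using g by (auto simp: repv_def rep_def)
 note [measurable] = a(1) mg component_measurable[OF u_measurable] component_measurable[OF us_measurable]
 show "rep Q ?f ?g"
  unfolding rep_def
 proof (intro conjI)
  show "?g \<in> borel_measurable borel"
   unfolding inner_vec_def inner_real_def vector_add_component by measurable
  show "AE z in lborel. z \<in> Q \<longrightarrow> ?f z = ?g z"
   using \<gamma> repv_AE[OF g]
  proof eventually_elim
   case (elim z)
   show ?case
   proof
    assume z: "z \<in> Q"
    show "?f z = ?g z"
    proof (cases "R z < \<delta>")
     case True
     then show ?thesis using \<gamma>1[OF z] a1[of z] by simp
    next
     case False
     then have n: "snd z \<noteq> y (fst z)" using \<delta> by auto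
     have "fst z \<ge> 0" using z by auto
     then show ?thesis using grad_U_tau[OF L y \<tau>(1) n] grad_U_star[OF L \<mu> y \<tau> n \<theta>(1)] False elim z by (simp add: u_def us_def)
    qed
   qed
  qed
 qed (use a1 Q_borel in auto)
qed

text \<open>Cauchy-Schwarz with the L2 bound of the potentials, which is uniform in tau and
  insensitive to a source inside the domain at t = T. The exponentials in front are kappa at T and
  at 0, together with exp (-tau^2 T) from \<open>U_star\<close> at T.\<close>

lemma boundary_term:
 assumes Cp: "Cp \<ge> 0" "\<And>L \<mu> q \<omega> \<tau>. curve_data L \<mu> q \<omega> \<Longrightarrow> \<tau> > 0 \<Longrightarrow> \<tau>\<^sup>2 - \<tau> * \<mu> \<ge> 1 \<Longrightarrow> L2 (pot \<tau> \<omega> q) \<and> N2 (pot \<tau> \<omega> q) \<le> Cp"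
  and \<mu>: "\<mu> \<ge> 0" and \<tau>: "\<tau> > 0" "\<tau>\<^sup>2 - \<tau> * \<mu> \<ge> 1"
  and WT: "rep \<Omega> (W T) WT" "L2 WT" and W0: "rep \<Omega> (W 0) W0b" "L2 W0b"
 shows "\<bar>LINT x:\<Omega>|lebesgue. kappa \<tau> \<mu> \<theta> T * W T x * U_star y \<tau> \<mu> \<theta> T x - kappa \<tau> \<mu> \<theta> 0 * W 0 x * U_star y \<tau> \<mu> \<theta> 0 x\<bar>
  \<le> exp (- \<tau> * \<mu> * (T - \<theta>)) * (exp (- (\<tau>\<^sup>2) * T) * csrc) * (sqrt (N2 WT) * sqrt Cp)
   + exp (- \<tau> * \<mu> * \<theta>) * csrc * (sqrt (N2 W0b) * sqrt Cp)" (is "\<bar>?I\<bar> \<le> _")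
proof -
 define pT p0 where "pT = fpot y \<tau> \<mu> \<theta> T" and "p0 = fpot y \<tau> \<mu> \<theta> 0"
 have p: "L2 pT" "N2 pT \<le> Cp" "L2 p0" "N2 p0 \<le> Cp"
  using Cp(2)[OF curve_data_forward[OF L \<mu> y, of T \<theta>] \<tau>] Cp(2)[OF curve_data_forward[OF L \<mu> y, of 0 \<theta>] \<tau>]
  unfolding pT_def p0_def by blast+
 define cT c0 where "cT = exp (- \<tau> * \<mu> * (T - \<theta>)) * (exp (- (\<tau>\<^sup>2) * T) * csrc)" and "c0 = exp (- \<tau> * \<mu> * \<theta>) * csrc"
 have c: "cT \<ge> 0" "c0 \<ge> 0" using csrc_pos by (auto simp: cT_def c0_def)
 have "rep \<Omega> (\<lambda>x. (W T x) * (cT * pT x) - W 0 x * (c0 * p0 x)) (\<lambda>x. WT x * (cT * pT x) - W0b x * (c0 * p0 x))"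
  by (intro rep_diff rep_mult_borel WT W0 borel_measurable_times borel_measurable_const L2_measurable p)
 from rep_set_integral(1)[OF this]
 have "?I
  = (LBINT x. WT x * (cT * pT x) - W0b x * (c0 * p0 x))"
  using \<theta> T by (simp add: U_star_def u_star_eq kappa_def cT_def c0_def pT_def p0_def mult_ac)
 also have "\<dots> = cT * (LBINT x. WT x * pT x) - c0 * (LBINT x. W0b x * p0 x)"
  using L2_prod_integrable[OF WT(2) p(1)] L2_prod_integrable[OF W0(2) p(3)]
  by (simp add: mult.left_commute[of _ cT] mult.left_commute[of _ c0])
 finally have eq: "?I
  = cT * (LBINT x. WT x * pT x) - c0 * (LBINT x. W0b x * p0 x)" .
 have 1: "\<bar>\<integral>x. WT x * pT x \<partial>lborel\<bar> \<le> sqrt (N2 WT) * sqrt Cp"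
  by (rule order_trans[OF L2_Cauchy_Schwarz[OF WT(2) p(1)]]) (use p in \<open>auto intro!: mult_left_mono\<close>)
 have 2: "\<bar>\<integral>x. W0b x * p0 x \<partial>lborel\<bar> \<le> sqrt (N2 W0b) * sqrt Cp"
  by (rule order_trans[OF L2_Cauchy_Schwarz[OF W0(2) p(3)]]) (use p in \<open>auto intro!: mult_left_mono\<close>)
 have "\<bar>cT * (LBINT x. WT x * pT x) - c0 * (LBINT x. W0b x * p0 x)\<bar> \<le> \<bar>cT * (LBINT x. WT x * pT x)\<bar> + \<bar>c0 * (LBINT x. W0b x * p0 x)\<bar>"
  by (rule abs_triangle_ineq4)
 also have "\<dots> \<le> cT * (sqrt (N2 WT) * sqrt Cp) + c0 * (sqrt (N2 W0b) * sqrt Cp)"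
  unfolding abs_mult abs_of_nonneg[OF c(1)] abs_of_nonneg[OF c(2)] using 1 2 c by (intro add_mono mult_left_mono)
 finally show ?thesis unfolding eq cT_def c0_def .
qed

end

context moving_source
begin

lemma a_nonneg: "0 \<le> a z"
proof -
 have "0 < 1 / C" using C by simp
 then show ?thesis using a(2)[of z] by linarith
qed

lemma evolution:
 assumes \<tau>: "\<tau> > 0" and ws: "weak_sol \<Omega> T \<gamma> (\<lambda>t x. (\<gamma> t x - 1) *\<^sub>R grad (U_tau y \<tau> t) x) W0 W G"
  and Bu: "\<And>z. norm (u \<tau> z) \<le> Bu"
 obtains w g W0b WT where "weak_evol \<Omega> T w g (\<lambda>z. a z *\<^sub>R g z + (a z - 1) *\<^sub>R u \<tau> z) W0b WT"
  "repv Q (\<lambda>z. G (fst z) (snd z)) g" "rep \<Omega> (W T) WT" "rep \<Omega> (W 0) W0b" "rep \<Omega> W0 W0b"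
proof -
 note [measurable] = a(1)
 have "bounded Q" using lip by (intro bounded_Times) (auto simp: lipschitz_domain_def)
 then obtain r where r: "\<And>z. z \<in> Q \<Longrightarrow> norm z \<le> r" unfolding bounded_iff by blast
 have Fm: "(\<lambda>z. (a z - 1) *\<^sub>R u \<tau> z) \<in> borel_measurable borel" by measurable
 have L2F: "L2 (\<lambda>z. ((a z - 1) *\<^sub>R u \<tau> z) $ i)" for i
 proof (rule bounded_support_L2[OF component_measurable[OF Fm], of i "C * Bu" 0 r])
  show "\<bar>((a z - 1) *\<^sub>R u \<tau> z) $ i\<bar> \<le> C * Bu" for z
  proof -
   have "\<bar>((a z - 1) *\<^sub>R u \<tau> z) $ i\<bar> \<le> \<bar>a z - 1\<bar> * norm (u \<tau> z)" using component_le_norm_cart[of "(a z - 1) *\<^sub>R u \<tau> z" i] by simp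
   also have "\<dots> \<le> C * Bu" using abs_a[of z] Bu[of z] C by (intro mult_mono) auto
   finally show ?thesis .
  qed
  show "((a z - 1) *\<^sub>R u \<tau> z) $ i = 0" if "z \<notin> cball 0 r" for z using that r[of z] a1[of z] by auto
 qed
 have \<gamma>b: "rep Q (\<lambda>z. \<gamma> (fst z) (snd z)) (\<lambda>z. indicator Q z * a z)"
  unfolding rep_def
 proof (intro conjI)
  show "(\<lambda>z. indicator Q z * a z) \<in> borel_measurable borel" using Q_borel by measurable
  show "AE z in lborel. z \<in> Q \<longrightarrow> \<gamma> (fst z) (snd z) = indicator Q z * a z" using \<gamma> by eventually_elim auto
 qed (use Q_borel in auto)
 have \<gamma>bb: "\<bar>indicator Q z * a z\<bar> \<le> C" for z
  using a_nonneg[of z] a(3)[of z] C by (cases "z \<in> Q") auto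
 obtain w g W0b WT where ev: "weak_evol \<Omega> T w g (\<lambda>z. (indicator Q z * a z) *\<^sub>R g z + (a z - 1) *\<^sub>R u \<tau> z) W0b WT"
  and r: "repv Q (\<lambda>z. G (fst z) (snd z)) g" "rep \<Omega> (W T) WT" "rep \<Omega> (W 0) W0b" "rep \<Omega> W0 W0b"
  by (rule weak_sol_weak_evol[OF lip T ws \<gamma>b \<gamma>bb flux_rep[OF \<tau>] L2F])
 have "(indicator Q z * a z) *\<^sub>R g z = a z *\<^sub>R g z" for z using repv_zero[OF r(1), of z] by (cases "z \<in> Q") auto
 then have "weak_evol \<Omega> T w g (\<lambda>z. a z *\<^sub>R g z + (a z - 1) *\<^sub>R u \<tau> z) W0b WT" using ev by (simp only:)
 then show thesis using r by (rule that)
qed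

text \<open>The value of mu1 makes mu m - 2 l0 exceed 2 Rm + mu m / 2 by more than 1. The
  contributions of the two end times are then smaller than the lower bound of the energy M by a
  factor exp (-tau), which beats every constant.\<close>

theorem two_sided_estimate:
 fixes l0 C0 \<mu> :: real
 defines "\<mu>1 \<equiv> (4 * Rm + 4 * l0 + 2) / min \<theta> (T - \<theta>)"
 assumes l0: "l0 > 0" "C0 > 0" and \<mu>1: "\<mu> > \<mu>1"
 shows "\<exists>C\<mu>>1. \<exists>\<tau>1>\<mu>1. \<forall>v0 W G. cond_C0 v0 \<Omega> C0 l0 \<and>
    (\<forall>\<tau>>0. weak_sol \<Omega> T \<gamma> (\<lambda>t x. (\<gamma> t x - 1) *\<^sub>R grad (U_tau y \<tau> t) x)
         (\<lambda>x. v0 \<tau> x - U_tau y \<tau> 0 x) (W \<tau>) (G \<tau>))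
    \<longrightarrow> (\<forall>\<tau>>\<tau>1. P_int \<Omega> T \<gamma> y \<tau> \<mu> \<theta> / C\<mu> \<le> \<bar>I_inf \<Omega> T \<gamma> y (W \<tau>) (G \<tau>) \<tau> \<mu> \<theta>\<bar>
          \<and> \<bar>I_inf \<Omega> T \<gamma> y (W \<tau>) (G \<tau>) \<tau> \<mu> \<theta>\<bar> \<le> C\<mu> * P_int \<Omega> T \<gamma> y \<tau> \<mu> \<theta>)"
proof -
 define m where "m = min \<theta> (T - \<theta>)"
 have m: "m > 0" "m \<le> \<theta>" "m \<le> T - \<theta>" using \<theta> by (auto simp: m_def)
 have \<mu>m: "4 * Rm + 4 * l0 + 2 < \<mu> * m" using \<mu>1 m(1) unfolding \<mu>1_def m_def[symmetric] by (simp add: pos_divide_less_eq)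
 have \<mu>10: "\<mu>1 > 0" unfolding \<mu>1_def m_def[symmetric] using m Rm(1) l0 by (intro divide_pos_pos) auto
 have \<mu>: "\<mu> \<ge> 0" "\<mu> > 0" using \<mu>1 \<mu>10 by auto
 obtain Cp where Cp: "Cp \<ge> 0" "\<And>L \<mu> q \<omega> \<tau>. curve_data L \<mu> q \<omega> \<Longrightarrow> \<tau> > 0 \<Longrightarrow> \<tau>\<^sup>2 - \<tau> * \<mu> \<ge> 1 \<Longrightarrow> L2 (pot \<tau> \<omega> q) \<and> N2 (pot \<tau> \<omega> q) \<le> Cp"
  using pot_L2_bound by blast
 obtain b0 b1 B where b: "b0 > 0" "b1 > 0" "B > 0"
  and asym: "\<And>\<epsilon>. 0 < \<epsilon> \<Longrightarrow> \<epsilon> \<le> 1/2 \<Longrightarrow> \<exists>\<tau>0\<ge>1. \<tau>0 > \<mu> \<and> (\<forall>\<tau>\<ge>\<tau>0. \<forall>t x \<psi>. \<delta> \<le> norm (x - y t) \<and> norm (x - y t) \<le> Rm \<and>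
    \<bar>\<psi> - log_weight y \<tau> \<mu> \<theta> (t, x)\<bar> \<le> \<epsilon> \<longrightarrow>
    potential_estimates y \<tau> \<mu> \<theta> \<epsilon> b0 b1 B t x \<psi>)"
  using potential_asymptotics[OF y L \<mu>(1) \<delta> Rm(1), where \<theta> = \<theta>] by blast
 obtain c where c: "c > 0" and Plow: "\<And>\<tau> \<mu>. \<tau> \<ge> 1 \<Longrightarrow> \<mu> \<ge> 0 \<Longrightarrow> integrable lborel (\<lambda>z. \<bar>a z - 1\<bar> * hP \<tau> \<mu> z) \<Longrightarrow>
  c * exp (- \<tau> * (2 * Rm + \<mu> * (m/2))) \<le> (LBINT z. \<bar>a z - 1\<bar> * hP \<tau> \<mu> z)"
  using P_lower[of "m/2"] m(1) by auto
 define \<epsilon> \<epsilon>' where "\<epsilon> = 1 / (8 * C)" and "\<epsilon>' = 1 / (4 * C * (2 + C + 2 * C\<^sup>2))"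
 have "4 * C * (2 + C + 2 * C\<^sup>2) > 0" using C by (intro mult_pos_pos add_pos_nonneg) auto
 then have \<epsilon>: "\<epsilon> > 0" "\<epsilon>' > 0" using C by (auto simp: \<epsilon>_def \<epsilon>'_def)
 \<comment> \<open>The factor 18 is the loss in \<open>potential_estimates\<close>; the remaining
   accuracy is the epsilon' of \<open>two_sided_from_energy\<close>.\<close>
 define \<epsilon>0 where "\<epsilon>0 = min (\<epsilon>' / 18) (1/2)"
 have \<epsilon>0: "\<epsilon>0 > 0" "\<epsilon>0 \<le> 1/2" "18 * \<epsilon>0 \<le> \<epsilon>'" using \<epsilon> by (auto simp: \<epsilon>0_def)
 obtain \<tau>0 where \<tau>0: "\<tau>0 \<ge> 1" and as: "\<And>\<tau> t x \<psi>. \<tau> \<ge> \<tau>0 \<Longrightarrow> \<delta> \<le> norm (x - y t) \<Longrightarrow> norm (x - y t) \<le> Rm \<Longrightarrow>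
    \<bar>\<psi> - log_weight y \<tau> \<mu> \<theta> (t, x)\<bar> \<le> \<epsilon>0 \<Longrightarrow>
    potential_estimates y \<tau> \<mu> \<theta> \<epsilon>0 b0 b1 B t x \<psi>"
  using asym[OF \<epsilon>0(1,2)] by blast
 \<comment> \<open>A1c (times tau) and Bx are the Lipschitz constants of the weight, cm is the
   distance of its mollification from the exponent of kappa, Cw exp (2 tau l0) bounds the squared
   norm of the initial value of W, H is the constant in the lower bound of M, and Kc dominates the
   coefficients of the three small terms I0, beta^2 and b2.\<close>
 define A1c Bx cm Cw \<epsilon>2 H Kc where "A1c = 2 * L + \<mu> + 3 * L\<^sup>2 + \<mu> * L / 2" and "Bx = 3 * L + \<mu> / 2"
  and "cm = (L + \<mu> / 2) * Rm + 1" and "Cw = 2 * C0\<^sup>2 + 2 * (csrc\<^sup>2 * Cp)" and "\<epsilon>2 = 1 / (64 * C\<^sup>2 * (3 + 2 * C))"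
  and "H = csrc\<^sup>2 * b0 * c" and "Kc = exp (cm + \<mu>) / 2 * Cw + 4 * csrc\<^sup>2 * Cp * exp cm + csrc * sqrt Cw * sqrt Cp"
 have A1c: "A1c \<ge> 0" and Bx: "Bx \<ge> 0" using L \<mu> by (auto simp: A1c_def Bx_def)
 have Cw: "Cw \<ge> 0" using Cp by (simp add: Cw_def)
 have Kc: "exp (cm + \<mu>) / 2 * Cw \<le> Kc" "4 * csrc\<^sup>2 * Cp * exp cm \<le> Kc" "csrc * sqrt Cw * sqrt Cp \<le> Kc" "Kc \<ge> 0"
  using Cw Cp(1) csrc_pos by (auto simp: Kc_def add_nonneg_nonneg)
 have H: "H > 0" using b c csrc_pos by (simp add: H_def)
 have \<epsilon>2: "\<epsilon>2 > 0" using C by (simp add: \<epsilon>2_def)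
 \<comment> \<open>A1c bounds the time growth of the weight by tau^2, Bx / epsilon its gradient by
   epsilon tau. The entries 1 / T and 1 / (T - theta) make room for strips of length 1 / tau at both
   ends, and Kc / (epsilon2 H) lets exp (-tau) absorb the constants.\<close>
 define \<tau>1 where "\<tau>1 = max \<tau>0 (max \<mu>1 (max (\<mu> + 1) (max A1c (max (Bx / \<epsilon>) (max (1 / T) (max (1 / (T - \<theta>)) (max (Kc / (\<epsilon>2 * H)) (\<mu>1 + 1))))))))"
 define C\<mu> where "C\<mu> = 1 + 4 * C / (csrc\<^sup>2 * b0) + (5 + 2 * C) * (csrc\<^sup>2 * b1)"
 have cb: "csrc\<^sup>2 * b0 > 0" "csrc\<^sup>2 * b1 > 0" using b csrc_pos by auto
 have pc: "4 * C / (csrc\<^sup>2 * b0) > 0" "(5 + 2 * C) * (csrc\<^sup>2 * b1) > 0" using C cb by auto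
 have C\<mu>: "C\<mu> > 1" "4 * C / (csrc\<^sup>2 * b0) \<le> C\<mu>" "(5 + 2 * C) * (csrc\<^sup>2 * b1) \<le> C\<mu>" unfolding C\<mu>_def using pc by linarith+
 have "\<mu>1 + 1 \<le> \<tau>1" unfolding \<tau>1_def by (intro order_trans[OF _ max.cobounded2] order_refl)
 then have \<tau>1\<mu>1: "\<tau>1 > \<mu>1" by simp
 show ?thesis
 proof (rule exI[of _ C\<mu>], rule conjI[OF C\<mu>(1)], rule exI[of _ \<tau>1], rule conjI[OF \<tau>1\<mu>1], intro allI impI, goal_cases)
  case (1 v0 W G \<tau>)
  then have C0: "cond_C0 v0 \<Omega> C0 l0" and ws0: "\<And>\<tau>. \<tau> > 0 \<Longrightarrow> weak_sol \<Omega> T \<gamma> (\<lambda>t x. (\<gamma> t x - 1) *\<^sub>R grad (U_tau y \<tau> t) x)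
         (\<lambda>x. v0 \<tau> x - U_tau y \<tau> 0 x) (W \<tau>) (G \<tau>)" and \<tau>1: "\<tau> > \<tau>1" by auto
  have \<tau>: "\<tau> > \<tau>0" "\<tau> > \<mu> + 1" "\<tau> > A1c" "\<tau> > Bx / \<epsilon>" "\<tau> > 1 / T" "\<tau> > 1 / (T - \<theta>)" "\<tau> > Kc / (\<epsilon>2 * H)"
   using \<tau>1 unfolding \<tau>1_def max_less_iff_conj by blast+
  have \<tau>p: "\<tau> > 0" "\<tau> \<ge> 1" "\<tau> > \<mu>" "\<tau> \<ge> \<tau>0" using \<tau> \<tau>0 by auto
  \<comment> \<open>The hypotheses of \<open>pot_L2_bound\<close> for the forward potential and,
    with mu = 0, for the backward one.\<close>
  have \<tau>\<mu>: "\<tau>\<^sup>2 - \<tau> * \<mu> \<ge> 1" "\<tau>\<^sup>2 - \<tau> * 0 \<ge> 1"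
  proof -
   have "1 * 1 \<le> \<tau> * (\<tau> - \<mu>)" using \<tau>p \<tau> by (intro mult_mono) auto
   then show "\<tau>\<^sup>2 - \<tau> * \<mu> \<ge> 1" by (simp add: power2_eq_square right_diff_distrib)
   then show "\<tau>\<^sup>2 - \<tau> * 0 \<ge> 1" using \<tau>p \<mu> mult_nonneg_nonneg[of \<tau> \<mu>] by simp
  qed
  \<comment> \<open>The growth in tau is harmless: boundedness for fixed tau serves only to make the
    integrals finite.\<close>
  define Bu where "Bu = exp (\<tau>\<^sup>2 * T) * csrc * (B * \<tau>)"
  have Bu: "norm (u \<tau> z) \<le> Bu" for z
  proof (cases "z \<in> Q \<and> \<delta> \<le> R z")
   case True
   then have t: "fst z \<in> {0<..<T}" "snd z \<in> \<Omega>" by auto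
   have "norm (bgpot y \<tau> (fst z) (snd z)) \<le> B * \<tau>"
    using as[of \<tau> "snd z" "fst z" "log_weight y \<tau> \<mu> \<theta> (fst z, snd z)"] \<tau>p \<epsilon>0 True Rm(2)[of "fst z" "snd z"] t by (simp add: potential_estimates_def)
   moreover have "exp (\<tau>\<^sup>2 * fst z) \<le> exp (\<tau>\<^sup>2 * T)" using t by (simp add: mult_left_mono)
   ultimately have "(exp (\<tau>\<^sup>2 * fst z) * csrc) * norm (bgpot y \<tau> (fst z) (snd z)) \<le> Bu"
    unfolding Bu_def using csrc_pos b(3) \<tau>p by (intro mult_mono) auto
   then show ?thesis using True csrc_pos by (simp add: u_def)
  next
   case False
   then show ?thesis using csrc_pos b \<tau>p by (auto simp: u_def Bu_def)
  qed
  obtain w g W0b WT where ev: "weak_evol \<Omega> T w g (\<lambda>z. a z *\<^sub>R g z + (a z - 1) *\<^sub>R u \<tau> z) W0b WT"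
   and rp: "repv Q (\<lambda>z. G \<tau> (fst z) (snd z)) g" "rep \<Omega> (W \<tau> T) WT" "rep \<Omega> (W \<tau> 0) W0b" "rep \<Omega> (\<lambda>x. v0 \<tau> x - U_tau y \<tau> 0 x) W0b"
   by (rule evolution[OF \<tau>p(1) ws0[OF \<tau>p(1)] Bu])
  have LW: "L2 W0b" "L2 WT" using ev unfolding weak_evol_def by blast+
  \<comment> \<open>The width of the mollifier may depend on tau; what counts is the accuracy
    epsilon0 and that the Lipschitz constants are preserved.\<close>
  obtain \<Psi> where \<Psi>: "C1 \<Psi>" "\<And>z. \<bar>\<Psi> z - log_weight y \<tau> \<mu> \<theta> z\<bar> \<le> \<epsilon>0"
   "\<And>t x t' x'. \<bar>\<Psi> (t, x) - \<Psi> (t', x')\<bar> \<le> \<tau> * A1c * \<bar>t - t'\<bar> + Bx * norm (x - x')"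
   "\<And>z. norm (gradx_part \<Psi> z) \<le> Bx"
  proof (rule mollify_lipschitz[of "log_weight y \<tau> \<mu> \<theta>" "\<tau> * A1c" Bx \<epsilon>0])
   show "\<bar>log_weight y \<tau> \<mu> \<theta> (t, x) - log_weight y \<tau> \<mu> \<theta> (t', x')\<bar> \<le> \<tau> * A1c * \<bar>t - t'\<bar> + Bx * norm (x - x')" for t x t' x'
    unfolding A1c_def Bx_def by (rule log_weight_lipschitz[OF y \<tau>p(2) \<mu>(1) L])
  qed (use A1c Bx \<epsilon>0 \<tau>p in auto)
  interpret r: reflected \<Omega> T w g "u \<tau>" a W0b WT \<Psi> \<tau> Bx "\<tau> * A1c" C \<epsilon> Bu
  proof unfold_locales
   show "\<Psi> (t + h, x) \<le> \<Psi> (t, x) + \<tau> * A1c * h" if "h \<ge> 0" for t x h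
    using \<Psi>(3)[of "t + h" x t x] that by simp
   show "\<tau> * A1c \<le> \<tau>\<^sup>2" using \<tau> \<tau>p by (simp add: power2_eq_square)
   show "Bx \<le> \<epsilon> * \<tau>" using \<tau>(4) \<epsilon>(1) by (simp add: divide_less_eq mult.commute less_imp_le)
   show "2 * \<epsilon> * C \<le> 1" using C by (simp add: \<epsilon>_def)
   show "0 \<le> a z" for z by (rule a_nonneg)
  qed (use ev lip T \<Psi> \<tau>p \<epsilon> C a Bu component_measurable[OF u_measurable] in \<open>auto simp: u_def\<close>)
  have \<Psi>k: "exp (- cm) * kappa \<tau> \<mu> \<theta> t \<le> exp (\<Psi> (t, x))" "exp (\<Psi> (t, x)) \<le> exp cm * kappa \<tau> \<mu> \<theta> t"
   if "t \<in> {0..T}" "x \<in> \<Omega>" for t x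
  proof -
   have "(L + \<mu> / 2) * norm (x - y t) \<le> (L + \<mu> / 2) * Rm" using Rm(2)[OF that] L \<mu> by (intro mult_left_mono) auto
   then have "\<bar>\<Psi> (t, x) + \<tau> * \<mu> * \<bar>t - \<theta>\<bar>\<bar> \<le> cm"
    using log_weight_bound[OF y \<tau>p(1) \<mu>(1) L, of \<theta> t x] \<Psi>(2)[of "(t, x)"] \<epsilon>0(2) unfolding cm_def by linarith
   then show "exp (- cm) * kappa \<tau> \<mu> \<theta> t \<le> exp (\<Psi> (t, x))" "exp (\<Psi> (t, x)) \<le> exp cm * kappa \<tau> \<mu> \<theta> t"
    by (auto simp: kappa_def exp_add[symmetric])
  qed
  have asz: "norm (kappa \<tau> \<mu> \<theta> (fst z) *\<^sub>R fgpot y \<tau> \<mu> \<theta> (fst z) (snd z) - exp (\<Psi> z) *\<^sub>R bgpot y \<tau> (fst z) (snd z)) \<le> 18 * \<epsilon>0 * (exp (\<Psi> z) * norm (bgpot y \<tau> (fst z) (snd z)))" (is ?A)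
   "b0 * hP \<tau> \<mu> z \<le> exp (\<Psi> z) * (norm (bgpot y \<tau> (fst z) (snd z)))\<^sup>2" (is ?B)
   "exp (\<Psi> z) * (norm (bgpot y \<tau> (fst z) (snd z)))\<^sup>2 \<le> b1 * hP \<tau> \<mu> z" (is ?C) if z: "z \<in> Q" "\<delta> \<le> R z" for z
  proof -
   have "R z \<le> Rm" using z Rm(2)[of "fst z" "snd z"] by auto
   then show ?A ?B ?C
    using as[of \<tau> "snd z" "fst z" "\<Psi> z"] \<tau>p z \<Psi>(2)[of z] by (auto simp: hP_def potential_estimates_def)
  qed
  have Ku: "r.K z * (u \<tau> z \<bullet> u \<tau> z) = csrc\<^sup>2 * (exp (\<Psi> z) * (norm (bgpot y \<tau> (fst z) (snd z)))\<^sup>2)"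
   "r.K z *\<^sub>R u \<tau> z = - (exp (- (\<tau>\<^sup>2) * fst z) * csrc) *\<^sub>R (exp (\<Psi> z) *\<^sub>R bgpot y \<tau> (fst z) (snd z))" if z: "z \<in> Q" "\<delta> \<le> R z" for z
  proof -
   have e: "r.K z * exp (\<tau>\<^sup>2 * fst z) = exp (\<Psi> z) * exp (- (\<tau>\<^sup>2) * fst z)" by (simp add: r.K_def mult_exp_exp)
   have e2: "r.K z * (exp (\<tau>\<^sup>2 * fst z) * exp (\<tau>\<^sup>2 * fst z)) = exp (\<Psi> z)" by (simp add: r.K_def mult_exp_exp)
   have "u \<tau> z \<bullet> u \<tau> z = (exp (\<tau>\<^sup>2 * fst z) * exp (\<tau>\<^sup>2 * fst z)) * (csrc\<^sup>2 * (norm (bgpot y \<tau> (fst z) (snd z)))\<^sup>2)"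
    using z by (simp add: u_def power2_norm_eq_inner) (simp add: power2_eq_square)
   then have "r.K z * (u \<tau> z \<bullet> u \<tau> z) = (r.K z * (exp (\<tau>\<^sup>2 * fst z) * exp (\<tau>\<^sup>2 * fst z))) * (csrc\<^sup>2 * (norm (bgpot y \<tau> (fst z) (snd z)))\<^sup>2)"
    by (simp only: mult.assoc)
   then show "r.K z * (u \<tau> z \<bullet> u \<tau> z) = csrc\<^sup>2 * (exp (\<Psi> z) * (norm (bgpot y \<tau> (fst z) (snd z)))\<^sup>2)"
    unfolding e2 by (simp only: mult_ac)
   have "r.K z *\<^sub>R u \<tau> z = - (r.K z * exp (\<tau>\<^sup>2 * fst z) * csrc) *\<^sub>R bgpot y \<tau> (fst z) (snd z)" using z by (simp add: u_def mult.assoc)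
   then show "r.K z *\<^sub>R u \<tau> z = - (exp (- (\<tau>\<^sup>2) * fst z) * csrc) *\<^sub>R (exp (\<Psi> z) *\<^sub>R bgpot y \<tau> (fst z) (snd z))"
    unfolding e by (simp add: mult_ac)
  qed
  let ?h = "\<lambda>z. \<bar>a z - 1\<bar> * hP \<tau> \<mu> z"
  \<comment> \<open>Pointwise comparison of the densities of M and of \<open>P_int\<close>; near the
    curve and outside the domain both vanish because a = 1.\<close>
  have Mh: "(csrc\<^sup>2 * b0) * ?h z \<le> r.K z * (\<bar>a z - 1\<bar> * (u \<tau> z \<bullet> u \<tau> z))" (is ?A) "r.K z * (\<bar>a z - 1\<bar> * (u \<tau> z \<bullet> u \<tau> z)) \<le> (csrc\<^sup>2 * b1) * ?h z" (is ?B) for z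
  proof -
   have "?A \<and> ?B"
   proof (cases "z \<in> Q \<and> \<delta> \<le> R z")
    case True
    have "r.K z * (\<bar>a z - 1\<bar> * (u \<tau> z \<bullet> u \<tau> z)) = \<bar>a z - 1\<bar> * (r.K z * (u \<tau> z \<bullet> u \<tau> z))" by (simp only: mult_ac)
    also have "\<dots> = (\<bar>a z - 1\<bar> * csrc\<^sup>2) * (exp (\<Psi> z) * (norm (bgpot y \<tau> (fst z) (snd z)))\<^sup>2)" using Ku(1) True by simp
    finally have e: "r.K z * (\<bar>a z - 1\<bar> * (u \<tau> z \<bullet> u \<tau> z)) = (\<bar>a z - 1\<bar> * csrc\<^sup>2) * (exp (\<Psi> z) * (norm (bgpot y \<tau> (fst z) (snd z)))\<^sup>2)" .
    have n: "0 \<le> \<bar>a z - 1\<bar> * csrc\<^sup>2" by simp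
    show ?thesis unfolding e
     using mult_left_mono[OF asz(2) n] mult_left_mono[OF asz(3) n] True by (simp add: mult_ac)
   next
    case False
    then show ?thesis using a1[of z] by auto
   qed
   then show ?A ?B by auto
  qed
  note [measurable] = a(1)
  have mh: "?h \<in> borel_measurable borel" by measurable
  have ih0: "integrable lborel (\<lambda>z. (csrc\<^sup>2 * b0) * ?h z)"
  proof (rule Bochner_Integration.integrable_bound[OF r.int_M])
   show "(\<lambda>z. (csrc\<^sup>2 * b0) * ?h z) \<in> borel_measurable lborel" using mh by simp
   show "AE z in lborel. norm ((csrc\<^sup>2 * b0) * ?h z) \<le> norm (r.K z * (\<bar>a z - 1\<bar> * (u \<tau> z \<bullet> u \<tau> z)))"
   proof (rule AE_I2)
    fix z
    have "0 \<le> (csrc\<^sup>2 * b0) * ?h z" using b hP_nonneg[of \<tau> \<mu> z] by (intro mult_nonneg_nonneg) auto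
    then show "norm ((csrc\<^sup>2 * b0) * ?h z) \<le> norm (r.K z * (\<bar>a z - 1\<bar> * (u \<tau> z \<bullet> u \<tau> z)))" using Mh(1)[of z] by simp
   qed
  qed
  have cancel: "inverse k * (k * X) = X" if "k > 0" for k X :: real using that by simp
  have ih: "integrable lborel ?h"
   using integrable_mult_right[OF ih0, of "inverse (csrc\<^sup>2 * b0)"] unfolding cancel[OF cb(1)] .
  define P where "P = P_int \<Omega> T \<gamma> y \<tau> \<mu> \<theta>"
  have P: "P = (LBINT z. ?h z)" unfolding P_def by (rule P_eq) (use \<tau>p in simp)
  have P0: "P \<ge> 0" unfolding P using hP_nonneg by (intro integral_nonneg_AE AE_I2 mult_nonneg_nonneg) auto
  have MP: "(csrc\<^sup>2 * b0) * P \<le> r.M" "r.M \<le> (csrc\<^sup>2 * b1) * P"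
  proof -
   have "(LBINT z. (csrc\<^sup>2 * b0) * ?h z) \<le> r.M" unfolding r.M_def by (rule integral_mono[OF ih0 r.int_M Mh(1)])
   then show "(csrc\<^sup>2 * b0) * P \<le> r.M" unfolding P by simp
   have "r.M \<le> (LBINT z. (csrc\<^sup>2 * b1) * ?h z)" unfolding r.M_def
    by (rule integral_mono[OF r.int_M integrable_mult_right[OF ih] Mh(2)])
   then show "r.M \<le> (csrc\<^sup>2 * b1) * P" unfolding P by simp
  qed
  define E0 where "E0 = exp (- \<tau> * (2 * Rm + \<mu> * (m/2)))"
  have HM: "H * E0 \<le> r.M"
  proof -
   have "(csrc\<^sup>2 * b0) * (c * E0) \<le> (csrc\<^sup>2 * b0) * P"
    using Plow[OF \<tau>p(2) \<mu>(1) ih] cb unfolding P E0_def by (intro mult_left_mono) auto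
   then show ?thesis using MP(1) by (simp add: H_def mult_ac)
  qed
  \<comment> \<open>The surplus 1 in the exponents, due to mu1, gives exp (-tau), which compensates
    Kc / (epsilon2 H). All three small terms are reduced to this estimate.\<close>
  have small: "Kc * exp (- \<tau> * (\<mu> * m - 2 * l0)) \<le> \<epsilon>2 * r.M"
  proof -
   have "\<tau> * (1 + (2 * Rm + \<mu> * (m/2))) \<le> \<tau> * (\<mu> * m - 2 * l0)" using \<mu>m \<tau>p by (intro mult_left_mono) auto
   then have "exp (- \<tau> * (\<mu> * m - 2 * l0)) \<le> exp (- \<tau>) * E0"
    unfolding E0_def exp_add[symmetric] exp_le_cancel_iff by (simp add: algebra_simps)
   then have "Kc * exp (- \<tau> * (\<mu> * m - 2 * l0)) \<le> Kc * (exp (- \<tau>) * E0)" using Kc(4) by (rule mult_left_mono)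
   also have "\<dots> = (Kc * exp (- \<tau>)) * E0" by simp
   also have "\<dots> \<le> (\<epsilon>2 * H) * E0"
    using exp_neg_le_inverse[of \<tau> Kc "\<epsilon>2 * H"] \<tau>p \<tau>(7) Kc(4) \<epsilon>2 H by (intro mult_right_mono) (auto simp: E0_def)
   also have "\<dots> \<le> \<epsilon>2 * r.M" using HM \<epsilon>2 by (simp add: mult_left_mono)
   finally show ?thesis .
  qed
  have N0: "N2 W0b \<le> Cw * (exp (\<tau> * l0))\<^sup>2"
  proof -
   have v: "v0 \<tau> \<in> borel_measurable (lebesgue_on \<Omega>)" "set_integrable lebesgue \<Omega> (\<lambda>x. (v0 \<tau> x)\<^sup>2)"
    "sqrt (LINT x:\<Omega>|lebesgue. (v0 \<tau> x)\<^sup>2) \<le> C0 * exp (\<tau> * l0)" using C0 \<tau>p(1) unfolding cond_C0_def by blast+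
   have p: "L2 (bpot y \<tau> 0)" "N2 (bpot y \<tau> 0) \<le> Cp" using Cp(2)[OF curve_data_backward[OF L y, of 0] \<tau>p(1) \<tau>\<mu>(2)] by blast+
   have U: "U_tau y \<tau> 0 = (\<lambda>x. csrc * bpot y \<tau> 0 x)" by (simp add: fun_eq_iff U_tau_def u_tau_eq)
   have "N2 W0b \<le> 2 * (LINT x:\<Omega>|lebesgue. (v0 \<tau> x)\<^sup>2) + 2 * N2 (\<lambda>x. csrc * bpot y \<tau> 0 x)"
    using N2_diff_bound_rep[OF v(1,2) borel_open[OF open_\<Omega>] L2_cmult[OF p(1), of csrc]] rp(4) unfolding U by blast
   also have "(LINT x:\<Omega>|lebesgue. (v0 \<tau> x)\<^sup>2) \<le> (C0 * exp (\<tau> * l0))\<^sup>2" using sqrt_le_D[OF v(3)] .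
   also have "N2 (\<lambda>x. csrc * bpot y \<tau> 0 x) \<le> (csrc\<^sup>2 * Cp) * (exp (\<tau> * l0))\<^sup>2"
   proof -
    have "1 \<le> (exp (\<tau> * l0))\<^sup>2" using \<tau>p l0 by (intro one_le_power) simp
    then have "(csrc\<^sup>2 * Cp) * 1 \<le> (csrc\<^sup>2 * Cp) * (exp (\<tau> * l0))\<^sup>2" using Cp(1) by (intro mult_left_mono) auto
    moreover have "N2 (\<lambda>x. csrc * bpot y \<tau> 0 x) \<le> csrc\<^sup>2 * Cp" unfolding N2_cmult using p(2) by (intro mult_left_mono) auto
    ultimately show ?thesis by simp
   qed
   finally show ?thesis by (simp add: Cw_def algebra_simps power_mult_distrib)
  qed
  have N0s: "sqrt (N2 W0b) \<le> sqrt Cw * exp (\<tau> * l0)"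
   using real_sqrt_le_mono[OF N0] by (simp add: real_sqrt_mult)
  \<comment> \<open>In a time 1 / tau the factor kappa grows by at most exp mu, so exp (cm + mu)
    times kappa at 0 bounds K on the initial strip.\<close>
  define I0 where "I0 = exp (cm + \<mu>) * exp (- \<tau> * \<mu> * \<theta>) / 2 * N2 W0b"
  \<comment> \<open>A lower bound for K on the last strip, written as a square because the boundary
    term involves the square root of Nk.\<close>
  define k0 where "k0 = (exp (- (\<tau>\<^sup>2) * T - cm / 2 - \<tau> * \<mu> * (T - \<theta>) / 2))\<^sup>2"
  have k0p: "k0 > 0" by (simp add: k0_def)
  have \<tau>T: "1 / \<tau> \<le> T" "1 / \<tau> \<le> T - \<theta>" using \<tau>(5,6) \<tau>p T \<theta> by (auto simp: field_simps)
  have en: "k0 / 4 * N2 WT + (1 - \<epsilon>) * r.AA + r.S \<le> I0 + \<epsilon> * r.M"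
   unfolding I0_def
  proof (rule r.energy[of "1 / \<tau>"])
   fix t x assume t: "T - 1 / \<tau> < t" "t < T" and x: "x \<in> \<Omega>"
   have t': "t \<in> {0..T}" "\<bar>t - \<theta>\<bar> \<le> T - \<theta>" "t \<le> T" using t \<tau>T by auto
   have "k0 = exp (- (2 * \<tau>\<^sup>2 * T)) * (exp (- cm) * exp (- \<tau> * \<mu> * (T - \<theta>)))"
    unfolding k0_def power2_eq_square exp_add[symmetric] by (simp add: algebra_simps)
   also have "\<dots> \<le> exp (- (2 * \<tau>\<^sup>2 * t)) * exp (\<Psi> (t, x))"
   proof (intro mult_mono)
    have "exp (- cm) * exp (- \<tau> * \<mu> * (T - \<theta>)) \<le> exp (- cm) * kappa \<tau> \<mu> \<theta> t"
     using t' \<tau>p \<mu> by (intro mult_left_mono) (auto simp: kappa_def mult_left_mono)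
    then show "exp (- cm) * exp (- \<tau> * \<mu> * (T - \<theta>)) \<le> exp (\<Psi> (t, x))" using \<Psi>k(1)[OF t'(1) x] by (rule order_trans)
   qed (use t' in \<open>auto simp: mult_left_mono\<close>)
   also have "\<dots> = r.K (t, x)" unfolding r.K_def exp_add[symmetric] by simp
   finally show "k0 \<le> r.K (t, x)" .
  next
   fix t x assume t: "0 \<le> t" "t \<le> 1 / \<tau>" and x: "x \<in> \<Omega>"
   have t': "t \<in> {0..T}" using t \<tau>T by auto
   have "r.K (t, x) \<le> exp (\<Psi> (t, x))" using t by (simp add: r.K_def)
   also have "\<dots> \<le> exp cm * kappa \<tau> \<mu> \<theta> t" by (rule \<Psi>k(2)[OF t' x])
   also have "\<dots> \<le> exp (cm + \<mu>) * exp (- \<tau> * \<mu> * \<theta>)"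
   proof -
    have "(\<tau> * \<mu>) * (\<theta> - \<bar>t - \<theta>\<bar>) \<le> (\<tau> * \<mu>) * (1 / \<tau>)" using t \<tau>p \<mu> by (intro mult_left_mono) auto
    then have "(\<tau> * \<mu>) * (\<theta> - \<bar>t - \<theta>\<bar>) \<le> \<mu>" using \<tau>p by simp
    then show ?thesis unfolding kappa_def exp_add[symmetric] by (simp add: algebra_simps)
   qed
   finally show "r.K (t, x) \<le> exp (cm + \<mu>) * exp (- \<tau> * \<mu> * \<theta>)" .
  qed (use \<tau>p k0p in auto)
  have \<sigma>1: "\<bar>\<sigma>\<bar> = 1" "\<And>z. a z - 1 = \<sigma> * \<bar>a z - 1\<bar>" using \<sigma> by auto
  \<comment> \<open>If a >= 1, then (a - 1) / a = 1 - 1/a <= 1 - 1/C; if a <= 1, then (1 - a) / a <=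
    1/a <= C.\<close>
  define q where "q = (if \<sigma> = 1 then 1 - 1 / C else C)"
  have cs: "(\<sigma> = 1 \<and> q = 1 - 1 / C) \<or> (\<sigma> = -1 \<and> q = C)" using \<sigma> by (auto simp: q_def)
  have q0: "q \<ge> 0" using C by (auto simp: q_def)
  have qa: "\<bar>a z - 1\<bar> \<le> q * a z" for z
  proof (cases "\<sigma> = 1")
   case True
   have "a z * (1 / C) \<le> C * (1 / C)" using a(3)[of z] C by (intro mult_right_mono) auto
   then have "a z / C \<le> 1" using C by simp
   moreover have "1 \<le> a z" using \<sigma> True by (cases z) auto
   ultimately show ?thesis using True by (simp add: q_def left_diff_distrib)
  next
   case False
   then have s: "a z \<le> 1" using \<sigma> by (cases z) auto
   have "C * (1 / C) \<le> C * a z" using a(2)[of z] C by (intro mult_left_mono) auto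
   moreover have "0 \<le> a z" by (rule r.a(2))
   ultimately show ?thesis using False s C by (simp add: q_def)
  qed
  have Sb: "\<bar>r.S\<bar> \<le> (r.AA + q * r.M) / 2" by (rule r.S_bound[OF q0 qa])
  define J where "J = (LBINT z. (a z - 1) * ((u \<tau> z + g z) \<bullet> us \<tau> \<mu> z) * kappa \<tau> \<mu> \<theta> (fst z))"
  have Jb: "\<bar>J - (\<sigma> * r.M + r.S)\<bar> \<le> \<epsilon>' * (2 * r.M + C * r.AA)"
   unfolding J_def
  proof (rule r.indicator_functional[OF component_measurable[OF us_measurable] kappa_measurable])
   show "norm (kappa \<tau> \<mu> \<theta> (fst z) *\<^sub>R us \<tau> \<mu> z - r.K z *\<^sub>R u \<tau> z) \<le> \<epsilon>' * (r.K z * norm (u \<tau> z))" if z: "z \<in> Q" for z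
   proof (cases "\<delta> \<le> R z")
    case True
    define d where "d = exp (- (\<tau>\<^sup>2) * fst z) * csrc"
    have d: "d > 0" using csrc_pos by (simp add: d_def)
    have "kappa \<tau> \<mu> \<theta> (fst z) *\<^sub>R us \<tau> \<mu> z - r.K z *\<^sub>R u \<tau> z
     = - d *\<^sub>R (kappa \<tau> \<mu> \<theta> (fst z) *\<^sub>R fgpot y \<tau> \<mu> \<theta> (fst z) (snd z) - exp (\<Psi> z) *\<^sub>R bgpot y \<tau> (fst z) (snd z))"
     unfolding Ku(2)[OF z True] d_def[symmetric] using z True
     by (simp add: us_def scaleR_diff_right d_def mult_ac)
    then have "norm (kappa \<tau> \<mu> \<theta> (fst z) *\<^sub>R us \<tau> \<mu> z - r.K z *\<^sub>R u \<tau> z)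
     = d * norm (kappa \<tau> \<mu> \<theta> (fst z) *\<^sub>R fgpot y \<tau> \<mu> \<theta> (fst z) (snd z) - exp (\<Psi> z) *\<^sub>R bgpot y \<tau> (fst z) (snd z))" using d by simp
    also have "\<dots> \<le> d * (18 * \<epsilon>0 * (exp (\<Psi> z) * norm (bgpot y \<tau> (fst z) (snd z))))"
     using asz(1)[OF z True] d by (intro mult_left_mono) auto
    also have "\<dots> = (18 * \<epsilon>0) * norm (r.K z *\<^sub>R u \<tau> z)" unfolding Ku(2)[OF z True] d_def[symmetric] using d by simp
    also have "\<dots> \<le> \<epsilon>' * norm (r.K z *\<^sub>R u \<tau> z)" using \<epsilon>0(3) by (intro mult_right_mono) auto
    also have "\<dots> = \<epsilon>' * (r.K z * norm (u \<tau> z))" using r.K_pos[of z] by simp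
    finally show ?thesis .
   qed (simp add: us_def u_def)
  qed (use \<epsilon> \<sigma>1 in \<open>auto simp: us_def\<close>)
  define Nk where "Nk = k0 / 4 * N2 WT"
  have I0n: "I0 \<ge> 0" and Nkn: "Nk \<ge> 0" using k0p by (auto simp: I0_def Nk_def)
  note ts = two_sided_from_energy[OF C r.M_nonneg r.A_nonneg I0n Nkn \<epsilon>_def \<epsilon>'_def en[folded Nk_def] Sb Jb cs]
  \<comment> \<open>Makes beta sqrt Nk equal to the terminal part of \<open>boundary_term\<close>:
    the factor exp (-tau^2 T) of \<open>U_star\<close> is matched by that in sqrt k0, and half of
    the exponent of kappa at T is left over for beta.\<close>
  define \<beta> where "\<beta> = 2 * csrc * sqrt Cp * exp (cm / 2) * exp (- \<tau> * \<mu> * (T - \<theta>) / 2)"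
  define b2 where "b2 = exp (- \<tau> * \<mu> * \<theta>) * csrc * (sqrt (N2 W0b) * sqrt Cp)"
  define bd where "bd = (LINT x:\<Omega>|lebesgue. kappa \<tau> \<mu> \<theta> T * W \<tau> T x * U_star y \<tau> \<mu> \<theta> T x - kappa \<tau> \<mu> \<theta> 0 * W \<tau> 0 x * U_star y \<tau> \<mu> \<theta> 0 x)"
  have bdb: "\<bar>bd\<bar> \<le> \<beta> * sqrt Nk + b2"
  proof -
   have "exp (- \<tau> * \<mu> * (T - \<theta>)) * (exp (- (\<tau>\<^sup>2) * T) * csrc) * (sqrt (N2 WT) * sqrt Cp) = \<beta> * sqrt Nk"
   proof -
    have "sqrt Nk = exp (- (\<tau>\<^sup>2) * T - cm / 2 - \<tau> * \<mu> * (T - \<theta>) / 2) / 2 * sqrt (N2 WT)"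
     unfolding Nk_def real_sqrt_mult real_sqrt_divide k0_def by simp
    moreover have "exp (cm / 2) * exp (- \<tau> * \<mu> * (T - \<theta>) / 2) * exp (- (\<tau>\<^sup>2) * T - cm / 2 - \<tau> * \<mu> * (T - \<theta>) / 2)
     = exp (- \<tau> * \<mu> * (T - \<theta>)) * exp (- (\<tau>\<^sup>2) * T)" unfolding exp_add[symmetric] by (simp add: field_simps)
    moreover have "f1 * (f2 * d) * (s * p) = 2 * d * p * e1 * e2 * n" if n: "n = e3 / 2 * s" and e: "e1 * e2 * e3 = f1 * f2"
     for n s p d e1 e2 e3 f1 f2 :: real
    proof -
     have "2 * d * p * e1 * e2 * n = (e1 * e2 * e3) * (d * (s * p))" by (simp add: n)
     then show ?thesis unfolding e by (simp only: mult_ac)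
    qed
    ultimately show ?thesis unfolding \<beta>_def by blast
   qed
   then show ?thesis using boundary_term[where W = "W \<tau>", OF Cp \<mu>(1) \<tau>p(1) \<tau>\<mu>(1) rp(2) LW(2) rp(3) LW(1)] unfolding bd_def b2_def by simp
  qed
  have e\<theta>: "exp (- \<tau> * \<mu> * \<theta>) * (exp (\<tau> * l0))\<^sup>2 \<le> exp (- \<tau> * (\<mu> * m - 2 * l0))"
   "exp (- \<tau> * \<mu> * (T - \<theta>)) \<le> exp (- \<tau> * (\<mu> * m - 2 * l0))"
   "exp (- \<tau> * \<mu> * \<theta>) * exp (\<tau> * l0) \<le> exp (- \<tau> * (\<mu> * m - 2 * l0))"
  proof -
   have 1: "(\<tau> * \<mu>) * m \<le> (\<tau> * \<mu>) * \<theta>" "(\<tau> * \<mu>) * m \<le> (\<tau> * \<mu>) * (T - \<theta>)" using m \<tau>p \<mu> by (auto intro!: mult_left_mono)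
   have 2: "0 \<le> \<tau> * l0" using \<tau>p l0 by simp
   show "exp (- \<tau> * \<mu> * \<theta>) * (exp (\<tau> * l0))\<^sup>2 \<le> exp (- \<tau> * (\<mu> * m - 2 * l0))"
    unfolding power2_eq_square exp_add[symmetric] exp_le_cancel_iff using 1 2 by (simp add: algebra_simps)
   show "exp (- \<tau> * \<mu> * (T - \<theta>)) \<le> exp (- \<tau> * (\<mu> * m - 2 * l0))"
    unfolding exp_le_cancel_iff using 1 2 by (simp add: algebra_simps)
   show "exp (- \<tau> * \<mu> * \<theta>) * exp (\<tau> * l0) \<le> exp (- \<tau> * (\<mu> * m - 2 * l0))"
    unfolding exp_add[symmetric] exp_le_cancel_iff using 1 2 by (simp add: algebra_simps)
  qed
  have I0s: "I0 \<le> \<epsilon>2 * r.M"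
  proof -
   have "I0 \<le> exp (cm + \<mu>) * exp (- \<tau> * \<mu> * \<theta>) / 2 * (Cw * (exp (\<tau> * l0))\<^sup>2)" unfolding I0_def using N0 by (intro mult_left_mono) auto
   also have "\<dots> = (exp (cm + \<mu>) / 2 * Cw) * (exp (- \<tau> * \<mu> * \<theta>) * (exp (\<tau> * l0))\<^sup>2)" by simp
   also have "\<dots> \<le> Kc * exp (- \<tau> * (\<mu> * m - 2 * l0))" using Kc e\<theta> by (intro mult_mono) auto
   finally show ?thesis using small by simp
  qed
  have \<beta>s: "\<beta>\<^sup>2 \<le> \<epsilon>2 * r.M"
  proof -
   have "\<beta>\<^sup>2 = (4 * csrc\<^sup>2 * Cp * exp cm) * exp (- \<tau> * \<mu> * (T - \<theta>))"
   proof -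
    have "(exp (cm / 2))\<^sup>2 = exp cm" "(exp (- \<tau> * \<mu> * (T - \<theta>) / 2))\<^sup>2 = exp (- \<tau> * \<mu> * (T - \<theta>))" "(sqrt Cp)\<^sup>2 = Cp"
     using Cp(1) by (simp_all only: power2_eq_square exp_add[symmetric] real_sqrt_mult_self) simp_all
    then show ?thesis unfolding \<beta>_def power_mult_distrib by (simp only:) simp
   qed
   also have "\<dots> \<le> Kc * exp (- \<tau> * (\<mu> * m - 2 * l0))" using Kc e\<theta> by (intro mult_mono) auto
   finally show ?thesis using small by simp
  qed
  have b2s: "b2 \<le> \<epsilon>2 * r.M"
  proof -
   have "b2 \<le> exp (- \<tau> * \<mu> * \<theta>) * csrc * ((sqrt Cw * exp (\<tau> * l0)) * sqrt Cp)"
    unfolding b2_def using N0s csrc_pos Cp(1) by (intro mult_left_mono mult_right_mono) auto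
   also have "\<dots> = (csrc * sqrt Cw * sqrt Cp) * (exp (- \<tau> * \<mu> * \<theta>) * exp (\<tau> * l0))" by (simp only: mult_ac)
   also have "\<dots> \<le> Kc * exp (- \<tau> * (\<mu> * m - 2 * l0))" using Kc e\<theta> by (intro mult_mono) auto
   finally show ?thesis using small by simp
  qed
  have I: "I_inf \<Omega> T \<gamma> y (W \<tau>) (G \<tau>) \<tau> \<mu> \<theta> = J + bd"
   unfolding I_inf_def volume_term[OF \<tau>p(1,3) \<mu>(1) rp(1)] J_def bd_def ..
  note cwb = combine_with_boundary[OF C r.M_nonneg I0n I0s \<epsilon>2_def ts(1,2) Nkn ts(3) \<beta>s b2s bdb]
  show ?case
  proof
   have "P / C\<mu> \<le> P / (4 * C / (csrc\<^sup>2 * b0))" using C\<mu> pc P0 by (intro divide_left_mono mult_pos_pos) auto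
   also have "\<dots> = ((csrc\<^sup>2 * b0) * P) / (4 * C)" by simp
   also have "\<dots> \<le> r.M / (4 * C)" using MP(1) C by (intro divide_right_mono) auto
   also have "\<dots> \<le> \<bar>J + bd\<bar>" by (rule cwb)
   finally show "P_int \<Omega> T \<gamma> y \<tau> \<mu> \<theta> / C\<mu> \<le> \<bar>I_inf \<Omega> T \<gamma> y (W \<tau>) (G \<tau>) \<tau> \<mu> \<theta>\<bar>" unfolding I P_def .
   have "\<bar>J + bd\<bar> \<le> (5 + 2 * C) * r.M" by (rule cwb)
   also have "\<dots> \<le> (5 + 2 * C) * ((csrc\<^sup>2 * b1) * P)" using MP(2) C by (intro mult_left_mono) auto
   also have "\<dots> = ((5 + 2 * C) * (csrc\<^sup>2 * b1)) * P" by simp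
   also have "\<dots> \<le> C\<mu> * P" using C\<mu>(3) P0 by (rule mult_right_mono)
   finally show "\<bar>I_inf \<Omega> T \<gamma> y (W \<tau>) (G \<tau>) \<tau> \<mu> \<theta>\<bar> \<le> C\<mu> * P_int \<Omega> T \<gamma> y \<tau> \<mu> \<theta>" unfolding I P_def .
  qed
 qed
qed

end

section \<open>Reduction of the theorem to a Borel coefficient with separated source\<close>

theorem theorem1p1:
  fixes \<Omega> \<Omega>' :: "(real^3) set" and T \<theta> C0 l0 :: real
    and \<gamma> k :: "real \<Rightarrow> real^3 \<Rightarrow> real" and D :: "real \<Rightarrow> (real^3) set"
    and y :: "real \<Rightarrow> real^3"
  assumes dom: "lipschitz_domain \<Omega>" and T: "T > 0"
    and reg: "W1inf_time \<gamma> \<Omega> T"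
    and kpos: "\<forall>t x. k t x > 0"
    and Dopen: "\<forall>t\<in>{0..T}. open (D t) \<and> D t \<noteq> {} \<and> D t \<subseteq> \<Omega>"
    and kbd: "\<exists>C>1. \<forall>(t,x)\<in>DT D T. 1 / C \<le> k t x \<and> k t x \<le> C"
    and ksign: "(\<forall>(t,x)\<in>DT D T. k t x \<ge> 1) \<or> (\<forall>(t,x)\<in>DT D T. k t x \<le> 1)"
    and gdef: "\<forall>t\<in>{0..T}. \<forall>x\<in>\<Omega>. \<gamma> t x = (if x \<in> D t then k t x else 1)"
    and CD: "\<forall>t\<in>{0..T}. \<forall>K. compact K \<and> K \<subseteq> D t \<longrightarrow> (\<exists>\<delta>>0. \<forall>x\<in>K. \<bar>k t x - 1\<bar> \<ge> \<delta>)"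
    and \<Omega>': "open \<Omega>'" "connected \<Omega>'" "bounded \<Omega>'" "closure \<Omega> \<subseteq> \<Omega>'"
    and ycurve: "\<forall>t. y t \<in> \<Omega>'" "\<exists>L. L-lipschitz_on UNIV y" "\<forall>t\<le>0. y t \<notin> closure \<Omega>"
    and \<theta>: "0 < \<theta>" "\<theta> < T"
    and sep: "SigmaT y T \<inter> closure (DT D T) = {}"
    and cpos: "C0 > 0" "l0 > 0"
  shows "\<exists>\<mu>1 > l0 * max (1 / \<theta>) (1 / (T - \<theta>)). \<forall>\<mu>>\<mu>1. \<exists>C\<mu>>1. \<exists>\<tau>1>\<mu>1.
     \<forall>(v0 :: real \<Rightarrow> real^3 \<Rightarrow> real) (W :: real \<Rightarrow> real \<Rightarrow> real^3 \<Rightarrow> real)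
       (G :: real \<Rightarrow> real \<Rightarrow> real^3 \<Rightarrow> real^3).
       cond_C0 v0 \<Omega> C0 l0 \<and>
       (\<forall>\<tau>>0. weak_sol \<Omega> T \<gamma> (\<lambda>t x. (\<gamma> t x - 1) *\<^sub>R grad (U_tau y \<tau> t) x)
                 (\<lambda>x. v0 \<tau> x - U_tau y \<tau> 0 x) (W \<tau>) (G \<tau>))
       \<longrightarrow> (\<forall>\<tau>>\<tau>1. P_int \<Omega> T \<gamma> y \<tau> \<mu> \<theta> / C\<mu> \<le> \<bar>I_inf \<Omega> T \<gamma> y (W \<tau>) (G \<tau>) \<tau> \<mu> \<theta>\<bar>
                   \<and> \<bar>I_inf \<Omega> T \<gamma> y (W \<tau>) (G \<tau>) \<tau> \<mu> \<theta>\<bar> \<le> C\<mu> * P_int \<Omega> T \<gamma> y \<tau> \<mu> \<theta>)"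
proof -
 obtain C where C: "C > 1" and kb: "\<And>t x. (t, x) \<in> DT D T \<Longrightarrow> 1 / C \<le> k t x \<and> k t x \<le> C" using kbd by blast
 obtain L where Ly: "L-lipschitz_on UNIV y" using ycurve(2) by blast
 have L: "L \<ge> 0" and y: "\<And>s s'. norm (y s - y s') \<le> L * \<bar>s - s'\<bar>"
  using Ly by (auto simp: lipschitz_on_def dist_norm)
 have yc: "continuous_on S y" for S using Ly lipschitz_on_continuous_on continuous_on_subset by blast
 have "SigmaT y T = (\<lambda>t. (t, y t)) ` {0..T}" by (auto simp: SigmaT_def)
 then have "compact (SigmaT y T)" by (auto intro!: compact_continuous_image continuous_intros yc)
 then obtain \<delta> where \<delta>: "\<delta> > 0" and sp: "\<And>p q. p \<in> SigmaT y T \<Longrightarrow> q \<in> closure (DT D T) \<Longrightarrow> \<delta> \<le> dist p q"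
  using separate_compact_closed[OF _ closed_closure sep] by blast
 \<comment> \<open>The two points have the same time coordinate, so their distance in space-time is
   the distance in space.\<close>
 have far: "\<delta> \<le> norm (x - y t)" if "t \<in> {0..T}" "x \<in> D t" for t x
 proof -
  have "(t, y t) \<in> SigmaT y T" "(t, x) \<in> closure (DT D T)"
   using that closure_subset[of "DT D T"] by (auto simp: SigmaT_def DT_def)
  from sp[OF this] show ?thesis by (simp add: dist_Pair_Pair dist_norm norm_minus_commute)
 qed
 obtain r where r: "\<And>x. x \<in> \<Omega>' \<Longrightarrow> norm x \<le> r" using \<Omega>'(3) unfolding bounded_iff by blast
 define Rm where "Rm = 2 * r + 1"
 have "r \<ge> 0" using r[of "y 0"] ycurve(1) norm_ge_zero[of "y 0"] by (meson order_trans)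
 then have Rm: "Rm > 0" by (simp add: Rm_def)
 have Rm2: "norm (x - y t) \<le> Rm" if "x \<in> \<Omega>" for t x
 proof -
  have "x \<in> \<Omega>'" using that \<Omega>'(4) closure_subset[of \<Omega>] by blast
  then show ?thesis using norm_triangle_ineq4[of x "y t"] r[of x] r[of "y t"] ycurve(1) by (simp add: Rm_def)
 qed
 \<comment> \<open>Since 1 lies between lo and hi, these bounds hold for gamma on the whole domain.
   Clamping the Borel version to them gives it the bounds and the sign everywhere, not only almost
   everywhere.\<close>
 obtain lo hi \<sigma> :: real where lh: "lo \<le> 1" "1 \<le> hi" "1 / C \<le> lo" "hi \<le> C" "(\<sigma> = 1 \<and> lo = 1) \<or> (\<sigma> = -1 \<and> hi = 1)"
  and klh: "\<And>t x. (t, x) \<in> DT D T \<Longrightarrow> lo \<le> k t x \<and> k t x \<le> hi"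
 proof (cases "\<forall>(t, x)\<in>DT D T. k t x \<ge> 1")
  case True
  then show thesis using C kb by (intro that[of 1 C 1]) auto
 next
  case False
  then have "\<forall>(t, x)\<in>DT D T. k t x \<le> 1" using ksign by blast
  then show thesis using C kb by (intro that[of "1 / C" 1 "-1"]) auto
 qed
 define Q where "Q = {0<..<T} \<times> \<Omega>"
 have Q: "Q \<in> sets borel" using dom by (auto simp: Q_def lipschitz_domain_def open_Times)
 have \<gamma>lh: "lo \<le> \<gamma> t x \<and> \<gamma> t x \<le> hi" if "t \<in> {0..T}" "x \<in> \<Omega>" for t x
  using that gdef klh[of t x] lh by (auto simp: DT_def)
 have "(\<lambda>z. \<gamma> (fst z) (snd z)) \<in> borel_measurable (lebesgue_on ({0..T} \<times> \<Omega>))"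
  using reg unfolding W1inf_time_def split_beta' by blast
 then have "(\<lambda>z. \<gamma> (fst z) (snd z)) \<in> borel_measurable (lebesgue_on Q)"
  by (rule measurable_restrict_mono) (auto simp: Q_def)
 then obtain \<gamma>b where \<gamma>b: "rep Q (\<lambda>z. \<gamma> (fst z) (snd z)) \<gamma>b" using rep_exists[OF Q] by blast
 define a where "a z = (if z \<in> Q \<and> \<delta> \<le> norm (snd z - y (fst z)) then max lo (min hi (\<gamma>b z)) else 1)" for z
 have near1: "\<gamma> (fst z) (snd z) = 1" if "z \<in> Q" "norm (snd z - y (fst z)) < \<delta>" for z
  using that gdef far[of "fst z" "snd z"] by (auto simp: Q_def)
 have \<gamma>a: "AE z in lborel. z \<in> Q \<longrightarrow> \<gamma> (fst z) (snd z) = a z"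
  using repD(4)[OF \<gamma>b]
 proof eventually_elim
  case (elim z)
  show ?case
  proof
   assume z: "z \<in> Q"
   then have "lo \<le> \<gamma> (fst z) (snd z) \<and> \<gamma> (fst z) (snd z) \<le> hi" by (intro \<gamma>lh) (auto simp: Q_def)
   then show "\<gamma> (fst z) (snd z) = a z" using z elim near1[OF z] by (auto simp: a_def)
  qed
 qed
 interpret moving_source \<Omega> T \<gamma> y a L \<delta> Rm C \<sigma> \<theta>
 proof unfold_locales
  have "(\<lambda>z :: real \<times> (real^3). norm (snd z - y (fst z))) \<in> borel_measurable borel"
   by (intro borel_measurable_continuous_onI continuous_intros continuous_on_compose2[OF yc[of UNIV]]) auto
  note [measurable] = this Q repD(2)[OF \<gamma>b]
  show "a \<in> borel_measurable borel" unfolding a_def[abs_def] by measurable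
  show "1 / C \<le> a z" "a z \<le> C" for z using lh C by (auto simp: a_def max_def min_def)
  show "(\<sigma> = 1 \<and> (\<forall>z. 1 \<le> a z)) \<or> (\<sigma> = -1 \<and> (\<forall>z. a z \<le> 1))" using lh by (auto simp: a_def)
  \<comment> \<open>Otherwise, by Fubini, gamma = 1 almost everywhere in x for almost all times near
    theta. Condition (C-D) for singletons says that gamma differs from 1 at every point of D t, a
    nonempty open set, so no time near theta is possible; yet these times form a nonempty open
    interval.\<close>
  show "\<not> (AE z in lborel. \<theta> - e < fst z \<and> fst z < \<theta> + e \<longrightarrow> a z = 1)" if e: "e > 0" for e
  proof
   assume "AE z in lborel. \<theta> - e < fst z \<and> fst z < \<theta> + e \<longrightarrow> a z = 1"
   with \<gamma>a have "AE z in (lborel :: (real \<times> (real^3)) measure). fst z \<in> {\<theta> - e<..<\<theta> + e} \<inter> {0<..<T} \<longrightarrow> snd z \<in> \<Omega> \<longrightarrow> \<gamma> (fst z) (snd z) = 1"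
    by eventually_elim (auto simp: Q_def)
   then have "AE z in (lborel :: real measure) \<Otimes>\<^sub>M (lborel :: (real^3) measure). fst z \<in> {\<theta> - e<..<\<theta> + e} \<inter> {0<..<T} \<longrightarrow> snd z \<in> \<Omega> \<longrightarrow> \<gamma> (fst z) (snd z) = 1"
    by (simp only: lborel_prod)
   then have "AE t in lborel. AE x in (lborel :: (real^3) measure). t \<in> {\<theta> - e<..<\<theta> + e} \<inter> {0<..<T} \<longrightarrow> x \<in> \<Omega> \<longrightarrow> \<gamma> t x = 1"
    by (drule_tac lborel_pair.AE_pair) simp
   then have "AE t in lborel. t \<notin> {\<theta> - e<..<\<theta> + e} \<inter> {0<..<T}"
   proof eventually_elim
    case (elim t)
    show ?case
    proof
     assume t: "t \<in> {\<theta> - e<..<\<theta> + e} \<inter> {0<..<T}"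
     then have t': "t \<in> {0..T}" by auto
     from elim have "AE x in lborel. x \<notin> D t"
     proof eventually_elim
      case (elim x)
      show ?case
      proof
       assume x: "x \<in> D t"
       have "compact {x} \<and> {x} \<subseteq> D t" using x by simp
       then obtain d where "d > 0" "\<bar>k t x - 1\<bar> \<ge> d" using CD t' by blast
       moreover have "x \<in> \<Omega>" using x Dopen t' by blast
       ultimately show False using elim t gdef t' x by auto
      qed
     qed
     then show False using open_not_AE_empty[of "D t"] Dopen t' by blast
    qed
   qed
   then have "{\<theta> - e<..<\<theta> + e} \<inter> {0<..<T} = {}" by (intro open_not_AE_empty) auto
   moreover have "\<theta> \<in> {\<theta> - e<..<\<theta> + e} \<inter> {0<..<T}" using e \<theta> by simp
   ultimately show False by blast
  qed
 qed (use dom T y L \<delta> Rm Rm2 C \<gamma>a near1 \<theta> in \<open>auto simp: a_def Q_def\<close>)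
 let ?\<mu>1 = "(4 * Rm + 4 * l0 + 2) / min \<theta> (T - \<theta>)"
 have m: "min \<theta> (T - \<theta>) > 0" using \<theta> by simp
 have "l0 * max (1 / \<theta>) (1 / (T - \<theta>)) = l0 / min \<theta> (T - \<theta>)"
  using \<theta> by (auto simp: max_def min_def field_simps)
 also have "\<dots> < ?\<mu>1" using m Rm cpos by (intro divide_strict_right_mono) auto
 finally show ?thesis using two_sided_estimate[OF cpos(2,1)] by blast
qed

end
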